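(* Let $n\geq1$, $\alpha=4$, and $c>0$. Let $\Omega\subset\mathbb{H}^n$ be a competitor set (for the parameter $\alpha=4$). Assume that $\Omega$ is cylindrically symmetric. If there exists a solution $u$ in $\Omega$ to the overdetermined problem $$\Delta_{\mathbb H}u=(Q+2)F_4\ \text{ in }\Omega,\qquad u=0\ \text{ on }\partial\Omega,\qquad |D_Hu|=c\,F_4^{1/2}\ \text{ on }\partial\Omega,$$ where $F_4(x,t)=|x|^2$, then there exists $t_0\in\mathbb{R}$ such that $$\Omega=B_{\sqrt c}((0,t_0))\qquad\text{and}\qquad u(x,t)=\frac{|x|^4+(t-t_0)^2-c^2}{4}.$$
   Context: Heisenberg group. For $n\ge1$, $\mathbb{H}^n=\mathbb{R}^{2n}\times\mathbb{R}$ with points $\xi=(x,t)$ and group law $(x,t)\circ(x',t')=(x+x',t+t'+2\langle Jx,x'\rangle)$, where $J=\begin{pmatrix}0&-I_n\\ I_n&0\end{pmatrix}$ and $\langle\cdot,\cdot\rangle$, $|\cdot|$ are the standard inner product and norm of $\mathbb{R}^{2n}$. Put $Q=2n+2$, $\rho(x,t)=(|x|^4+t^2)^{1/4}$. The gauge ball of center $\xi_0\in\mathbb{H}^n$ and radius $R>0$ is $B_R(\xi_0)=\{\xi:\rho(\xi_0^{-1}\circ\xi)<R\}$. Let $X_j=\partial_{x_j}+2(Jx)_j\partial_t$ for $j=1,\dots,2n$, $D_Hu=(X_1u,\dots,X_{2n}u)$, $\Delta_{\mathbb H}=\sum_{j=1}^{2n}X_j^2$. A set $\Omega$ is cylindrically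 symmetric if $(x,t)\in\Omega$ implies $(x',t)\in\Omega$ for every $x'\in\mathbb{R}^{2n}$ with $|x'|=|x|$. Weak solutions. $H^1_0(\Omega,X)$ is the Folland-Stein space (functions in $L^2$ with horizontal gradient in $L^2$, vanishing on the boundary, i.e. the closure of $C_0^\infty(\Omega)$). A weak solution of the Dirichlet problem $\Delta_{\mathbb H}u=(Q+2)F_4$ in $\Omega$, $u=0$ on $\partial\Omega$, is a $u\in H^1_0(\Omega,X)$ with $\int_\Omega\langle D_Hu,D_H\psi\rangle+(Q+2)\int_\Omega F_4\psi=0$ for all $\psi\in C_0^\infty(\Omega)$; it is unique. Competitor set (for $\alpha=4$). An open, bounded, connected set $\Omega\subset\mathbb{H}^n$ with smooth boundary such that: (a) at every characteristic point of $\partial\Omega$ (a point where $D_Hf=0$ for a smooth defining function $f$ of $\Omega$, i.e. $\Omega=\{f<0\}$, $\partial\Omega=\{f=0\}$, Euclidean gradient $Df\ne0$ on $\partial\Omega$) $\Omega$ has interior and exterior tangent gauge balls; (b) the unique weak solution of the Dirichlet problem $\Delta_{\mathbb H}u=(Q+2)F_4$ in $\Omega$, $u=0$ on $\partial\Omega$, is smooth in a neighborhood of $\partial\Omega$ (smooth up to the boundary). Solution of the overdetermined problem in a competitor set $\Omega$: the unique weak solution $u$ of the Dirichlet problem $\Delta_{\mathbb H}u=(Q+2)F_4$ in $\Omega$, $u=0$ on $\partial\Omega$, when it satisfies in addition $|D_Hu(\xi)|=c\,F_4^{1/2}(\xi)$ for all $\xi\in\partial\Omega$. *)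

theory Defs
  imports "HOL-Analysis.Analysis"
begin

section \<open>The Heisenberg group\<close>

text \<open>
  The Heisenberg group is $R^{2n} \times R$ with \<open>n = CARD('n)\<close>. The index type \<open>'n + 'n\<close> of
  $R^{2n}$ reflects the block structure of $J$: \<open>Inl\<close> indexes the first and \<open>Inr\<close> the last $n$
  coordinates. Index types are nonempty, so $n \ge 1$.
\<close>

type_synonym 'n hvec = "real ^ ('n + 'n)"
type_synonym 'n heis = "'n hvec \<times> real"

definition hJ :: "'n::finite hvec \<Rightarrow> 'n hvec" where
  "hJ x = (\<chi> i. case i of Inl k \<Rightarrow> - (x $ Inr k) | Inr k \<Rightarrow> x $ Inl k)"

definition hmult :: "'n::finite heis \<Rightarrow> 'n heis \<Rightarrow> 'n heis" where
  "hmult \<xi> \<eta> = (fst \<xi> + fst \<eta>, snd \<xi> + snd \<eta> + 2 * (hJ (fst \<xi>) \<bullet> fst \<eta>))"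

text \<open>Since $\langle Jx, x\rangle = 0$, the group inverse is the Euclidean negation.\<close>

definition hinv :: "'n::finite heis \<Rightarrow> 'n heis" where
  "hinv \<xi> = (- fst \<xi>, - snd \<xi>)"

definition hom_dim :: "'n::finite itself \<Rightarrow> real" where
  "hom_dim _ = 2 * real CARD('n) + 2"

definition gauge_norm :: "'n::finite heis \<Rightarrow> real" where
  "gauge_norm \<xi> = root 4 (norm (fst \<xi>) ^ 4 + (snd \<xi>)\<^sup>2)"

definition gauge_ball :: "'n::finite heis \<Rightarrow> real \<Rightarrow> 'n heis set" where
  "gauge_ball \<xi>\<^sub>0 R = {\<xi>. gauge_norm (hmult (hinv \<xi>\<^sub>0) \<xi>) < R}"

definition cylindrically_symmetric :: "'n::finite heis set \<Rightarrow> bool" where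
  "cylindrically_symmetric \<Omega> \<longleftrightarrow>
     (\<forall>x t x'. (x, t) \<in> \<Omega> \<longrightarrow> norm x' = norm x \<longrightarrow> (x', t) \<in> \<Omega>)"

section \<open>Smooth functions and the horizontal gradient\<close>

text \<open>Meant for open \<open>S\<close>.\<close>

primrec C_k_on :: "nat \<Rightarrow> 'a::euclidean_space set \<Rightarrow> ('a \<Rightarrow> real) \<Rightarrow> bool" where
  "C_k_on 0 S f \<longleftrightarrow> continuous_on S f"
| "C_k_on (Suc k) S f \<longleftrightarrow> f differentiable_on S \<and>
     (\<forall>b\<in>Basis. C_k_on k S (\<lambda>x. frechet_derivative f (at x) b))"

definition smooth_on :: "'a::euclidean_space set \<Rightarrow> ('a \<Rightarrow> real) \<Rightarrow> bool" where
  "smooth_on S f \<longleftrightarrow> (\<forall>k. C_k_on k S f)"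

text \<open>The horizontal gradient $D_H f = (X_1 f, \dots, X_{2n} f)$ with
  $X_j = \partial_{x_j} + 2 (Jx)_j \partial_t$.\<close>

definition hgrad :: "('n::finite heis \<Rightarrow> real) \<Rightarrow> 'n heis \<Rightarrow> 'n hvec" where
  "hgrad f \<xi> = (\<chi> j. frechet_derivative f (at \<xi>) (axis j 1, 0)
                   + 2 * (hJ (fst \<xi>) $ j) * frechet_derivative f (at \<xi>) (0, 1))"

definition test_functions :: "'n::finite heis set \<Rightarrow> ('n heis \<Rightarrow> real) set" where
  "test_functions \<Omega> = {\<phi>. smooth_on UNIV \<phi> \<and>
     compact (closure {\<xi>. \<phi> \<xi> \<noteq> 0}) \<and> closure {\<xi>. \<phi> \<xi> \<noteq> 0} \<subseteq> \<Omega>}"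

section \<open>The Folland-Stein space and weak solutions\<close>

text \<open>
  Elements of the function spaces on $\Omega$ are represented by functions on the whole group. All
  notions below depend only on the values almost everywhere in $\Omega$.
\<close>

definition L2_on :: "'a::euclidean_space set \<Rightarrow> ('a \<Rightarrow> 'b::euclidean_space) \<Rightarrow> bool" where
  "L2_on \<Omega> f \<longleftrightarrow> f \<in> borel_measurable (lebesgue_on \<Omega>) \<and>
     integrable (lebesgue_on \<Omega>) (\<lambda>\<xi>. (norm (f \<xi>))\<^sup>2)"

text \<open>
  \<open>g\<close> is the distributional horizontal gradient of \<open>u\<close>: the coefficients of $X_j$ are independent
  of the variables they are paired with, so the formal adjoint of $X_j$ is $-X_j$.
\<close>

definition has_weak_hgrad ::
    "'n::finite heis set \<Rightarrow> ('n heis \<Rightarrow> real) \<Rightarrow> ('n heis \<Rightarrow> 'n hvec) \<Rightarrow> bool" where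
  "has_weak_hgrad \<Omega> u g \<longleftrightarrow> L2_on \<Omega> u \<and> L2_on \<Omega> g \<and>
     (\<forall>\<phi>\<in>test_functions \<Omega>. \<forall>j.
        integral\<^sup>L (lebesgue_on \<Omega>) (\<lambda>\<xi>. u \<xi> * (hgrad \<phi> \<xi> $ j))
        = - integral\<^sup>L (lebesgue_on \<Omega>) (\<lambda>\<xi>. g \<xi> $ j * \<phi> \<xi>))"

text \<open>The space $H^1_0(\Omega, X)$: the closure of the test functions with respect to the norm
  $(\|u\|_{L^2}^2 + \|D_H u\|_{L^2}^2)^{1/2}$.\<close>

definition H10 :: "'n::finite heis set \<Rightarrow> ('n heis \<Rightarrow> real) set" where
  "H10 \<Omega> = {u. \<exists>g. has_weak_hgrad \<Omega> u g \<and>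
     (\<exists>\<phi>. (\<forall>k::nat. \<phi> k \<in> test_functions \<Omega>) \<and>
        (\<lambda>k. integral\<^sup>L (lebesgue_on \<Omega>) (\<lambda>\<xi>. (\<phi> k \<xi> - u \<xi>)\<^sup>2)) \<longlonglongrightarrow> 0 \<and>
        (\<lambda>k. integral\<^sup>L (lebesgue_on \<Omega>) (\<lambda>\<xi>. (norm (hgrad (\<phi> k) \<xi> - g \<xi>))\<^sup>2)) \<longlonglongrightarrow> 0)}"

definition F4 :: "'n::finite heis \<Rightarrow> real" where
  "F4 \<xi> = (norm (fst \<xi>))\<^sup>2"

text \<open>Weak solutions of $\Delta_H u = (Q+2) F_4$ in $\Omega$, $u = 0$ on $\partial\Omega$.\<close>

definition weak_solution :: "'n::finite heis set \<Rightarrow> ('n heis \<Rightarrow> real) \<Rightarrow> bool" where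
  "weak_solution \<Omega> u \<longleftrightarrow> u \<in> H10 \<Omega> \<and>
     (\<exists>g. has_weak_hgrad \<Omega> u g \<and>
        (\<forall>\<psi>\<in>test_functions \<Omega>.
           integral\<^sup>L (lebesgue_on \<Omega>) (\<lambda>\<xi>. g \<xi> \<bullet> hgrad \<psi> \<xi>)
           + (hom_dim TYPE('n) + 2) * integral\<^sup>L (lebesgue_on \<Omega>) (\<lambda>\<xi>. F4 \<xi> * \<psi> \<xi>) = 0))"

section \<open>Competitor sets and the overdetermined problem\<close>

definition defining_function :: "'n::finite heis set \<Rightarrow> ('n heis \<Rightarrow> real) \<Rightarrow> bool" where
  "defining_function \<Omega> f \<longleftrightarrow> smooth_on UNIV f \<and> \<Omega> = {\<xi>. f \<xi> < 0} \<and>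
     frontier \<Omega> = {\<xi>. f \<xi> = 0} \<and>
     (\<forall>\<xi>\<in>frontier \<Omega>. frechet_derivative f (at \<xi>) \<noteq> (\<lambda>_. 0))"

definition characteristic_point :: "'n::finite heis set \<Rightarrow> 'n heis \<Rightarrow> bool" where
  "characteristic_point \<Omega> p \<longleftrightarrow> p \<in> frontier \<Omega> \<and>
     (\<exists>f. defining_function \<Omega> f \<and> hgrad f p = 0)"

definition interior_tangent_ball :: "'n::finite heis set \<Rightarrow> 'n heis \<Rightarrow> bool" where
  "interior_tangent_ball \<Omega> p \<longleftrightarrow>
     (\<exists>\<xi>\<^sub>0 R. 0 < R \<and> gauge_ball \<xi>\<^sub>0 R \<subseteq> \<Omega> \<and> p \<in> frontier (gauge_ball \<xi>\<^sub>0 R))"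

definition exterior_tangent_ball :: "'n::finite heis set \<Rightarrow> 'n heis \<Rightarrow> bool" where
  "exterior_tangent_ball \<Omega> p \<longleftrightarrow>
     (\<exists>\<xi>\<^sub>0 R. 0 < R \<and> gauge_ball \<xi>\<^sub>0 R \<inter> \<Omega> = {} \<and> p \<in> frontier (gauge_ball \<xi>\<^sub>0 R))"

text \<open>
  \<open>w\<close> is smooth on a neighborhood of $\partial\Omega$ and represents \<open>u\<close> inside $\Omega$ there. The
  boundary values of \<open>w\<close> and of its derivatives are limits from $\Omega$, hence determined by \<open>u\<close>
  when $\Omega$ is open; they are the boundary values of \<open>u\<close> and of its derivatives.
\<close>

definition smooth_near_boundary ::
    "'n::finite heis set \<Rightarrow> ('n heis \<Rightarrow> real) \<Rightarrow> ('n heis \<Rightarrow> real) \<Rightarrow> bool" where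
  "smooth_near_boundary \<Omega> u w \<longleftrightarrow>
     (\<exists>V. open V \<and> frontier \<Omega> \<subseteq> V \<and> smooth_on V w \<and>
        (AE \<xi> in lebesgue_on (V \<inter> \<Omega>). u \<xi> = w \<xi>))"

text \<open>The weak solution is unique almost everywhere, and the last condition does not depend on its
  representative.\<close>

definition competitor_set :: "'n::finite heis set \<Rightarrow> bool" where
  "competitor_set \<Omega> \<longleftrightarrow>
     \<Omega> \<noteq> {} \<and> open \<Omega> \<and> bounded \<Omega> \<and> connected \<Omega> \<and> (\<exists>f. defining_function \<Omega> f) \<and>
     (\<forall>p. characteristic_point \<Omega> p \<longrightarrow> interior_tangent_ball \<Omega> p \<and> exterior_tangent_ball \<Omega> p) \<and>
     (\<forall>u. weak_solution \<Omega> u \<longrightarrow> (\<exists>w. smooth_near_boundary \<Omega> u w))"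

definition overdetermined_solution ::
    "real \<Rightarrow> 'n::finite heis set \<Rightarrow> ('n heis \<Rightarrow> real) \<Rightarrow> bool" where
  "overdetermined_solution c \<Omega> u \<longleftrightarrow> weak_solution \<Omega> u \<and>
     (\<exists>w. smooth_near_boundary \<Omega> u w \<and>
        (\<forall>\<xi>\<in>frontier \<Omega>. norm (hgrad w \<xi>) = c * sqrt (F4 \<xi>)))"

end

theory Submission
  imports Defs
begin

text \<open>Put Q + 2 = 2n + 4. The model solution (|x|^4 + (t - t0)^2 - c^2) / 4 is singled out by
  the P-function P = |D_H u|^2 / (4 |x|^2) - u, which equals c^2 / 4 identically for the model. The
  proof shows that the overdetermined data force P to be constant and that constancy of P forces the
  model.

  Regularity. A quarter of the fourth power of the gauge is an explicit solution of the equation, so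
  its difference with \<open>u\<close> is weakly harmonic for the sub-Laplacian.
  \<open>Weyl\<close>, proved with a smooth mean value kernel built from the gauge, makes
  \<open>u\<close> smooth inside; glued to the smooth function near the boundary it becomes a
  function \<open>v\<close> smooth on a neighbourhood of the closure
  (\<open>solution_extension\<close>). Membership in the closure of the test functions means that
  \<open>v\<close> has no flux through the boundary against any smooth weight, hence vanishes at
  every boundary point that is not characteristic. Cylindrical symmetry confines the characteristic
  points to the axis, where they are limits of the others (\<open>trace_zero\<close>).

  Symmetry. For a unitary map A of the horizontal space, \<open>v\<close> and its composition with A
  solve the same equation with zero boundary values. A maximum principle identifies them, and
  unitary maps act transitively on spheres, so v = v(r, t) with r = |x|
  (\<open>solution_symmetric\<close>).

  P-function. On the half plane r > 0 the equation reads v_rr + (2n - 1) v_r / r + 4 r^2 v_tt = (2n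
  + 4) r^2. For the operator L on its left side without the right-hand side, L P is 8 r^2 times a
  sum of squares (\<open>P_function_identity\<close>). On the boundary P is at most c^2 / 4 by the
  gradient condition, and P is bounded near the axis, so the maximum principle with a logarithmic
  barrier at the axis gives P <= c^2 / 4 (\<open>PP_le\<close>).

  Integral identity. A Pohozaev type argument with the dilation field yields that |D_H v|^2 - 4
  |x|^2 v - c^2 |x|^2 has integral zero (\<open>integral_grad_sq_defect\<close>). This integrand is
  4 |x|^2 (P - c^2 / 4), which is nonpositive, so P = c^2 / 4 everywhere off the axis
  (\<open>PP_eq\<close>).

  Rigidity. All squares in L P vanish, which gives v_r = r^3 and v_tt = 1/2. Connectedness turns
  this into the explicit formula with one free constant t0 (\<open>solution_rigid\<close>). The
  boundary then lies on one gauge sphere, and a connectedness argument identifies the domain with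
  the gauge ball (\<open>domain_eq_gauge_ball\<close>).\<close>

section \<open>Directional derivatives and calculus of smooth functions\<close>

text \<open>The direction is the first argument, so that \<open>pd b f\<close> is again a function
  and derivatives can be iterated as \<open>pd a (pd b f)\<close>.\<close>

definition pd :: "'a::euclidean_space \<Rightarrow> ('a \<Rightarrow> real) \<Rightarrow> 'a \<Rightarrow> real" where
  "pd b f x = frechet_derivative f (at x) b"

lemma pd_at: "(f has_derivative f') (at x) \<Longrightarrow> pd b f x = f' b"
  by (metis frechet_derivative_at pd_def)

lemma C_k_on_Suc: "C_k_on (Suc k) S f \<longleftrightarrow> f differentiable_on S \<and> (\<forall>b\<in>Basis. C_k_on k S (pd b f))"
  by (simp add: pd_def[abs_def])

declare C_k_on.simps(2) [simp del]

lemma pd_has_derivative: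
  assumes "f differentiable (at x)"
  shows "(f has_derivative (\<lambda>b. pd b f x)) (at x)"
  using assms frechet_derivative_works[of f "at x"] by (simp add: pd_def)

lemma pd_cong:
  assumes "open S" "x \<in> S" "\<And>y. y \<in> S \<Longrightarrow> f y = g y"
  shows "pd b f x = pd b g x"
proof -
  have *: "(f has_derivative D) (at x) \<longleftrightarrow> (g has_derivative D) (at x)" for D
    using assms has_derivative_transform_within_open[OF _ assms(1,2)] by metis
  show ?thesis unfolding pd_def frechet_derivative_def by (simp add: *)
qed

lemma C_k_on_cong:
  assumes "open S"
  shows "(\<And>y. y \<in> S \<Longrightarrow> f y = g y) \<Longrightarrow> C_k_on k S f \<Longrightarrow> C_k_on k S g"
proof (induction k arbitrary: f g)
  case 0
  then show ?case using continuous_on_cong by (metis C_k_on.simps(1))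
next
  case (Suc k)
  have "g differentiable_on S"
    using Suc.prems unfolding C_k_on_Suc differentiable_on_eq_differentiable_at[OF assms]
    by (metis assms frechet_derivative_works has_derivative_transform_within_open differentiableI)
  moreover have "C_k_on k S (pd b g)" if "b \<in> Basis" for b
  proof (rule Suc.IH[of "pd b f"])
    show "pd b f y = pd b g y" if "y \<in> S" for y
      by (rule pd_cong[OF assms that Suc.prems(1)])
    show "C_k_on k S (pd b f)" using Suc.prems(2) that by (simp add: C_k_on_Suc)
  qed
  ultimately show ?case by (simp add: C_k_on_Suc)
qed

lemma C_k_on_SucD: "C_k_on (Suc k) S f \<Longrightarrow> C_k_on k S f"
proof (induction k arbitrary: f)
  case 0
  then show ?case by (simp add: C_k_on_Suc differentiable_imp_continuous_on)
next
  case (Suc k)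
  then show ?case by (subst C_k_on_Suc) (auto simp: C_k_on_Suc[of "Suc k"])
qed

lemma C_k_on_differentiable_at:
  "open S \<Longrightarrow> C_k_on (Suc k) S f \<Longrightarrow> x \<in> S \<Longrightarrow> f differentiable (at x)"
  by (simp add: C_k_on_Suc differentiable_on_eq_differentiable_at)

lemma C_k_on_subset:
  assumes "open T" "open S" "T \<subseteq> S"
  shows "C_k_on k S f \<Longrightarrow> C_k_on k T f"
proof (induction k arbitrary: f)
  case 0
  then show ?case using assms continuous_on_subset by auto
next
  case (Suc k)
  then show ?case using assms differentiable_on_subset by (auto simp: C_k_on_Suc)
qed

lemma C_k_on_Un:
  assumes "open S" "open T"
  shows "C_k_on k S f \<Longrightarrow> C_k_on k T f \<Longrightarrow> C_k_on k (S \<union> T) f"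
proof (induction k arbitrary: f)
  case 0
  then show ?case using assms continuous_on_open_Un by auto
next
  case (Suc k)
  then show ?case using assms
    by (auto simp: C_k_on_Suc differentiable_on_eq_differentiable_at open_Un)
qed

lemma C_k_on_local:
  assumes "\<And>x. x \<in> S \<Longrightarrow> \<exists>T. open T \<and> x \<in> T \<and> C_k_on k T f"
  shows "C_k_on k S f"
  using assms
proof (induction k arbitrary: f)
  case 0
  then show ?case
    by (metis C_k_on.simps(1) continuous_at_imp_continuous_on continuous_on_eq_continuous_at)
next
  case (Suc k)
  have "f differentiable_on S"
    unfolding differentiable_on_def
    by (metis Suc.prems C_k_on_differentiable_at differentiable_at_withinI)
  moreover have "C_k_on k S (pd b f)" if b: "b \<in> Basis" for b
    by (rule Suc.IH) (metis Suc.prems C_k_on_Suc b)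
  ultimately show ?case by (simp add: C_k_on_Suc)
qed

lemma C_k_on_const: "C_k_on k S (\<lambda>x. c)"
proof (induction k arbitrary: c)
  case 0
  then show ?case by simp
next
  case (Suc k)
  have "pd b (\<lambda>x. c) = (\<lambda>x. 0)" for b :: 'a
    by (simp add: pd_def fun_eq_iff)
  then show ?case using Suc by (simp add: C_k_on_Suc)
qed

lemma C_k_on_linear:
  assumes "bounded_linear f"
  shows "C_k_on k S f"
proof (cases k)
  case 0
  then show ?thesis using assms linear_continuous_on by auto
next
  case (Suc k')
  have "pd b f = (\<lambda>x. f b)" for b
    using pd_at[OF bounded_linear_imp_has_derivative[OF assms]] by auto
  then show ?thesis using assms Suc bounded_linear_imp_differentiable_on
    by (auto simp: C_k_on_Suc C_k_on_const)
qed

lemma pd_add: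
  assumes "f differentiable (at x)" "g differentiable (at x)"
  shows "pd b (\<lambda>y. f y + g y) x = pd b f x + pd b g x"
  by (rule pd_at) (intro derivative_intros pd_has_derivative assms)

lemma pd_diff:
  assumes "f differentiable (at x)" "g differentiable (at x)"
  shows "pd b (\<lambda>y. f y - g y) x = pd b f x - pd b g x"
  by (rule pd_at) (intro derivative_intros pd_has_derivative assms)

lemma pd_mult:
  assumes "f differentiable (at x)" "g differentiable (at x)"
  shows "pd b (\<lambda>y. f y * g y) x = f x * pd b g x + pd b f x * g x"
  by (rule pd_at) (intro derivative_intros pd_has_derivative assms)

lemma pd_compose:
  fixes f :: "'a::euclidean_space \<Rightarrow> real" and g :: "real \<Rightarrow> real"
  assumes "f differentiable (at x)" "g differentiable (at (f x))"
  shows "pd b (\<lambda>y. g (f y)) x = pd 1 g (f x) * pd b f x"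
proof -
  have "((\<lambda>y. g (f y)) has_derivative (\<lambda>b. pd (pd b f x) g (f x))) (at x)"
    using has_derivative_compose[OF pd_has_derivative[OF assms(1)] pd_has_derivative[OF assms(2)]] .
  then have "pd b (\<lambda>y. g (f y)) x = pd (pd b f x) g (f x)"
    by (rule pd_at)
  also have "\<dots> = pd 1 g (f x) * pd b f x"
    using linear_frechet_derivative[OF assms(2)] linear_cmul[of "frechet_derivative g (at (f x))" "pd b f x" 1]
    by (simp add: pd_def)
  finally show ?thesis .
qed

lemma pd_scaleR_dir:
  "f differentiable (at x) \<Longrightarrow> pd (c *\<^sub>R a) f x = c * pd a f x"
  using linear_cmul[OF linear_frechet_derivative] by (fastforce simp: pd_def)

lemma pd_add_dir:
  "f differentiable (at x) \<Longrightarrow> pd (a + b) f x = pd a f x + pd b f x"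
  using linear_add[OF linear_frechet_derivative] by (fastforce simp: pd_def)

lemma pd_sum_dir:
  "f differentiable (at x) \<Longrightarrow> pd (\<Sum>i\<in>I. c i *\<^sub>R a i) f x = (\<Sum>i\<in>I. c i * pd (a i) f x)"
  using linear_sum[OF linear_frechet_derivative, of f "at x" "\<lambda>i. c i *\<^sub>R a i" I]
  by (simp add: pd_def linear_cmul[OF linear_frechet_derivative])

lemma C_k_on_add:
  assumes "open S"
  shows "C_k_on k S f \<Longrightarrow> C_k_on k S g \<Longrightarrow> C_k_on k S (\<lambda>x. f x + g x)"
proof (induction k arbitrary: f g)
  case 0
  then show ?case by (simp add: continuous_on_add)
next
  case (Suc k)
  have "C_k_on k S (pd b (\<lambda>x. f x + g x))" if "b \<in> Basis" for b
    by (rule C_k_on_cong[OF assms _ Suc.IH[of "pd b f" "pd b g"]])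
      (use Suc.prems that C_k_on_differentiable_at[OF assms] in \<open>auto simp: C_k_on_Suc pd_add\<close>)
  then show ?case using Suc.prems by (simp add: C_k_on_Suc differentiable_on_add)
qed

lemma C_k_on_mult:
  assumes "open S"
  shows "C_k_on k S f \<Longrightarrow> C_k_on k S g \<Longrightarrow> C_k_on k S (\<lambda>x. f x * g x)"
proof (induction k arbitrary: f g)
  case 0
  then show ?case by (simp add: continuous_on_mult)
next
  case (Suc k)
  have "C_k_on k S (pd b (\<lambda>x. f x * g x))" if b: "b \<in> Basis" for b
  proof (rule C_k_on_cong[OF assms _ C_k_on_add[OF assms Suc.IH[of f "pd b g"] Suc.IH[of "pd b f" g]]])
    show "f y * pd b g y + pd b f y * g y = pd b (\<lambda>x. f x * g x) y" if "y \<in> S" for y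
      using that Suc.prems C_k_on_differentiable_at[OF assms] by (metis pd_mult)
  qed (use Suc.prems b C_k_on_SucD in \<open>auto simp: C_k_on_Suc\<close>)
  then show ?case using Suc.prems by (simp add: C_k_on_Suc differentiable_on_mult)
qed

lemma C_k_on_compose:
  fixes f :: "'a::euclidean_space \<Rightarrow> real" and g :: "real \<Rightarrow> real"
  assumes "open S" "open T" "f ` S \<subseteq> T"
  shows "C_k_on k S f \<Longrightarrow> C_k_on k T g \<Longrightarrow> C_k_on k S (\<lambda>x. g (f x))"
proof (induction k arbitrary: g)
  case 0
  then show ?case using assms by (auto intro: continuous_on_compose2)
next
  case (Suc k)
  have d: "f differentiable (at x)" "g differentiable (at (f x))" if "x \<in> S" for x
    using that Suc.prems assms C_k_on_differentiable_at by blast+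
  have "C_k_on k S (pd b (\<lambda>x. g (f x)))" if b: "b \<in> Basis" for b
  proof (rule C_k_on_cong[OF assms(1) _ C_k_on_mult[OF assms(1)], of "\<lambda>x. pd 1 g (f x)" "pd b f"])
    show "pd 1 g (f y) * pd b f y = pd b (\<lambda>x. g (f x)) y" if "y \<in> S" for y
      using pd_compose[OF d[OF that]] by simp
    show "C_k_on k S (\<lambda>x. pd 1 g (f x))"
      by (rule Suc.IH) (use Suc.prems C_k_on_SucD in \<open>auto simp: C_k_on_Suc[of k T]\<close>)
    show "C_k_on k S (pd b f)" using b Suc.prems by (simp add: C_k_on_Suc)
  qed
  moreover have "(\<lambda>x. g (f x)) differentiable_on S"
    unfolding differentiable_on_eq_differentiable_at[OF assms(1)]
    using d by (metis differentiable_compose)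
  ultimately show ?case by (simp add: C_k_on_Suc)
qed

lemma smooth_on_const [intro, simp]: "smooth_on S (\<lambda>x. c)"
  by (simp add: smooth_on_def C_k_on_const)

lemma smooth_on_linear: "bounded_linear f \<Longrightarrow> smooth_on S f"
  by (simp add: smooth_on_def C_k_on_linear)

lemma smooth_on_add: "open S \<Longrightarrow> smooth_on S f \<Longrightarrow> smooth_on S g \<Longrightarrow> smooth_on S (\<lambda>x. f x + g x)"
  by (simp add: smooth_on_def C_k_on_add)

lemma smooth_on_mult: "open S \<Longrightarrow> smooth_on S f \<Longrightarrow> smooth_on S g \<Longrightarrow> smooth_on S (\<lambda>x. f x * g x)"
  by (simp add: smooth_on_def C_k_on_mult)

lemma smooth_on_uminus: "open S \<Longrightarrow> smooth_on S f \<Longrightarrow> smooth_on S (\<lambda>x. - f x)"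
  using smooth_on_mult[of S "\<lambda>x. -1" f] by simp

lemma smooth_on_diff: "open S \<Longrightarrow> smooth_on S f \<Longrightarrow> smooth_on S g \<Longrightarrow> smooth_on S (\<lambda>x. f x - g x)"
  using smooth_on_add[of S f "\<lambda>x. - g x"] smooth_on_uminus by fastforce

lemma smooth_on_divide_const: "open S \<Longrightarrow> smooth_on S f \<Longrightarrow> smooth_on S (\<lambda>x. f x / c)"
  using smooth_on_mult[of S f "\<lambda>x. 1/c"] by simp

lemma smooth_on_power: "open S \<Longrightarrow> smooth_on S f \<Longrightarrow> smooth_on S (\<lambda>x. f x ^ m)"
  by (induction m) (auto intro: smooth_on_mult)

lemma smooth_on_sum:
  assumes "open S" "\<And>i. i \<in> I \<Longrightarrow> smooth_on S (f i)"
  shows "smooth_on S (\<lambda>x. \<Sum>i\<in>I. f i x)"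
proof (cases "finite I")
  case True
  then show ?thesis using assms by (induction I) (auto intro: smooth_on_add)
qed simp

lemma smooth_on_compose:
  fixes f :: "'a::euclidean_space \<Rightarrow> real" and g :: "real \<Rightarrow> real"
  shows "open S \<Longrightarrow> smooth_on UNIV g \<Longrightarrow> smooth_on S f \<Longrightarrow> smooth_on S (\<lambda>x. g (f x))"
  using C_k_on_compose[of S UNIV f _ g] by (simp add: smooth_on_def)

lemmas smooth_intros = smooth_on_add smooth_on_mult smooth_on_uminus smooth_on_diff
  smooth_on_divide_const smooth_on_power smooth_on_sum smooth_on_const

lemma smooth_on_cong:
  "open S \<Longrightarrow> (\<And>y. y \<in> S \<Longrightarrow> f y = g y) \<Longrightarrow> smooth_on S f \<Longrightarrow> smooth_on S g"
  unfolding smooth_on_def using C_k_on_cong by blast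

lemma smooth_on_subset:
  "open T \<Longrightarrow> open S \<Longrightarrow> T \<subseteq> S \<Longrightarrow> smooth_on S f \<Longrightarrow> smooth_on T f"
  unfolding smooth_on_def using C_k_on_subset by blast

lemma smooth_on_Un:
  "open S \<Longrightarrow> open T \<Longrightarrow> smooth_on S f \<Longrightarrow> smooth_on T f \<Longrightarrow> smooth_on (S \<union> T) f"
  unfolding smooth_on_def using C_k_on_Un by blast

lemma smooth_on_local:
  assumes "\<And>x. x \<in> S \<Longrightarrow> \<exists>T. open T \<and> x \<in> T \<and> smooth_on T f"
  shows "smooth_on S f"
  unfolding smooth_on_def using assms C_k_on_local by (metis smooth_on_def)

lemma smooth_on_differentiable:
  "smooth_on S f \<Longrightarrow> open S \<Longrightarrow> x \<in> S \<Longrightarrow> f differentiable (at x)"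
  unfolding smooth_on_def using C_k_on_differentiable_at by blast

lemma smooth_on_has_derivative:
  "smooth_on S f \<Longrightarrow> open S \<Longrightarrow> x \<in> S \<Longrightarrow> (f has_derivative (\<lambda>b. pd b f x)) (at x)"
  by (simp add: pd_has_derivative smooth_on_differentiable)

lemma smooth_on_continuous: "smooth_on S f \<Longrightarrow> continuous_on S f"
  unfolding smooth_on_def by (metis C_k_on.simps(1))

text \<open>\<open>C_k_on\<close> speaks of basis directions only; linearity of the derivative in
  its direction reduces an arbitrary \<open>b\<close> to those.\<close>

lemma smooth_on_pd:
  assumes "open S" "smooth_on S f"
  shows "smooth_on S (pd b f)"
proof (rule smooth_on_cong[OF assms(1)])
  show "smooth_on S (\<lambda>x. \<Sum>i\<in>Basis. (b \<bullet> i) * pd i f x)"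
  proof (intro smooth_intros assms)
    fix i :: 'a assume "i \<in> Basis"
    then show "smooth_on S (pd i f)"
      using assms unfolding smooth_on_def by (metis C_k_on_Suc)
  qed
  show "(\<Sum>i\<in>Basis. (b \<bullet> i) * pd i f y) = pd b f y" if "y \<in> S" for y
    using pd_sum_dir[OF smooth_on_differentiable[OF assms(2,1) that], of "\<lambda>i. b \<bullet> i" "\<lambda>i. i" Basis]
    by (simp add: euclidean_representation)
qed

lemma smooth_on_line:
  assumes "smooth_on S f" "open S" "p + s *\<^sub>R d \<in> S"
  shows "((\<lambda>s. f (p + s *\<^sub>R d)) has_field_derivative pd d f (p + s *\<^sub>R d)) (at s)"
proof -
  have "((\<lambda>s. p + s *\<^sub>R d) has_derivative (\<lambda>h. h *\<^sub>R d)) (at s)"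
    by (auto intro!: derivative_eq_intros)
  from has_derivative_compose[OF this smooth_on_has_derivative[OF assms]]
  have "((\<lambda>s. f (p + s *\<^sub>R d)) has_derivative (\<lambda>h. pd (h *\<^sub>R d) f (p + s *\<^sub>R d))) (at s)" .
  moreover have "(\<lambda>h. pd (h *\<^sub>R d) f (p + s *\<^sub>R d)) = (*) (pd d f (p + s *\<^sub>R d))"
    using pd_scaleR_dir[OF smooth_on_differentiable[OF assms], of _ d] by (simp add: fun_eq_iff)
  ultimately show ?thesis
    by (simp add: has_field_derivative_def)
qed

text \<open>The second difference of \<open>f\<close> over a small parallelogram is symmetric in the
  two directions. Two applications of the mean value theorem write it as \<open>s\<^sup>2\<close>
  times a mixed derivative at a nearby point, in either order. As the parallelogram shrinks both
  points tend to \<open>p\<close>, where the mixed derivatives are continuous.\<close>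

lemma pd_commute:
  fixes f :: "'a::euclidean_space \<Rightarrow> real"
  assumes S: "open S" "smooth_on S f" "p \<in> S"
  shows "pd a (pd b f) p = pd b (pd a f) p"
proof -
  have key: "\<exists>y. dist y p \<le> s * (norm a + norm b) \<and>
        f (p + s *\<^sub>R a + s *\<^sub>R b) - f (p + s *\<^sub>R a) - f (p + s *\<^sub>R b) + f p = s\<^sup>2 * pd b (pd a f) y"
    if s: "s > 0" and sub: "cball p (s * (norm a + norm b)) \<subseteq> S" for a b :: 'a and s
  proof -
    have inS: "p + u *\<^sub>R a + w *\<^sub>R b \<in> S" if "0 \<le> u" "u \<le> s" "0 \<le> w" "w \<le> s" for u w
    proof -
      have "norm (u *\<^sub>R a + w *\<^sub>R b) \<le> u * norm a + w * norm b"
        using norm_triangle_ineq[of "u *\<^sub>R a" "w *\<^sub>R b"] that by simp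
      also have "\<dots> \<le> s * (norm a + norm b)"
        using that by (simp add: distrib_left add_mono mult_right_mono)
      finally have "p + u *\<^sub>R a + w *\<^sub>R b \<in> cball p (s * (norm a + norm b))"
        by (simp add: dist_norm norm_minus_commute add_ac)
      then show ?thesis using sub by blast
    qed
    \<comment> \<open>The difference in direction \<open>b\<close> as a function of the displacement
      along \<open>a\<close>: the mean value theorem is applied first in \<open>u\<close>, then in
      the displacement along \<open>b\<close>.\<close>
    define g where "g u = f (p + s *\<^sub>R b + u *\<^sub>R a) - f (p + u *\<^sub>R a)" for u
    have "\<exists>u>0. u < s \<and> g s - g 0 = (s - 0) * (pd a f (p + s *\<^sub>R b + u *\<^sub>R a) - pd a f (p + u *\<^sub>R a))"
    proof (rule MVT2[OF s])
      fix u assume "0 \<le> u" "u \<le> s"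
      then have "p + s *\<^sub>R b + u *\<^sub>R a \<in> S" "p + u *\<^sub>R a \<in> S"
        using inS[of u s] inS[of u 0] s by (auto simp: add_ac)
      then show "(g has_field_derivative pd a f (p + s *\<^sub>R b + u *\<^sub>R a) - pd a f (p + u *\<^sub>R a)) (at u)"
        unfolding g_def[abs_def] by (intro DERIV_diff smooth_on_line[OF S(2,1)])
    qed
    then obtain u where u: "0 < u" "u < s"
      "g s - g 0 = s * (pd a f (p + s *\<^sub>R b + u *\<^sub>R a) - pd a f (p + u *\<^sub>R a))" by auto
    have "\<exists>w>0. w < s \<and> pd a f (p + u *\<^sub>R a + s *\<^sub>R b) - pd a f (p + u *\<^sub>R a + 0 *\<^sub>R b)
        = (s - 0) * pd b (pd a f) (p + u *\<^sub>R a + w *\<^sub>R b)"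
    proof (rule MVT2[OF s])
      fix w assume "0 \<le> w" "w \<le> s"
      then show "((\<lambda>w. pd a f (p + u *\<^sub>R a + w *\<^sub>R b)) has_field_derivative
          pd b (pd a f) (p + u *\<^sub>R a + w *\<^sub>R b)) (at w)"
        using inS u by (intro smooth_on_line[OF smooth_on_pd[OF S(1,2)] S(1)]) auto
    qed
    then obtain w where w: "0 < w" "w < s"
      "pd a f (p + s *\<^sub>R b + u *\<^sub>R a) - pd a f (p + u *\<^sub>R a) = s * pd b (pd a f) (p + u *\<^sub>R a + w *\<^sub>R b)"
      by (auto simp: add_ac)
    have "norm (u *\<^sub>R a + w *\<^sub>R b) \<le> u * norm a + w * norm b"
      using norm_triangle_ineq[of "u *\<^sub>R a" "w *\<^sub>R b"] u w by simp
    also have "\<dots> \<le> s * (norm a + norm b)"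
      using u w by (simp add: distrib_left add_mono mult_right_mono)
    finally have "dist (p + u *\<^sub>R a + w *\<^sub>R b) p \<le> s * (norm a + norm b)"
      by (simp add: dist_norm add_ac)
    moreover have "g s - g 0 = s\<^sup>2 * pd b (pd a f) (p + u *\<^sub>R a + w *\<^sub>R b)"
      using u(3) w(3) by (simp add: power2_eq_square)
    ultimately show ?thesis
      unfolding g_def by (intro exI[of _ "p + u *\<^sub>R a + w *\<^sub>R b"]) (simp add: add_ac)
  qed
  define M where "M = norm a + norm b"
  obtain r where r: "r > 0" "cball p r \<subseteq> S"
    using S open_contains_cball by blast
  have *: "\<exists>y z. dist y p \<le> \<epsilon> \<and> dist z p \<le> \<epsilon> \<and> pd b (pd a f) y = pd a (pd b f) z" if "0 < \<epsilon>" "\<epsilon> \<le> r" for \<epsilon>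
  proof -
    \<comment> \<open>Adding 1 keeps the divisor positive when both directions are zero.\<close>
    define s where "s = \<epsilon> / (M + 1)"
    have M: "M \<ge> 0" by (simp add: M_def)
    have s: "s > 0" "s * M \<le> \<epsilon>" using that M by (auto simp: s_def field_simps)
    have "cball p (s * M) \<subseteq> S" using s r that by force
    then obtain y z where y: "dist y p \<le> s * M" "f (p + s *\<^sub>R a + s *\<^sub>R b) - f (p + s *\<^sub>R a) - f (p + s *\<^sub>R b) + f p = s\<^sup>2 * pd b (pd a f) y"
      and z: "dist z p \<le> s * M" "f (p + s *\<^sub>R b + s *\<^sub>R a) - f (p + s *\<^sub>R b) - f (p + s *\<^sub>R a) + f p = s\<^sup>2 * pd a (pd b f) z"
      using key[OF s(1), of a b] key[OF s(1), of b a] by (auto simp: M_def add.commute)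
    have "p + s *\<^sub>R b + s *\<^sub>R a = p + s *\<^sub>R a + s *\<^sub>R b" by simp
    with y z have "s\<^sup>2 * pd b (pd a f) y = s\<^sup>2 * pd a (pd b f) z"
      by (simp add: algebra_simps)
    then have "pd b (pd a f) y = pd a (pd b f) z" using s by simp
    then show ?thesis using y z s by force
  qed
  have "\<forall>m. \<exists>y z. dist y p \<le> r / (real m + 1) \<and> dist z p \<le> r / (real m + 1) \<and> pd b (pd a f) y = pd a (pd b f) z"
  proof (intro allI)
    fix m
    have "0 < r / (real m + 1)" "r / (real m + 1) \<le> r"
      using r mult_left_mono[of 1 "real m + 1" r] by (auto simp: divide_le_eq)
    from * [OF this]
    show "\<exists>y z. dist y p \<le> r / (real m + 1) \<and> dist z p \<le> r / (real m + 1) \<and> pd b (pd a f) y = pd a (pd b f) z" .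
  qed
  then obtain Y Z where YZ: "\<And>m. dist (Y m) p \<le> r / (real m + 1)" "\<And>m. dist (Z m) p \<le> r / (real m + 1)"
    "\<And>m. pd b (pd a f) (Y m) = pd a (pd b f) (Z m)" by metis
  have lim: "(\<lambda>m. r / (real m + 1)) \<longlonglongrightarrow> 0"
    using tendsto_mult[OF tendsto_const[of r] LIMSEQ_inverse_real_of_nat] by (simp add: divide_inverse add.commute)
  have "Y \<longlonglongrightarrow> p" "Z \<longlonglongrightarrow> p"
    using r YZ by (auto intro!: metric_tendsto_imp_tendsto[OF lim] always_eventually)
  moreover have "isCont (pd b (pd a f)) p" "isCont (pd a (pd b f)) p"
    using S smooth_on_continuous smooth_on_pd continuous_on_eq_continuous_at by metis+
  ultimately have "(\<lambda>m. pd b (pd a f) (Y m)) \<longlonglongrightarrow> pd b (pd a f) p" "(\<lambda>m. pd a (pd b f) (Z m)) \<longlonglongrightarrow> pd a (pd b f) p"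
    by (auto intro: isCont_tendsto_compose)
  then show ?thesis using YZ(3) LIMSEQ_unique by auto
qed

section \<open>Flat functions for cutoffs\<close>

text \<open>The powers in the denominator make the family closed under differentiation up to linear
  combinations, so one induction proves all members smooth. \<open>bmp 0\<close> is the usual
  profile of a cutoff function; \<open>bmp 2\<close> is its derivative.\<close>

definition bmp :: "nat \<Rightarrow> real \<Rightarrow> real" where
  "bmp m x = (if x > 0 then exp (-1/x) / x ^ m else 0)"

lemma bmp_nonneg: "0 \<le> bmp m x" and bmp_pos: "0 < x \<Longrightarrow> 0 < bmp m x"
  and bmp_eq_0: "x \<le> 0 \<Longrightarrow> bmp m x = 0"
  by (auto simp: bmp_def)

lemma bmp_0_le_1: "bmp 0 x \<le> 1"
  by (auto simp: bmp_def)

text \<open>From (1 + y / N)^N <= exp y with y = 1 / x and N = m + 2. Two powers of x are left over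
  after the division by x^m; they give derivative 0 at the origin.\<close>

lemma bmp_square_bound: "bmp m x \<le> real (m + 2) ^ (m + 2) * x\<^sup>2"
proof (cases "x > 0")
  case True
  define N where "N = m + 2"
  have N: "N > 0" by (simp add: N_def)
  have "(1 / x / N) ^ N \<le> (1 + 1 / x / N) ^ N"
    using True by (intro power_mono) auto
  also have "\<dots> \<le> exp (1 / x)"
    by (rule exp_ge_one_plus_x_over_n_power_n) (use True N in \<open>auto intro: order_trans[of _ 0]\<close>)
  finally have *: "(1 / x / N) ^ N \<le> exp (1 / x)" .
  have "exp (-1/x) = 1 / exp (1/x)" by (simp add: exp_minus inverse_eq_divide)
  also have "\<dots> \<le> 1 / (1 / x / N) ^ N"
    using * True N by (intro divide_left_mono) auto
  also have "\<dots> = real N ^ N * x ^ N" using True N by (simp add: field_simps)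
  finally have "exp (-1/x) / x ^ m \<le> real N ^ N * x ^ N / x ^ m"
    using True by (intro divide_right_mono) auto
  also have "\<dots> = real N ^ N * x\<^sup>2" using True by (simp add: N_def power_add power2_eq_square)
  finally show ?thesis using True by (simp add: bmp_def N_def)
qed (simp add: bmp_def)

lemma DERIV_bmp: "(bmp m has_field_derivative (bmp (m + 2) x - m * bmp (m + 1) x)) (at x)"
proof -
  consider "x > 0" | "x < 0" | "x = 0" by linarith
  then show ?thesis
  proof cases
    case 1
    have "((\<lambda>x. exp (-1/x) / x ^ m) has_field_derivative (bmp (m + 2) x - m * bmp (m + 1) x)) (at x)"
    proof (cases m)
      case 0
      then show ?thesis using 1 by (auto intro!: derivative_eq_intros simp: bmp_def power2_eq_square)
    next
      case (Suc k)
      have "((\<lambda>x. exp (-1/x) / x ^ Suc k) has_field_derivative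
          ((exp (-1/x) * (1 / x\<^sup>2)) * x ^ Suc k - exp (-1/x) * (real (Suc k) * x ^ k)) / (x ^ Suc k * x ^ Suc k)) (at x)"
        using 1 by (auto intro!: derivative_eq_intros simp: power2_eq_square simp del: power_Suc)
      moreover have "((exp (-1/x) * (1 / x\<^sup>2)) * x ^ Suc k - exp (-1/x) * (real (Suc k) * x ^ k)) / (x ^ Suc k * x ^ Suc k)
          = bmp (m + 2) x - m * bmp (m + 1) x"
        using 1 by (simp add: bmp_def Suc divide_simps power2_eq_square) (simp add: algebra_simps)
      ultimately show ?thesis by (simp only: Suc)
    qed
    then show ?thesis
      by (rule has_field_derivative_transform_within_open[where S = "{0<..}"]) (use 1 in \<open>auto simp: bmp_def\<close>)
  next
    case 2
    have "((\<lambda>x. 0) has_field_derivative (bmp (m + 2) x - m * bmp (m + 1) x)) (at x)"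
      using 2 by (simp add: bmp_def)
    then show ?thesis
      by (rule has_field_derivative_transform_within_open[where S = "{..<0}"]) (use 2 in \<open>auto simp: bmp_def\<close>)
  next
    case 3
    \<comment> \<open>At the origin the quadratic bound makes the difference quotient at most
      \<open>C\<close> times \<open>\<bar>h\<bar>\<close>.\<close>
    define C where "C = real (m + 2) ^ (m + 2)"
    have "((\<lambda>h. C * \<bar>h\<bar>) \<longlongrightarrow> C * \<bar>0\<bar>) (at 0)"
      by (intro tendsto_intros)
    then have "((\<lambda>h. C * \<bar>h\<bar>) \<longlongrightarrow> 0) (at 0)" by simp
    moreover have "norm (bmp m h / h) \<le> C * \<bar>h\<bar>" for h
      using bmp_square_bound[of m h] bmp_nonneg[of m h]
      by (cases "h = 0") (auto simp: C_def abs_div divide_le_eq power2_eq_square mult.assoc abs_mult_self_eq)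
    ultimately have "((\<lambda>h. bmp m h / h) \<longlongrightarrow> 0) (at 0)"
      by (metis (mono_tags, lifting) Lim_null_comparison always_eventually)
    then show ?thesis
      using 3 by (simp add: DERIV_def bmp_eq_0)
  qed
qed

lemma pd_real:
  assumes "(g has_field_derivative D) (at x)"
  shows "pd 1 g x = D"
  using pd_at[of g "(*) D" x 1] assms by (simp add: has_field_derivative_def)

lemma pd_bmp: "pd 1 (bmp m) x = bmp (m + 2) x - m * bmp (m + 1) x"
  by (rule pd_real[OF DERIV_bmp])

lemma smooth_bmp: "smooth_on UNIV (bmp m)"
proof -
  have "C_k_on k UNIV (bmp m)" for k
  proof (induction k arbitrary: m)
    case 0
    show ?case using DERIV_continuous_on[OF has_field_derivative_at_within[OF DERIV_bmp]]
      by (simp only: C_k_on.simps)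
  next
    case (Suc k)
    have "bmp m differentiable_on UNIV"
      unfolding differentiable_on_def
      using DERIV_bmp has_field_derivative_def differentiableI differentiable_at_withinI by metis
    moreover have "pd 1 (bmp m) = (\<lambda>x. bmp (m + 2) x + (- real m) * bmp (m + 1) x)"
      by (auto simp: pd_bmp)
    moreover have "C_k_on k UNIV \<dots>"
      by (intro C_k_on_add C_k_on_mult C_k_on_const Suc.IH) auto
    ultimately show ?case by (simp add: C_k_on_Suc)
  qed
  then show ?thesis by (simp add: smooth_on_def)
qed

lemma tendsto_bmp_1:
  assumes "filterlim f at_top F"
  shows "((\<lambda>x. bmp 0 (f x)) \<longlongrightarrow> 1) F"
proof -
  have "((\<lambda>x. exp (-1 / f x)) \<longlongrightarrow> exp 0) F"
    by (intro tendsto_exp tendsto_divide_0[OF tendsto_const] filterlim_at_top_imp_at_infinity assms)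
  moreover have "eventually (\<lambda>x. exp (-1 / f x) = bmp 0 (f x)) F"
    using assms unfolding filterlim_at_top_dense
    by (auto elim!: eventually_mono simp: bmp_def dest!: spec[of _ 0])
  ultimately show ?thesis by (simp add: tendsto_cong)
qed

section \<open>Integration\<close>

lemma integrable_on_closure:
  fixes f :: "'a::euclidean_space \<Rightarrow> real"
  assumes "open \<Omega>" "bounded \<Omega>" "continuous_on (closure \<Omega>) f"
  shows "integrable (lebesgue_on \<Omega>) f"
proof -
  have L: "\<Omega> \<in> lmeasurable" using assms lmeasurable_open by blast
  interpret finite_measure "lebesgue_on \<Omega>" by (rule finite_measure_lebesgue_on[OF L])
  have "compact (closure \<Omega>)" using assms by simp
  then have "bounded (f ` closure \<Omega>)" using assms compact_continuous_image compact_imp_bounded by blast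
  then obtain B where B: "\<And>x. x \<in> closure \<Omega> \<Longrightarrow> \<bar>f x\<bar> \<le> B"
    unfolding bounded_iff by auto
  show ?thesis
  proof (rule integrable_const_bound)
    show "AE x in lebesgue_on \<Omega>. norm (f x) \<le> B"
      using B closure_subset[of \<Omega>] by (auto intro!: AE_I2)
    show "f \<in> borel_measurable (lebesgue_on \<Omega>)"
      using continuous_on_subset[OF assms(3) closure_subset] L
      by (intro continuous_imp_measurable_on_sets_lebesgue) auto
  qed
qed

text \<open>Cut the interval at its first and its last zero of \<open>g\<close>. The mean value
  theorem applies on the two outer pieces, and the values at the two zeros agree. Nothing is
  demanded at zeros, where the extension of a function by zero may have a kink.\<close>

lemma lipschitz_off_zeros:
  fixes g :: "real \<Rightarrow> real"
  assumes cont: "continuous_on UNIV g"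
    and d: "\<And>x. g x \<noteq> 0 \<Longrightarrow> \<exists>D. (g has_field_derivative D) (at x) \<and> \<bar>D\<bar> \<le> C"
    and C: "C \<ge> 0"
  shows "\<bar>g a - g b\<bar> \<le> C * \<bar>a - b\<bar>"
proof -
  have 1: "\<bar>g b - g a\<bar> \<le> C * (b - a)" if "a < b" "\<And>x. a < x \<Longrightarrow> x < b \<Longrightarrow> g x \<noteq> 0" for a b
  proof -
    obtain D where D: "\<And>x. g x \<noteq> 0 \<Longrightarrow> (g has_field_derivative D x) (at x) \<and> \<bar>D x\<bar> \<le> C"
      using d by metis
    obtain \<xi> where "a < \<xi>" "\<xi> < b" "g b - g a = D \<xi> * (b - a)"
    proof (rule mvt[OF \<open>a < b\<close>, of g "\<lambda>x. (*) (D x)"])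
      show "continuous_on {a..b} g" using cont continuous_on_subset by blast
      show "(g has_derivative (*) (D x)) (at x)" if "a < x" "x < b" for x
        using D \<open>\<And>x. a < x \<Longrightarrow> x < b \<Longrightarrow> g x \<noteq> 0\<close>[OF that] by (simp add: has_field_derivative_def)
    qed auto
    then show ?thesis using D[of \<xi>] that by (simp add: abs_mult mult_right_mono)
  qed
  have 2: "\<bar>g b - g a\<bar> \<le> C * (b - a)" if "a < b" for a b
  proof (cases "\<exists>x\<in>{a..b}. g x = 0")
    case False
    then show ?thesis using 1[OF that] by auto
  next
    case True
    define Z where "Z = {x\<in>{a..b}. g x = 0}"
    have "closed Z"
      using continuous_closed_preimage_constant[of "{a..b}" g 0] cont continuous_on_subset
      unfolding Z_def by blast
    then have Zc: "compact Z" unfolding compact_eq_bounded_closed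
      by (auto simp: Z_def intro: bounded_subset[OF bounded_closed_interval])
    have Z0: "Z \<noteq> {}" using True by (auto simp: Z_def)
    obtain l where l: "l \<in> Z" "\<And>x. x \<in> Z \<Longrightarrow> l \<le> x" using compact_attains_inf[OF Zc Z0] by auto
    obtain h where h: "h \<in> Z" "\<And>x. x \<in> Z \<Longrightarrow> x \<le> h" using compact_attains_sup[OF Zc Z0] by auto
    have lh: "a \<le> l" "l \<le> h" "h \<le> b" "g l = 0" "g h = 0" using l h by (auto simp: Z_def)
    have "\<bar>g l - g a\<bar> \<le> C * (l - a)"
    proof (cases "a = l")
      case False
      have "g x \<noteq> 0" if "a < x" "x < l" for x using that l(2)[of x] lh by (auto simp: Z_def)
      then show ?thesis using 1[of a l] lh False by simp
    qed simp
    moreover have "\<bar>g b - g h\<bar> \<le> C * (b - h)"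
    proof (cases "b = h")
      case False
      have "g x \<noteq> 0" if "h < x" "x < b" for x using that h(2)[of x] lh by (auto simp: Z_def)
      then show ?thesis using 1[of h b] lh False by simp
    qed simp
    moreover have "C * (l - a) + C * (b - h) \<le> C * (b - a)"
      using lh C by (simp add: distrib_left[symmetric] mult_left_mono)
    ultimately show ?thesis using lh by linarith
  qed
  show ?thesis
    using 2[of a b] 2[of b a] by (cases a b rule: linorder_cases) (auto simp: abs_minus_commute)
qed

lemma integral_lborel_translate:
  fixes G :: "'a::euclidean_space \<Rightarrow> real"
  assumes "G \<in> borel_measurable borel"
  shows "integral\<^sup>L lborel (\<lambda>x. G (x + c)) = integral\<^sup>L lborel G"
proof -
  have "integral\<^sup>L lborel G = integral\<^sup>L (distr lborel borel ((+) c)) G"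
    by (simp add: lborel_distr_plus)
  also have "\<dots> = integral\<^sup>L lborel (\<lambda>x. G (c + x))"
    by (rule integral_distr) (use assms in auto)
  finally show ?thesis by (simp add: add.commute)
qed

lemma integrable_lborel_translate:
  fixes G :: "'a::euclidean_space \<Rightarrow> real"
  assumes "integrable lborel G"
  shows "integrable lborel (\<lambda>x. G (x + c))"
proof -
  have "integrable (distr lborel borel ((+) c)) G"
    using assms by (simp add: lborel_distr_plus)
  then have "integrable lborel (\<lambda>x. G (c + x))"
    by (subst (asm) integrable_distr_eq) (use assms in auto)
  then show ?thesis by (simp add: add.commute)
qed

text \<open>Only fields vanishing on the boundary are ever integrated, so no surface measure is needed:
  the difference quotients of the zero extension have integral zero and converge boundedly.\<close>

lemma integral_pd_eq_0:
  fixes G :: "'a::euclidean_space \<Rightarrow> real"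
  assumes \<Omega>: "open \<Omega>" "bounded \<Omega>" "negligible (frontier \<Omega>)"
    and cont: "continuous_on UNIV G" and out: "\<And>x. x \<notin> \<Omega> \<Longrightarrow> G x = 0"
    and diff: "\<And>x. x \<in> \<Omega> \<Longrightarrow> G differentiable (at x)"
    and bd: "\<And>x. x \<in> \<Omega> \<Longrightarrow> \<bar>pd b G x\<bar> \<le> C"
  shows "integral\<^sup>L (lebesgue_on \<Omega>) (pd b G) = 0"
proof (cases "\<Omega> = {}")
  case True
  then show ?thesis by (simp add: integral_restrict_space)
next
  case False
  then have C: "C \<ge> 0" using bd by force
  have line: "((\<lambda>s. G (x + s *\<^sub>R b)) has_field_derivative pd b G (x + s *\<^sub>R b)) (at s)"
    if "x + s *\<^sub>R b \<in> \<Omega>" for x s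
  proof -
    have "((\<lambda>s. x + s *\<^sub>R b) has_derivative (\<lambda>h. h *\<^sub>R b)) (at s)"
      by (auto intro!: derivative_eq_intros)
    from has_derivative_compose[OF this pd_has_derivative[OF diff[OF that]]]
    have "((\<lambda>s. G (x + s *\<^sub>R b)) has_derivative (\<lambda>h. pd (h *\<^sub>R b) G (x + s *\<^sub>R b))) (at s)" .
    moreover have "(\<lambda>h. pd (h *\<^sub>R b) G (x + s *\<^sub>R b)) = (*) (pd b G (x + s *\<^sub>R b))"
      using pd_scaleR_dir[OF diff[OF that]] by (simp add: fun_eq_iff)
    ultimately show ?thesis by (simp add: has_field_derivative_def)
  qed
  have lip: "\<bar>G (x + h *\<^sub>R b) - G x\<bar> \<le> C * \<bar>h\<bar>" for x h
  proof -
    have "\<bar>G (x + h *\<^sub>R b) - G (x + 0 *\<^sub>R b)\<bar> \<le> C * \<bar>h - 0\<bar>"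
    proof (rule lipschitz_off_zeros[OF _ _ C])
      show "continuous_on UNIV (\<lambda>s. G (x + s *\<^sub>R b))"
        by (intro continuous_on_compose2[OF cont] continuous_intros) auto
      show "\<exists>D. ((\<lambda>s. G (x + s *\<^sub>R b)) has_field_derivative D) (at s) \<and> \<bar>D\<bar> \<le> C"
        if "G (x + s *\<^sub>R b) \<noteq> 0" for s
        using line[of x s] bd[of "x + s *\<^sub>R b"] out that by blast
    qed
    then show ?thesis by simp
  qed
  \<comment> \<open>Difference quotients with step 1 / (k + 1), which never exceeds 1; their
    integrals vanish by translation invariance of Lebesgue measure.\<close>
  define Dq where "Dq k x = (G (x + (1 / (real k + 1)) *\<^sub>R b) - G x) / (1 / (real k + 1))" for k :: nat and x
  obtain R where R: "\<And>x. x \<in> \<Omega> \<Longrightarrow> norm x \<le> R" using \<Omega> bounded_iff by metis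
  have Gm: "G \<in> borel_measurable borel" using cont by (rule borel_measurable_continuous_onI)
  have Gint: "integrable lborel G"
  proof -
    have "compact (closure \<Omega>)" using \<Omega> by simp
    then have "set_integrable lborel (closure \<Omega>) G"
      unfolding set_integrable_def
      by (rule borel_integrable_compact) (rule continuous_on_subset[OF cont], simp)
    moreover have "(\<lambda>x. indicator (closure \<Omega>) x *\<^sub>R G x) = G"
      using out closure_subset by (fastforce simp: indicator_def fun_eq_iff)
    ultimately show ?thesis by (simp add: set_integrable_def)
  qed
  have I0: "integral\<^sup>L lebesgue (Dq k) = 0" for k
  proof -
    have m: "Dq k \<in> borel_measurable borel"
      unfolding Dq_def by (intro borel_measurable_continuous_onI continuous_intros continuous_on_compose2[OF cont]) auto
    have "integral\<^sup>L lborel (Dq k) = (integral\<^sup>L lborel (\<lambda>x. G (x + (1 / (real k + 1)) *\<^sub>R b)) - integral\<^sup>L lborel G) / (1 / (real k + 1))"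
      unfolding Dq_def by (subst integral_divide_zero, subst Bochner_Integration.integral_diff)
        (auto intro: Gint integrable_lborel_translate)
    then have "integral\<^sup>L lborel (Dq k) = 0"
      by (simp add: integral_lborel_translate[OF Gm])
    then show ?thesis using m by (simp add: integral_completion)
  qed
  define L where "L x = (if x \<in> \<Omega> then pd b G x else 0)" for x
  have conv: "(\<lambda>k. Dq k x) \<longlonglongrightarrow> L x" if "x \<notin> frontier \<Omega>" for x
  proof (cases "x \<in> \<Omega>")
    case True
    have "((\<lambda>h. (G (x + h *\<^sub>R b) - G x) / h) \<longlongrightarrow> pd b G x) (at 0)"
      using line[of x 0] True by (simp add: DERIV_def)
    moreover have "filterlim (\<lambda>k. 1 / (real k + 1)) (at 0) sequentially"
      unfolding filterlim_at using LIMSEQ_inverse_real_of_nat by (auto simp: inverse_eq_divide add.commute)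
    ultimately have "(\<lambda>k. (G (x + (1 / (real k + 1)) *\<^sub>R b) - G x) / (1 / (real k + 1))) \<longlonglongrightarrow> pd b G x"
      by (rule filterlim_compose)
    then show ?thesis using True by (simp add: Dq_def L_def)
  next
    case False
    with that have "x \<in> - closure \<Omega>" using closure_Un_frontier by blast
    moreover have "open (- closure \<Omega>)" by auto
    moreover have "(\<lambda>k. x + (1 / (real k + 1)) *\<^sub>R b) \<longlonglongrightarrow> x"
    proof -
      have "(\<lambda>k. x + (inverse (real (Suc k))) *\<^sub>R b) \<longlonglongrightarrow> x + 0 *\<^sub>R b"
        by (intro tendsto_intros LIMSEQ_inverse_real_of_nat)
      then show ?thesis by (simp add: inverse_eq_divide add.commute)
    qed
    ultimately have "eventually (\<lambda>k. x + (1 / (real k + 1)) *\<^sub>R b \<in> - closure \<Omega>) sequentially"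
      by (metis topological_tendstoD)
    then have "eventually (\<lambda>k. Dq k x = 0) sequentially"
      by eventually_elim (use False out closure_subset in \<open>auto simp: Dq_def subset_eq\<close>)
    then show ?thesis using False by (simp add: L_def tendsto_eventually)
  qed
  \<comment> \<open>The dominating function: the Lipschitz bound \<open>C\<close> controls the
    quotients, and beyond radius \<open>R + norm b\<close> both points of the quotient lie outside
    \<open>\<Omega>\<close>.\<close>
  define w where "w x = C * indicator (cball 0 (R + norm b)) x" for x :: 'a
  have AEf: "AE x in lebesgue. x \<notin> frontier \<Omega>"
    using \<Omega>(3) by (auto simp: negligible_iff_null_sets intro: AE_not_in)
  have "(\<lambda>k. integral\<^sup>L lebesgue (Dq k)) \<longlonglongrightarrow> integral\<^sup>L lebesgue L"
  proof (rule integral_dominated_convergence[where w = w])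
    show "Dq k \<in> borel_measurable lebesgue" for k
      unfolding Dq_def by (intro measurable_completion) (auto intro!: borel_measurable_continuous_onI continuous_intros continuous_on_compose2[OF cont])
    show "integrable lebesgue w"
      unfolding w_def by (intro integrable_mult_right) (use emeasure_lborel_cball_finite[of "0::'a" "R + norm b"] in \<open>auto simp: integrable_indicator_iff\<close>)
    show "AE x in lebesgue. (\<lambda>k. Dq k x) \<longlonglongrightarrow> L x"
      using AEf conv by (auto elim!: eventually_mono)
    \<comment> \<open>Multiplied by the indicator of the complement of the frontier, the quotients
      converge to \<open>L\<close> at every point: on the frontier both sides are zero because
      \<open>\<Omega>\<close> is open.\<close>
    show "L \<in> borel_measurable lebesgue"
    proof (rule borel_measurable_LIMSEQ_real)
      show "(\<lambda>k. indicator (- frontier \<Omega>) x * Dq k x) \<longlonglongrightarrow> L x" for x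
        using conv[of x] \<Omega>(1) by (auto simp: indicator_def L_def frontier_def interior_open)
      show "(\<lambda>x. indicator (- frontier \<Omega>) x * Dq k x) \<in> borel_measurable lebesgue" for k
        unfolding Dq_def by (intro measurable_completion borel_measurable_times borel_measurable_indicator)
          (auto intro!: borel_measurable_continuous_onI continuous_intros continuous_on_compose2[OF cont])
    qed
    show "AE x in lebesgue. norm (Dq k x) \<le> w x" for k
    proof (rule AE_I2)
      fix x
      have h: "1 / (real k + 1) > 0" "1 / (real k + 1) \<le> 1" by auto
      show "norm (Dq k x) \<le> w x"
      proof (cases "norm x \<le> R + norm b")
        case True
        have "\<bar>G (x + (1 / (real k + 1)) *\<^sub>R b) - G x\<bar> \<le> C * (1 / (real k + 1))"
          using lip[of x "1 / (real k + 1)"] h by simp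
        then have "norm (Dq k x) \<le> C"
          unfolding Dq_def real_norm_def abs_divide using h(1)
          by (subst pos_divide_le_eq) (auto simp: abs_of_pos)
        then show ?thesis using True by (simp add: w_def)
      next
        case False
        have "norm x \<le> norm (x + (1 / (real k + 1)) *\<^sub>R b) + norm ((1 / (real k + 1)) *\<^sub>R b)"
          by (metis add_diff_cancel_right' norm_triangle_ineq4)
        also have "norm ((1 / (real k + 1)) *\<^sub>R b) \<le> norm b"
          by (simp add: divide_le_eq distrib_left)
        finally have "x + (1 / (real k + 1)) *\<^sub>R b \<notin> \<Omega>" "x \<notin> \<Omega>"
          using R False by (smt (verit) norm_ge_zero)+
        then show ?thesis using out C by (simp add: Dq_def w_def)
      qed
    qed
  qed
  then have "integral\<^sup>L lebesgue L = 0"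
    by (simp add: I0 LIMSEQ_const_iff)
  moreover have "integral\<^sup>L (lebesgue_on \<Omega>) (pd b G) = integral\<^sup>L lebesgue L"
    using \<Omega> by (subst integral_restrict_space) (auto simp: L_def indicator_def intro!: Bochner_Integration.integral_cong)
  ultimately show ?thesis by simp
qed

text \<open>Each isolated point is the only point of \<open>S\<close> in some interval with rational
  endpoints.\<close>

lemma countable_isolated_real:
  fixes S :: "real set"
  assumes "\<And>x. x \<in> S \<Longrightarrow> \<exists>e>0. \<forall>y\<in>S. \<bar>y - x\<bar> < e \<longrightarrow> y = x"
  shows "countable S"
proof -
  have "S \<subseteq> (\<lambda>(a, b). THE x. x \<in> S \<and> a < x \<and> x < b) ` (\<rat> \<times> \<rat>)"
  proof
    fix x assume x: "x \<in> S"
    then obtain e where e: "e > 0" "\<And>y. y \<in> S \<Longrightarrow> \<bar>y - x\<bar> < e \<Longrightarrow> y = x" using assms by metis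
    obtain a where a: "a \<in> \<rat>" "x - e < a" "a < x" using Rats_dense_in_real[of "x - e" x] e by auto
    obtain b where b: "b \<in> \<rat>" "x < b" "b < x + e" using Rats_dense_in_real[of x "x + e"] e by auto
    have "(THE y. y \<in> S \<and> a < y \<and> y < b) = x"
    proof (rule the_equality)
      show "y = x" if "y \<in> S \<and> a < y \<and> y < b" for y
        using that a b by (intro e(2)) auto
    qed (use x a b in auto)
    then show "x \<in> (\<lambda>(a, b). THE x. x \<in> S \<and> a < x \<and> x < b) ` (\<rat> \<times> \<rat>)"
      using a(1) b(1) by (force intro!: rev_image_eqI[of "(a, b)"])
  qed
  moreover have "countable (\<rat> \<times> \<rat> :: (real \<times> real) set)"
    using countable_rat by (intro countable_SIGMA) auto
  ultimately show ?thesis by (meson countable_image countable_subset)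
qed

text \<open>Fubini in two orders for the set of pairs (x, s) with x + s b in \<open>N\<close> and s
  in the unit interval. For fixed x the slice is countable, hence null; for fixed s it is a
  translate of \<open>N\<close>, so the total measure is also that of \<open>N\<close>.\<close>

lemma emeasure_lborel_0_if_countable_lines:
  fixes N :: "'a::euclidean_space set"
  assumes N: "N \<in> sets borel" and c: "\<And>x. countable {s. x + s *\<^sub>R b \<in> N}"
  shows "emeasure lborel N = 0"
proof -

  define A where "A = {p \<in> space (lborel \<Otimes>\<^sub>M lborel). fst p + snd p *\<^sub>R b \<in> N \<and> snd p \<in> {0..1::real}}"
  have A: "A \<in> sets (lborel \<Otimes>\<^sub>M lborel)"
    unfolding A_def using N by measurable
  have sh: "emeasure lborel {x. x + c \<in> N} = emeasure lborel N" for c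
  proof -
    have "emeasure lborel N = emeasure (distr lborel borel ((+) c)) N"
      by (simp add: lborel_distr_plus)
    also have "\<dots> = emeasure lborel ((+) c -` N \<inter> space lborel)"
      by (rule emeasure_distr) (use N in auto)
    also have "(+) c -` N \<inter> space lborel = {x. x + c \<in> N}" by (auto simp: add.commute)
    finally show ?thesis by simp
  qed
  have "emeasure (lborel \<Otimes>\<^sub>M lborel) A = (\<integral>\<^sup>+x. emeasure lborel (Pair x -` A) \<partial>lborel)"
    by (rule lborel.emeasure_pair_measure_alt[OF A])
  also have "\<dots> = (\<integral>\<^sup>+(x::'a). 0 \<partial>lborel)"
  proof (rule nn_integral_cong)
    fix x :: 'a
    have "Pair x -` A \<subseteq> {s. x + s *\<^sub>R b \<in> N}" by (auto simp: A_def)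
    then have "countable (Pair x -` A)" using c countable_subset by blast
    then show "emeasure lborel (Pair x -` A) = 0" by (rule emeasure_lborel_countable)
  qed
  finally have "emeasure (lborel \<Otimes>\<^sub>M lborel) A = 0" by simp
  moreover have "emeasure (lborel \<Otimes>\<^sub>M lborel) A = (\<integral>\<^sup>+s. emeasure lborel ((\<lambda>x. (x, s)) -` A) \<partial>lborel)"
    by (rule lborel_pair.emeasure_pair_measure_alt2[OF A])
  also have "\<dots> = (\<integral>\<^sup>+(s::real). emeasure lborel N * indicator {0..1} s \<partial>lborel)"
  proof (rule nn_integral_cong)
    fix s :: real
    have "(\<lambda>x. (x, s)) -` A = (if s \<in> {0..1} then {x. x + s *\<^sub>R b \<in> N} else {})"
      by (auto simp: A_def space_pair_measure)
    then show "emeasure lborel ((\<lambda>x. (x, s)) -` A) = emeasure lborel N * indicator {0..1} s"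
      using sh[of "s *\<^sub>R b"] by auto
  qed
  also have "\<dots> = emeasure lborel N"
    by (subst nn_integral_cmult_indicator) auto
  finally show ?thesis by simp
qed

text \<open>Where the derivative in direction \<open>b\<close> does not vanish, \<open>f\<close> is
  strictly monotone through its zero along the line in direction \<open>b\<close>, so zeros on that
  line are isolated. Finitely many basis directions cover the level set.\<close>

lemma negligible_regular_level_set:
  fixes f :: "'a::euclidean_space \<Rightarrow> real"
  assumes f: "smooth_on UNIV f" and reg: "\<And>x. f x = 0 \<Longrightarrow> \<exists>b\<in>Basis. pd b f x \<noteq> 0"
  shows "negligible {x. f x = 0}"
proof -
  define N where "N b = {x. f x = 0 \<and> pd b f x \<noteq> 0}" for b
  have cf: "continuous_on UNIV f" "continuous_on UNIV (pd b f)" for b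
    using f smooth_on_continuous smooth_on_pd by blast+
  have "negligible (N b)" for b
  proof -
    have [measurable]: "f \<in> borel_measurable borel" "pd b f \<in> borel_measurable borel"
      using cf borel_measurable_continuous_onI by blast+
    have "N b \<in> sets borel"
      unfolding N_def by measurable
    moreover have "countable {s. x + s *\<^sub>R b \<in> N b}" for x
    proof (rule countable_isolated_real)
      fix s assume "s \<in> {s. x + s *\<^sub>R b \<in> N b}"
      then have s: "f (x + s *\<^sub>R b) = 0" "pd b f (x + s *\<^sub>R b) \<noteq> 0" by (auto simp: N_def)
      define g where "g s = f (x + s *\<^sub>R b)" for s
      have D: "(g has_field_derivative pd b f (x + s *\<^sub>R b)) (at s)" for s
        unfolding g_def using smooth_on_line[OF f] by simp
      have "\<exists>e>0. \<forall>y. y \<noteq> s \<and> \<bar>y - s\<bar> < e \<longrightarrow> g y \<noteq> 0"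
      proof (cases "pd b f (x + s *\<^sub>R b) > 0")
        case True
        obtain d1 where d1: "d1 > 0" "\<And>h. h > 0 \<Longrightarrow> h < d1 \<Longrightarrow> g s < g (s + h)" using DERIV_pos_inc_right[OF D True] by auto
        obtain d2 where d2: "d2 > 0" "\<And>h. h > 0 \<Longrightarrow> h < d2 \<Longrightarrow> g (s - h) < g s" using DERIV_pos_inc_left[OF D True] by auto
        have "g y \<noteq> 0" if "y \<noteq> s" "\<bar>y - s\<bar> < min d1 d2" for y
          using s(1) that g_def[of s] d1(2)[of "y - s"] d2(2)[of "s - y"] by (cases "y > s") auto
        then have "\<forall>y. y \<noteq> s \<and> \<bar>y - s\<bar> < min d1 d2 \<longrightarrow> g y \<noteq> 0" "min d1 d2 > 0"
          using d1(1) d2(1) by auto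
        then show ?thesis by blast
      next
        case False
        then have neg: "pd b f (x + s *\<^sub>R b) < 0" using s by auto
        obtain d1 where d1: "d1 > 0" "\<And>h. h > 0 \<Longrightarrow> h < d1 \<Longrightarrow> g s > g (s + h)" using DERIV_neg_dec_right[OF D neg] by auto
        obtain d2 where d2: "d2 > 0" "\<And>h. h > 0 \<Longrightarrow> h < d2 \<Longrightarrow> g (s - h) > g s" using DERIV_neg_dec_left[OF D neg] by auto
        have "g y \<noteq> 0" if "y \<noteq> s" "\<bar>y - s\<bar> < min d1 d2" for y
          using s(1) that g_def[of s] d1(2)[of "y - s"] d2(2)[of "s - y"] by (cases "y > s") auto
        then have "\<forall>y. y \<noteq> s \<and> \<bar>y - s\<bar> < min d1 d2 \<longrightarrow> g y \<noteq> 0" "min d1 d2 > 0"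
          using d1(1) d2(1) by auto
        then show ?thesis by blast
      qed
      then show "\<exists>e>0. \<forall>y\<in>{s. x + s *\<^sub>R b \<in> N b}. \<bar>y - s\<bar> < e \<longrightarrow> y = s"
        by (auto simp: N_def g_def)
    qed
    ultimately have "emeasure lborel (N b) = 0" "N b \<in> sets borel"
      using emeasure_lborel_0_if_countable_lines by blast+
    then show ?thesis
      by (auto simp: negligible_iff_null_sets null_sets_def intro: null_sets_completionI)
  qed
  then have "negligible (\<Union>b\<in>Basis. N b)" by (intro negligible_Union) auto
  then show ?thesis
    by (rule negligible_subset) (use reg in \<open>auto simp: N_def\<close>)
qed

lemma smooth_on_real_polynomial_function:
  assumes "real_polynomial_function p"
  shows "smooth_on UNIV (p :: 'a::euclidean_space \<Rightarrow> real)"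
  using assms by induction (auto intro: smooth_intros smooth_on_linear)

text \<open>A bounded measurable function is a pointwise limit of continuous functions, and continuous
  functions are limits of polynomials, so it suffices to test against the sign of \<open>y\<close>.\<close>

lemma AE_eq_0_if_smooth_tests:
  fixes y :: "'a::euclidean_space \<Rightarrow> real"
  assumes \<Omega>: "open \<Omega>" "bounded \<Omega>" and y: "integrable (lebesgue_on \<Omega>) y"
    and tests: "\<And>p. smooth_on UNIV p \<Longrightarrow> integral\<^sup>L (lebesgue_on \<Omega>) (\<lambda>x. y x * p x) = 0"
  shows "AE x in lebesgue_on \<Omega>. y x = 0"
proof -
  have L: "\<Omega> \<in> sets lebesgue" using \<Omega> by auto
  have ym[measurable]: "y \<in> borel_measurable (lebesgue_on \<Omega>)" using y by auto
  have cm: "g \<in> borel_measurable (lebesgue_on \<Omega>)" if "continuous_on UNIV g" for g :: "'a \<Rightarrow> real"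
    using that L continuous_on_subset by (blast intro: continuous_imp_measurable_on_sets_lebesgue)
  have intg: "integrable (lebesgue_on \<Omega>) (\<lambda>x. y x * g x)" if "continuous_on UNIV g" for g
  proof -
    have "compact (closure \<Omega>)" using \<Omega> by simp
    then have "bounded (g ` closure \<Omega>)"
      using compact_continuous_image[OF continuous_on_subset[OF that subset_UNIV]] compact_imp_bounded by blast
    then obtain B where B: "\<And>x. x \<in> closure \<Omega> \<Longrightarrow> \<bar>g x\<bar> \<le> B"
      unfolding bounded_iff by auto
    have [measurable]: "g \<in> borel_measurable (lebesgue_on \<Omega>)" using cm that by blast
    have "integrable (lebesgue_on \<Omega>) (\<lambda>x. B * \<bar>y x\<bar>)" using y by auto
    then show ?thesis
    proof (rule Bochner_Integration.integrable_bound)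
      show "AE x in lebesgue_on \<Omega>. norm (y x * g x) \<le> norm (B * \<bar>y x\<bar>)"
      proof (rule AE_I2)
        fix x assume "x \<in> space (lebesgue_on \<Omega>)"
        then have "\<bar>g x\<bar> \<le> \<bar>B\<bar>" using B[of x] closure_subset[of \<Omega>] by auto
        then show "norm (y x * g x) \<le> norm (B * \<bar>y x\<bar>)"
          by (simp add: abs_mult mult.commute[of "\<bar>y x\<bar>"] mult_right_mono)
      qed
    qed measurable
  qed
  have cont: "integral\<^sup>L (lebesgue_on \<Omega>) (\<lambda>x. y x * g x) = 0" if g: "continuous_on UNIV g" for g
  proof (rule ccontr)
    define Y where "Y = integral\<^sup>L (lebesgue_on \<Omega>) (\<lambda>x. \<bar>y x\<bar>)"
    define I where "I = integral\<^sup>L (lebesgue_on \<Omega>) (\<lambda>x. y x * g x)"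
    assume "integral\<^sup>L (lebesgue_on \<Omega>) (\<lambda>x. y x * g x) \<noteq> 0"
    then have I: "\<bar>I\<bar> > 0" by (simp add: I_def)
    have Y: "Y \<ge> 0" unfolding Y_def by simp
    \<comment> \<open>Chosen so that an approximation within \<open>e\<close> on the closure changes
      the integral by at most \<open>e * Y\<close>, less than the supposed nonzero value.\<close>
    define e where "e = \<bar>I\<bar> / (2 * (Y + 1))"
    have e: "e > 0" using I Y by (simp add: e_def)
    have "compact (closure \<Omega>)" using \<Omega> by simp
    then obtain p where p: "polynomial_function p" "\<And>x. x \<in> closure \<Omega> \<Longrightarrow> norm (g x - p x) < e"
      using Stone_Weierstrass_polynomial_function[of "closure \<Omega>" g e] e g continuous_on_subset by blast
    have ps: "smooth_on UNIV p"
      using p(1) smooth_on_real_polynomial_function real_polynomial_function_eq by blast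
    have pc: "continuous_on UNIV p" using ps smooth_on_continuous by blast
    have "I = integral\<^sup>L (lebesgue_on \<Omega>) (\<lambda>x. y x * g x) - integral\<^sup>L (lebesgue_on \<Omega>) (\<lambda>x. y x * p x)"
      using tests[OF ps] by (simp add: I_def)
    also have "\<dots> = integral\<^sup>L (lebesgue_on \<Omega>) (\<lambda>x. y x * g x - y x * p x)"
      using intg[OF g] intg[OF pc] by simp
    finally have "\<bar>I\<bar> \<le> integral\<^sup>L (lebesgue_on \<Omega>) (\<lambda>x. \<bar>y x * g x - y x * p x\<bar>)"
      by simp
    also have "\<dots> \<le> integral\<^sup>L (lebesgue_on \<Omega>) (\<lambda>x. e * \<bar>y x\<bar>)"
    proof (rule integral_mono)
      show "integrable (lebesgue_on \<Omega>) (\<lambda>x. \<bar>y x * g x - y x * p x\<bar>)"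
        using intg[OF g] intg[OF pc] by auto
      show "integrable (lebesgue_on \<Omega>) (\<lambda>x. e * \<bar>y x\<bar>)" using y by auto
      fix x assume "x \<in> space (lebesgue_on \<Omega>)"
      then have "\<bar>g x - p x\<bar> \<le> e" using p(2)[of x] closure_subset[of \<Omega>] by auto
      then have "\<bar>y x\<bar> * \<bar>g x - p x\<bar> \<le> \<bar>y x\<bar> * e" by (rule mult_left_mono) auto
      then show "\<bar>y x * g x - y x * p x\<bar> \<le> e * \<bar>y x\<bar>"
        by (simp add: abs_mult[symmetric] right_diff_distrib mult.commute)
    qed
    also have "\<dots> = e * Y" by (simp add: Y_def)
    also have "\<dots> < \<bar>I\<bar>"
      using I Y by (simp add: e_def field_simps) (intro add_nonneg_pos mult_nonneg_nonneg mult_pos_pos; simp)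
    finally show False by simp
  qed
  define h where "h x = indicator \<Omega> x * sgn (y x)" for x
  have "h \<in> borel_measurable lebesgue"
  proof -
    have "(\<lambda>x. sgn (y x)) \<in> borel_measurable (lebesgue_on \<Omega>)" by measurable
    then show ?thesis
      using borel_measurable_restrict_space_iff[of \<Omega> lebesgue "\<lambda>x. sgn (y x)"] L by (simp add: h_def[abs_def])
  qed
  then have "h measurable_on UNIV"
    by (simp add: measurable_on_iff_borel_measurable lebesgue_on_UNIV_eq)
  then obtain N g where N: "negligible N" "\<And>n. continuous_on UNIV (g n)"
    "\<And>x. x \<notin> N \<Longrightarrow> (\<lambda>n. g n x) \<longlonglongrightarrow> (if x \<in> UNIV then h x else 0)"
    unfolding measurable_on_def by metis
  \<comment> \<open>Truncation to [-1, 1] leaves the limit unchanged, since a sign lies in that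
    interval, and makes the absolute value of \<open>y\<close> a dominating function.\<close>
  define k where "k n x = max (-1) (min 1 (g n x))" for n x
  have kc: "continuous_on UNIV (k n)" for n unfolding k_def using N(2) by (intro continuous_intros)
  have "(\<lambda>n. integral\<^sup>L (lebesgue_on \<Omega>) (\<lambda>x. y x * k n x)) \<longlonglongrightarrow> integral\<^sup>L (lebesgue_on \<Omega>) (\<lambda>x. \<bar>y x\<bar>)"
  proof (rule integral_dominated_convergence[where w = "\<lambda>x. \<bar>y x\<bar>"])
    show "integrable (lebesgue_on \<Omega>) (\<lambda>x. \<bar>y x\<bar>)" using y by auto
    show "(\<lambda>x. y x * k n x) \<in> borel_measurable (lebesgue_on \<Omega>)" for n using intg[OF kc] by auto
    show "AE x in lebesgue_on \<Omega>. norm (y x * k n x) \<le> \<bar>y x\<bar>" for n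
      by (intro AE_I2) (auto simp: k_def abs_mult intro!: mult_left_le)
    have "AE x in lebesgue. x \<notin> N" using N(1) by (auto simp: negligible_iff_null_sets intro: AE_not_in)
    then have "AE x in lebesgue_on \<Omega>. x \<notin> N" using L by (subst AE_restrict_space_iff) auto
    then show "AE x in lebesgue_on \<Omega>. (\<lambda>n. y x * k n x) \<longlonglongrightarrow> \<bar>y x\<bar>"
    proof (rule AE_mp, intro AE_I2 impI)
      fix x assume x: "x \<in> space (lebesgue_on \<Omega>)" "x \<notin> N"
      then have "(\<lambda>n. g n x) \<longlonglongrightarrow> sgn (y x)" using N(3)[of x] by (simp add: h_def)
      then have "(\<lambda>n. y x * k n x) \<longlonglongrightarrow> y x * max (-1) (min 1 (sgn (y x)))"
        unfolding k_def by (intro tendsto_intros)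
      also have "y x * max (-1) (min 1 (sgn (y x))) = \<bar>y x\<bar>" by (auto simp: sgn_if)
      finally show "(\<lambda>n. y x * k n x) \<longlonglongrightarrow> \<bar>y x\<bar>" .
    qed
  qed auto
  then have "integral\<^sup>L (lebesgue_on \<Omega>) (\<lambda>x. \<bar>y x\<bar>) = 0"
    by (simp add: cont[OF kc] LIMSEQ_const_iff)
  then show ?thesis
    using integral_nonneg_eq_0_iff_AE[of "lebesgue_on \<Omega>" "\<lambda>x. \<bar>y x\<bar>"] y by auto
qed

section \<open>Horizontal vector fields\<close>

definition hX :: "'n::finite + 'n \<Rightarrow> 'n hvec \<Rightarrow> 'n heis" where
  "hX j x = (axis j 1, 2 * (hJ x $ j))"

definition XX :: "'n::finite + 'n \<Rightarrow> ('n heis \<Rightarrow> real) \<Rightarrow> 'n heis \<Rightarrow> real" where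
  "XX j f \<xi> = pd (axis j 1, 0) f \<xi> + 2 * (hJ (fst \<xi>) $ j) * pd (0, 1) f \<xi>"

definition lapH :: "('n::finite heis \<Rightarrow> real) \<Rightarrow> 'n heis \<Rightarrow> real" where
  "lapH f \<xi> = (\<Sum>j\<in>UNIV. XX j (XX j f) \<xi>)"

text \<open>The generator of the dilations sending (x, t) to (s x, s^2 t).\<close>

definition ZZ :: "('n::finite heis \<Rightarrow> real) \<Rightarrow> 'n heis \<Rightarrow> real" where
  "ZZ f \<xi> = (\<Sum>i\<in>UNIV. fst \<xi> $ i * pd (axis i 1, 0) f \<xi>) + 2 * snd \<xi> * pd (0, 1) f \<xi>"

lemma hgrad_nth: "hgrad f \<xi> $ j = XX j f \<xi>"
  by (simp add: hgrad_def XX_def pd_def)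

lemma XX_eq_pd:
  assumes "f differentiable (at \<xi>)"
  shows "XX j f \<xi> = pd (hX j (fst \<xi>)) f \<xi>"
proof -
  have "hX j (fst \<xi>) = (axis j 1, 0) + (2 * (hJ (fst \<xi>) $ j)) *\<^sub>R (0, 1)"
    by (simp add: hX_def)
  then show ?thesis
    using assms by (simp only: XX_def pd_add_dir pd_scaleR_dir)
qed

lemma hJ_nth: "hJ x $ i = (case i of Inl k \<Rightarrow> - (x $ Inr k) | Inr k \<Rightarrow> x $ Inl k)"
  by (simp add: hJ_def)

lemma linear_hJ: "linear hJ"
  by (rule linearI) (auto simp: vec_eq_iff hJ_nth split: sum.splits)

lemmas hJ_linear_simps = linear_add[OF linear_hJ] linear_diff[OF linear_hJ] linear_cmul[OF linear_hJ]
  linear_neg[OF linear_hJ] linear_0[OF linear_hJ]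

lemma sum_UNIV_Plus:
  fixes g :: "'a::finite + 'b::finite \<Rightarrow> 'c::comm_monoid_add"
  shows "(\<Sum>i\<in>UNIV. g i) = (\<Sum>k\<in>UNIV. g (Inl k)) + (\<Sum>k\<in>UNIV. g (Inr k))"
proof -
  have "sum g (range Inl \<union> range Inr) = sum g (range Inl) + sum g (range Inr)"
    by (rule sum.union_disjoint) auto
  then show ?thesis
    by (simp add: UNIV_sum sum.reindex)
qed

lemma hJ_inner: "hJ x \<bullet> y = - (x \<bullet> hJ y)"
  by (simp add: inner_vec_def sum_UNIV_Plus hJ_nth sum_negf)

lemma hJ_inner_self [simp]: "hJ x \<bullet> x = 0" "x \<bullet> hJ x = 0"
  using hJ_inner[of x x] by (simp_all add: inner_commute)

lemma hJ_hJ: "hJ (hJ x) = - x"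
  by (auto simp: vec_eq_iff hJ_nth split: sum.splits)

lemma hJ_inner_hJ [simp]: "hJ x \<bullet> hJ y = x \<bullet> y"
  by (simp add: hJ_inner[of x "hJ y"] hJ_hJ)

lemma norm_hJ [simp]: "norm (hJ x) = norm x"
  by (simp add: norm_eq_sqrt_inner)

lemma hJ_axis_nth [simp]: "hJ (axis j c) $ j = 0"
  by (simp add: hJ_nth axis_def split: sum.splits)

lemma hJ_line_nth [simp]: "hJ (x + s *\<^sub>R axis j 1) $ j = hJ x $ j"
  by (simp add: hJ_linear_simps)

lemma card_sum_type: "CARD('n::finite + 'n) = 2 * CARD('n)"
  by (simp add: card_UNIV_sum)

lemma bounded_linear_coord: "bounded_linear (\<lambda>\<xi>::'n::finite heis. fst \<xi> $ i)"
  by (intro bounded_linear_compose[OF bounded_linear_vec_nth bounded_linear_fst])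

lemma smooth_coord [simp]: "smooth_on S (\<lambda>\<xi>::'n::finite heis. fst \<xi> $ i)"
  by (rule smooth_on_linear[OF bounded_linear_coord])

lemma smooth_snd [simp]: "smooth_on S (\<lambda>\<xi>::'n::finite heis. snd \<xi>)"
  by (rule smooth_on_linear[OF bounded_linear_snd])

lemma bounded_linear_hJ_coord: "bounded_linear (\<lambda>\<xi>::'n::finite heis. hJ (fst \<xi>) $ i)"
  by (cases i) (simp_all add: hJ_nth bounded_linear_coord bounded_linear_minus)

lemma smooth_hJ_coord [simp]: "smooth_on S (\<lambda>\<xi>::'n::finite heis. hJ (fst \<xi>) $ i)"
  by (rule smooth_on_linear[OF bounded_linear_hJ_coord])

lemma smooth_XX: "open S \<Longrightarrow> smooth_on S f \<Longrightarrow> smooth_on S (XX j f)"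
  unfolding XX_def[abs_def] by (intro smooth_intros smooth_on_pd smooth_hJ_coord)

lemma smooth_lapH: "open S \<Longrightarrow> smooth_on S f \<Longrightarrow> smooth_on S (lapH f)"
  unfolding lapH_def[abs_def] by (intro smooth_intros smooth_XX)

lemma smooth_ZZ: "open S \<Longrightarrow> smooth_on S f \<Longrightarrow> smooth_on S (ZZ f)"
  unfolding ZZ_def[abs_def] by (intro smooth_intros smooth_on_pd smooth_coord smooth_snd)

lemma XX_cong: "open S \<Longrightarrow> \<xi> \<in> S \<Longrightarrow> (\<And>y. y \<in> S \<Longrightarrow> f y = g y) \<Longrightarrow> XX j f \<xi> = XX j g \<xi>"
  unfolding XX_def using pd_cong[of S \<xi> f g] by simp

lemma lapH_cong: "open S \<Longrightarrow> \<xi> \<in> S \<Longrightarrow> (\<And>y. y \<in> S \<Longrightarrow> f y = g y) \<Longrightarrow> lapH f \<xi> = lapH g \<xi>"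
  unfolding lapH_def by (intro sum.cong refl XX_cong[of S]) (auto intro: XX_cong[of S])

lemma XX_at: "(f has_derivative f') (at \<xi>) \<Longrightarrow> XX j f \<xi> = f' (hX j (fst \<xi>))"
  using XX_eq_pd[of f \<xi> j] pd_at[of f f'] by (simp add: differentiableI)

lemma XX_const [simp]: "XX j (\<lambda>_. c) \<xi> = 0"
  by (simp add: XX_at[OF has_derivative_const])

lemma XX_add: "f differentiable (at \<xi>) \<Longrightarrow> g differentiable (at \<xi>) \<Longrightarrow>
    XX j (\<lambda>y. f y + g y) \<xi> = XX j f \<xi> + XX j g \<xi>"
  by (simp add: XX_def pd_add algebra_simps)

lemma XX_diff: "f differentiable (at \<xi>) \<Longrightarrow> g differentiable (at \<xi>) \<Longrightarrow>
    XX j (\<lambda>y. f y - g y) \<xi> = XX j f \<xi> - XX j g \<xi>"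
  by (simp add: XX_def pd_diff algebra_simps)

lemma XX_mult: "f differentiable (at \<xi>) \<Longrightarrow> g differentiable (at \<xi>) \<Longrightarrow>
    XX j (\<lambda>y. f y * g y) \<xi> = f \<xi> * XX j g \<xi> + XX j f \<xi> * g \<xi>"
  by (simp add: XX_def pd_mult algebra_simps)

lemma XX_cmult: "f differentiable (at \<xi>) \<Longrightarrow> XX j (\<lambda>y. c * f y) \<xi> = c * XX j f \<xi>"
  using XX_mult[of "\<lambda>_. c" \<xi> f] by simp

lemma XX_compose:
  fixes g :: "real \<Rightarrow> real"
  shows "f differentiable (at \<xi>) \<Longrightarrow> g differentiable (at (f \<xi>)) \<Longrightarrow>
    XX j (\<lambda>y. g (f y)) \<xi> = pd 1 g (f \<xi>) * XX j f \<xi>"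
  by (simp add: XX_def pd_compose algebra_simps)

lemma lapH_diff:
  assumes "open S" "smooth_on S f" "smooth_on S g" "\<xi> \<in> S"
  shows "lapH (\<lambda>y. f y - g y) \<xi> = lapH f \<xi> - lapH g \<xi>"
proof -
  have "XX j (XX j (\<lambda>y. f y - g y)) \<xi> = XX j (XX j f) \<xi> - XX j (XX j g) \<xi>" for j
  proof -
    have "XX j (XX j (\<lambda>y. f y - g y)) \<xi> = XX j (\<lambda>y. XX j f y - XX j g y) \<xi>"
      using assms smooth_on_differentiable by (intro XX_cong[of S] XX_diff) blast+
    also have "\<dots> = XX j (XX j f) \<xi> - XX j (XX j g) \<xi>"
      using assms smooth_on_differentiable smooth_XX by (intro XX_diff) blast+
    finally show ?thesis .
  qed
  then show ?thesis by (simp add: lapH_def sum_subtractf)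
qed

lemma pd_pd_frozen:
  fixes f :: "'n::finite heis \<Rightarrow> real"
  assumes "open S" "smooth_on S f" "p \<in> S"
  shows "XX j (XX j f) p = pd (hX j (fst p)) (pd (hX j (fst p)) f) p"
proof -
  define d where "d = hX j (fst p)"
  have dd: "d = (axis j 1, 0) + (2 * (hJ (fst p) $ j)) *\<^sub>R (0, 1)" by (simp add: d_def hX_def)
  have sX: "smooth_on S (XX j f)" using assms smooth_XX by blast
  have spd: "smooth_on S (pd b f)" for b using assms smooth_on_pd by blast
  have df: "f differentiable (at x)" if "x \<in> S" for x using that assms smooth_on_differentiable by blast
  have "XX j (XX j f) p = pd d (XX j f) p"
    using XX_eq_pd[OF smooth_on_differentiable[OF sX assms(1,3)]] by (simp add: d_def)
  also have "\<dots> = pd d (\<lambda>\<xi>. pd d f \<xi> + (2 * (hJ (fst \<xi>) $ j) - 2 * (hJ (fst p) $ j)) * pd (0, 1) f \<xi>) p"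
  proof (rule pd_cong[OF assms(1,3)])
    fix y assume "y \<in> S"
    then show "XX j f y = pd d f y + (2 * (hJ (fst y) $ j) - 2 * (hJ (fst p) $ j)) * pd (0, 1) f y"
      unfolding dd XX_def by (simp only: pd_add_dir[OF df] pd_scaleR_dir[OF df]) (simp add: algebra_simps)
  qed
  also have "\<dots> = pd d (pd d f) p + pd d (\<lambda>\<xi>. (2 * (hJ (fst \<xi>) $ j) - 2 * (hJ (fst p) $ j)) * pd (0, 1) f \<xi>) p"
    by (rule pd_add) (rule smooth_on_differentiable[OF _ assms(1,3)], intro smooth_intros assms spd smooth_hJ_coord)+
  also have "pd d (\<lambda>\<xi>. (2 * (hJ (fst \<xi>) $ j) - 2 * (hJ (fst p) $ j)) * pd (0, 1) f \<xi>) p = 0"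
  proof -
    define l where "l \<xi> = 2 * (hJ (fst \<xi>) $ j) - 2 * (hJ (fst p) $ j)" for \<xi> :: "'n heis"
    have "(l has_derivative (\<lambda>\<xi>. 2 * (hJ (fst \<xi>) $ j) - 0)) (at p)"
      unfolding l_def[abs_def]
      by (intro has_derivative_diff has_derivative_const has_derivative_mult_right
          bounded_linear_imp_has_derivative bounded_linear_hJ_coord)
    then have "l differentiable (at p)" "pd d l p = 0"
      by (auto simp: differentiable_def d_def hX_def pd_at)
    then show ?thesis
      using pd_mult[of l p "pd (0,1) f" d] smooth_on_differentiable[OF spd assms(1,3)]
      by (simp add: l_def)
  qed
  finally show ?thesis by (simp add: d_def)
qed

section \<open>Integration by parts\<close>

text \<open>The extension of \<open>G\<close> by zero is continuous because \<open>G\<close>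
  vanishes on the frontier, and \<open>integral_pd_eq_0\<close> applies to it.\<close>

lemma integral_pd_smooth_eq_0:
  fixes G :: "'a::euclidean_space \<Rightarrow> real"
  assumes \<Omega>: "open \<Omega>" "bounded \<Omega>" "negligible (frontier \<Omega>)"
    and U: "open U" "closure \<Omega> \<subseteq> U" and G: "smooth_on U G" "\<And>x. x \<in> frontier \<Omega> \<Longrightarrow> G x = 0"
  shows "integral\<^sup>L (lebesgue_on \<Omega>) (pd b G) = 0"
proof -
  define H where "H x = (if x \<in> closure \<Omega> then G x else 0)" for x
  have HG: "H x = G x" if "x \<in> \<Omega>" for x using that closure_subset by (auto simp: H_def)
  have pdH: "pd b H x = pd b G x" if "x \<in> \<Omega>" for x
    using pd_cong[OF \<Omega>(1) that] HG by metis
  have cl: "compact (closure \<Omega>)" using \<Omega> by simp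
  have cG: "continuous_on (closure \<Omega>) G" "continuous_on (closure \<Omega>) (pd b G)"
    using G U smooth_on_continuous smooth_on_pd continuous_on_subset by metis+
  have "continuous_on UNIV H"
  proof -
    have "continuous_on (closure \<Omega> \<union> - \<Omega>) H"
      unfolding H_def
    proof (rule continuous_on_cases)
      show "\<forall>x. x \<in> closure \<Omega> \<and> x \<notin> closure \<Omega> \<or> x \<in> - \<Omega> \<and> x \<in> closure \<Omega> \<longrightarrow> G x = 0"
        using G(2) \<Omega>(1) by (auto simp: frontier_def interior_open)
    qed (use \<Omega> cG in auto)
    moreover have "closure \<Omega> \<union> - \<Omega> = UNIV" using closure_subset by blast
    ultimately show ?thesis by simp
  qed
  moreover have "H x = 0" if "x \<notin> \<Omega>" for x
    using that G(2) \<Omega>(1) by (auto simp: H_def frontier_def interior_open)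
  moreover have "H differentiable (at x)" if "x \<in> \<Omega>" for x
  proof -
    have "G differentiable (at x)"
      using that U closure_subset G smooth_on_differentiable by blast
    then have "(G has_derivative (\<lambda>b. pd b G x)) (at x)" by (rule pd_has_derivative)
    then have "(H has_derivative (\<lambda>b. pd b G x)) (at x)"
      by (rule has_derivative_transform_within_open[OF _ \<Omega>(1) that]) (simp add: HG)
    then show ?thesis by (rule differentiableI)
  qed
  moreover obtain C where "\<And>x. x \<in> \<Omega> \<Longrightarrow> \<bar>pd b H x\<bar> \<le> C"
  proof -
    have "bounded (pd b G ` closure \<Omega>)" using cl cG compact_continuous_image compact_imp_bounded by blast
    then obtain C where "\<And>x. x \<in> closure \<Omega> \<Longrightarrow> \<bar>pd b G x\<bar> \<le> C" unfolding bounded_iff by auto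
    then show ?thesis using that[of C] pdH closure_subset[of \<Omega>] by (auto simp: subset_eq)
  qed
  ultimately have "integral\<^sup>L (lebesgue_on \<Omega>) (pd b H) = 0"
    using \<Omega> by (intro integral_pd_eq_0) auto
  moreover have "integral\<^sup>L (lebesgue_on \<Omega>) (pd b H) = integral\<^sup>L (lebesgue_on \<Omega>) (pd b G)"
    by (rule Bochner_Integration.integral_cong) (auto simp: pdH)
  ultimately show ?thesis by simp
qed

lemma integrable_smooth:
  assumes "open \<Omega>" "bounded \<Omega>" "open U" "closure \<Omega> \<subseteq> U" "smooth_on U f"
  shows "integrable (lebesgue_on \<Omega>) f"
  using assms integrable_on_closure smooth_on_continuous continuous_on_subset by metis

text \<open>The coefficient of the vertical derivative in X_j is independent of t, so X_j G is a sum
  of coordinate derivatives of functions that vanish on the frontier.\<close>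

lemma integral_XX_eq_0:
  fixes G :: "'n::finite heis \<Rightarrow> real"
  assumes \<Omega>: "open \<Omega>" "bounded \<Omega>" "negligible (frontier \<Omega>)"
    and U: "open U" "closure \<Omega> \<subseteq> U" and G: "smooth_on U G" "\<And>x. x \<in> frontier \<Omega> \<Longrightarrow> G x = 0"
  shows "integral\<^sup>L (lebesgue_on \<Omega>) (XX j G) = 0"
proof -
  define H where "H \<xi> = 2 * (hJ (fst \<xi>) $ j) * G \<xi>" for \<xi>
  have H: "smooth_on U H" unfolding H_def by (intro smooth_intros U G smooth_hJ_coord)
  have "XX j G \<xi> = pd (axis j 1, 0) G \<xi> + pd (0, 1) H \<xi>" if "\<xi> \<in> U" for \<xi>
  proof -
    define l where "l \<xi> = 2 * (hJ (fst \<xi>) $ j)" for \<xi> :: "'n heis"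
    have "(l has_derivative l) (at \<xi>)"
      unfolding l_def[abs_def]
      by (intro has_derivative_mult_right bounded_linear_imp_has_derivative bounded_linear_hJ_coord)
    then have "l differentiable (at \<xi>)" "pd (0,1) l \<xi> = 0"
      by (auto simp: differentiable_def pd_at l_def hJ_linear_simps)
    then have "pd (0, 1) H \<xi> = 2 * (hJ (fst \<xi>) $ j) * pd (0, 1) G \<xi>"
      using pd_mult[of l \<xi> G] smooth_on_differentiable[OF G(1) U(1) that]
      unfolding H_def[abs_def] l_def[symmetric] by simp
    then show ?thesis by (simp add: XX_def)
  qed
  then have "integral\<^sup>L (lebesgue_on \<Omega>) (XX j G) = integral\<^sup>L (lebesgue_on \<Omega>) (\<lambda>\<xi>. pd (axis j 1, 0) G \<xi> + pd (0, 1) H \<xi>)"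
    using U(2) closure_subset[of \<Omega>] by (intro Bochner_Integration.integral_cong) (auto simp: subset_eq)
  also have "\<dots> = integral\<^sup>L (lebesgue_on \<Omega>) (pd (axis j 1, 0) G) + integral\<^sup>L (lebesgue_on \<Omega>) (pd (0, 1) H)"
    by (intro Bochner_Integration.integral_add integrable_smooth[OF \<Omega>(1,2) U] smooth_on_pd U G H)
  also have "\<dots> = 0"
    using integral_pd_smooth_eq_0[OF \<Omega> U G, of "(axis j 1, 0)"] integral_pd_smooth_eq_0[OF \<Omega> U H, of "(0,1)"] G(2)
    by (simp add: H_def)
  finally show ?thesis .
qed

text \<open>The dilation field has divergence 2n + 2, so the integrand is the divergence of
  \<open>G\<close> times that field.\<close>

lemma integral_ZZ:
  fixes G :: "'n::finite heis \<Rightarrow> real"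
  assumes \<Omega>: "open \<Omega>" "bounded \<Omega>" "negligible (frontier \<Omega>)"
    and U: "open U" "closure \<Omega> \<subseteq> U" and G: "smooth_on U G" "\<And>x. x \<in> frontier \<Omega> \<Longrightarrow> G x = 0"
  shows "integral\<^sup>L (lebesgue_on \<Omega>) (\<lambda>\<xi>. ZZ G \<xi> + (2 * real CARD('n) + 2) * G \<xi>) = 0"
proof -
  define H where "H i \<xi> = fst \<xi> $ i * G \<xi>" for i and \<xi> :: "'n heis"
  define K where "K \<xi> = 2 * snd \<xi> * G \<xi>" for \<xi> :: "'n heis"
  have H: "smooth_on U (H i)" for i unfolding H_def[abs_def] by (intro smooth_intros U G smooth_coord)
  have K: "smooth_on U K" unfolding K_def[abs_def] by (intro smooth_intros U G smooth_snd)
  have "ZZ G \<xi> + (2 * real CARD('n) + 2) * G \<xi> = (\<Sum>i\<in>UNIV. pd (axis i 1, 0) (H i) \<xi>) + pd (0, 1) K \<xi>" if "\<xi> \<in> U" for \<xi>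
  proof -
    note D = smooth_on_has_derivative[OF G(1) U(1) that]
    have "pd (axis i 1, 0) (H i) \<xi> = G \<xi> + fst \<xi> $ i * pd (axis i 1, 0) G \<xi>" for i
      unfolding H_def[abs_def]
      by (subst pd_at[OF has_derivative_mult[OF bounded_linear_imp_has_derivative[OF bounded_linear_coord] D]]) simp
    moreover have "pd (0, 1) K \<xi> = 2 * G \<xi> + 2 * snd \<xi> * pd (0, 1) G \<xi>"
      unfolding K_def[abs_def]
      by (subst pd_at[OF has_derivative_mult[OF has_derivative_mult_right[OF bounded_linear_imp_has_derivative[OF bounded_linear_snd]] D]]) simp
    ultimately show ?thesis
      by (simp add: ZZ_def sum.distrib card_UNIV_sum algebra_simps)
  qed
  then have "integral\<^sup>L (lebesgue_on \<Omega>) (\<lambda>\<xi>. ZZ G \<xi> + (2 * real CARD('n) + 2) * G \<xi>)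
      = integral\<^sup>L (lebesgue_on \<Omega>) (\<lambda>\<xi>. (\<Sum>i\<in>UNIV. pd (axis i 1, 0) (H i) \<xi>) + pd (0, 1) K \<xi>)"
    using U(2) closure_subset[of \<Omega>] by (intro Bochner_Integration.integral_cong) (auto simp: subset_eq)
  also have "\<dots> = (\<Sum>i\<in>UNIV. integral\<^sup>L (lebesgue_on \<Omega>) (pd (axis i 1, 0) (H i))) + integral\<^sup>L (lebesgue_on \<Omega>) (pd (0, 1) K)"
    by (subst Bochner_Integration.integral_add, intro Bochner_Integration.integrable_sum)
      (auto intro!: integrable_smooth[OF \<Omega>(1,2) U] smooth_on_pd U G H K Bochner_Integration.integral_sum)
  also have "\<dots> = 0"
    using integral_pd_smooth_eq_0[OF \<Omega> U H] integral_pd_smooth_eq_0[OF \<Omega> U K] G(2)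
    by (simp add: H_def K_def)
  finally show ?thesis .
qed

lemma integrable_mult_continuous:
  fixes z g :: "'a::euclidean_space \<Rightarrow> real"
  assumes \<Omega>: "open \<Omega>" "bounded \<Omega>" and z: "integrable (lebesgue_on \<Omega>) z"
    and g: "continuous_on (closure \<Omega>) g"
  shows "integrable (lebesgue_on \<Omega>) (\<lambda>x. z x * g x)"
proof -
  have L: "\<Omega> \<in> sets lebesgue" using \<Omega> by auto
  have [measurable]: "g \<in> borel_measurable (lebesgue_on \<Omega>)" "z \<in> borel_measurable (lebesgue_on \<Omega>)"
    using continuous_on_subset[OF g closure_subset] L z
    by (auto intro: continuous_imp_measurable_on_sets_lebesgue)
  have "compact (closure \<Omega>)" using \<Omega> by simp
  then have "bounded (g ` closure \<Omega>)"
    using compact_continuous_image[OF g] compact_imp_bounded by blast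
  then obtain B where B: "\<And>x. x \<in> closure \<Omega> \<Longrightarrow> \<bar>g x\<bar> \<le> B"
    unfolding bounded_iff by auto
  have "integrable (lebesgue_on \<Omega>) (\<lambda>x. B * \<bar>z x\<bar>)" using z by auto
  then show ?thesis
  proof (rule Bochner_Integration.integrable_bound)
    show "AE x in lebesgue_on \<Omega>. norm (z x * g x) \<le> norm (B * \<bar>z x\<bar>)"
    proof (rule AE_I2)
      fix x assume "x \<in> space (lebesgue_on \<Omega>)"
      then have "\<bar>g x\<bar> \<le> \<bar>B\<bar>" using B[of x] closure_subset[of \<Omega>] by auto
      then show "norm (z x * g x) \<le> norm (B * \<bar>z x\<bar>)"
        by (simp add: abs_mult mult.commute[of "\<bar>z x\<bar>"] mult_right_mono)
    qed
  qed measurable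
qed

text \<open>Only the kernel is differentiated, so integrability of \<open>z\<close> suffices. The
  remainder is uniformly small in the integration variable by uniform continuity of the kernel's
  derivatives on a compact product set.\<close>

lemma param_integral_has_derivative:
  fixes \<kappa> :: "'a::euclidean_space \<times> 'b::euclidean_space \<Rightarrow> real"
  assumes \<Omega>: "open \<Omega>" "bounded \<Omega>" and z: "integrable (lebesgue_on \<Omega>) z" and \<kappa>: "smooth_on UNIV \<kappa>"
  shows "((\<lambda>a. integral\<^sup>L (lebesgue_on \<Omega>) (\<lambda>\<xi>. z \<xi> * \<kappa> (a, \<xi>))) has_derivative
    (\<lambda>h. integral\<^sup>L (lebesgue_on \<Omega>) (\<lambda>\<xi>. z \<xi> * pd (h, 0) \<kappa> (a, \<xi>)))) (at a)"
proof -
  define I where "I g = integral\<^sup>L (lebesgue_on \<Omega>) (\<lambda>\<xi>. z \<xi> * g \<xi>)" for g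
  have cpd: "continuous_on UNIV (pd b \<kappa>)" for b using smooth_on_continuous smooth_on_pd[OF open_UNIV \<kappa>] by blast
  have c\<kappa>: "continuous_on UNIV \<kappa>" using smooth_on_continuous \<kappa> by blast
  have int: "integrable (lebesgue_on \<Omega>) (\<lambda>\<xi>. z \<xi> * g (a, \<xi>))" if "continuous_on UNIV g" for g :: "'a \<times> 'b \<Rightarrow> real" and a
    by (intro integrable_mult_continuous[OF \<Omega> z] continuous_on_compose2[OF that] continuous_intros) auto
  have d\<kappa>: "\<kappa> differentiable (at p)" for p using smooth_on_differentiable[OF \<kappa>] by simp
  have lin: "linear (\<lambda>h. I (\<lambda>\<xi>. pd (h, 0) \<kappa> (a, \<xi>)))"
  proof (rule linearI)
    show "I (\<lambda>\<xi>. pd (h + k, 0) \<kappa> (a, \<xi>)) = I (\<lambda>\<xi>. pd (h, 0) \<kappa> (a, \<xi>)) + I (\<lambda>\<xi>. pd (k, 0) \<kappa> (a, \<xi>))" for h k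
      using int[OF cpd] pd_add_dir[OF d\<kappa>, of "(h,0)" "(k,0)"] by (simp add: I_def distrib_left)
    show "I (\<lambda>\<xi>. pd (r *\<^sub>R h, 0) \<kappa> (a, \<xi>)) = r *\<^sub>R I (\<lambda>\<xi>. pd (h, 0) \<kappa> (a, \<xi>))" for r h
      using int[OF cpd] pd_scaleR_dir[OF d\<kappa>, of r "(h,0)"] by (simp add: I_def mult.left_commute[of _ r])
  qed
  define Y where "Y = integral\<^sup>L (lebesgue_on \<Omega>) (\<lambda>\<xi>. \<bar>z \<xi>\<bar>)"
  have Y: "Y \<ge> 0" by (simp add: Y_def)
  have "\<exists>d>0. \<forall>y. norm (y - a) < d \<longrightarrow> norm (I (\<lambda>\<xi>. \<kappa> (y, \<xi>)) - I (\<lambda>\<xi>. \<kappa> (a, \<xi>)) - I (\<lambda>\<xi>. pd (y - a, 0) \<kappa> (a, \<xi>))) \<le> e * norm (y - a)"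
    if e: "e > 0" for e
  proof -
    \<comment> \<open>The dimension pays for summing over basis directions, and \<open>Y + 1\<close>
      for integrating against \<open>z\<close>; the summand 1 avoids a zero divisor.\<close>
    define \<epsilon> where "\<epsilon> = e / (DIM('a) * (Y + 1))"
    have \<epsilon>: "\<epsilon> > 0" using e Y by (simp add: \<epsilon>_def)
    define C where "C = cball a 1 \<times> closure \<Omega>"
    have C: "compact C" using \<Omega> by (simp add: C_def compact_Times)
    have "\<exists>d>0. \<forall>p\<in>C. \<forall>p'\<in>C. dist p' p < d \<longrightarrow> dist (pd (i, 0) \<kappa> p') (pd (i, 0) \<kappa> p) < \<epsilon>" for i :: 'a
      using compact_uniformly_continuous[OF continuous_on_subset[OF cpd subset_UNIV] C] \<epsilon>
      unfolding uniformly_continuous_on_def by blast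
    then obtain D where D: "\<And>i. D i > 0" "\<And>i p p'. p \<in> C \<Longrightarrow> p' \<in> C \<Longrightarrow> dist p' p < D i \<Longrightarrow> dist (pd (i, 0) \<kappa> p') (pd (i, 0) \<kappa> p) < \<epsilon>"
      by metis
    \<comment> \<open>The inserted 1 keeps the parameter inside \<open>cball a 1\<close>, where
      uniform continuity was obtained.\<close>
    define d where "d = Min (insert 1 (D ` Basis))"
    have d: "d > 0" "d \<le> 1" "\<And>i. i \<in> Basis \<Longrightarrow> d \<le> D i"
    proof -
      show "d > 0" using D(1) unfolding d_def by (subst Min_gr_iff) auto
      show "d \<le> 1" unfolding d_def by (rule Min_le) auto
      show "d \<le> D i" if "i \<in> Basis" for i unfolding d_def using that by (intro Min_le) auto
    qed
    have bound: "\<bar>\<kappa> (y, \<xi>) - \<kappa> (a, \<xi>) - pd (y - a, 0) \<kappa> (a, \<xi>)\<bar> \<le> norm (y - a) * (DIM('a) * \<epsilon>)"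
      if y: "norm (y - a) < d" and \<xi>: "\<xi> \<in> \<Omega>" for y \<xi>
    proof -
      define h where "h = y - a"
      have "\<exists>s>0. s < 1 \<and> \<kappa> ((a, \<xi>) + 1 *\<^sub>R (h, 0)) - \<kappa> ((a, \<xi>) + 0 *\<^sub>R (h, 0)) = (1 - 0) * pd (h, 0) \<kappa> ((a, \<xi>) + s *\<^sub>R (h, 0))"
        by (rule MVT2) (rule zero_less_one, rule smooth_on_line[OF \<kappa>], auto)
      then obtain s where s: "0 < s" "s < 1" "\<kappa> (y, \<xi>) - \<kappa> (a, \<xi>) = pd (h, 0) \<kappa> (a + s *\<^sub>R h, \<xi>)"
        by (auto simp: h_def)
      have hb: "(h, 0 :: 'b) = (\<Sum>i\<in>Basis. (h \<bullet> i) *\<^sub>R (i, 0))"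
        by (simp add: prod_eq_iff fst_sum snd_sum euclidean_representation)
      have ex: "pd (h, 0) \<kappa> p = (\<Sum>i\<in>Basis. (h \<bullet> i) * pd (i, 0) \<kappa> p)" for p
        by (subst hb, rule pd_sum_dir[OF d\<kappa>])
      have sh: "norm (s *\<^sub>R h) < d"
      proof -
        have "s * norm h \<le> 1 * norm h" using s by (intro mult_right_mono) auto
        then show ?thesis using s y by (simp add: h_def)
      qed
      have "\<bar>\<kappa> (y, \<xi>) - \<kappa> (a, \<xi>) - pd (h, 0) \<kappa> (a, \<xi>)\<bar>
          = \<bar>\<Sum>i\<in>Basis. (h \<bullet> i) * (pd (i, 0) \<kappa> (a + s *\<^sub>R h, \<xi>) - pd (i, 0) \<kappa> (a, \<xi>))\<bar>"
        by (simp add: s(3) ex sum_subtractf right_diff_distrib)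
      also have "\<dots> \<le> (\<Sum>i\<in>Basis. \<bar>(h \<bullet> i) * (pd (i, 0) \<kappa> (a + s *\<^sub>R h, \<xi>) - pd (i, 0) \<kappa> (a, \<xi>))\<bar>)"
        by (rule sum_abs)
      also have "\<dots> \<le> (\<Sum>i\<in>(Basis::'a set). norm h * \<epsilon>)"
      proof (rule sum_mono)
        fix i :: 'a assume i: "i \<in> Basis"
        have "dist (pd (i, 0) \<kappa> (a + s *\<^sub>R h, \<xi>)) (pd (i, 0) \<kappa> (a, \<xi>)) < \<epsilon>"
        proof (rule D(2))
          show "(a, \<xi>) \<in> C" "(a + s *\<^sub>R h, \<xi>) \<in> C"
            using \<xi> closure_subset[of \<Omega>] sh d by (auto simp: C_def dist_norm)
          show "dist (a + s *\<^sub>R h, \<xi>) (a, \<xi>) < D i"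
            using sh d(3)[OF i] by (simp add: dist_norm)
        qed
        then show "\<bar>(h \<bullet> i) * (pd (i, 0) \<kappa> (a + s *\<^sub>R h, \<xi>) - pd (i, 0) \<kappa> (a, \<xi>))\<bar> \<le> norm h * \<epsilon>"
          unfolding abs_mult dist_real_def by (intro mult_mono Basis_le_norm i) auto
      qed
      finally show ?thesis by (simp add: h_def mult.left_commute)
    qed
    show ?thesis
    proof (intro exI[of _ d] conjI allI impI d(1))
      fix y assume y: "norm (y - a) < d"
      have "I (\<lambda>\<xi>. \<kappa> (y, \<xi>)) - I (\<lambda>\<xi>. \<kappa> (a, \<xi>)) - I (\<lambda>\<xi>. pd (y - a, 0) \<kappa> (a, \<xi>))
          = integral\<^sup>L (lebesgue_on \<Omega>) (\<lambda>\<xi>. z \<xi> * \<kappa> (y, \<xi>) - z \<xi> * \<kappa> (a, \<xi>) - z \<xi> * pd (y - a, 0) \<kappa> (a, \<xi>))"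
        unfolding I_def using int[OF cpd] int[OF c\<kappa>] by simp
      also have "norm \<dots> \<le> integral\<^sup>L (lebesgue_on \<Omega>) (\<lambda>\<xi>. \<bar>z \<xi> * \<kappa> (y, \<xi>) - z \<xi> * \<kappa> (a, \<xi>) - z \<xi> * pd (y - a, 0) \<kappa> (a, \<xi>)\<bar>)"
        by simp
      also have "\<dots> \<le> integral\<^sup>L (lebesgue_on \<Omega>) (\<lambda>\<xi>. (norm (y - a) * (DIM('a) * \<epsilon>)) * \<bar>z \<xi>\<bar>)"
      proof (rule integral_mono)
        show "integrable (lebesgue_on \<Omega>) (\<lambda>\<xi>. \<bar>z \<xi> * \<kappa> (y, \<xi>) - z \<xi> * \<kappa> (a, \<xi>) - z \<xi> * pd (y - a, 0) \<kappa> (a, \<xi>)\<bar>)"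
          using int[OF cpd] int[OF c\<kappa>] by auto
        show "integrable (lebesgue_on \<Omega>) (\<lambda>\<xi>. (norm (y - a) * (DIM('a) * \<epsilon>)) * \<bar>z \<xi>\<bar>)" using z by auto
        fix \<xi> assume "\<xi> \<in> space (lebesgue_on \<Omega>)"
        then have "\<bar>z \<xi>\<bar> * \<bar>\<kappa> (y, \<xi>) - \<kappa> (a, \<xi>) - pd (y - a, 0) \<kappa> (a, \<xi>)\<bar> \<le> \<bar>z \<xi>\<bar> * (norm (y - a) * (DIM('a) * \<epsilon>))"
          using bound[OF y] by (intro mult_left_mono) auto
        then show "\<bar>z \<xi> * \<kappa> (y, \<xi>) - z \<xi> * \<kappa> (a, \<xi>) - z \<xi> * pd (y - a, 0) \<kappa> (a, \<xi>)\<bar> \<le> (norm (y - a) * (DIM('a) * \<epsilon>)) * \<bar>z \<xi>\<bar>"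
          by (simp add: abs_mult[symmetric] right_diff_distrib mult.commute)
      qed
      also have "\<dots> = norm (y - a) * (DIM('a) * \<epsilon> * Y)" by (simp add: Y_def)
      also have "\<dots> \<le> norm (y - a) * e"
      proof (rule mult_left_mono)
        have "DIM('a) * \<epsilon> * Y = e * (Y / (Y + 1))" by (simp add: \<epsilon>_def)
        also have "\<dots> \<le> e * 1" using e Y by (intro mult_left_mono) auto
        finally show "DIM('a) * \<epsilon> * Y \<le> e" by simp
      qed auto
      finally show "norm (I (\<lambda>\<xi>. \<kappa> (y, \<xi>)) - I (\<lambda>\<xi>. \<kappa> (a, \<xi>)) - I (\<lambda>\<xi>. pd (y - a, 0) \<kappa> (a, \<xi>))) \<le> e * norm (y - a)"
        by (simp add: mult.commute)
    qed
  qed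
  then show ?thesis
    using lin unfolding has_derivative_at_alt I_def by (simp add: linear_conv_bounded_linear)
qed

lemma smooth_param_integral:
  fixes \<kappa> :: "'a::euclidean_space \<times> 'b::euclidean_space \<Rightarrow> real"
  assumes \<Omega>: "open \<Omega>" "bounded \<Omega>" and z: "integrable (lebesgue_on \<Omega>) z" and \<kappa>: "smooth_on UNIV \<kappa>"
  shows "smooth_on UNIV (\<lambda>a. integral\<^sup>L (lebesgue_on \<Omega>) (\<lambda>\<xi>. z \<xi> * \<kappa> (a, \<xi>)))"
proof -
  have "C_k_on k UNIV (\<lambda>a. integral\<^sup>L (lebesgue_on \<Omega>) (\<lambda>\<xi>. z \<xi> * \<kappa> (a, \<xi>)))" if "smooth_on UNIV \<kappa>" for k and \<kappa> :: "'a \<times> 'b \<Rightarrow> real"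
    using that
  proof (induction k arbitrary: \<kappa>)
    case 0
    then show ?case
      using param_integral_has_derivative[OF \<Omega> z 0]
      by (auto intro!: has_derivative_continuous_on[where f' = "\<lambda>a h. integral\<^sup>L (lebesgue_on \<Omega>) (\<lambda>\<xi>. z \<xi> * pd (h, 0) \<kappa> (a, \<xi>))"])
  next
    case (Suc k)
    note D = param_integral_has_derivative[OF \<Omega> z Suc.prems]
    have "pd b (\<lambda>a. integral\<^sup>L (lebesgue_on \<Omega>) (\<lambda>\<xi>. z \<xi> * \<kappa> (a, \<xi>))) = (\<lambda>a. integral\<^sup>L (lebesgue_on \<Omega>) (\<lambda>\<xi>. z \<xi> * pd (b, 0) \<kappa> (a, \<xi>)))" for b
      using pd_at[OF D] by blast
    then show ?case
      using Suc.IH[OF smooth_on_pd[OF open_UNIV Suc.prems]] D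
      by (auto simp: C_k_on_Suc differentiable_on_def intro!: differentiableI)
  qed
  then show ?thesis using \<kappa> by (simp add: smooth_on_def)
qed

section \<open>The gauge and the mean value kernel\<close>

definition hd2 :: "'n::finite heis \<Rightarrow> 'n heis \<Rightarrow> real" where
  "hd2 a \<xi> = (fst \<xi> - fst a) \<bullet> (fst \<xi> - fst a)"

text \<open>The vertical coordinate of the product of the inverse of \<open>a\<close> with \<xi>.
  Since \<open>hd2\<close> is the squared norm of its horizontal part, \<open>qH a\<close> is the
  fourth power of the gauge distance from \<open>a\<close>.\<close>

definition htau :: "'n::finite heis \<Rightarrow> 'n heis \<Rightarrow> real" where
  "htau a \<xi> = snd \<xi> - snd a - 2 * (hJ (fst a) \<bullet> fst \<xi>)"

definition qH :: "'n::finite heis \<Rightarrow> 'n heis \<Rightarrow> real" where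
  "qH a \<xi> = (hd2 a \<xi>)\<^sup>2 + (htau a \<xi>)\<^sup>2"

lemma smooth_hd2_gen:
  assumes "open S" "\<And>i. smooth_on S (\<lambda>p. fst (A p) $ i)" "\<And>i. smooth_on S (\<lambda>p. fst (B p) $ i)"
  shows "smooth_on S (\<lambda>p. hd2 (A p) (B p))"
  unfolding hd2_def inner_vec_def by (simp add: smooth_intros assms)

lemma smooth_htau_gen:
  assumes "open S" "\<And>i. smooth_on S (\<lambda>p. fst (A p) $ i)" "\<And>i. smooth_on S (\<lambda>p. fst (B p) $ i)"
    "smooth_on S (\<lambda>p. snd (A p))" "smooth_on S (\<lambda>p. snd (B p))"
  shows "smooth_on S (\<lambda>p. htau (A p) (B p))"
proof -
  have "smooth_on S (\<lambda>p. hJ (fst (A p)) $ i)" for i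
    by (cases i) (simp_all add: hJ_nth assms smooth_intros)
  then show ?thesis
    unfolding htau_def inner_vec_def by (simp add: smooth_intros assms)
qed

lemma smooth_qH_gen:
  assumes "open S" "\<And>i. smooth_on S (\<lambda>p. fst (A p) $ i)" "\<And>i. smooth_on S (\<lambda>p. fst (B p) $ i)"
    "smooth_on S (\<lambda>p. snd (A p))" "smooth_on S (\<lambda>p. snd (B p))"
  shows "smooth_on S (\<lambda>p. qH (A p) (B p))"
  unfolding qH_def by (intro smooth_intros smooth_hd2_gen smooth_htau_gen assms)

lemma smooth_hd2 [simp]: "smooth_on UNIV (hd2 a)"
  using smooth_hd2_gen[of UNIV "\<lambda>_. a" "\<lambda>\<xi>. \<xi>"] by simp

lemma smooth_htau [simp]: "smooth_on UNIV (htau a)"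
  using smooth_htau_gen[of UNIV "\<lambda>_. a" "\<lambda>\<xi>. \<xi>"] by simp

lemma smooth_qH [simp]: "smooth_on UNIV (qH a)"
  using smooth_qH_gen[of UNIV "\<lambda>_. a" "\<lambda>\<xi>. \<xi>"] by simp

lemma differentiable_qH [simp]: "qH a differentiable (at \<xi>)" "hd2 a differentiable (at \<xi>)" "htau a differentiable (at \<xi>)"
  by (rule smooth_on_differentiable[where S = UNIV]; simp)+

lemma XX_coord: "XX j (\<lambda>\<xi>. fst \<xi> $ i) \<xi> = (if i = j then 1 else 0)"
  by (subst XX_at[OF bounded_linear_imp_has_derivative[OF bounded_linear_coord]]) (simp add: hX_def axis_def)

lemma XX_hd2: "XX j (hd2 a) \<xi> = 2 * (fst \<xi> - fst a) $ j"
proof -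
  have "(hd2 a has_derivative (\<lambda>h. 2 * ((fst \<xi> - fst a) \<bullet> fst h))) (at \<xi>)"
    unfolding hd2_def[abs_def] by (auto intro!: derivative_eq_intros simp: inner_commute)
  then show ?thesis by (simp add: XX_at hX_def inner_axis)
qed

lemma XX_htau: "XX j (htau a) \<xi> = 2 * hJ (fst \<xi> - fst a) $ j"
proof -
  have "(htau a has_derivative (\<lambda>h. snd h - 2 * (hJ (fst a) \<bullet> fst h))) (at \<xi>)"
    unfolding htau_def[abs_def] by (auto intro!: derivative_eq_intros)
  then show ?thesis by (simp add: XX_at hX_def inner_axis hJ_linear_simps)
qed

lemma XX_qH: "XX j (qH a) \<xi> = 4 * hd2 a \<xi> * (fst \<xi> - fst a) $ j + 4 * htau a \<xi> * hJ (fst \<xi> - fst a) $ j"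
proof -
  have "XX j (\<lambda>\<xi>. hd2 a \<xi> * hd2 a \<xi> + htau a \<xi> * htau a \<xi>) \<xi>
      = 4 * hd2 a \<xi> * (fst \<xi> - fst a) $ j + 4 * htau a \<xi> * hJ (fst \<xi> - fst a) $ j"
    by (simp add: XX_add XX_mult XX_hd2 XX_htau differentiable_mult)
  then show ?thesis by (simp add: qH_def[abs_def] power2_eq_square)
qed

lemma XX_XX_qH:
  fixes \<xi> :: "'n::finite heis"
  shows "XX j (XX j (qH a)) \<xi> = 4 * hd2 a \<xi> + 8 * ((fst \<xi> - fst a) $ j)\<^sup>2 + 8 * (hJ (fst \<xi> - fst a) $ j)\<^sup>2"
proof -
  define A where "A \<xi> = (fst \<xi> - fst a) $ j" for \<xi> :: "'n heis"
  define B where "B \<xi> = hJ (fst \<xi> - fst a) $ j" for \<xi> :: "'n heis"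
  have dA: "(A has_derivative (\<lambda>h. fst h $ j)) (at \<xi>)"
    unfolding A_def[abs_def] using bounded_linear_imp_has_derivative[OF bounded_linear_coord]
    by (auto intro!: derivative_eq_intros)
  have dB: "(B has_derivative (\<lambda>h. hJ (fst h) $ j - 0)) (at \<xi>)"
    unfolding B_def[abs_def] hJ_linear_simps vector_minus_component
    by (intro has_derivative_diff has_derivative_const bounded_linear_imp_has_derivative bounded_linear_hJ_coord)
  have XA: "XX j A \<xi> = 1" and XB: "XX j B \<xi> = 0"
    using XX_at[OF dA] XX_at[OF dB] by (simp_all add: hX_def)
  have diff: "A differentiable (at \<xi>)" "B differentiable (at \<xi>)"
    using dA dB by (auto simp: differentiable_def)
  have "XX j (XX j (qH a)) \<xi> = XX j (\<lambda>\<xi>. 4 * (hd2 a \<xi> * A \<xi>) + 4 * (htau a \<xi> * B \<xi>)) \<xi>"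
    by (rule arg_cong[where f = "\<lambda>g. XX j g \<xi>"]) (auto simp: XX_qH A_def B_def)
  also have "\<dots> = 4 * (hd2 a \<xi> + 2 * A \<xi> * A \<xi>) + 4 * (2 * B \<xi> * B \<xi>)"
    using diff XX_hd2[of j a \<xi>, folded A_def] XX_htau[of j a \<xi>, folded B_def]
    by (simp add: XX_add XX_cmult XX_mult differentiable_mult XA XB)
  finally show ?thesis by (simp add: A_def B_def power2_eq_square)
qed

lemma sum_nth_sq: "(\<Sum>j\<in>UNIV. ((x :: real^'m::finite) $ j)\<^sup>2) = x \<bullet> x"
  by (simp add: inner_vec_def power2_eq_square)

text \<open>Centred at the origin and divided by 4, this exhibits an explicit solution of the
  equation with right-hand side (2n + 4) |x|^2.\<close>

lemma lapH_qH: "lapH (qH a) \<xi> = 4 * (2 * real CARD('n) + 4) * hd2 a (\<xi> :: 'n::finite heis)"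
  unfolding lapH_def XX_XX_qH sum.distrib sum_distrib_left[symmetric] sum_nth_sq
  by (simp add: hd2_def card_UNIV_sum algebra_simps)

text \<open>The gradient of \<open>qH a\<close> is a combination of y and Jy with y = x - a; these
  are orthogonal and of equal length, so the squares of the coefficients add up to a multiple of
  \<open>qH\<close> itself.\<close>

lemma sum_XX_qH_sq: "(\<Sum>j\<in>UNIV. (XX j (qH a) \<xi>)\<^sup>2) = 16 * hd2 a \<xi> * qH a \<xi>"
proof -
  define y where "y = fst \<xi> - fst a"
  have "(\<Sum>j\<in>UNIV. (XX j (qH a) \<xi>)\<^sup>2) = (\<Sum>j\<in>UNIV. ((4 * hd2 a \<xi>) *\<^sub>R y + (4 * htau a \<xi>) *\<^sub>R hJ y) $ j ^ 2)"
    by (simp add: XX_qH y_def)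
  also have "\<dots> = ((4 * hd2 a \<xi>) *\<^sub>R y + (4 * htau a \<xi>) *\<^sub>R hJ y) \<bullet> ((4 * hd2 a \<xi>) *\<^sub>R y + (4 * htau a \<xi>) *\<^sub>R hJ y)"
    by (rule sum_nth_sq)
  also have "\<dots> = 16 * hd2 a \<xi> * qH a \<xi>"
    by (simp add: inner_add_left inner_add_right qH_def power2_eq_square) (simp add: hd2_def y_def algebra_simps)
  finally show ?thesis .
qed

lemma lapH_compose:
  fixes g :: "real \<Rightarrow> real"
  assumes S: "open S" "\<xi> \<in> S" "smooth_on S f" and g: "smooth_on UNIV g"
  shows "lapH (\<lambda>y. g (f y)) \<xi> = pd 1 (pd 1 g) (f \<xi>) * (\<Sum>j\<in>UNIV. (XX j f \<xi>)\<^sup>2) + pd 1 g (f \<xi>) * lapH f \<xi>"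
proof -
  have df: "f differentiable (at y)" if "y \<in> S" for y using that S smooth_on_differentiable by blast
  have dg: "g differentiable (at r)" "pd 1 g differentiable (at r)" for r
    using g smooth_on_differentiable smooth_on_pd open_UNIV by blast+
  have "XX j (XX j (\<lambda>y. g (f y))) \<xi> = pd 1 (pd 1 g) (f \<xi>) * (XX j f \<xi>)\<^sup>2 + pd 1 g (f \<xi>) * XX j (XX j f) \<xi>" for j
  proof -
    have "XX j (XX j (\<lambda>y. g (f y))) \<xi> = XX j (\<lambda>y. pd 1 g (f y) * XX j f y) \<xi>"
      by (rule XX_cong[OF S(1,2)]) (simp add: XX_compose df dg)
    also have "\<dots> = pd 1 g (f \<xi>) * XX j (XX j f) \<xi> + (pd 1 (pd 1 g) (f \<xi>) * XX j f \<xi>) * XX j f \<xi>"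
      using smooth_on_differentiable[OF smooth_XX[OF S(1,3)] S(1,2)]
        differentiable_compose[of "pd 1 g" f \<xi>] dg df S
      by (subst XX_mult) (auto simp: XX_compose)
    finally show ?thesis by (simp add: power2_eq_square)
  qed
  then show ?thesis by (simp add: lapH_def sum.distrib sum_distrib_left)
qed

section \<open>Weyl's lemma for the sub-Laplacian\<close>

text \<open>The factor \<open>hd2\<close> is common to \<open>lapH_qH\<close> and
  \<open>sum_XX_qH_sq\<close>, so it comes out of the sub-Laplacian of every function of
  \<open>qH a\<close>. The power n + 2 of \<mu> keeps the total mass fixed under dilations: the
  gauge ball where \<open>\<mu>\<^sup>2 * qH a \<xi>\<close> is below 1 has volume of order \<mu> to
  the power -(n + 1), and \<open>hd2\<close> is of order 1 / \<mu> on it.\<close>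

definition Kr :: "real \<Rightarrow> 'n::finite heis \<Rightarrow> 'n heis \<Rightarrow> real" where
  "Kr \<mu> a \<xi> = hd2 a \<xi> * (\<mu> ^ (CARD('n) + 2) * bmp 2 (1 - \<mu>\<^sup>2 * qH a \<xi>))"

lemma hd2_sym: "hd2 a \<xi> = hd2 \<xi> a"
  by (simp add: hd2_def inner_diff_left inner_diff_right inner_commute)

lemma htau_sym: "htau a \<xi> = - htau \<xi> a"
  using hJ_inner[of "fst a" "fst \<xi>"] by (simp add: htau_def inner_commute)

lemma qH_sym: "qH a \<xi> = qH \<xi> a"
  using htau_sym[of a \<xi>] hd2_sym[of a \<xi>] by (simp add: qH_def)

lemma Kr_sym: "Kr \<mu> a \<xi> = Kr \<mu> \<xi> a"
  by (simp add: Kr_def qH_sym[of a] hd2_sym[of a])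

lemma hd2_nonneg [simp]: "0 \<le> hd2 a \<xi>" by (simp add: hd2_def)

lemma qH_nonneg [simp]: "0 \<le> qH a \<xi>" by (simp add: qH_def)

lemma Kr_nonneg: "0 \<le> \<mu> \<Longrightarrow> 0 \<le> Kr \<mu> a \<xi>"
  by (simp add: Kr_def bmp_nonneg)

lemma Kr_eq_0: "1 \<le> \<mu>\<^sup>2 * qH a \<xi> \<Longrightarrow> Kr \<mu> a \<xi> = 0"
  by (simp add: Kr_def bmp_eq_0)

lemma smooth_Kr_gen:
  fixes A B :: "'a::euclidean_space \<Rightarrow> 'n::finite heis"
  assumes "\<And>i. smooth_on UNIV (\<lambda>p. fst (A p) $ i)" "\<And>i. smooth_on UNIV (\<lambda>p. fst (B p) $ i)"
    "smooth_on UNIV (\<lambda>p. snd (A p))" "smooth_on UNIV (\<lambda>p. snd (B p))" "smooth_on UNIV m"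
  shows "smooth_on UNIV (\<lambda>p. Kr (m p) (A p) (B p))"
  unfolding Kr_def by (intro smooth_intros smooth_hd2_gen smooth_qH_gen smooth_on_compose[OF _ smooth_bmp] assms open_UNIV)

lemma smooth_Kr_center: "smooth_on UNIV (\<lambda>p. Kr \<mu> (fst p) (snd p) :: real)"
  by (rule smooth_Kr_gen) (auto intro!: smooth_on_linear bounded_linear_compose[OF bounded_linear_vec_nth]
      bounded_linear_compose[OF bounded_linear_fst] bounded_linear_compose[OF bounded_linear_snd]
      bounded_linear_fst bounded_linear_snd)

lemma smooth_Kr_scale: "smooth_on UNIV (\<lambda>p. Kr (fst p) a (snd p) :: real)"
  by (rule smooth_Kr_gen) (auto intro!: smooth_on_linear bounded_linear_compose[OF bounded_linear_vec_nth]
      bounded_linear_compose[OF bounded_linear_fst] bounded_linear_compose[OF bounded_linear_snd]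
      bounded_linear_fst bounded_linear_snd)

lemma DERIV_bmp_0: "(bmp 0 has_field_derivative bmp 2 x) (at x)"
  using DERIV_bmp[of 0 x] by (simp add: numeral_2_eq_2)

lemma DERIV_bmp_2: "(bmp 2 has_field_derivative bmp 4 x - 2 * bmp 3 x) (at x)"
  using DERIV_bmp[of 2 x] by (simp add: eval_nat_numeral)

text \<open>A potential for the change of scale: its sub-Laplacian is the \<mu>-derivative of
  \<open>Kr\<close> up to a power of \<mu>, and it vanishes outside a gauge ball.\<close>

definition Phi :: "real \<Rightarrow> 'n::finite heis \<Rightarrow> 'n heis \<Rightarrow> real" where
  "Phi \<mu> a \<xi> = - bmp 0 (1 - \<mu>\<^sup>2 * qH a \<xi>)"

lemma smooth_Phi: "smooth_on UNIV (Phi \<mu> a)"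
  unfolding Phi_def[abs_def] by (intro smooth_intros smooth_on_compose[OF _ smooth_bmp] smooth_qH open_UNIV)

lemma lapH_Phi:
  fixes a :: "'n::finite heis"
  shows "lapH (Phi \<mu> a) \<xi> = hd2 a \<xi> * (4 * (2 * real CARD('n) + 4) * \<mu>\<^sup>2 * bmp 2 (1 - \<mu>\<^sup>2 * qH a \<xi>)
     - 16 * \<mu>^4 * qH a \<xi> * (bmp 4 (1 - \<mu>\<^sup>2 * qH a \<xi>) - 2 * bmp 3 (1 - \<mu>\<^sup>2 * qH a \<xi>)))"
proof -
  define g where "g r = - bmp 0 (1 - \<mu>\<^sup>2 * r)" for r
  have g: "smooth_on UNIV g"
    unfolding g_def[abs_def] by (intro smooth_intros smooth_on_compose[OF _ smooth_bmp] open_UNIV smooth_on_linear bounded_linear_ident)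
  have lin: "((\<lambda>r. 1 - \<mu>\<^sup>2 * r) has_field_derivative - \<mu>\<^sup>2) (at r)" for r
    by (auto intro!: derivative_eq_intros)
  have g1: "pd 1 g r = \<mu>\<^sup>2 * bmp 2 (1 - \<mu>\<^sup>2 * r)" for r
    unfolding g_def[abs_def]
    by (rule pd_real) (auto intro!: derivative_eq_intros DERIV_chain2[OF DERIV_bmp_0 lin])
  have g2: "pd 1 (pd 1 g) r = - (\<mu>^4) * (bmp 4 (1 - \<mu>\<^sup>2 * r) - 2 * bmp 3 (1 - \<mu>\<^sup>2 * r))" for r
    unfolding g1 using pd_real[OF DERIV_cmult[OF DERIV_chain2[OF DERIV_bmp_2 lin]], of "\<mu>\<^sup>2" r]
    by (simp add: power4_eq_xxxx power2_eq_square)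
  have "Phi \<mu> a = (\<lambda>y. g (qH a y))" by (simp add: Phi_def g_def fun_eq_iff)
  then have "lapH (Phi \<mu> a) \<xi> = lapH (\<lambda>y. g (qH a y)) \<xi>" by simp
  also have "\<dots> = pd 1 (pd 1 g) (qH a \<xi>) * (16 * hd2 a \<xi> * qH a \<xi>) + pd 1 g (qH a \<xi>) * (4 * (2 * real CARD('n) + 4) * hd2 a \<xi>)"
    by (subst lapH_compose[of UNIV]) (auto simp: g sum_XX_qH_sq lapH_qH)
  finally show ?thesis by (simp add: g1 g2 algebra_simps)
qed

text \<open>The identity behind the mean value property. Varying the scale changes the kernel by the
  sub-Laplacian of a function supported in the gauge ball, which a weakly harmonic function does not
  see.\<close>

lemma DERIV_Kr:
  fixes a :: "'n::finite heis"
  shows "((\<lambda>\<mu>. Kr \<mu> a \<xi>) has_field_derivative \<mu> ^ (CARD('n) - 1) / 8 * lapH (Phi \<mu> a) \<xi>) (at \<mu>)"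
proof -
  \<comment> \<open>Since n is at least 1, the subtraction in the exponent n - 1 is not
    truncated.\<close>
  obtain m where m: "CARD('n) = Suc m" using not0_implies_Suc[of "CARD('n)"] by auto
  have in1: "((\<lambda>\<mu>. 1 - \<mu>\<^sup>2 * qH a \<xi>) has_field_derivative - (2 * \<mu> * qH a \<xi>)) (at \<mu>)"
    by (auto intro!: derivative_eq_intros)
  have "((\<lambda>\<mu>. Kr \<mu> a \<xi>) has_field_derivative
     hd2 a \<xi> * (real (m + 3) * \<mu> ^ (m + 2) * bmp 2 (1 - \<mu>\<^sup>2 * qH a \<xi>)
      + (bmp 4 (1 - \<mu>\<^sup>2 * qH a \<xi>) - 2 * bmp 3 (1 - \<mu>\<^sup>2 * qH a \<xi>)) * - (2 * \<mu> * qH a \<xi>) * \<mu> ^ (m + 3))) (at \<mu>)"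
  proof -
    have "((\<lambda>\<mu>. \<mu> ^ (m + 3)) has_field_derivative real (m + 3) * \<mu> ^ (m + 2)) (at \<mu>)"
      using DERIV_pow[of "m + 3" \<mu>] by simp
    from DERIV_cmult[OF DERIV_mult[OF this DERIV_chain2[OF DERIV_bmp_2 in1]], of "hd2 a \<xi>"]
    show ?thesis unfolding Kr_def m by (simp add: eval_nat_numeral)
  qed
  moreover have "hd2 a \<xi> * (real (m + 3) * \<mu> ^ (m + 2) * bmp 2 (1 - \<mu>\<^sup>2 * qH a \<xi>)
      + (bmp 4 (1 - \<mu>\<^sup>2 * qH a \<xi>) - 2 * bmp 3 (1 - \<mu>\<^sup>2 * qH a \<xi>)) * - (2 * \<mu> * qH a \<xi>) * \<mu> ^ (m + 3))
    = \<mu> ^ (CARD('n) - 1) / 8 * lapH (Phi \<mu> a) \<xi>"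
    unfolding lapH_Phi m by (simp add: power_add eval_nat_numeral algebra_simps)
  ultimately show ?thesis by (rule DERIV_cong)
qed

text \<open>A small gauge distance bounds both coordinates of the translated point. Undoing the
  translation costs the twist 2 <Ja, y>, which is controlled by the bound \<open>R\<close> on the
  centres; hence the uniformity in \<open>a\<close>.\<close>

lemma qH_close:
  assumes e: "e > 0" and R: "R \<ge> 0"
  obtains \<mu>0 where "\<mu>0 > 0"
    "\<And>\<mu> a \<xi>. \<mu>0 \<le> \<mu> \<Longrightarrow> norm a \<le> R \<Longrightarrow> \<mu>\<^sup>2 * qH a \<xi> \<le> 1 \<Longrightarrow> dist a (\<xi> :: 'n::finite heis) < e"
proof -
  \<comment> \<open>The minimum with 1 gives \<open>\<delta>\<^sup>2 \<le> \<delta>\<close>. The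
    horizontal part contributes \<delta>, the vertical part \<delta> + 2R\<delta>; the divisor 3 +
    2R leaves room for a strict inequality.\<close>
  define \<delta> where "\<delta> = min 1 (e / (3 + 2 * R))"
  have \<delta>: "\<delta> > 0" "\<delta> \<le> 1" "(3 + 2 * R) * \<delta> \<le> e"
  proof -
    have "\<delta> \<le> e / (3 + 2 * R)" by (simp add: \<delta>_def)
    then show "(3 + 2 * R) * \<delta> \<le> e" using R by (simp add: field_simps)
  qed (use e R in \<open>auto simp: \<delta>_def\<close>)
  show ?thesis
  proof
    show "1 / \<delta>\<^sup>2 > 0" using \<delta> by simp
    fix \<mu> and a \<xi> :: "'n heis" assume \<mu>: "1 / \<delta>\<^sup>2 \<le> \<mu>" and a: "norm a \<le> R" and q: "\<mu>\<^sup>2 * qH a \<xi> \<le> 1"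
    have "(1 / \<delta>\<^sup>2)\<^sup>2 \<le> \<mu>\<^sup>2" using \<mu> \<delta> by (intro power_mono) auto
    then have "(1 / \<delta>\<^sup>2)\<^sup>2 * qH a \<xi> \<le> 1"
      using q mult_right_mono[of _ _ "qH a \<xi>"] qH_nonneg[of a \<xi>] by fastforce
    then have q4: "qH a \<xi> \<le> \<delta> ^ 4"
    proof -
      have "(1 / \<delta>\<^sup>2)\<^sup>2 * qH a \<xi> = qH a \<xi> / \<delta> ^ 4"
        by (simp add: power_divide flip: power_mult)
      then show ?thesis using \<open>(1 / \<delta>\<^sup>2)\<^sup>2 * qH a \<xi> \<le> 1\<close> \<delta> by (simp add: divide_le_eq_1_pos)
    qed
    define y where "y = fst \<xi> - fst a"
    have "(norm y) ^ 4 = (hd2 a \<xi>)\<^sup>2"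
      by (simp add: hd2_def y_def dot_square_norm)
    then have "norm y ^ 4 \<le> \<delta> ^ 4" using q4 by (simp add: qH_def) (smt (verit) zero_le_power2)
    then have y: "norm y \<le> \<delta>"
      using \<delta> power_mono_iff[of "norm y" \<delta> 4] by simp
    have "(htau a \<xi>)\<^sup>2 \<le> (\<delta>\<^sup>2)\<^sup>2" using q4 by (simp add: qH_def) (smt (verit) zero_le_power2)
    then have "\<bar>htau a \<xi>\<bar> \<le> \<delta>\<^sup>2" using abs_le_square_iff[of "htau a \<xi>" "\<delta>\<^sup>2"] by simp
    also have "\<delta>\<^sup>2 \<le> \<delta>" using \<delta> by (simp add: power2_eq_square mult_left_le)
    finally have t: "\<bar>htau a \<xi>\<bar> \<le> \<delta>" .
    have "snd \<xi> - snd a = htau a \<xi> + 2 * (hJ (fst a) \<bullet> y)"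
      by (simp add: htau_def y_def inner_diff_right)
    moreover have "\<bar>hJ (fst a) \<bullet> y\<bar> \<le> R * \<delta>"
    proof -
      have "\<bar>hJ (fst a) \<bullet> y\<bar> \<le> norm (fst a) * norm y"
        using Cauchy_Schwarz_ineq2[of "hJ (fst a)" y] by simp
      also have "\<dots> \<le> R * \<delta>"
        using a y R norm_fst_le[of "fst a" "snd a"] by (intro mult_mono) auto
      finally show ?thesis .
    qed
    ultimately have s: "\<bar>snd \<xi> - snd a\<bar> \<le> \<delta> + 2 * (R * \<delta>)" using t by linarith
    have "dist a \<xi> \<le> norm (fst \<xi> - fst a) + norm (snd \<xi> - snd a)"
      by (metis dist_commute dist_norm fst_diff norm_Pair_le prod.collapse snd_diff)
    also have "\<dots> \<le> \<delta> + (\<delta> + 2 * (R * \<delta>))" using y s by (simp add: y_def)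
    also have "\<dots> < (3 + 2 * R) * \<delta>" using \<delta> by (simp add: algebra_simps)
    finally show "dist a \<xi> < e" using \<delta> by linarith
  qed
qed

lemma AE_continuous_eq_0:
  fixes g :: "'a::euclidean_space \<Rightarrow> real"
  assumes S: "open S" and g: "continuous_on S g" and ae: "AE x in lebesgue_on S. g x = 0" and x: "x \<in> S"
  shows "g x = 0"
proof (rule ccontr)
  assume "g x \<noteq> 0"
  define T where "T = {y \<in> S. g y \<noteq> 0}"
  have "open T"
    unfolding T_def using continuous_open_preimage[OF g S, of "- {0}"] by (auto simp: vimage_def Int_def)
  moreover have "x \<in> T" using x \<open>g x \<noteq> 0\<close> by (simp add: T_def)
  ultimately have "\<not> negligible T" using open_not_negligible by blast
  moreover have "AE y in lebesgue. y \<notin> T"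
    using ae S by (subst (asm) AE_restrict_space_iff) (auto simp: T_def elim!: eventually_mono)
  then have "negligible T"
    by (simp add: negligible_iff_null_sets AE_iff_null_sets[symmetric] \<open>open T\<close> lmeasurable_open borel_open sets_completionI_sets)
  ultimately show False by simp
qed

section \<open>Bounded domains with a smooth defining function\<close>

locale smooth_domain =
  fixes \<Omega> :: "'n::finite heis set" and f :: "'n heis \<Rightarrow> real"
  assumes open_dom: "open \<Omega>" and bounded_dom: "bounded \<Omega>" and defining: "defining_function \<Omega> f"
begin

lemma smooth_f: "smooth_on UNIV f" and dom_eq: "\<Omega> = {\<xi>. f \<xi> < 0}" and frontier_eq: "frontier \<Omega> = {\<xi>. f \<xi> = 0}"
  using defining by (auto simp: defining_function_def)

lemma grad_f_nonzero:
  assumes "p \<in> frontier \<Omega>"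
  shows "\<exists>b\<in>Basis. pd b f p \<noteq> 0"
proof (rule ccontr)
  assume "\<not> ?thesis"
  then have "pd v f p = 0" for v
    using pd_sum_dir[OF smooth_on_differentiable[OF smooth_f open_UNIV], where c = "\<lambda>i. v \<bullet> i" and a = "\<lambda>i. i" and I = Basis and x = p]
    by (simp add: euclidean_representation)
  then have "frechet_derivative f (at p) = (\<lambda>_. 0)" by (simp add: pd_def fun_eq_iff)
  then show False using defining assms unfolding defining_function_def by blast
qed

lemma negligible_frontier: "negligible (frontier \<Omega>)"
  unfolding frontier_eq
  by (rule negligible_regular_level_set[OF smooth_f]) (use grad_f_nonzero frontier_eq in auto)

lemma compact_closure_dom: "compact (closure \<Omega>)"
  using bounded_dom by simp

lemma test_functionsI:
  assumes "smooth_on UNIV \<psi>" "closed K" "K \<subseteq> \<Omega>" "\<And>\<xi>. \<xi> \<notin> K \<Longrightarrow> \<psi> \<xi> = 0"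
  shows "\<psi> \<in> test_functions \<Omega>"
proof -
  have K: "compact K" using assms bounded_dom bounded_subset compact_eq_bounded_closed by blast
  have "closure {\<xi>. \<psi> \<xi> \<noteq> 0} \<subseteq> K"
    by (rule closure_minimal) (use assms in auto)
  moreover have "bounded {\<xi>. \<psi> \<xi> \<noteq> 0}"
    by (rule bounded_subset[OF compact_imp_bounded[OF K]]) (use assms in auto)
  ultimately show ?thesis
    using assms unfolding test_functions_def by auto
qed

lemma test_functionsE:
  assumes "\<psi> \<in> test_functions \<Omega>"
  obtains K where "compact K" "K \<subseteq> \<Omega>" "\<And>\<xi>. \<xi> \<notin> K \<Longrightarrow> \<psi> \<xi> = 0" "smooth_on UNIV \<psi>"
proof (rule that[of "closure {\<xi>. \<psi> \<xi> \<noteq> 0}"])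
  show "\<psi> \<xi> = 0" if "\<xi> \<notin> closure {\<xi>. \<psi> \<xi> \<noteq> 0}" for \<xi>
    using that subsetD[OF closure_subset, of \<xi> "{\<xi>. \<psi> \<xi> \<noteq> 0}"] by blast
  show "compact (closure {\<xi>. \<psi> \<xi> \<noteq> 0})" "closure {\<xi>. \<psi> \<xi> \<noteq> 0} \<subseteq> \<Omega>" "smooth_on UNIV \<psi>"
    using assms unfolding test_functions_def by blast+
qed

lemma test_smooth: "\<psi> \<in> test_functions \<Omega> \<Longrightarrow> smooth_on UNIV \<psi>"
  by (auto simp: test_functions_def)

lemma test_mult:
  assumes "\<psi> \<in> test_functions \<Omega>" "smooth_on UNIV p"
  shows "(\<lambda>\<xi>. \<psi> \<xi> * p \<xi>) \<in> test_functions \<Omega>"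
proof -
  obtain K where K: "compact K" "K \<subseteq> \<Omega>" "\<And>\<xi>. \<xi> \<notin> K \<Longrightarrow> \<psi> \<xi> = 0" "smooth_on UNIV \<psi>"
    using test_functionsE[OF assms(1)] by blast
  show ?thesis
    by (rule test_functionsI[OF smooth_on_mult[OF open_UNIV K(4) assms(2)] compact_imp_closed[OF K(1)] K(2)])
      (simp add: K(3))
qed

lemma XX_0_off_closed:
  assumes "closed K" "\<And>\<xi>. \<xi> \<notin> K \<Longrightarrow> \<psi> \<xi> = 0" "\<xi> \<notin> K"
  shows "XX j \<psi> \<xi> = 0"
  using XX_cong[of "- K" \<xi> \<psi> "\<lambda>_. 0"] assms by auto

lemma test_XX:
  assumes "\<psi> \<in> test_functions \<Omega>"
  shows "XX j \<psi> \<in> test_functions \<Omega>"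
proof -
  obtain K where K: "compact K" "K \<subseteq> \<Omega>" "\<And>\<xi>. \<xi> \<notin> K \<Longrightarrow> \<psi> \<xi> = 0" "smooth_on UNIV \<psi>"
    using test_functionsE[OF assms(1)] by blast
  show ?thesis
    by (rule test_functionsI[OF smooth_XX[OF open_UNIV K(4)] compact_imp_closed[OF K(1)] K(2)
        XX_0_off_closed[OF compact_imp_closed[OF K(1)] K(3)]])
qed

lemma test_frontier:
  assumes "\<psi> \<in> test_functions \<Omega>" "\<xi> \<notin> \<Omega>"
  shows "\<psi> \<xi> = 0"
proof -
  obtain K where "K \<subseteq> \<Omega>" "\<And>\<xi>. \<xi> \<notin> K \<Longrightarrow> \<psi> \<xi> = 0"
    using test_functionsE[OF assms(1)] by blast
  then show ?thesis using assms(2) by blast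
qed

lemma test_integral_XX:
  assumes "\<psi> \<in> test_functions \<Omega>"
  shows "integral\<^sup>L (lebesgue_on \<Omega>) (XX j \<psi>) = 0"
  using integral_XX_eq_0[OF open_dom bounded_dom negligible_frontier open_UNIV subset_UNIV test_smooth[OF assms]]
    test_frontier[OF assms] open_dom by (auto simp: frontier_def interior_open)

lemma test_integral_lapH:
  assumes "\<psi> \<in> test_functions \<Omega>"
  shows "integral\<^sup>L (lebesgue_on \<Omega>) (lapH \<psi>) = 0"
proof -
  have "integral\<^sup>L (lebesgue_on \<Omega>) (lapH \<psi>) = (\<Sum>j\<in>UNIV. integral\<^sup>L (lebesgue_on \<Omega>) (XX j (XX j \<psi>)))"
    unfolding lapH_def[abs_def]
    by (intro Bochner_Integration.integral_sum integrable_smooth[OF open_dom bounded_dom open_UNIV subset_UNIV] smooth_XX test_smooth[OF assms] open_UNIV)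
  then show ?thesis using test_integral_XX test_XX[OF assms] by simp
qed

text \<open>Smooth cutoffs supported where f is at most -1/k (for k > 0), tending to 1 at every
  point of the domain.\<close>

definition chi :: "nat \<Rightarrow> 'n heis \<Rightarrow> real" where
  "chi k \<xi> = bmp 0 (- real k * f \<xi> - 1)"

lemma smooth_chi: "smooth_on UNIV (chi k)"
  unfolding chi_def[abs_def] by (intro smooth_on_compose[OF _ smooth_bmp] smooth_intros smooth_f open_UNIV)

lemma chi_test: "chi k \<in> test_functions \<Omega>"
proof (rule test_functionsI[OF smooth_chi])
  show "closed {\<xi>. - real k * f \<xi> - 1 \<ge> 0}"
    using smooth_on_continuous[OF smooth_f] by (intro closed_Collect_le continuous_intros) auto
  show "{\<xi>. - real k * f \<xi> - 1 \<ge> 0} \<subseteq> \<Omega>"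
  proof
    fix \<xi> assume "\<xi> \<in> {\<xi>. - real k * f \<xi> - 1 \<ge> 0}"
    then have "real k * f \<xi> < 0" by simp
    then show "\<xi> \<in> \<Omega>" by (simp add: dom_eq mult_less_0_iff)
  qed
  show "chi k \<xi> = 0" if "\<xi> \<notin> {\<xi>. - real k * f \<xi> - 1 \<ge> 0}" for \<xi>
    using that by (simp add: chi_def bmp_eq_0)
qed

lemma chi_bounds: "0 \<le> chi k \<xi>" "chi k \<xi> \<le> 1"
  by (simp_all add: chi_def bmp_nonneg bmp_0_le_1)

lemma chi_tendsto: "\<xi> \<in> \<Omega> \<Longrightarrow> (\<lambda>k. chi k \<xi>) \<longlonglongrightarrow> 1"
proof -
  assume "\<xi> \<in> \<Omega>"
  then have "- f \<xi> > 0" by (simp add: dom_eq)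
  then have "filterlim (\<lambda>k. (- f \<xi>) * real k) at_top sequentially"
    by (intro filterlim_tendsto_pos_mult_at_top[OF tendsto_const] filterlim_real_sequentially)
  then have "filterlim (\<lambda>k. - 1 + (- f \<xi>) * real k) at_top sequentially"
    by (intro filterlim_tendsto_add_at_top[OF tendsto_const])
  moreover have "(\<lambda>k. - 1 + (- f \<xi>) * real k) = (\<lambda>k. - real k * f \<xi> - 1)"
    by (simp add: fun_eq_iff)
  ultimately show ?thesis unfolding chi_def by (intro tendsto_bmp_1) simp
qed

text \<open>Testing \<open>y * chi k\<close> with an arbitrary smooth function is testing
  \<open>y\<close> with a test function, so \<open>AE_eq_0_if_smooth_tests\<close> yields that each
  \<open>y * chi k\<close> vanishes almost everywhere; then let k grow.\<close>

lemma AE_eq_0_tests: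
  assumes y: "\<And>\<theta>. \<theta> \<in> test_functions \<Omega> \<Longrightarrow> integrable (lebesgue_on \<Omega>) (\<lambda>\<xi>. y \<xi> * \<theta> \<xi>)"
    and 0: "\<And>\<psi>. \<psi> \<in> test_functions \<Omega> \<Longrightarrow> integral\<^sup>L (lebesgue_on \<Omega>) (\<lambda>\<xi>. y \<xi> * \<psi> \<xi>) = 0"
  shows "AE \<xi> in lebesgue_on \<Omega>. y \<xi> = 0"
proof -
  have "AE \<xi> in lebesgue_on \<Omega>. y \<xi> * chi k \<xi> = 0" for k
    using 0[OF test_mult[OF chi_test]]
    by (intro AE_eq_0_if_smooth_tests[OF open_dom bounded_dom y[OF chi_test]]) (simp add: mult.assoc)
  then have "AE \<xi> in lebesgue_on \<Omega>. \<forall>k. y \<xi> * chi k \<xi> = 0"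
    unfolding AE_all_countable by blast
  then show ?thesis
  proof (rule AE_mp, intro AE_I2 impI)
    fix \<xi> assume \<xi>: "\<xi> \<in> space (lebesgue_on \<Omega>)" "\<forall>k. y \<xi> * chi k \<xi> = 0"
    show "y \<xi> = 0"
    proof (rule ccontr)
      assume "y \<xi> \<noteq> 0"
      then have "(\<lambda>k. 0) \<longlonglongrightarrow> (1::real)" using \<xi> chi_tendsto[of \<xi>] by simp
      then show False by (simp add: LIMSEQ_const_iff)
    qed
  qed
qed

end

lemma smooth_on_inverse: "smooth_on {0<..} (inverse :: real \<Rightarrow> real)"
proof -
  have "C_k_on k {0<..} (inverse :: real \<Rightarrow> real)" for k
  proof (induction k)
    case 0
    show ?case by (auto intro!: continuous_intros)
  next
    case (Suc k)
    have D: "(inverse has_field_derivative - (inverse x * inverse x)) (at x)" if "x > 0" for x :: real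
      using that by (auto intro!: derivative_eq_intros simp: power2_eq_square)
    have "C_k_on k {0<..} (\<lambda>x::real. (-1) * (inverse x * inverse x))"
      by (intro C_k_on_mult C_k_on_const Suc.IH) auto
    then have "C_k_on k {0<..} (pd 1 (inverse :: real \<Rightarrow> real))"
      by (rule C_k_on_cong[rotated 2]) (simp_all add: pd_real[OF D])
    moreover have "(inverse :: real \<Rightarrow> real) differentiable_on {0<..}"
      unfolding differentiable_on_def
      using D has_field_derivative_def differentiableI differentiable_at_withinI by (metis greaterThan_iff)
    ultimately show ?case by (simp add: C_k_on_Suc)
  qed
  then show ?thesis by (simp add: smooth_on_def)
qed

lemma smooth_on_divide:
  assumes "open S" "smooth_on S f" "smooth_on S g" "\<And>x. x \<in> S \<Longrightarrow> g x > 0"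
  shows "smooth_on S (\<lambda>x. f x / g x)"
proof -
  have "smooth_on S (\<lambda>x. inverse (g x))"
    unfolding smooth_on_def
  proof (intro allI)
    show "C_k_on k S (\<lambda>x. inverse (g x))" for k
    proof (rule C_k_on_compose[OF assms(1) open_greaterThan, where f = g and g = inverse])
      show "g ` S \<subseteq> {0<..}" using assms(4) by auto
      show "C_k_on k S g" using assms(3) by (simp add: smooth_on_def)
      show "C_k_on k {0<..} (inverse :: real \<Rightarrow> real)" using smooth_on_inverse by (simp add: smooth_on_def)
    qed
  qed
  from smooth_on_mult[OF assms(1,2) this] show ?thesis by (simp add: divide_inverse)
qed

context smooth_domain
begin

text \<open>\<open>g\<close> may be wild at the boundary; the compact support of \<theta> hides
  this, and the zero extension is smooth on the two open sets \<Omega> and the complement of the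
  support, which cover the space.\<close>

lemma ext_test:
  assumes "smooth_on \<Omega> g" "\<theta> \<in> test_functions \<Omega>"
  shows "(\<lambda>\<xi>. if \<xi> \<in> \<Omega> then g \<xi> * \<theta> \<xi> else 0) \<in> test_functions \<Omega>"
proof -
  obtain K where K: "compact K" "K \<subseteq> \<Omega>" "\<And>\<xi>. \<xi> \<notin> K \<Longrightarrow> \<theta> \<xi> = 0" "smooth_on UNIV \<theta>"
    using test_functionsE[OF assms(2)] by blast
  define h where "h \<xi> = (if \<xi> \<in> \<Omega> then g \<xi> * \<theta> \<xi> else 0)" for \<xi>
  have cK: "open (- K)" using K compact_imp_closed by blast
  have "smooth_on \<Omega> h"
    by (rule smooth_on_cong[OF open_dom _ smooth_on_mult[OF open_dom assms(1) smooth_on_subset[OF open_dom open_UNIV _ K(4)]]])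
      (auto simp: h_def)
  moreover have "smooth_on (- K) h"
    by (rule smooth_on_cong[OF cK _ smooth_on_const[of _ 0]]) (use K in \<open>auto simp: h_def\<close>)
  ultimately have "smooth_on (\<Omega> \<union> - K) h" using open_dom cK smooth_on_Un by blast
  moreover have "\<Omega> \<union> - K = UNIV" using K by blast
  ultimately have "smooth_on UNIV h" by simp
  then have "h \<in> test_functions \<Omega>"
    by (rule test_functionsI[OF _ compact_imp_closed[OF K(1)] K(2)]) (use K in \<open>auto simp: h_def\<close>)
  then show ?thesis by (simp add: h_def[abs_def])
qed

lemma test_integrable: "\<psi> \<in> test_functions \<Omega> \<Longrightarrow> integrable (lebesgue_on \<Omega>) \<psi>"
  using integrable_smooth[OF open_dom bounded_dom open_UNIV subset_UNIV] test_smooth by blast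

definition weakly_harmonic :: "('n heis \<Rightarrow> real) \<Rightarrow> bool" where
  "weakly_harmonic z \<longleftrightarrow> integrable (lebesgue_on \<Omega>) z \<and>
     (\<forall>\<psi>\<in>test_functions \<Omega>. integral\<^sup>L (lebesgue_on \<Omega>) (\<lambda>\<xi>. z \<xi> * lapH \<psi> \<xi>) = 0)"

definition FF :: "('n heis \<Rightarrow> real) \<Rightarrow> real \<Rightarrow> 'n heis \<Rightarrow> real" where
  "FF z \<mu> a = integral\<^sup>L (lebesgue_on \<Omega>) (\<lambda>\<xi>. z \<xi> * Kr \<mu> a \<xi>)"

text \<open>For weakly harmonic \<open>z\<close> the sequence is eventually constant at every point
  of \<Omega>; the limit merely names the common value of the averages at small scales.\<close>

definition LL :: "('n heis \<Rightarrow> real) \<Rightarrow> 'n heis \<Rightarrow> real" where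
  "LL z a = lim (\<lambda>k. FF z (real k) a)"

lemma smooth_FF: "integrable (lebesgue_on \<Omega>) z \<Longrightarrow> smooth_on UNIV (FF z \<mu>)"
  using smooth_param_integral[OF open_dom bounded_dom _ smooth_Kr_center[of \<mu>]] by (simp add: FF_def[abs_def])

lemma DERIV_FF:
  assumes "integrable (lebesgue_on \<Omega>) z"
  shows "((\<lambda>\<mu>. FF z \<mu> a) has_field_derivative
    \<mu> ^ (CARD('n) - 1) / 8 * integral\<^sup>L (lebesgue_on \<Omega>) (\<lambda>\<xi>. z \<xi> * lapH (Phi \<mu> a) \<xi>)) (at \<mu>)"
proof -
  define \<kappa> where "\<kappa> p = Kr (fst p) a (snd p)" for p :: "real \<times> 'n heis"
  have s: "smooth_on UNIV \<kappa>" using smooth_Kr_scale[of a] by (simp add: \<kappa>_def[abs_def])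
  have p1: "pd (1, 0) \<kappa> (\<mu>, \<xi>) = \<mu> ^ (CARD('n) - 1) / 8 * lapH (Phi \<mu> a) \<xi>" for \<xi>
  proof -
    have "((\<lambda>s. \<kappa> ((0, \<xi>) + s *\<^sub>R (1, 0))) has_field_derivative pd (1, 0) \<kappa> ((0, \<xi>) + \<mu> *\<^sub>R (1, 0))) (at \<mu>)"
      by (rule smooth_on_line[OF s]) auto
    then have "((\<lambda>s. Kr s a \<xi>) has_field_derivative pd (1, 0) \<kappa> (\<mu>, \<xi>)) (at \<mu>)"
      by (simp add: \<kappa>_def)
    then show ?thesis using DERIV_Kr DERIV_unique by blast
  qed
  have p2: "pd (h, 0) \<kappa> (\<mu>, \<xi>) = h * pd (1, 0) \<kappa> (\<mu>, \<xi>)" for h \<xi>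
    using pd_scaleR_dir[OF smooth_on_differentiable[OF s open_UNIV UNIV_I], of h "(1, 0)"] by simp
  have "((\<lambda>\<mu>. FF z \<mu> a) has_derivative (\<lambda>h. integral\<^sup>L (lebesgue_on \<Omega>) (\<lambda>\<xi>. z \<xi> * pd (h, 0) \<kappa> (\<mu>, \<xi>)))) (at \<mu>)"
    using param_integral_has_derivative[OF open_dom bounded_dom assms s, of \<mu>] by (simp add: FF_def \<kappa>_def)
  moreover have "(\<lambda>h. integral\<^sup>L (lebesgue_on \<Omega>) (\<lambda>\<xi>. z \<xi> * pd (h, 0) \<kappa> (\<mu>, \<xi>)))
      = (*) (\<mu> ^ (CARD('n) - 1) / 8 * integral\<^sup>L (lebesgue_on \<Omega>) (\<lambda>\<xi>. z \<xi> * lapH (Phi \<mu> a) \<xi>))"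
  proof
    fix h
    have "(\<lambda>\<xi>. z \<xi> * pd (h, 0) \<kappa> (\<mu>, \<xi>)) = (\<lambda>\<xi>. (h * (\<mu> ^ (CARD('n) - 1) / 8)) * (z \<xi> * lapH (Phi \<mu> a) \<xi>))"
      using p2[of h] by (auto simp: p1 fun_eq_iff)
    then show "integral\<^sup>L (lebesgue_on \<Omega>) (\<lambda>\<xi>. z \<xi> * pd (h, 0) \<kappa> (\<mu>, \<xi>))
      = \<mu> ^ (CARD('n) - 1) / 8 * integral\<^sup>L (lebesgue_on \<Omega>) (\<lambda>\<xi>. z \<xi> * lapH (Phi \<mu> a) \<xi>) * h"
      by (simp only: integral_mult_right_zero) simp
  qed
  ultimately show ?thesis by (simp add: has_field_derivative_def)
qed

text \<open>As long as the gauge ball lies in \<Omega>, \<open>Phi \<nu> a\<close> is a test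
  function, so the derivative of the average in the scale parameter is zero.\<close>

lemma FF_const:
  assumes z: "weakly_harmonic z" and \<mu>: "0 < \<mu>0" "\<mu>0 \<le> \<mu>"
    and sub: "\<And>\<xi>. \<mu>0\<^sup>2 * qH a \<xi> \<le> 1 \<Longrightarrow> \<xi> \<in> \<Omega>"
  shows "FF z \<mu> a = FF z \<mu>0 a"
proof (cases "\<mu> = \<mu>0")
  case False
  then have lt: "\<mu>0 < \<mu>" using \<mu> by simp
  have D: "((\<lambda>\<mu>. FF z \<mu> a) has_field_derivative 0) (at \<nu>)" if "\<mu>0 \<le> \<nu>" for \<nu>
  proof -
    have "Phi \<nu> a \<in> test_functions \<Omega>"
    proof (rule test_functionsI[OF smooth_Phi])
      show "closed {\<xi>. \<nu>\<^sup>2 * qH a \<xi> \<le> 1}"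
        by (intro closed_Collect_le continuous_intros smooth_on_continuous[OF smooth_qH])
      show "{\<xi>. \<nu>\<^sup>2 * qH a \<xi> \<le> 1} \<subseteq> \<Omega>"
      proof
        fix \<xi> assume "\<xi> \<in> {\<xi>. \<nu>\<^sup>2 * qH a \<xi> \<le> 1}"
        moreover have "\<mu>0\<^sup>2 * qH a \<xi> \<le> \<nu>\<^sup>2 * qH a \<xi>" using that \<mu> by (intro mult_right_mono power_mono) auto
        ultimately show "\<xi> \<in> \<Omega>" by (intro sub) auto
      qed
    qed (auto simp: Phi_def bmp_eq_0)
    then show ?thesis
      using DERIV_FF[of z a \<nu>] z by (simp add: weakly_harmonic_def)
  qed
  obtain \<nu> where "FF z \<mu> a - FF z \<mu>0 a = (\<mu> - \<mu>0) * 0"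
    using MVT2[OF lt, of "\<lambda>\<mu>. FF z \<mu> a" "\<lambda>_. 0"] D by auto
  then show ?thesis by simp
qed simp

lemma nested_gauge:
  assumes "compact K" "K \<subseteq> \<Omega>" "e > 0"
  obtains \<mu>0 where "\<mu>0 > 0"
    "\<And>\<mu> a \<xi>. \<mu>0 \<le> \<mu> \<Longrightarrow> a \<in> K \<Longrightarrow> \<mu>\<^sup>2 * qH a \<xi> \<le> 1 \<Longrightarrow> \<xi> \<in> \<Omega> \<and> dist a \<xi> < e"
proof -
  obtain d where d: "d > 0" "(\<Union>x\<in>K. ball x d) \<subseteq> \<Omega>"
    using compact_subset_open_imp_ball_epsilon_subset[OF assms(1) open_dom assms(2)] by metis
  obtain R where R: "\<And>a. a \<in> \<Omega> \<Longrightarrow> norm a \<le> R" using bounded_dom bounded_iff by metis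
  obtain \<mu>0 where \<mu>0: "\<mu>0 > 0"
    "\<And>\<mu> a \<xi>. \<mu>0 \<le> \<mu> \<Longrightarrow> norm a \<le> max R 0 \<Longrightarrow> \<mu>\<^sup>2 * qH a \<xi> \<le> 1 \<Longrightarrow> dist a (\<xi> :: 'n heis) < min d e"
    using qH_close[of "min d e" "max R 0"] d assms(3) by (metis max.cobounded2 min_less_iff_conj)
  show ?thesis
  proof (rule that[OF \<mu>0(1)])
    fix \<mu> a \<xi> assume *: "\<mu>0 \<le> \<mu>" "a \<in> K" "\<mu>\<^sup>2 * qH a \<xi> \<le> 1"
    have "norm a \<le> max R 0" using R[OF subsetD[OF assms(2) *(2)]] by simp
    then have "dist a \<xi> < min d e" using \<mu>0(2) * by blast
    then have "\<xi> \<in> ball a d" "dist a \<xi> < e" by (simp_all add: mem_ball)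
    then show "\<xi> \<in> \<Omega> \<and> dist a \<xi> < e" using d(2) *(2) by blast
  qed
qed

text \<open>One threshold serves all centres in a compact set. Therefore \<open>LL z\<close>
  coincides locally with a single \<open>FF z \<mu>\<close>, whose smoothness comes from the
  kernel.\<close>

lemma LL_eq:
  assumes "compact K" "K \<subseteq> \<Omega>"
  obtains \<mu>0 where "\<mu>0 > 0"
    "\<And>z \<mu> a. weakly_harmonic z \<Longrightarrow> \<mu>0 \<le> \<mu> \<Longrightarrow> a \<in> K \<Longrightarrow> LL z a = FF z \<mu> a"
proof -
  obtain \<mu>0 where \<mu>0: "\<mu>0 > 0"
    "\<And>\<mu> a \<xi>. \<mu>0 \<le> \<mu> \<Longrightarrow> a \<in> K \<Longrightarrow> \<mu>\<^sup>2 * qH a \<xi> \<le> 1 \<Longrightarrow> \<xi> \<in> \<Omega> \<and> dist a \<xi> < 1"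
    using nested_gauge[OF assms zero_less_one] by metis
  show ?thesis
  proof (rule that[OF \<mu>0(1)])
    fix z \<mu> a assume *: "weakly_harmonic z" "\<mu>0 \<le> \<mu>" "a \<in> K"
    have c: "FF z \<nu> a = FF z \<mu>0 a" if "\<mu>0 \<le> \<nu>" for \<nu>
      using FF_const[OF *(1) \<mu>0(1) that] \<mu>0(2) *(3) by blast
    have "eventually (\<lambda>k. \<mu>0 \<le> real k) sequentially"
      using eventually_ge_at_top[of "nat \<lceil>\<mu>0\<rceil>"] by eventually_elim linarith
    then have "eventually (\<lambda>k. FF z (real k) a = FF z \<mu>0 a) sequentially"
      by eventually_elim (rule c)
    then have "LL z a = FF z \<mu>0 a"
      unfolding LL_def by (intro limI tendsto_eventually)
    then show "LL z a = FF z \<mu> a" using c[OF *(2)] by (rule trans[OF _ sym])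
  qed
qed

lemma smooth_LL:
  assumes "weakly_harmonic z"
  shows "smooth_on \<Omega> (LL z)"
proof (rule smooth_on_local)
  fix a assume "a \<in> \<Omega>"
  then obtain e where e: "e > 0" "cball a e \<subseteq> \<Omega>" using open_dom open_contains_cball by blast
  obtain \<mu>0 where "\<mu>0 > 0" "\<And>b. b \<in> cball a e \<Longrightarrow> LL z b = FF z \<mu>0 b"
    using LL_eq[OF compact_cball e(2)] assms by (metis order_refl)
  moreover have "smooth_on (ball a e) (FF z \<mu>0)"
    using smooth_on_subset[OF open_ball open_UNIV subset_UNIV smooth_FF] assms by (simp add: weakly_harmonic_def)
  ultimately have "smooth_on (ball a e) (LL z)"
    by (intro smooth_on_cong[OF open_ball _ \<open>smooth_on (ball a e) (FF z \<mu>0)\<close>]) auto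
  then show "\<exists>T. open T \<and> a \<in> T \<and> smooth_on T (LL z)" using e by (meson centre_in_ball open_ball)
qed

lemma weakly_harmonic_1: "weakly_harmonic (\<lambda>_. 1)"
  using test_integral_lapH integrable_smooth[OF open_dom bounded_dom open_UNIV subset_UNIV smooth_on_const]
  by (simp add: weakly_harmonic_def)

text \<open>The kernel is nonnegative and continuous, so it is enough to find one point of \<Omega>
  where it is positive. It vanishes at the centre itself because of the factor \<open>hd2\<close>,
  so the point is displaced horizontally.\<close>

lemma LL_1_pos:
  assumes "a \<in> \<Omega>"
  shows "LL (\<lambda>_. 1) a > 0"
proof -
  obtain \<mu>0 where \<mu>0: "\<mu>0 > 0" "LL (\<lambda>_. 1) a = FF (\<lambda>_. 1) \<mu>0 a"
    using LL_eq[of "{a}"] assms weakly_harmonic_1 by (metis compact_sing empty_subsetI insert_subset order_refl singletonI)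
  have s: "smooth_on UNIV (Kr \<mu>0 a)"
    using smooth_Kr_gen[of "\<lambda>_. a" "\<lambda>\<xi>. \<xi>" "\<lambda>_. \<mu>0"] by simp
  have int: "integrable (lebesgue_on \<Omega>) (Kr \<mu>0 a)"
    by (rule integrable_smooth[OF open_dom bounded_dom open_UNIV subset_UNIV s])
  have nn: "0 \<le> Kr \<mu>0 a \<xi>" for \<xi> by (rule Kr_nonneg[OF less_imp_le[OF \<mu>0(1)]])
  have "FF (\<lambda>_. 1) \<mu>0 a \<noteq> 0"
  proof
    assume "FF (\<lambda>_. 1) \<mu>0 a = 0"
    then have ae: "AE \<xi> in lebesgue_on \<Omega>. Kr \<mu>0 a \<xi> = 0"
      using integral_nonneg_eq_0_iff_AE[OF int] nn by (simp add: FF_def)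
    define v :: "'n hvec" where "v = axis (Inl undefined) 1"
    have "v \<noteq> 0" by (simp add: v_def axis_eq_0_iff)
    \<comment> \<open>Motion in a horizontal direction at \<open>a\<close>: the vertical coordinate
      relative to \<open>a\<close> stays zero, so only the horizontal part enters
      \<open>qH\<close>.\<close>
    define g where "g s = a + s *\<^sub>R (v, 2 * (hJ (fst a) \<bullet> v))" for s :: real
    have qg: "qH a (g s) = (s\<^sup>2 * (v \<bullet> v))\<^sup>2" for s
      by (simp add: fun_eq_iff qH_def hd2_def htau_def g_def power2_eq_square inner_add_right)
    have "((\<lambda>s. \<mu>0\<^sup>2 * (s\<^sup>2 * (v \<bullet> v))\<^sup>2) \<longlongrightarrow> \<mu>0\<^sup>2 * (0\<^sup>2 * (v \<bullet> v))\<^sup>2) (at_right 0)"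
      by (intro tendsto_intros)
    then have "((\<lambda>s. \<mu>0\<^sup>2 * qH a (g s)) \<longlongrightarrow> \<mu>0\<^sup>2 * (0\<^sup>2 * (v \<bullet> v))\<^sup>2) (at_right 0)"
      by (simp only: qg)
    then have "eventually (\<lambda>s. \<mu>0\<^sup>2 * qH a (g s) < 1) (at_right 0)"
      by (auto dest: order_tendstoD(2)[where a = 1])
    moreover have "(g \<longlongrightarrow> a + 0 *\<^sub>R (v, 2 * (hJ (fst a) \<bullet> v))) (at_right 0)"
      unfolding g_def by (intro tendsto_intros)
    then have "eventually (\<lambda>s. g s \<in> \<Omega>) (at_right 0)"
      using topological_tendstoD[OF _ open_dom] assms by (simp add: zero_prod_def[symmetric])
    moreover have "eventually (\<lambda>s. s > 0) (at_right (0::real))" by (simp add: eventually_at_right_less)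
    ultimately have "eventually (\<lambda>s. s > 0 \<and> g s \<in> \<Omega> \<and> \<mu>0\<^sup>2 * qH a (g s) < 1) (at_right 0)"
      by eventually_elim auto
    then obtain s where s': "s > 0" "g s \<in> \<Omega>" "\<mu>0\<^sup>2 * qH a (g s) < 1"
      using eventually_happens[of _ "at_right (0::real)"] by force
    have "hd2 a (g s) > 0" using s' \<open>v \<noteq> 0\<close> by (simp add: hd2_def g_def)
    then have "Kr \<mu>0 a (g s) > 0"
      using s' \<mu>0(1) by (auto simp: Kr_def intro!: mult_pos_pos bmp_pos)
    moreover have "Kr \<mu>0 a (g s) = 0"
      using AE_continuous_eq_0[OF open_dom _ ae s'(2)] smooth_on_continuous[OF s] continuous_on_subset by blast
    ultimately show False by simp
  qed
  moreover have "FF (\<lambda>_. 1) \<mu>0 a \<ge> 0" unfolding FF_def using nn by simp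
  ultimately show ?thesis using \<mu>0 by simp
qed

lemma Fubini_Kr:
  assumes z: "integrable (lebesgue_on \<Omega>) z" and \<psi>: "smooth_on UNIV \<psi>"
  shows "integral\<^sup>L (lebesgue_on \<Omega>) (\<lambda>a. FF z \<mu> a * \<psi> a)
    = integral\<^sup>L (lebesgue_on \<Omega>) (\<lambda>\<xi>. z \<xi> * integral\<^sup>L (lebesgue_on \<Omega>) (\<lambda>a. Kr \<mu> a \<xi> * \<psi> a))"
proof -
  let ?M = "lebesgue_on \<Omega>"
  have L: "\<Omega> \<in> lmeasurable" using open_dom bounded_dom lmeasurable_open by blast
  interpret M: finite_measure ?M by (rule finite_measure_lebesgue_on[OF L])
  interpret P: pair_sigma_finite ?M ?M by standard
  define k where "k p = Kr \<mu> (snd p) (fst p) * \<psi> (snd p)" for p :: "'n heis \<times> 'n heis"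
  have kc: "continuous_on UNIV k"
  proof -
    have "continuous_on UNIV (\<lambda>p. Kr \<mu> (fst p) (snd p) * \<psi> (fst p))"
      by (intro continuous_on_mult smooth_on_continuous[OF smooth_Kr_center]
          continuous_on_compose2[OF smooth_on_continuous[OF \<psi>]] continuous_intros) auto
    then have "continuous_on UNIV (\<lambda>q. (\<lambda>p. Kr \<mu> (fst p) (snd p) * \<psi> (fst p)) (snd q, fst q))"
      by (rule continuous_on_compose2) (auto intro!: continuous_intros)
    then show ?thesis by (simp add: k_def[abs_def])
  qed
  have idm: "(\<lambda>x. x) \<in> ?M \<rightarrow>\<^sub>M borel" using id_borel_measurable_lebesgue_on[of \<Omega>] by (simp add: id_def)
  have "(\<lambda>p. (fst p, snd p)) \<in> ?M \<Otimes>\<^sub>M ?M \<rightarrow>\<^sub>M borel \<Otimes>\<^sub>M borel"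
    by (intro measurable_Pair measurable_compose[OF measurable_fst idm] measurable_compose[OF measurable_snd idm])
  then have "(\<lambda>p. p) \<in> ?M \<Otimes>\<^sub>M ?M \<rightarrow>\<^sub>M (borel :: ('n heis \<times> 'n heis) measure)" by (simp add: borel_prod)
  then have km[measurable]: "k \<in> borel_measurable (?M \<Otimes>\<^sub>M ?M)"
    by (rule measurable_compose[OF _ borel_measurable_continuous_onI[OF kc]])
  have [measurable]: "z \<in> borel_measurable ?M" using z by auto
  have zi: "integrable (?M \<Otimes>\<^sub>M ?M) (\<lambda>p. z (fst p))"
  proof (rule P.Fubini_integrable)
    show "(\<lambda>p. z (fst p)) \<in> borel_measurable (?M \<Otimes>\<^sub>M ?M)" by measurable
    show "integrable ?M (\<lambda>x. LINT y|?M. norm (z (fst (x, y))))" using z by simp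
  qed simp
  obtain B where B: "\<And>p. p \<in> closure \<Omega> \<times> closure \<Omega> \<Longrightarrow> \<bar>k p\<bar> \<le> B"
  proof -
    have "compact (closure \<Omega> \<times> closure \<Omega>)" using compact_closure_dom compact_Times by blast
    then have "bounded (k ` (closure \<Omega> \<times> closure \<Omega>))"
      using compact_continuous_image[OF continuous_on_subset[OF kc subset_UNIV]] compact_imp_bounded by blast
    then show ?thesis using that unfolding bounded_iff by auto
  qed
  have "integrable (?M \<Otimes>\<^sub>M ?M) (\<lambda>p. B * z (fst p))" using zi by auto
  then have fi: "integrable (?M \<Otimes>\<^sub>M ?M) (\<lambda>p. z (fst p) * k p)"
  proof (rule Bochner_Integration.integrable_bound)
    show "AE p in ?M \<Otimes>\<^sub>M ?M. norm (z (fst p) * k p) \<le> norm (B * z (fst p))"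
    proof (rule AE_I2)
      fix p assume "p \<in> space (?M \<Otimes>\<^sub>M ?M)"
      then have "\<bar>k p\<bar> \<le> \<bar>B\<bar>" using B[of p] closure_subset[of \<Omega>] by (force simp: space_pair_measure)
      then show "norm (z (fst p) * k p) \<le> norm (B * z (fst p))"
        by (simp add: abs_mult mult.commute[of "\<bar>z (fst p)\<bar>"] mult_right_mono)
    qed
  qed measurable
  have "integral\<^sup>L ?M (\<lambda>a. FF z \<mu> a * \<psi> a) = integral\<^sup>L ?M (\<lambda>a. integral\<^sup>L ?M (\<lambda>\<xi>. z \<xi> * k (\<xi>, a)))"
    by (simp add: FF_def k_def mult.assoc[symmetric])
  also have "\<dots> = integral\<^sup>L ?M (\<lambda>\<xi>. integral\<^sup>L ?M (\<lambda>a. z \<xi> * k (\<xi>, a)))"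
    by (rule P.Fubini_integral) (use fi in \<open>simp add: case_prod_unfold\<close>)
  also have "\<dots> = integral\<^sup>L ?M (\<lambda>\<xi>. z \<xi> * integral\<^sup>L ?M (\<lambda>a. Kr \<mu> a \<xi> * \<psi> a))"
    by (simp add: k_def)
  finally show ?thesis .
qed

end

context smooth_domain
begin

lemma test_diff:
  assumes "\<phi> \<in> test_functions \<Omega>" "\<psi> \<in> test_functions \<Omega>"
  shows "(\<lambda>\<xi>. \<phi> \<xi> - \<psi> \<xi>) \<in> test_functions \<Omega>"
proof -
  obtain K1 where K1: "compact K1" "K1 \<subseteq> \<Omega>" "\<And>\<xi>. \<xi> \<notin> K1 \<Longrightarrow> \<phi> \<xi> = 0" "smooth_on UNIV \<phi>"
    by (rule test_functionsE[OF assms(1)], rule that)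
  obtain K2 where K2: "compact K2" "K2 \<subseteq> \<Omega>" "\<And>\<xi>. \<xi> \<notin> K2 \<Longrightarrow> \<psi> \<xi> = 0" "smooth_on UNIV \<psi>"
    by (rule test_functionsE[OF assms(2)], rule that)
  show ?thesis
    by (rule test_functionsI[OF smooth_on_diff[OF open_UNIV assms[THEN test_smooth]]
        compact_imp_closed[OF compact_Un[OF K1(1) K2(1)]]])
      (use K1(2,3) K2(2,3) in \<open>blast, simp\<close>)
qed

text \<open>Fubini and the symmetry of the kernel move the averaging from \<open>z\<close> to
  \<psi>. At a small scale the average of \<psi> differs little from \<psi> times the mass of the
  kernel, by uniform continuity. The left side does not depend on the scale, so the identity is
  exact.\<close>

lemma LL_pairing:
  assumes z: "weakly_harmonic z" and \<psi>: "\<psi> \<in> test_functions \<Omega>"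
  shows "integral\<^sup>L (lebesgue_on \<Omega>) (\<lambda>a. LL z a * \<psi> a)
    = integral\<^sup>L (lebesgue_on \<Omega>) (\<lambda>\<xi>. z \<xi> * (LL (\<lambda>_. 1) \<xi> * \<psi> \<xi>))"
proof -
  let ?M = "lebesgue_on \<Omega>"
  define C where "C = LL (\<lambda>_. 1)"
  have zi: "integrable ?M z" using z by (simp add: weakly_harmonic_def)
  have one: "integrable ?M (\<lambda>_. 1 :: real)" using weakly_harmonic_1 by (simp add: weakly_harmonic_def)
  obtain K where K: "compact K" "K \<subseteq> \<Omega>" "\<And>\<xi>. \<xi> \<notin> K \<Longrightarrow> \<psi> \<xi> = 0" and \<psi>s: "smooth_on UNIV \<psi>"
    by (rule test_functionsE[OF \<psi>], rule that)
  obtain d where d: "d > 0" "(\<Union>x\<in>K. ball x d) \<subseteq> \<Omega>"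
    using compact_subset_open_imp_ball_epsilon_subset[OF K(1) open_dom K(2)] by metis
  \<comment> \<open>A compact neighbourhood of the support \<open>K\<close> inside \<Omega>: it
    contains the supports of all small-scale kernels centred in \<open>K\<close>.\<close>
  define K1 where "K1 = {x + y | x y. x \<in> K \<and> y \<in> cball 0 (d / 2)}"
  have K1: "compact K1" unfolding K1_def by (rule compact_sums[OF K(1) compact_cball])
  have K1I: "\<xi> \<in> K1" if "a \<in> K" "dist a \<xi> < d / 2" for a \<xi>
    unfolding K1_def using that by (intro CollectI exI[of _ a] exI[of _ "\<xi> - a"]) (auto simp: dist_norm norm_minus_commute)
  have K1sub: "K1 \<subseteq> \<Omega>"
  proof
    fix \<xi> assume "\<xi> \<in> K1"
    then obtain x y where xy: "\<xi> = x + y" "x \<in> K" "norm y \<le> d / 2" by (auto simp: K1_def)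
    then have "\<xi> \<in> ball x d" using d(1) by (simp add: dist_norm)
    then show "\<xi> \<in> \<Omega>" using d(2) xy(2) by blast
  qed
  have KK1: "K \<subseteq> K1"
  proof
    fix a assume "a \<in> K" then show "a \<in> K1" using K1I[of a a] d(1) by simp
  qed
  have sC: "smooth_on \<Omega> C" unfolding C_def by (rule smooth_LL[OF weakly_harmonic_1])
  have "bounded (C ` K1)"
    using compact_continuous_image[OF continuous_on_subset[OF smooth_on_continuous[OF sC] K1sub] K1] compact_imp_bounded by blast
  then obtain B where B: "\<And>\<xi>. \<xi> \<in> K1 \<Longrightarrow> \<bar>C \<xi>\<bar> \<le> B" unfolding bounded_iff by auto
  obtain m1 where m1: "m1 > 0" "\<And>z \<mu> a. weakly_harmonic z \<Longrightarrow> m1 \<le> \<mu> \<Longrightarrow> a \<in> K1 \<Longrightarrow> LL z a = FF z \<mu> a"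
    using LL_eq[OF K1 K1sub] by metis
  obtain R where R: "\<And>a. a \<in> \<Omega> \<Longrightarrow> norm a \<le> R" using bounded_dom bounded_iff by metis
  have ci: "integrable ?M (\<lambda>\<xi>. z \<xi> * (C \<xi> * \<psi> \<xi>))"
  proof -
    have "integrable ?M (\<lambda>\<xi>. z \<xi> * (if \<xi> \<in> \<Omega> then C \<xi> * \<psi> \<xi> else 0))"
      by (intro integrable_mult_continuous[OF open_dom bounded_dom zi]
          continuous_on_subset[OF smooth_on_continuous[OF test_smooth[OF ext_test[OF sC \<psi>]]]]) simp
    then show ?thesis by (rule Bochner_Integration.integrable_cong[THEN iffD1, rotated 2]) auto
  qed
  have sk: "smooth_on UNIV (\<lambda>a. Kr \<mu> a \<xi>)" for \<mu> \<xi>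
    using smooth_Kr_gen[of "\<lambda>a. a" "\<lambda>_. \<xi>" "\<lambda>_. \<mu>"] by simp
  define Y where "Y = integral\<^sup>L ?M (\<lambda>\<xi>. \<bar>z \<xi>\<bar>)"
  define D where "D = \<bar>integral\<^sup>L ?M (\<lambda>a. LL z a * \<psi> a) - integral\<^sup>L ?M (\<lambda>\<xi>. z \<xi> * (C \<xi> * \<psi> \<xi>))\<bar>"
  have small: "D \<le> \<epsilon> * (\<bar>B\<bar> * Y)" if \<epsilon>: "\<epsilon> > 0" for \<epsilon>
  proof -
    have "uniformly_continuous_on (closure \<Omega>) \<psi>"
      by (intro compact_uniformly_continuous compact_closure_dom continuous_on_subset[OF smooth_on_continuous[OF \<psi>s]]) simp
    then obtain \<delta> where \<delta>: "\<delta> > 0" "\<And>a \<xi>. a \<in> closure \<Omega> \<Longrightarrow> \<xi> \<in> closure \<Omega> \<Longrightarrow> dist a \<xi> < \<delta> \<Longrightarrow> dist (\<psi> a) (\<psi> \<xi>) < \<epsilon>"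
      using \<epsilon> unfolding uniformly_continuous_on_def by metis
    obtain m2 where m2: "m2 > 0"
      "\<And>\<mu> a \<xi>. m2 \<le> \<mu> \<Longrightarrow> norm a \<le> max R 0 \<Longrightarrow> \<mu>\<^sup>2 * qH a \<xi> \<le> 1 \<Longrightarrow> dist a (\<xi> :: 'n heis) < min \<delta> (d / 2)"
      using qH_close[of "min \<delta> (d / 2)" "max R 0"] d \<delta> by (metis half_gt_zero max.cobounded2 min_less_iff_conj)
    \<comment> \<open>Large enough for the mean value property on \<open>K1\<close> and for the
      kernel to live within distances \<delta> and d / 2 of its centre.\<close>
    define \<mu> where "\<mu> = max m1 m2"
    have \<mu>: "\<mu> > 0" "m1 \<le> \<mu>" "m2 \<le> \<mu>" using m1 m2 by (auto simp: \<mu>_def)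
    have near: "dist a \<xi> < \<delta>" "dist a \<xi> < d / 2" if "a \<in> \<Omega>" "Kr \<mu> a \<xi> \<noteq> 0" for a \<xi>
    proof -
      have "\<mu>\<^sup>2 * qH a \<xi> \<le> 1" using Kr_eq_0[of \<mu> a \<xi>] that(2) by linarith
      then have "dist a \<xi> < min \<delta> (d / 2)" using R[OF that(1)] by (intro m2(2)[OF \<mu>(3)]) auto
      then show "dist a \<xi> < \<delta>" "dist a \<xi> < d / 2" by auto
    qed
    \<comment> \<open>The error made in replacing the average of \<psi> by its value at the
      point.\<close>
    define J where "J \<xi> = integral\<^sup>L ?M (\<lambda>a. Kr \<mu> a \<xi> * (\<psi> a - \<psi> \<xi>))" for \<xi>
    have ik: "integrable ?M (\<lambda>a. Kr \<mu> a \<xi> * \<psi> a)" "integrable ?M (\<lambda>a. Kr \<mu> a \<xi> * c)" for \<xi> c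
      by (intro integrable_smooth[OF open_dom bounded_dom open_UNIV subset_UNIV] smooth_intros open_UNIV sk \<psi>s)+
    have FC: "integral\<^sup>L ?M (\<lambda>a. Kr \<mu> a \<xi>) = C \<xi>" if "\<xi> \<in> K1" for \<xi>
      using m1(2)[OF weakly_harmonic_1 \<mu>(2) that] Kr_sym[of \<mu> \<xi>] by (simp add: FF_def C_def)
    have J: "J \<xi> = integral\<^sup>L ?M (\<lambda>a. Kr \<mu> a \<xi> * \<psi> a) - C \<xi> * \<psi> \<xi>" for \<xi>
    proof -
      have "J \<xi> = integral\<^sup>L ?M (\<lambda>a. Kr \<mu> a \<xi> * \<psi> a) - integral\<^sup>L ?M (\<lambda>a. Kr \<mu> a \<xi>) * \<psi> \<xi>"
        using ik by (simp add: J_def right_diff_distrib)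
      also have "integral\<^sup>L ?M (\<lambda>a. Kr \<mu> a \<xi>) * \<psi> \<xi> = C \<xi> * \<psi> \<xi>"
        using FC[of \<xi>] K(3)[of \<xi>] KK1 by (cases "\<xi> \<in> K") auto
      finally show ?thesis .
    qed
    have Jb: "\<bar>J \<xi>\<bar> \<le> \<epsilon> * \<bar>B\<bar>" if \<xi>: "\<xi> \<in> \<Omega>" for \<xi>
    proof (cases "\<xi> \<in> K1")
      case True
      have "\<bar>J \<xi>\<bar> \<le> integral\<^sup>L ?M (\<lambda>a. \<bar>Kr \<mu> a \<xi> * (\<psi> a - \<psi> \<xi>)\<bar>)"
        unfolding J_def by simp
      also have "\<dots> \<le> integral\<^sup>L ?M (\<lambda>a. Kr \<mu> a \<xi> * \<epsilon>)"
      proof (rule integral_mono)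
        show "integrable ?M (\<lambda>a. \<bar>Kr \<mu> a \<xi> * (\<psi> a - \<psi> \<xi>)\<bar>)" using ik by (simp add: right_diff_distrib)
        show "integrable ?M (\<lambda>a. Kr \<mu> a \<xi> * \<epsilon>)" by (rule ik)
        fix a assume "a \<in> space ?M"
        then have a: "a \<in> \<Omega>" by simp
        have "\<bar>\<psi> a - \<psi> \<xi>\<bar> \<le> \<epsilon>" if "Kr \<mu> a \<xi> \<noteq> 0"
          using \<delta>(2)[OF _ _ near(1)[OF a that]] subsetD[OF closure_subset a] subsetD[OF closure_subset \<xi>]
          by (simp add: dist_real_def)
        then show "\<bar>Kr \<mu> a \<xi> * (\<psi> a - \<psi> \<xi>)\<bar> \<le> Kr \<mu> a \<xi> * \<epsilon>"
          using Kr_nonneg[of \<mu> a \<xi>] \<mu>(1) by (cases "Kr \<mu> a \<xi> = 0") (auto simp: abs_mult mult_left_mono)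
      qed
      also have "\<dots> = C \<xi> * \<epsilon>" using FC[OF True] by simp
      also have "\<dots> \<le> \<bar>B\<bar> * \<epsilon>" using B[OF True] \<epsilon> by (intro mult_right_mono) auto
      finally show ?thesis by (simp add: mult.commute)
    next
      case False
      have "Kr \<mu> a \<xi> * (\<psi> a - \<psi> \<xi>) = 0" if a: "a \<in> \<Omega>" for a
        using near(2)[OF a, of \<xi>] K1I[of a \<xi>] K(3)[of a] K(3)[of \<xi>] KK1 False by (cases "Kr \<mu> a \<xi> = 0"; cases "a \<in> K") auto
      then have "J \<xi> = integral\<^sup>L ?M (\<lambda>a. 0)"
        unfolding J_def by (intro Bochner_Integration.integral_cong) auto
      then show ?thesis using \<epsilon> by simp
    qed
    have "integral\<^sup>L ?M (\<lambda>a. LL z a * \<psi> a) = integral\<^sup>L ?M (\<lambda>a. FF z \<mu> a * \<psi> a)"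
    proof (rule Bochner_Integration.integral_cong)
      fix a
      show "LL z a * \<psi> a = FF z \<mu> a * \<psi> a"
        using m1(2)[OF z \<mu>(2), of a] K(3)[of a] KK1 by (cases "a \<in> K") auto
    qed simp
    also have "\<dots> = integral\<^sup>L ?M (\<lambda>\<xi>. z \<xi> * integral\<^sup>L ?M (\<lambda>a. Kr \<mu> a \<xi> * \<psi> a))"
      by (rule Fubini_Kr[OF zi \<psi>s])
    also have "\<dots> = integral\<^sup>L ?M (\<lambda>\<xi>. z \<xi> * J \<xi> + z \<xi> * (C \<xi> * \<psi> \<xi>))"
      by (simp add: J algebra_simps)
    also have "\<dots> = integral\<^sup>L ?M (\<lambda>\<xi>. z \<xi> * J \<xi>) + integral\<^sup>L ?M (\<lambda>\<xi>. z \<xi> * (C \<xi> * \<psi> \<xi>))"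
    proof (rule Bochner_Integration.integral_add[OF _ ci])
      have "smooth_on UNIV (\<lambda>\<xi>. integral\<^sup>L ?M (\<lambda>a. \<psi> a * Kr \<mu> \<xi> a))"
        using smooth_param_integral[OF open_dom bounded_dom test_integrable[OF \<psi>] smooth_Kr_center[of \<mu>]] by simp
      then have "continuous_on UNIV (\<lambda>\<xi>. integral\<^sup>L ?M (\<lambda>a. Kr \<mu> a \<xi> * \<psi> a))"
        using smooth_on_continuous by (subst Kr_sym) (simp add: mult.commute)
      then have "integrable ?M (\<lambda>\<xi>. z \<xi> * integral\<^sup>L ?M (\<lambda>a. Kr \<mu> a \<xi> * \<psi> a))"
        by (rule integrable_mult_continuous[OF open_dom bounded_dom zi continuous_on_subset[OF _ subset_UNIV]])
      from Bochner_Integration.integrable_diff[OF this ci]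
      show "integrable ?M (\<lambda>\<xi>. z \<xi> * J \<xi>)" by (simp add: J right_diff_distrib)
    qed
    finally have "D = \<bar>integral\<^sup>L ?M (\<lambda>\<xi>. z \<xi> * J \<xi>)\<bar>" by (simp add: D_def)
    also have "\<dots> \<le> integral\<^sup>L ?M (\<lambda>\<xi>. \<bar>z \<xi>\<bar> * (\<epsilon> * \<bar>B\<bar>))"
    proof (rule order_trans)
      show "\<bar>integral\<^sup>L ?M (\<lambda>\<xi>. z \<xi> * J \<xi>)\<bar> \<le> integral\<^sup>L ?M (\<lambda>\<xi>. \<bar>z \<xi> * J \<xi>\<bar>)" by simp
      show "integral\<^sup>L ?M (\<lambda>\<xi>. \<bar>z \<xi> * J \<xi>\<bar>) \<le> integral\<^sup>L ?M (\<lambda>\<xi>. \<bar>z \<xi>\<bar> * (\<epsilon> * \<bar>B\<bar>))"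
        by (rule integral_mono') (use zi Jb \<epsilon> in \<open>auto simp: abs_mult mult_left_mono\<close>)
    qed
    also have "\<dots> = \<epsilon> * (\<bar>B\<bar> * Y)" by (simp add: Y_def)
    finally show ?thesis .
  qed
  have "D \<le> 0"
  proof (rule ccontr)
    assume "\<not> D \<le> 0"
    moreover have "D \<le> D / (2 * (\<bar>B\<bar> * Y + 1)) * (\<bar>B\<bar> * Y)" if "D > 0"
      using that by (intro small) (auto simp: Y_def intro!: divide_pos_pos add_nonneg_pos)
    moreover have "D / (2 * (\<bar>B\<bar> * Y + 1)) * (\<bar>B\<bar> * Y) < D" if "D > 0"
    proof -
      have "\<bar>B\<bar> * Y \<ge> 0" by (simp add: Y_def)
      moreover have "b / (2 * (b + 1)) < 1" if "b \<ge> 0" for b :: real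
        using that by (simp add: divide_less_eq)
      ultimately have "(\<bar>B\<bar> * Y) / (2 * (\<bar>B\<bar> * Y + 1)) < 1" by blast
      then have "D * ((\<bar>B\<bar> * Y) / (2 * (\<bar>B\<bar> * Y + 1))) < D * 1" using that by (intro mult_strict_left_mono) auto
      then show ?thesis by simp
    qed
    ultimately show False by linarith
  qed
  then show ?thesis by (simp add: D_def C_def)
qed

text \<open>The difference of the two integrands is the sum over j of X_j applied to h X_j \<psi> -
  \<psi> X_j h, and these functions, extended by zero, are test functions.\<close>

lemma Green_test:
  assumes sh: "smooth_on \<Omega> h" and \<psi>: "\<psi> \<in> test_functions \<Omega>"
  shows "integral\<^sup>L (lebesgue_on \<Omega>) (\<lambda>\<xi>. h \<xi> * lapH \<psi> \<xi>) = integral\<^sup>L (lebesgue_on \<Omega>) (\<lambda>\<xi>. lapH h \<xi> * \<psi> \<xi>)"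
    and "integrable (lebesgue_on \<Omega>) (\<lambda>\<xi>. h \<xi> * lapH \<psi> \<xi>)"
proof -
  let ?M = "lebesgue_on \<Omega>"
  have slh: "smooth_on \<Omega> (lapH h)" by (rule smooth_lapH[OF open_dom sh])
  have ext: "integrable ?M (\<lambda>\<xi>. g \<xi> * \<theta> \<xi>)" if "smooth_on \<Omega> g" "\<theta> \<in> test_functions \<Omega>" for g \<theta>
    by (rule Bochner_Integration.integrable_cong[THEN iffD1, rotated 2, OF test_integrable[OF ext_test[OF that]]]) auto
  define G where "G j \<xi> = (if \<xi> \<in> \<Omega> then h \<xi> * XX j \<psi> \<xi> else 0) - (if \<xi> \<in> \<Omega> then XX j h \<xi> * \<psi> \<xi> else 0)" for j \<xi>
  have t: "G j \<in> test_functions \<Omega>" for j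
  proof -
    have 1: "(\<lambda>\<xi>. if \<xi> \<in> \<Omega> then h \<xi> * XX j \<psi> \<xi> else 0) \<in> test_functions \<Omega>"
      by (rule ext_test[OF sh test_XX[OF \<psi>]])
    have 2: "(\<lambda>\<xi>. if \<xi> \<in> \<Omega> then XX j h \<xi> * \<psi> \<xi> else 0) \<in> test_functions \<Omega>"
      by (rule ext_test[OF smooth_XX[OF open_dom sh] \<psi>])
    show ?thesis
      unfolding G_def[abs_def] by (rule test_diff[OF 1 2])
  qed
  have XG: "XX j (G j) \<xi> = h \<xi> * XX j (XX j \<psi>) \<xi> - XX j (XX j h) \<xi> * \<psi> \<xi>" if \<xi>: "\<xi> \<in> \<Omega>" for j \<xi>
  proof -
    have D: "h differentiable (at \<xi>)" "XX j h differentiable (at \<xi>)" "\<psi> differentiable (at \<xi>)" "XX j \<psi> differentiable (at \<xi>)"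
      using smooth_on_differentiable[OF _ open_dom \<xi>] sh smooth_XX[OF open_dom sh]
        smooth_on_differentiable[OF _ open_UNIV UNIV_I] test_smooth[OF \<psi>] test_smooth[OF test_XX[OF \<psi>]] by blast+
    have "XX j (G j) \<xi> = XX j (\<lambda>\<xi>. h \<xi> * XX j \<psi> \<xi> - XX j h \<xi> * \<psi> \<xi>) \<xi>"
      by (rule XX_cong[OF open_dom \<xi>]) (simp add: G_def)
    then show ?thesis using D by (simp add: XX_diff XX_mult differentiable_mult)
  qed
  have i: "integrable ?M (\<lambda>\<xi>. h \<xi> * lapH \<psi> \<xi>)"
  proof -
    have "integrable ?M (\<lambda>\<xi>. \<Sum>j\<in>UNIV. h \<xi> * XX j (XX j \<psi>) \<xi>)"
      by (intro Bochner_Integration.integrable_sum ext[OF sh] test_XX \<psi>)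
    then show ?thesis by (simp add: lapH_def sum_distrib_left)
  qed
  have "0 = (\<Sum>j\<in>UNIV. integral\<^sup>L ?M (XX j (G j)))" using test_integral_XX[OF t] by simp
  also have "\<dots> = integral\<^sup>L ?M (\<lambda>\<xi>. \<Sum>j\<in>UNIV. XX j (G j) \<xi>)"
    by (rule Bochner_Integration.integral_sum[symmetric]) (rule test_integrable[OF test_XX[OF t]])
  also have "\<dots> = integral\<^sup>L ?M (\<lambda>\<xi>. h \<xi> * lapH \<psi> \<xi> - lapH h \<xi> * \<psi> \<xi>)"
    by (rule Bochner_Integration.integral_cong) (auto simp: XG lapH_def sum_subtractf sum_distrib_left sum_distrib_right)
  also have "\<dots> = integral\<^sup>L ?M (\<lambda>\<xi>. h \<xi> * lapH \<psi> \<xi>) - integral\<^sup>L ?M (\<lambda>\<xi>. lapH h \<xi> * \<psi> \<xi>)"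
    by (rule Bochner_Integration.integral_diff[OF i ext[OF slh \<psi>]])
  finally show "integral\<^sup>L ?M (\<lambda>\<xi>. h \<xi> * lapH \<psi> \<xi>) = integral\<^sup>L ?M (\<lambda>\<xi>. lapH h \<xi> * \<psi> \<xi>)" by simp
  show "integrable ?M (\<lambda>\<xi>. h \<xi> * lapH \<psi> \<xi>)" by (rule i)
qed

text \<open>By \<open>LL_pairing\<close>, \<open>LL z\<close> equals \<open>z\<close> times the mass
  function \<open>LL (\<lambda>_. 1)\<close> almost everywhere. Both averages are smooth and the
  mass is positive, so their quotient is a smooth representative. Green's identity passes weak
  harmonicity to it, and continuity makes the equation hold at every point.\<close>

lemma Weyl:
  assumes z: "weakly_harmonic z"
  obtains h where "smooth_on \<Omega> h" "AE \<xi> in lebesgue_on \<Omega>. z \<xi> = h \<xi>" "\<And>\<xi>. \<xi> \<in> \<Omega> \<Longrightarrow> lapH h \<xi> = 0"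
proof -
  let ?M = "lebesgue_on \<Omega>"
  define C where "C = LL (\<lambda>_. 1)"
  have zi: "integrable ?M z" using z by (simp add: weakly_harmonic_def)
  have sC: "smooth_on \<Omega> C" unfolding C_def by (rule smooth_LL[OF weakly_harmonic_1])
  have sL: "smooth_on \<Omega> (LL z)" by (rule smooth_LL[OF z])
  have Cpos: "C \<xi> > 0" if "\<xi> \<in> \<Omega>" for \<xi> unfolding C_def by (rule LL_1_pos[OF that])
  define h where "h \<xi> = LL z \<xi> / C \<xi>" for \<xi>
  have sh: "smooth_on \<Omega> h" unfolding h_def by (rule smooth_on_divide[OF open_dom sL sC Cpos])
  have ext: "integrable ?M (\<lambda>\<xi>. g \<xi> * \<theta> \<xi>)" if "smooth_on \<Omega> g" "\<theta> \<in> test_functions \<Omega>" for g \<theta>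
    by (rule Bochner_Integration.integrable_cong[THEN iffD1, rotated 2, OF test_integrable[OF ext_test[OF that]]]) auto
  have zext: "integrable ?M (\<lambda>\<xi>. z \<xi> * (g \<xi> * \<theta> \<xi>))" if "smooth_on \<Omega> g" "\<theta> \<in> test_functions \<Omega>" for g \<theta>
  proof -
    have "integrable ?M (\<lambda>\<xi>. z \<xi> * (if \<xi> \<in> \<Omega> then g \<xi> * \<theta> \<xi> else 0))"
      by (intro integrable_mult_continuous[OF open_dom bounded_dom zi]
          continuous_on_subset[OF smooth_on_continuous[OF test_smooth[OF ext_test[OF that]]]]) simp
    then show ?thesis by (rule Bochner_Integration.integrable_cong[THEN iffD1, rotated 2]) auto
  qed
  have "AE \<xi> in ?M. LL z \<xi> - z \<xi> * C \<xi> = 0"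
  proof (rule AE_eq_0_tests)
    fix \<psi> assume \<psi>: "\<psi> \<in> test_functions \<Omega>"
    have eq: "(\<lambda>\<xi>. (LL z \<xi> - z \<xi> * C \<xi>) * \<psi> \<xi>) = (\<lambda>\<xi>. LL z \<xi> * \<psi> \<xi> - z \<xi> * (C \<xi> * \<psi> \<xi>))"
      by (simp add: fun_eq_iff algebra_simps)
    show "integrable ?M (\<lambda>\<xi>. (LL z \<xi> - z \<xi> * C \<xi>) * \<psi> \<xi>)"
      unfolding eq using ext[OF sL \<psi>] zext[OF sC \<psi>] by auto
    show "integral\<^sup>L ?M (\<lambda>\<xi>. (LL z \<xi> - z \<xi> * C \<xi>) * \<psi> \<xi>) = 0"
      unfolding eq using ext[OF sL \<psi>] zext[OF sC \<psi>] LL_pairing[OF z \<psi>] by (simp add: C_def)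
  qed
  then have ae: "AE \<xi> in ?M. z \<xi> = h \<xi>"
  proof (rule AE_mp, intro AE_I2 impI)
    fix \<xi> assume "\<xi> \<in> space ?M" "LL z \<xi> - z \<xi> * C \<xi> = 0"
    then show "z \<xi> = h \<xi>" using Cpos[of \<xi>] by (simp add: h_def field_simps)
  qed
  have slh: "smooth_on \<Omega> (lapH h)" by (rule smooth_lapH[OF open_dom sh])
  have "AE \<xi> in ?M. lapH h \<xi> = 0"
  proof (rule AE_eq_0_tests)
    fix \<psi> assume \<psi>: "\<psi> \<in> test_functions \<Omega>"
    show "integrable ?M (\<lambda>\<xi>. lapH h \<xi> * \<psi> \<xi>)" by (rule ext[OF slh \<psi>])
    note i = Green_test(2)[OF sh \<psi>]
    have "integral\<^sup>L ?M (\<lambda>\<xi>. lapH h \<xi> * \<psi> \<xi>) = integral\<^sup>L ?M (\<lambda>\<xi>. h \<xi> * lapH \<psi> \<xi>)"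
      by (rule Green_test(1)[OF sh \<psi>, symmetric])
    also have "integral\<^sup>L ?M (\<lambda>\<xi>. h \<xi> * lapH \<psi> \<xi>) = integral\<^sup>L ?M (\<lambda>\<xi>. z \<xi> * lapH \<psi> \<xi>)"
    proof (rule Bochner_Integration.integral_cong_AE)
      show "(\<lambda>\<xi>. h \<xi> * lapH \<psi> \<xi>) \<in> borel_measurable ?M" using i by auto
      have "continuous_on (closure \<Omega>) (lapH \<psi>)"
        using smooth_on_continuous[OF smooth_lapH[OF open_UNIV test_smooth[OF \<psi>]]] continuous_on_subset by blast
      then have "integrable ?M (\<lambda>\<xi>. z \<xi> * lapH \<psi> \<xi>)"
        by (rule integrable_mult_continuous[OF open_dom bounded_dom zi])
      then show "(\<lambda>\<xi>. z \<xi> * lapH \<psi> \<xi>) \<in> borel_measurable ?M" by auto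
      show "AE \<xi> in ?M. h \<xi> * lapH \<psi> \<xi> = z \<xi> * lapH \<psi> \<xi>" using ae by (auto elim!: eventually_mono)
    qed
    also have "\<dots> = 0" using z \<psi> by (simp add: weakly_harmonic_def)
    finally show "integral\<^sup>L ?M (\<lambda>\<xi>. lapH h \<xi> * \<psi> \<xi>) = 0" .
  qed
  then have "lapH h \<xi> = 0" if "\<xi> \<in> \<Omega>" for \<xi>
    using AE_continuous_eq_0[OF open_dom smooth_on_continuous[OF slh]] that by blast
  then show ?thesis using that sh ae by blast
qed

end

section \<open>Vanishing of the solution on the boundary\<close>

lemma smooth_exp: "smooth_on UNIV (exp :: real \<Rightarrow> real)"
proof -
  have "C_k_on k UNIV (exp :: real \<Rightarrow> real)" for k
  proof (induction k)
    case (Suc k)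
    have "pd 1 (exp :: real \<Rightarrow> real) = exp" by (rule ext) (rule pd_real[OF DERIV_exp])
    moreover have "(exp :: real \<Rightarrow> real) differentiable_on UNIV"
      unfolding differentiable_on_def
      using DERIV_exp has_field_derivative_def differentiableI differentiable_at_withinI by metis
    ultimately show ?case using Suc by (simp add: C_k_on_Suc)
  qed (simp add: continuous_on_exp)
  then show ?thesis by (simp add: smooth_on_def)
qed

lemma pd_exp: "pd 1 (exp :: real \<Rightarrow> real) x = exp x"
  by (rule pd_real[OF DERIV_exp])

lemma smooth_sq_dist:
  fixes p :: "'a::euclidean_space"
  assumes "open S"
  shows "smooth_on S (\<lambda>\<xi>. (\<xi> - p) \<bullet> (\<xi> - p))"
proof -
  have "(\<lambda>\<xi>. (\<xi> - p) \<bullet> (\<xi> - p)) = (\<lambda>\<xi>. \<Sum>b\<in>Basis. (\<xi> \<bullet> b - p \<bullet> b) * (\<xi> \<bullet> b - p \<bullet> b))"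
    by (rule ext, subst euclidean_inner) (simp add: inner_diff_left)
  moreover have "smooth_on S \<dots>"
    by (intro smooth_intros assms smooth_on_linear bounded_linear_inner_left)
  ultimately show ?thesis by simp
qed

definition bump :: "'a::euclidean_space \<Rightarrow> real \<Rightarrow> 'a \<Rightarrow> real" where
  "bump p \<rho> \<xi> = bmp 0 (1 - (\<xi> - p) \<bullet> (\<xi> - p) / \<rho>\<^sup>2)"

lemma smooth_bump: "smooth_on UNIV (bump p \<rho>)"
  unfolding bump_def[abs_def] by (intro smooth_on_compose[OF _ smooth_bmp] smooth_intros smooth_sq_dist open_UNIV)

lemma bump_props:
  assumes "\<rho> > 0"
  shows "0 \<le> bump p \<rho> \<xi>" "bump p \<rho> \<xi> \<le> 1" "\<rho> \<le> dist \<xi> p \<Longrightarrow> bump p \<rho> \<xi> = 0" "bump p \<rho> p > 0"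
proof -
  show "bump p \<rho> \<xi> = 0" if "\<rho> \<le> dist \<xi> p"
  proof -
    have "\<rho>\<^sup>2 \<le> (\<xi> - p) \<bullet> (\<xi> - p)"
      using that assms power_mono[of \<rho> "norm (\<xi> - p)" 2] by (simp add: dist_norm dot_square_norm)
    then have "1 \<le> (\<xi> - p) \<bullet> (\<xi> - p) / \<rho>\<^sup>2" using assms by simp
    then show ?thesis by (simp add: bump_def bmp_eq_0)
  qed
qed (simp_all add: bump_def bmp_nonneg bmp_0_le_1 bmp_pos)

lemma pd_bump:
  "pd b (bump p \<rho>) \<xi> = - (2 * ((\<xi> - p) \<bullet> b) / \<rho>\<^sup>2) * bmp 2 (1 - (\<xi> - p) \<bullet> (\<xi> - p) / \<rho>\<^sup>2)"
proof -
  have "((\<lambda>\<xi>. 1 - (\<xi> - p) \<bullet> (\<xi> - p) / \<rho>\<^sup>2) has_derivative (\<lambda>h. - (2 * ((\<xi> - p) \<bullet> h) / \<rho>\<^sup>2))) (at \<xi>)"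
  proof -
    have "((\<lambda>\<xi>. (\<xi> - p) \<bullet> (\<xi> - p)) has_derivative (\<lambda>h. 2 * ((\<xi> - p) \<bullet> h))) (at \<xi>)"
      by (auto intro!: derivative_eq_intros simp: inner_commute)
    from has_derivative_diff[OF has_derivative_const has_derivative_mult_right[OF this], of 1 "1 / \<rho>\<^sup>2"]
    show ?thesis by simp
  qed
  from has_derivative_compose[OF this DERIV_bmp_0[unfolded has_field_derivative_def]]
  have "(bump p \<rho> has_derivative (\<lambda>h. bmp 2 (1 - (\<xi> - p) \<bullet> (\<xi> - p) / \<rho>\<^sup>2) * - (2 * ((\<xi> - p) \<bullet> h) / \<rho>\<^sup>2))) (at \<xi>)"
    unfolding bump_def[abs_def] .
  from pd_at[OF this, of b] show ?thesis by simp
qed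

lemma smooth_ext_by_zero:
  assumes V: "open V" and g: "smooth_on V g" and \<phi>: "smooth_on UNIV \<phi>"
    and K: "closed K" "K \<subseteq> V" "\<And>\<xi>. \<xi> \<notin> K \<Longrightarrow> \<phi> \<xi> = 0"
  shows "smooth_on UNIV (\<lambda>\<xi>. if \<xi> \<in> V then g \<xi> * \<phi> \<xi> else 0)"
proof -
  define h where "h \<xi> = (if \<xi> \<in> V then g \<xi> * \<phi> \<xi> else 0)" for \<xi>
  have cK: "open (- K)" using K by blast
  have "smooth_on V h"
    by (rule smooth_on_cong[OF V _ smooth_on_mult[OF V g smooth_on_subset[OF V open_UNIV _ \<phi>]]])
      (auto simp: h_def)
  moreover have "smooth_on (- K) h"
    by (rule smooth_on_cong[OF cK _ smooth_on_const[of _ 0]]) (use K in \<open>auto simp: h_def\<close>)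
  ultimately have "smooth_on (V \<union> - K) h" using V cK smooth_on_Un by blast
  moreover have "V \<union> - K = UNIV" using K by blast
  ultimately show ?thesis by (simp add: h_def[abs_def])
qed

text \<open>The weighted inequality |a p| <= a^2 / (2 \<delta>) + \<delta> p^2 / 2 plays the part of
  Cauchy-Schwarz.\<close>

lemma integral_tendsto_0_if_L2:
  fixes a :: "nat \<Rightarrow> 'a::euclidean_space \<Rightarrow> real"
  assumes am: "\<And>k. a k \<in> borel_measurable M" and a2: "\<And>k. integrable M (\<lambda>x. (a k x)\<^sup>2)"
    and lim: "(\<lambda>k. integral\<^sup>L M (\<lambda>x. (a k x)\<^sup>2)) \<longlonglongrightarrow> 0"
    and p: "p \<in> borel_measurable M" "integrable M (\<lambda>x. (p x)\<^sup>2)"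
  shows "(\<lambda>k. integral\<^sup>L M (\<lambda>x. a k x * p x)) \<longlonglongrightarrow> 0"
proof (rule LIMSEQ_I)
  fix r :: real assume r: "0 < r"
  define P where "P = integral\<^sup>L M (\<lambda>x. (p x)\<^sup>2)"
  have P: "P \<ge> 0" by (simp add: P_def)
  \<comment> \<open>With this weight each of the two terms is bounded by r / 2 once the integral of
    \<open>a k\<close> squared is below \<delta> r.\<close>
  define \<delta> where "\<delta> = r / (P + 1)"
  have \<delta>: "\<delta> > 0" using r P by (simp add: \<delta>_def)
  have "\<delta> * r > 0" using \<delta> r by simp
  then obtain N where N: "\<And>k. k \<ge> N \<Longrightarrow> norm (integral\<^sup>L M (\<lambda>x. (a k x)\<^sup>2) - 0) < \<delta> * r"
    using LIMSEQ_D[OF lim] by metis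
  show "\<exists>N. \<forall>k\<ge>N. norm (integral\<^sup>L M (\<lambda>x. a k x * p x) - 0) < r"
  proof (intro exI allI impI)
    fix k assume k: "k \<ge> N"
    have pt: "\<bar>a k x * p x\<bar> \<le> (1 / (2 * \<delta>)) * (a k x)\<^sup>2 + (\<delta> / 2) * (p x)\<^sup>2" for x
    proof -
      have "0 \<le> (\<bar>a k x\<bar> - \<delta> * \<bar>p x\<bar>)\<^sup>2" by simp
      then have "2 * \<delta> * \<bar>a k x * p x\<bar> \<le> (a k x)\<^sup>2 + \<delta>\<^sup>2 * (p x)\<^sup>2"
        by (simp add: power2_diff power_mult_distrib abs_mult mult_ac)
      then show ?thesis using \<delta> by (simp add: field_simps power2_eq_square)
    qed
    have i: "integrable M (\<lambda>x. (1 / (2 * \<delta>)) * (a k x)\<^sup>2 + (\<delta> / 2) * (p x)\<^sup>2)" using a2 p by auto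
    have "norm (integral\<^sup>L M (\<lambda>x. a k x * p x)) \<le> integral\<^sup>L M (\<lambda>x. \<bar>a k x * p x\<bar>)" by simp
    also have "\<dots> \<le> integral\<^sup>L M (\<lambda>x. (1 / (2 * \<delta>)) * (a k x)\<^sup>2 + (\<delta> / 2) * (p x)\<^sup>2)"
      by (rule integral_mono'[OF i pt]) (use \<delta> in auto)
    also have "\<dots> = (1 / (2 * \<delta>)) * integral\<^sup>L M (\<lambda>x. (a k x)\<^sup>2) + (\<delta> / 2) * P"
      using a2 p by (simp add: P_def)
    also have "\<dots> < (1 / (2 * \<delta>)) * (\<delta> * r) + (\<delta> / 2) * (P + 1)"
      using N[OF k] \<delta> by (intro add_strict_mono mult_strict_left_mono) auto
    also have "\<dots> = r"
    proof -
      have "\<delta> * (P + 1) = r" using P by (simp add: \<delta>_def)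
      then have "\<delta> / 2 * (P + 1) = r / 2" by simp
      moreover have "(1 / (2 * \<delta>)) * (\<delta> * r) = r / 2" using \<delta> by simp
      ultimately show ?thesis by simp
    qed
    finally show "norm (integral\<^sup>L M (\<lambda>x. a k x * p x) - 0) < r" by simp
  qed
qed

context smooth_domain
begin

lemma integrable_sm: "smooth_on UNIV g \<Longrightarrow> integrable (lebesgue_on \<Omega>) g"
  by (rule integrable_smooth[OF open_dom bounded_dom open_UNIV subset_UNIV])

lemma smooth_expf: "smooth_on UNIV (\<lambda>\<xi>. exp (c * f \<xi>))"
  by (intro smooth_on_compose[OF _ smooth_exp] smooth_intros smooth_f open_UNIV)

lemma expf_le_1: "0 \<le> c \<Longrightarrow> \<xi> \<in> \<Omega> \<Longrightarrow> exp (c * f \<xi>) \<le> 1"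
  by (simp add: dom_eq mult_nonneg_nonpos)

lemma integral_expf_tendsto_0:
  assumes g: "smooth_on UNIV g"
  shows "(\<lambda>k. integral\<^sup>L (lebesgue_on \<Omega>) (\<lambda>\<xi>. exp (real k * f \<xi>) * g \<xi>)) \<longlonglongrightarrow> 0"
proof -
  have "(\<lambda>k. integral\<^sup>L (lebesgue_on \<Omega>) (\<lambda>\<xi>. exp (real k * f \<xi>) * g \<xi>)) \<longlonglongrightarrow> integral\<^sup>L (lebesgue_on \<Omega>) (\<lambda>\<xi>. 0)"
  proof (rule integral_dominated_convergence[where w = "\<lambda>\<xi>. \<bar>g \<xi>\<bar>"])
    show "(\<lambda>\<xi>. exp (real k * f \<xi>) * g \<xi>) \<in> borel_measurable (lebesgue_on \<Omega>)" for k
      by (rule borel_measurable_integrable[OF integrable_sm[OF smooth_on_mult[OF open_UNIV smooth_expf g]]])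
    show "integrable (lebesgue_on \<Omega>) (\<lambda>\<xi>. \<bar>g \<xi>\<bar>)" using integrable_sm[OF g] by auto
    show "AE \<xi> in lebesgue_on \<Omega>. norm (exp (real k * f \<xi>) * g \<xi>) \<le> \<bar>g \<xi>\<bar>" for k
    proof (rule AE_I2)
      fix \<xi> assume "\<xi> \<in> space (lebesgue_on \<Omega>)"
      then show "norm (exp (real k * f \<xi>) * g \<xi>) \<le> \<bar>g \<xi>\<bar>"
        using expf_le_1[of "real k" \<xi>] by (simp add: abs_mult mult_left_le_one_le)
    qed
    show "AE \<xi> in lebesgue_on \<Omega>. (\<lambda>k. exp (real k * f \<xi>) * g \<xi>) \<longlonglongrightarrow> 0"
    proof (rule AE_I2)
      fix \<xi> assume "\<xi> \<in> space (lebesgue_on \<Omega>)"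
      then have "exp (f \<xi>) < 1" by (simp add: dom_eq)
      then have "(\<lambda>k. exp (f \<xi>) ^ k) \<longlonglongrightarrow> 0" by (intro LIMSEQ_power_zero) simp
      then have "(\<lambda>k. exp (f \<xi>) ^ k * g \<xi>) \<longlonglongrightarrow> 0 * g \<xi>" by (rule tendsto_mult[OF _ tendsto_const])
      then show "(\<lambda>k. exp (real k * f \<xi>) * g \<xi>) \<longlonglongrightarrow> 0" by (simp add: exp_of_nat_mult)
    qed
  qed simp
  then show ?thesis by simp
qed

text \<open>The limit of \<open>k * \<integral> exp (k f) H\<close> replaces the integral of \<open>H\<close> against a surface measure.
  Its positivity is tested with a bump centred slightly outside \<open>\<Omega>\<close>, which increases along the
  outer normal inside \<open>\<Omega>\<close>.\<close>

lemma boundary_layer_eq_0: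
  assumes H: "smooth_on UNIV H" "\<And>\<xi>. 0 \<le> H \<xi>"
    and lim: "(\<lambda>k. real k * integral\<^sup>L (lebesgue_on \<Omega>) (\<lambda>\<xi>. exp (real k * f \<xi>) * H \<xi>)) \<longlonglongrightarrow> 0"
    and p: "p \<in> frontier \<Omega>"
  shows "H p = 0"
proof (rule ccontr)
  let ?M = "lebesgue_on \<Omega>"
  assume "H p \<noteq> 0"
  then have Hp: "H p > 0" using H(2)[of p] by simp
  define m where "m = H p / 2"
  have m: "m > 0" using Hp by (simp add: m_def)
  have "isCont H p" using smooth_on_continuous[OF H(1)] continuous_on_eq_continuous_at[OF open_UNIV] by blast
  then obtain \<rho> where \<rho>: "\<rho> > 0" "\<And>\<xi>. dist \<xi> p < \<rho> \<Longrightarrow> dist (H \<xi>) (H p) < m"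
    using m unfolding continuous_at_eps_delta by metis
  have Hm: "H \<xi> \<ge> m" if "dist \<xi> p < \<rho>" for \<xi>
    using \<rho>(2)[OF that] by (simp add: m_def dist_real_def) (smt (verit) field_sum_of_halves)
  have fp: "f p = 0" using p frontier_eq by simp
  define b where "b = (\<Sum>i\<in>Basis. pd i f p *\<^sub>R i)"
  have df: "f differentiable (at \<xi>)" for \<xi> using smooth_on_differentiable[OF smooth_f] by simp
  have pdb: "pd h f p = b \<bullet> h" for h
  proof -
    have "pd h f p = (\<Sum>i\<in>Basis. (h \<bullet> i) * pd i f p)"
      using pd_sum_dir[OF df, where c = "\<lambda>i. h \<bullet> i" and a = "\<lambda>i. i" and I = Basis and x = p]
      by (simp add: euclidean_representation)
    then show ?thesis by (simp add: b_def inner_sum_left inner_commute[of h] mult.commute)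
  qed
  have b: "norm b > 0" using grad_f_nonzero[OF p] pdb by auto
  define n where "n = (1 / norm b) *\<^sub>R b"
  have n: "norm n = 1" "b = norm b *\<^sub>R n" using b by (simp_all add: n_def)
  have "(f has_derivative (\<lambda>h. b \<bullet> h)) (at p)" using pd_has_derivative[OF df, of p] pdb by simp
  then obtain r where r: "r > 0"
    "\<And>\<xi>. norm (\<xi> - p) < r \<Longrightarrow> norm (f \<xi> - f p - b \<bullet> (\<xi> - p)) \<le> norm b / 4 * norm (\<xi> - p)"
    using b unfolding has_derivative_at_alt by (metis divide_pos_pos zero_less_numeral)
  define \<delta> where "\<delta> = min r \<rho> / 4"
  have \<delta>: "\<delta> > 0" "3 * \<delta> < r" "3 * \<delta> < \<rho>" using r \<rho> by (auto simp: \<delta>_def min_def)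
  \<comment> \<open>The bump is centred at distance \<delta> from \<open>p\<close> along the outer
    normal and has radius 2\<delta>, so it reaches into \<Omega> and has a definite slope
    there.\<close>
  define c where "c = p + \<delta> *\<^sub>R n"
  define \<phi> where "\<phi> = bump c (2 * \<delta>)"
  have \<phi>s: "smooth_on UNIV \<phi>" by (simp add: \<phi>_def smooth_bump)
  have d2: "2 * \<delta> > 0" using \<delta> by simp
  have close: "norm (\<xi> - p) < 3 * \<delta>" if "dist \<xi> c < 2 * \<delta>" for \<xi>
  proof -
    have "norm (\<xi> - p) \<le> dist \<xi> c + norm (\<delta> *\<^sub>R n)"
      using norm_triangle_ineq[of "\<xi> - c" "\<delta> *\<^sub>R n"] by (simp add: c_def dist_norm)
    then show ?thesis using that n \<delta> by simp
  qed
  have side: "(\<xi> - c) \<bullet> n < 0" if "\<xi> \<in> \<Omega>" "dist \<xi> c < 2 * \<delta>" for \<xi>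
  proof -
    have nx: "norm (\<xi> - p) < 3 * \<delta>" using close[OF that(2)] .
    \<comment> \<open>The first-order expansion of \<open>f\<close> at \<open>p\<close> has error at
      most a quarter of |b| times 3\<delta>, less than |b|\<delta>. Together with f < 0 in \<Omega>
      this puts the points of \<Omega> in the bump strictly on the inner side of the centre.\<close>
    have "norm (f \<xi> - f p - b \<bullet> (\<xi> - p)) \<le> norm b / 4 * norm (\<xi> - p)" using nx \<delta> by (intro r(2)) simp
    also have "\<dots> \<le> norm b / 4 * (3 * \<delta>)" using nx by (intro mult_left_mono) auto
    finally have "\<bar>f \<xi> - f p - b \<bullet> (\<xi> - p)\<bar> \<le> norm b / 4 * (3 * \<delta>)" by simp
    moreover have "norm b / 4 * (3 * \<delta>) = 3 / 4 * (norm b * \<delta>)" by simp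
    moreover have "f \<xi> < 0" using that(1) by (simp add: dom_eq)
    ultimately have "b \<bullet> (\<xi> - p) < norm b * \<delta>"
      using fp mult_pos_pos[OF b \<delta>(1)] by linarith
    then have "norm b * (n \<bullet> (\<xi> - p)) < norm b * \<delta>" by (subst (asm) n(2)) simp
    then have "n \<bullet> (\<xi> - p) < \<delta>" using b by simp
    moreover have "(\<xi> - c) \<bullet> n = n \<bullet> (\<xi> - p) - \<delta>"
      using n(1) by (simp add: c_def inner_diff_left inner_add_left inner_add_right inner_diff_right inner_commute norm_eq_1)
    ultimately show ?thesis by simp
  qed
  have pos: "pd n \<phi> \<xi> \<ge> 0" if "\<xi> \<in> \<Omega>" for \<xi>
  proof (cases "dist \<xi> c < 2 * \<delta>")
    case True
    then show ?thesis using side[OF that True] bmp_nonneg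
      by (simp add: \<phi>_def pd_bump mult_nonpos_nonneg divide_nonpos_nonneg)
  next
    case False
    have "(2 * \<delta>)\<^sup>2 \<le> (\<xi> - c) \<bullet> (\<xi> - c)"
      using False \<delta> power_mono[of "2 * \<delta>" "norm (\<xi> - c)" 2] by (simp add: dist_norm dot_square_norm)
    then have "1 \<le> (\<xi> - c) \<bullet> (\<xi> - c) / (2 * \<delta>)\<^sup>2" using \<delta> by simp
    then show ?thesis by (simp add: \<phi>_def pd_bump bmp_eq_0)
  qed
  have sn: "smooth_on UNIV (pd n \<phi>)" by (rule smooth_on_pd[OF open_UNIV \<phi>s])
  have "integral\<^sup>L ?M (pd n \<phi>) \<noteq> 0"
  proof
    assume "integral\<^sup>L ?M (pd n \<phi>) = 0"
    moreover have "AE \<xi> in ?M. 0 \<le> pd n \<phi> \<xi>" using pos by (intro AE_I2) simp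
    ultimately have ae: "AE \<xi> in ?M. pd n \<phi> \<xi> = 0"
      using integral_nonneg_eq_0_iff_AE[OF integrable_sm[OF sn]] by simp
    have "p \<in> closure \<Omega>" using p by (simp add: frontier_def)
    then obtain \<xi> where \<xi>: "\<xi> \<in> \<Omega>" "dist \<xi> p < \<delta>" using closure_approachable \<delta>(1) by metis
    have "dist \<xi> c \<le> dist \<xi> p + dist p c" by (rule dist_triangle)
    also have "dist p c = \<delta>" using n \<delta> by (simp add: c_def dist_norm)
    finally have dc: "dist \<xi> c < 2 * \<delta>" using \<xi> by simp
    have "(norm (\<xi> - c))\<^sup>2 < (2 * \<delta>)\<^sup>2" using dc by (intro power_strict_mono) (auto simp: dist_norm)
    then have "(\<xi> - c) \<bullet> (\<xi> - c) / (2 * \<delta>)\<^sup>2 < 1" using \<delta> by (simp add: dot_square_norm)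
    then have "pd n \<phi> \<xi> > 0"
      using side[OF \<xi>(1) dc] \<delta> unfolding \<phi>_def pd_bump
      by (intro mult_pos_pos bmp_pos) (auto simp: divide_less_0_iff mult_less_0_iff)
    moreover have "pd n \<phi> \<xi> = 0"
      by (rule AE_continuous_eq_0[OF open_dom continuous_on_subset[OF smooth_on_continuous[OF sn] subset_UNIV] ae \<xi>(1)])
    ultimately show False by simp
  qed
  moreover have "integral\<^sup>L ?M (pd n \<phi>) = 0"
  proof -
    have "compact (pd n f ` closure \<Omega>)"
      by (rule compact_continuous_image[OF continuous_on_subset[OF smooth_on_continuous[OF smooth_on_pd[OF open_UNIV smooth_f]] subset_UNIV] compact_closure_dom])
    then have "bounded (pd n f ` closure \<Omega>)" by (rule compact_imp_bounded)
    then obtain B where B: "\<And>\<xi>. \<xi> \<in> closure \<Omega> \<Longrightarrow> \<bar>pd n f \<xi>\<bar> \<le> B"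
      unfolding bounded_iff by auto
    have spf: "smooth_on UNIV (pd n f)" by (rule smooth_on_pd[OF open_UNIV smooth_f])
    define E where "E k = integral\<^sup>L ?M (\<lambda>\<xi>. exp (real k * f \<xi>) * pd n \<phi> \<xi>)" for k :: nat
    define G where "G k = real k * integral\<^sup>L ?M (\<lambda>\<xi>. exp (real k * f \<xi>) * (\<phi> \<xi> * pd n f \<xi>))" for k :: nat
    \<comment> \<open>The derivative of \<phi> (1 - exp (k f)) has integral zero since that function
      vanishes on the frontier. It splits into the integral of interest, a term with exp (k f), and
      k times a layer concentrating at the boundary.\<close>
    have id: "integral\<^sup>L ?M (pd n \<phi>) = E k + G k" for k
    proof -
      define e where "e \<xi> = exp (real k * f \<xi>)" for \<xi>
      have se: "smooth_on UNIV e" unfolding e_def by (rule smooth_expf)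
      define F where "F \<xi> = \<phi> \<xi> * (1 - e \<xi>)" for \<xi>
      have sF: "smooth_on UNIV F" unfolding F_def by (intro smooth_intros \<phi>s se open_UNIV)
      have "integral\<^sup>L ?M (pd n F) = 0"
        by (rule integral_pd_smooth_eq_0[OF open_dom bounded_dom negligible_frontier open_UNIV subset_UNIV sF])
          (simp add: F_def e_def frontier_eq)
      moreover have "pd n F = (\<lambda>\<xi>. pd n \<phi> \<xi> - (e \<xi> * pd n \<phi> \<xi> + real k * (e \<xi> * (\<phi> \<xi> * pd n f \<xi>))))"
      proof (rule ext)
        fix \<xi>
        have D\<phi>: "(\<phi> has_derivative (\<lambda>h. pd h \<phi> \<xi>)) (at \<xi>)" by (rule smooth_on_has_derivative[OF \<phi>s]) auto
        have Df: "(f has_derivative (\<lambda>h. pd h f \<xi>)) (at \<xi>)" by (rule smooth_on_has_derivative[OF smooth_f]) auto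
        have "(F has_derivative (\<lambda>h. \<phi> \<xi> * (0 - exp (real k * f \<xi>) * (real k * pd h f \<xi>)) + pd h \<phi> \<xi> * (1 - e \<xi>))) (at \<xi>)"
          unfolding F_def[abs_def] e_def
          by (rule derivative_eq_intros D\<phi> Df refl)+ (auto simp: fun_eq_iff algebra_simps)
        from pd_at[OF this, of n]
        show "pd n F \<xi> = pd n \<phi> \<xi> - (e \<xi> * pd n \<phi> \<xi> + real k * (e \<xi> * (\<phi> \<xi> * pd n f \<xi>)))"
          by (simp add: e_def algebra_simps)
      qed
      ultimately have "0 = integral\<^sup>L ?M (\<lambda>\<xi>. pd n \<phi> \<xi> - (e \<xi> * pd n \<phi> \<xi> + real k * (e \<xi> * (\<phi> \<xi> * pd n f \<xi>))))"
        by simp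
      also have "\<dots> = integral\<^sup>L ?M (pd n \<phi>) - (integral\<^sup>L ?M (\<lambda>\<xi>. e \<xi> * pd n \<phi> \<xi>) + real k * integral\<^sup>L ?M (\<lambda>\<xi>. e \<xi> * (\<phi> \<xi> * pd n f \<xi>)))"
        by (subst Bochner_Integration.integral_diff, rule integrable_sm[OF sn], intro integrable_sm smooth_intros se sn \<phi>s spf open_UNIV,
            subst Bochner_Integration.integral_add) (auto intro!: integrable_sm smooth_intros se sn \<phi>s spf open_UNIV)
      finally show ?thesis by (simp add: E_def G_def e_def)
    qed
    have "E \<longlonglongrightarrow> 0" unfolding E_def by (rule integral_expf_tendsto_0[OF sn])
    moreover have "G \<longlonglongrightarrow> 0"
    proof (rule Lim_null_comparison)
      show "(\<lambda>k. (\<bar>B\<bar> / m) * (real k * integral\<^sup>L ?M (\<lambda>\<xi>. exp (real k * f \<xi>) * H \<xi>))) \<longlonglongrightarrow> 0"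
        by (rule tendsto_mult_right_zero[OF lim])
      show "eventually (\<lambda>k. norm (G k) \<le> (\<bar>B\<bar> / m) * (real k * integral\<^sup>L ?M (\<lambda>\<xi>. exp (real k * f \<xi>) * H \<xi>))) sequentially"
      proof (rule always_eventually, rule allI)
        fix k
        \<comment> \<open>On the support of the bump \<open>H\<close> is at least \<open>m\<close>,
          so the layer is dominated by a multiple of the layer with weight \<open>H\<close>, which
          tends to zero by hypothesis.\<close>
        have pt: "\<bar>exp (real k * f \<xi>) * (\<phi> \<xi> * pd n f \<xi>)\<bar> \<le> (\<bar>B\<bar> / m) * (exp (real k * f \<xi>) * H \<xi>)" if "\<xi> \<in> \<Omega>" for \<xi>
        proof -
          have "\<bar>\<phi> \<xi> * pd n f \<xi>\<bar> \<le> (\<bar>B\<bar> / m) * H \<xi>"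
          proof (cases "dist \<xi> c < 2 * \<delta>")
            case True
            have "dist \<xi> p < \<rho>" using close[OF True] \<delta> by (simp add: dist_norm)
            then have "1 \<le> H \<xi> / m" using Hm m by simp
            have "\<bar>\<phi> \<xi> * pd n f \<xi>\<bar> \<le> 1 * \<bar>B\<bar>"
              unfolding abs_mult using bump_props(1,2)[OF d2, of c \<xi>] B[OF subsetD[OF closure_subset that]]
              by (intro mult_mono) (auto simp: \<phi>_def)
            also have "\<dots> \<le> \<bar>B\<bar> * (H \<xi> / m)" using \<open>1 \<le> H \<xi> / m\<close> mult_left_mono[of 1 "H \<xi> / m" "\<bar>B\<bar>"] by simp
            finally show ?thesis by simp
          next
            case False
            then have "\<phi> \<xi> = 0" using bump_props(3)[OF d2, of \<xi> c] by (simp add: \<phi>_def)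
            then show ?thesis using H(2) m by simp
          qed
          then have "exp (real k * f \<xi>) * \<bar>\<phi> \<xi> * pd n f \<xi>\<bar> \<le> exp (real k * f \<xi>) * ((\<bar>B\<bar> / m) * H \<xi>)" by (intro mult_left_mono) auto
          then show ?thesis by (simp add: abs_mult mult_ac)
        qed
        have iH: "integrable ?M (\<lambda>\<xi>. exp (real k * f \<xi>) * H \<xi>)"
          by (intro integrable_sm smooth_intros smooth_expf H open_UNIV)
        have "norm (integral\<^sup>L ?M (\<lambda>\<xi>. exp (real k * f \<xi>) * (\<phi> \<xi> * pd n f \<xi>))) \<le> integral\<^sup>L ?M (\<lambda>\<xi>. \<bar>exp (real k * f \<xi>) * (\<phi> \<xi> * pd n f \<xi>)\<bar>)"
          by simp
        also have "\<dots> \<le> integral\<^sup>L ?M (\<lambda>\<xi>. (\<bar>B\<bar> / m) * (exp (real k * f \<xi>) * H \<xi>))"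
          by (rule integral_mono') (use iH pt H(2) m in auto)
        also have "\<dots> = (\<bar>B\<bar> / m) * integral\<^sup>L ?M (\<lambda>\<xi>. exp (real k * f \<xi>) * H \<xi>)" by simp
        finally have "real k * norm (integral\<^sup>L ?M (\<lambda>\<xi>. exp (real k * f \<xi>) * (\<phi> \<xi> * pd n f \<xi>)))
            \<le> real k * ((\<bar>B\<bar> / m) * integral\<^sup>L ?M (\<lambda>\<xi>. exp (real k * f \<xi>) * H \<xi>))" by (rule mult_left_mono) simp
        then show "norm (G k) \<le> (\<bar>B\<bar> / m) * (real k * integral\<^sup>L ?M (\<lambda>\<xi>. exp (real k * f \<xi>) * H \<xi>))"
          by (simp add: G_def abs_mult mult_ac)
      qed
    qed
    ultimately have "(\<lambda>k. E k + G k) \<longlonglongrightarrow> 0 + 0" by (intro tendsto_add)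
    then have "(\<lambda>k::nat. integral\<^sup>L ?M (pd n \<phi>)) \<longlonglongrightarrow> 0" by (simp add: id[symmetric])
    then show ?thesis by (simp add: LIMSEQ_const_iff)
  qed
  ultimately show False by simp
qed

lemma XX_expf: "XX j (\<lambda>\<xi>. exp (c * f \<xi>)) \<xi> = c * exp (c * f \<xi>) * XX j f \<xi>"
proof -
  have df: "f differentiable (at \<xi>)" using smooth_on_differentiable[OF smooth_f] by simp
  have "XX j (\<lambda>\<xi>. exp (c * f \<xi>)) \<xi> = pd 1 exp (c * f \<xi>) * XX j (\<lambda>\<xi>. c * f \<xi>) \<xi>"
    by (rule XX_compose) (auto intro!: differentiable_mult df smooth_on_differentiable[OF smooth_exp])
  then show ?thesis by (simp add: pd_exp XX_cmult[OF df])
qed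

text \<open>The hypothesis says that the boundary integral of a p X_j f vanishes for all smooth p.
  The choice p = a X_j f exp (k f) turns this into k times the integral of exp (k f) (a X_j f)^2
  being minus an integral of exp (k f) times a smooth function, hence tending to zero;
  \<open>boundary_layer_eq_0\<close> finishes.\<close>

lemma boundary_flux_eq_0:
  assumes a: "smooth_on UNIV a"
    and flux: "\<And>p. smooth_on UNIV p \<Longrightarrow> integral\<^sup>L (lebesgue_on \<Omega>) (XX j (\<lambda>\<xi>. a \<xi> * p \<xi>)) = 0"
    and p: "p \<in> frontier \<Omega>"
  shows "a p * XX j f p = 0"
proof -
  let ?M = "lebesgue_on \<Omega>"
  define g where "g \<xi> = a \<xi> * a \<xi> * XX j f \<xi>" for \<xi>
  have sX: "smooth_on UNIV (XX j f)" by (rule smooth_XX[OF open_UNIV smooth_f])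
  have sg: "smooth_on UNIV g" unfolding g_def by (intro smooth_intros a sX open_UNIV)
  define H where "H \<xi> = (a \<xi> * XX j f \<xi>)\<^sup>2" for \<xi>
  have sH: "smooth_on UNIV H" unfolding H_def by (intro smooth_intros a sX open_UNIV)
  have sXg: "smooth_on UNIV (XX j g)" by (rule smooth_XX[OF open_UNIV sg])
  have "real k * integral\<^sup>L ?M (\<lambda>\<xi>. exp (real k * f \<xi>) * H \<xi>) = - integral\<^sup>L ?M (\<lambda>\<xi>. exp (real k * f \<xi>) * XX j g \<xi>)" for k
  proof -
    define e where "e \<xi> = exp (real k * f \<xi>)" for \<xi>
    have se: "smooth_on UNIV e" unfolding e_def by (rule smooth_expf)
    have "XX j (\<lambda>\<xi>. a \<xi> * (a \<xi> * XX j f \<xi> * e \<xi>)) = (\<lambda>\<xi>. real k * (e \<xi> * H \<xi>) + e \<xi> * XX j g \<xi>)"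
    proof (rule ext)
      fix \<xi>
      have "(\<lambda>\<xi>. a \<xi> * (a \<xi> * XX j f \<xi> * e \<xi>)) = (\<lambda>\<xi>. g \<xi> * e \<xi>)" by (simp add: g_def fun_eq_iff)
      then have "XX j (\<lambda>\<xi>. a \<xi> * (a \<xi> * XX j f \<xi> * e \<xi>)) \<xi> = g \<xi> * XX j e \<xi> + XX j g \<xi> * e \<xi>"
        using smooth_on_differentiable[OF sg open_UNIV UNIV_I] smooth_on_differentiable[OF se open_UNIV UNIV_I]
        by (simp add: XX_mult)
      also have "XX j e \<xi> = real k * e \<xi> * XX j f \<xi>" unfolding e_def by (rule XX_expf)
      finally show "XX j (\<lambda>\<xi>. a \<xi> * (a \<xi> * XX j f \<xi> * e \<xi>)) \<xi> = real k * (e \<xi> * H \<xi>) + e \<xi> * XX j g \<xi>"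
        by (simp add: g_def[of \<xi>] H_def power2_eq_square mult_ac add.commute)
    qed
    moreover have "smooth_on UNIV (\<lambda>\<xi>. a \<xi> * XX j f \<xi> * e \<xi>)" by (intro smooth_intros a sX se open_UNIV)
    ultimately have "0 = integral\<^sup>L ?M (\<lambda>\<xi>. real k * (e \<xi> * H \<xi>) + e \<xi> * XX j g \<xi>)"
      using flux[of "\<lambda>\<xi>. a \<xi> * XX j f \<xi> * e \<xi>"] by simp
    also have "\<dots> = real k * integral\<^sup>L ?M (\<lambda>\<xi>. e \<xi> * H \<xi>) + integral\<^sup>L ?M (\<lambda>\<xi>. e \<xi> * XX j g \<xi>)"
      by (subst Bochner_Integration.integral_add) (auto intro!: integrable_sm smooth_intros se sH sXg open_UNIV)
    finally show ?thesis by (simp add: e_def)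
  qed
  moreover have "(\<lambda>k. - integral\<^sup>L ?M (\<lambda>\<xi>. exp (real k * f \<xi>) * XX j g \<xi>)) \<longlonglongrightarrow> - 0"
    by (intro tendsto_minus integral_expf_tendsto_0 sXg)
  ultimately have "(\<lambda>k. real k * integral\<^sup>L ?M (\<lambda>\<xi>. exp (real k * f \<xi>) * H \<xi>)) \<longlonglongrightarrow> 0" by simp
  from boundary_layer_eq_0[OF sH _ this p] show ?thesis by (simp add: H_def)
qed

end

lemma XX_ext:
  assumes V: "open V" and w: "smooth_on V w" and \<phi>: "smooth_on UNIV \<phi>"
    and K: "closed K" "K \<subseteq> V" "\<And>\<xi>. \<xi> \<notin> K \<Longrightarrow> \<phi> \<xi> = 0"
  shows "XX j (\<lambda>\<xi>. if \<xi> \<in> V then w \<xi> * \<phi> \<xi> else 0) \<xi>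
    = (if \<xi> \<in> V then w \<xi> * XX j \<phi> \<xi> else 0) + (if \<xi> \<in> V then XX j w \<xi> * \<phi> \<xi> else 0)"
proof (cases "\<xi> \<in> V")
  case True
  have "XX j (\<lambda>\<xi>. if \<xi> \<in> V then w \<xi> * \<phi> \<xi> else 0) \<xi> = XX j (\<lambda>\<xi>. w \<xi> * \<phi> \<xi>) \<xi>"
    by (rule XX_cong[OF V True]) simp
  also have "\<dots> = w \<xi> * XX j \<phi> \<xi> + XX j w \<xi> * \<phi> \<xi>"
    by (rule XX_mult[OF smooth_on_differentiable[OF w V True] smooth_on_differentiable[OF \<phi> open_UNIV UNIV_I]])
  finally show ?thesis using True by simp
next
  case False
  then have "\<xi> \<in> - K" using K by blast
  have "open (- K)" using K by blast
  from XX_cong[OF this \<open>\<xi> \<in> - K\<close>, of "\<lambda>\<xi>. if \<xi> \<in> V then w \<xi> * \<phi> \<xi> else 0" "\<lambda>_. 0"]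
  show ?thesis using False K(3) by simp
qed

lemma norm_sq_sum: "(norm (x :: real ^ 'm::finite))\<^sup>2 = (\<Sum>j\<in>UNIV. (x $ j)\<^sup>2)"
  by (simp add: sum_nth_sq dot_square_norm)

context smooth_domain
begin

lemma square_integrable_imp_integrable:
  fixes h :: "'n heis \<Rightarrow> real"
  assumes [measurable]: "h \<in> borel_measurable (lebesgue_on \<Omega>)" and h2: "integrable (lebesgue_on \<Omega>) (\<lambda>\<xi>. (h \<xi>)\<^sup>2)"
  shows "integrable (lebesgue_on \<Omega>) h"
proof (rule Bochner_Integration.integrable_bound[OF Bochner_Integration.integrable_add[OF integrable_sm[OF smooth_on_const[of _ 1]] h2]])
  have "\<bar>y\<bar> \<le> 1 + y\<^sup>2" for y :: real
    using zero_le_power2[of "\<bar>y\<bar> - 1"] zero_le_power2[of y] unfolding power2_diff power2_abs by simp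
  then show "AE \<xi> in lebesgue_on \<Omega>. norm (h \<xi>) \<le> norm (1 + (h \<xi>)\<^sup>2)" by (intro AE_I2) (simp add: abs_of_nonneg)
qed measurable

lemma L2_on_component:
  assumes "L2_on \<Omega> (g :: 'n heis \<Rightarrow> 'n hvec)"
  shows "(\<lambda>\<xi>. g \<xi> $ i) \<in> borel_measurable (lebesgue_on \<Omega>)" "integrable (lebesgue_on \<Omega>) (\<lambda>\<xi>. (g \<xi> $ i)\<^sup>2)"
proof -
  have gm[measurable]: "g \<in> borel_measurable (lebesgue_on \<Omega>)" and g2: "integrable (lebesgue_on \<Omega>) (\<lambda>\<xi>. (norm (g \<xi>))\<^sup>2)"
    using assms by (auto simp: L2_on_def)
  have "(\<lambda>\<xi>. g \<xi> \<bullet> axis i 1) \<in> borel_measurable (lebesgue_on \<Omega>)" by measurable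
  then show m[measurable]: "(\<lambda>\<xi>. g \<xi> $ i) \<in> borel_measurable (lebesgue_on \<Omega>)" by (simp add: inner_axis)
  show "integrable (lebesgue_on \<Omega>) (\<lambda>\<xi>. (g \<xi> $ i)\<^sup>2)"
  proof (rule Bochner_Integration.integrable_bound[OF g2])
    show "AE \<xi> in lebesgue_on \<Omega>. norm ((g \<xi> $ i)\<^sup>2) \<le> norm ((norm (g \<xi>))\<^sup>2)"
      using component_le_norm_cart by (intro AE_I2) (auto simp: abs_le_square_iff[symmetric])
  qed measurable
qed

text \<open>Test functions integrate by parts against \<phi> without boundary term, and this
  survives the limit that defines \<open>H10\<close>. Inside V the weak gradient of \<open>u\<close>
  is the classical gradient of \<open>w\<close>, so the formula becomes the statement that w \<phi>
  has zero total horizontal derivative.\<close>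

lemma trace_flux:
  assumes u: "u \<in> H10 \<Omega>" and V: "open V" and w: "smooth_on V w"
    and uw: "AE \<xi> in lebesgue_on (V \<inter> \<Omega>). u \<xi> = w \<xi>"
    and \<phi>: "smooth_on UNIV \<phi>" and K: "closed K" "K \<subseteq> V" "\<And>\<xi>. \<xi> \<notin> K \<Longrightarrow> \<phi> \<xi> = 0"
  shows "integral\<^sup>L (lebesgue_on \<Omega>) (XX j (\<lambda>\<xi>. if \<xi> \<in> V then w \<xi> * \<phi> \<xi> else 0)) = 0"
proof -
  let ?M = "lebesgue_on \<Omega>"
  obtain g \<Phi> where g: "has_weak_hgrad \<Omega> u g" and \<Phi>: "\<And>k::nat. \<Phi> k \<in> test_functions \<Omega>"
    and l1: "(\<lambda>k. integral\<^sup>L ?M (\<lambda>\<xi>. (\<Phi> k \<xi> - u \<xi>)\<^sup>2)) \<longlonglongrightarrow> 0"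
    and l2: "(\<lambda>k. integral\<^sup>L ?M (\<lambda>\<xi>. (norm (hgrad (\<Phi> k) \<xi> - g \<xi>))\<^sup>2)) \<longlonglongrightarrow> 0"
    using u unfolding H10_def by auto
  have um[measurable]: "u \<in> borel_measurable ?M" and u2: "integrable ?M (\<lambda>\<xi>. (u \<xi>)\<^sup>2)"
    and gm[measurable]: "g \<in> borel_measurable ?M" and g2: "integrable ?M (\<lambda>\<xi>. (norm (g \<xi>))\<^sup>2)"
    and weak: "\<And>\<psi>. \<psi> \<in> test_functions \<Omega> \<Longrightarrow> integral\<^sup>L ?M (\<lambda>\<xi>. u \<xi> * XX j \<psi> \<xi>) = - integral\<^sup>L ?M (\<lambda>\<xi>. g \<xi> $ j * \<psi> \<xi>)"
    using g by (auto simp: has_weak_hgrad_def L2_on_def hgrad_nth)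
  have gjm[measurable]: "(\<lambda>\<xi>. g \<xi> $ i) \<in> borel_measurable ?M" and gj2: "integrable ?M (\<lambda>\<xi>. (g \<xi> $ i)\<^sup>2)" for i
    using L2_on_component[of g i] g by (auto simp: has_weak_hgrad_def)
  have sub2: "integrable ?M (\<lambda>\<xi>. (h \<xi> - k \<xi>)\<^sup>2)" if [measurable]: "h \<in> borel_measurable ?M" "k \<in> borel_measurable ?M"
    and h2: "integrable ?M (\<lambda>\<xi>. (h \<xi>)\<^sup>2)" "integrable ?M (\<lambda>\<xi>. (k \<xi>)\<^sup>2)" for h k :: "'n heis \<Rightarrow> real"
  proof (rule Bochner_Integration.integrable_bound)
    show "integrable ?M (\<lambda>\<xi>. 2 * (h \<xi>)\<^sup>2 + 2 * (k \<xi>)\<^sup>2)" using h2 by auto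
    have "(a - b)\<^sup>2 \<le> 2 * a\<^sup>2 + 2 * b\<^sup>2" for a b :: real
      using zero_le_power2[of "a + b"] by (simp add: power2_diff power2_sum)
    then show "AE \<xi> in ?M. norm ((h \<xi> - k \<xi>)\<^sup>2) \<le> norm (2 * (h \<xi>)\<^sup>2 + 2 * (k \<xi>)\<^sup>2)"
      by (intro AE_I2) (simp add: abs_of_nonneg)
  qed measurable
  have sm_int: "s \<in> borel_measurable ?M" "integrable ?M (\<lambda>\<xi>. (s \<xi>)\<^sup>2)" if "smooth_on UNIV s" for s
    using integrable_sm[OF that] integrable_sm[OF smooth_on_power[OF open_UNIV that, of 2]] by auto
  have uI: "integrable ?M u" by (rule square_integrable_imp_integrable[OF um u2])
  have gI: "integrable ?M (\<lambda>\<xi>. g \<xi> $ i)" for i by (rule square_integrable_imp_integrable[OF gjm gj2])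
  have times: "integrable ?M (\<lambda>\<xi>. h \<xi> * s \<xi>)" if "integrable ?M h" "smooth_on UNIV s" for h s
    by (rule integrable_mult_continuous[OF open_dom bounded_dom that(1) continuous_on_subset[OF smooth_on_continuous[OF that(2)] subset_UNIV]])
  have sX\<phi>: "smooth_on UNIV (XX j \<phi>)" by (rule smooth_XX[OF open_UNIV \<phi>])
  have s\<Phi>: "smooth_on UNIV (\<Phi> k)" "smooth_on UNIV (XX i (\<Phi> k))" for k i
    using test_smooth[OF \<Phi>] smooth_XX[OF open_UNIV test_smooth[OF \<Phi>]] by blast+
  have lim1: "(\<lambda>k. integral\<^sup>L ?M (\<lambda>\<xi>. (\<Phi> k \<xi> - u \<xi>) * XX j \<phi> \<xi>)) \<longlonglongrightarrow> 0"
    by (rule integral_tendsto_0_if_L2[OF _ _ l1]) (use sm_int[OF s\<Phi>(1)] sm_int[OF sX\<phi>] u2 in \<open>auto intro!: sub2\<close>)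
  have lim2: "(\<lambda>k. integral\<^sup>L ?M (\<lambda>\<xi>. (XX j (\<Phi> k) \<xi> - g \<xi> $ j) * \<phi> \<xi>)) \<longlonglongrightarrow> 0"
  proof (rule integral_tendsto_0_if_L2)
    show b2: "integrable ?M (\<lambda>\<xi>. (XX i (\<Phi> k) \<xi> - g \<xi> $ i)\<^sup>2)" for k i
      using sm_int[OF s\<Phi>(2)] gj2 by (intro sub2) auto
    show "(\<lambda>\<xi>. XX j (\<Phi> k) \<xi> - g \<xi> $ j) \<in> borel_measurable ?M" for k using sm_int[OF s\<Phi>(2)] by auto
    have up: "integral\<^sup>L ?M (\<lambda>\<xi>. (XX j (\<Phi> k) \<xi> - g \<xi> $ j)\<^sup>2) \<le> integral\<^sup>L ?M (\<lambda>\<xi>. (norm (hgrad (\<Phi> k) \<xi> - g \<xi>))\<^sup>2)" for k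
    proof (rule integral_mono[OF b2])
      have "(\<lambda>\<xi>. (norm (hgrad (\<Phi> k) \<xi> - g \<xi>))\<^sup>2) = (\<lambda>\<xi>. \<Sum>i\<in>UNIV. (XX i (\<Phi> k) \<xi> - g \<xi> $ i)\<^sup>2)"
        by (rule ext) (simp add: norm_sq_sum hgrad_nth)
      then show "integrable ?M (\<lambda>\<xi>. (norm (hgrad (\<Phi> k) \<xi> - g \<xi>))\<^sup>2)" using b2 by simp
      show "(XX j (\<Phi> k) \<xi> - g \<xi> $ j)\<^sup>2 \<le> (norm (hgrad (\<Phi> k) \<xi> - g \<xi>))\<^sup>2" for \<xi>
        using component_le_norm_cart[of "hgrad (\<Phi> k) \<xi> - g \<xi>" j] by (simp add: hgrad_nth abs_le_square_iff[symmetric])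
    qed
    show "(\<lambda>k. integral\<^sup>L ?M (\<lambda>\<xi>. (XX j (\<Phi> k) \<xi> - g \<xi> $ j)\<^sup>2)) \<longlonglongrightarrow> 0"
      by (rule tendsto_sandwich[OF _ _ tendsto_const l2]) (auto intro!: always_eventually up)
  qed (use sm_int[OF \<phi>] in auto)
  \<comment> \<open>The left side tends to zero, while the right side does not depend on k, so it is
    zero: the sum of the two integrals of products with \<open>\<Phi> k\<close> vanishes for each
    k.\<close>
  have const: "integral\<^sup>L ?M (\<lambda>\<xi>. (\<Phi> k \<xi> - u \<xi>) * XX j \<phi> \<xi>) + integral\<^sup>L ?M (\<lambda>\<xi>. (XX j (\<Phi> k) \<xi> - g \<xi> $ j) * \<phi> \<xi>)
      = - (integral\<^sup>L ?M (\<lambda>\<xi>. u \<xi> * XX j \<phi> \<xi>) + integral\<^sup>L ?M (\<lambda>\<xi>. g \<xi> $ j * \<phi> \<xi>))" for k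
  proof -
    have i: "integrable ?M (\<lambda>\<xi>. \<Phi> k \<xi> * XX j \<phi> \<xi>)" "integrable ?M (\<lambda>\<xi>. XX j (\<Phi> k) \<xi> * \<phi> \<xi>)"
      by (intro integrable_sm smooth_intros open_UNIV s\<Phi> sX\<phi> \<phi>)+
    have "0 = integral\<^sup>L ?M (XX j (\<lambda>\<xi>. \<Phi> k \<xi> * \<phi> \<xi>))" using test_integral_XX[OF test_mult[OF \<Phi> \<phi>]] by simp
    also have "XX j (\<lambda>\<xi>. \<Phi> k \<xi> * \<phi> \<xi>) = (\<lambda>\<xi>. \<Phi> k \<xi> * XX j \<phi> \<xi> + XX j (\<Phi> k) \<xi> * \<phi> \<xi>)"
      by (rule ext, rule XX_mult[OF smooth_on_differentiable[OF s\<Phi>(1) open_UNIV UNIV_I] smooth_on_differentiable[OF \<phi> open_UNIV UNIV_I]])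
    also have "integral\<^sup>L ?M \<dots> = integral\<^sup>L ?M (\<lambda>\<xi>. \<Phi> k \<xi> * XX j \<phi> \<xi>) + integral\<^sup>L ?M (\<lambda>\<xi>. XX j (\<Phi> k) \<xi> * \<phi> \<xi>)"
      by (rule Bochner_Integration.integral_add[OF i])
    finally show ?thesis
      using i times[OF uI sX\<phi>] times[OF gI \<phi>, of j] by (simp add: left_diff_distrib)
  qed
  have "(\<lambda>k::nat. - (integral\<^sup>L ?M (\<lambda>\<xi>. u \<xi> * XX j \<phi> \<xi>) + integral\<^sup>L ?M (\<lambda>\<xi>. g \<xi> $ j * \<phi> \<xi>))) \<longlonglongrightarrow> 0 + 0"
    using tendsto_add[OF lim1 lim2] unfolding const .
  then have ibp: "integral\<^sup>L ?M (\<lambda>\<xi>. u \<xi> * XX j \<phi> \<xi>) + integral\<^sup>L ?M (\<lambda>\<xi>. g \<xi> $ j * \<phi> \<xi>) = 0"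
    by (simp add: LIMSEQ_const_iff)
  have uwO: "AE \<xi> in ?M. \<xi> \<in> V \<longrightarrow> u \<xi> = w \<xi>"
    using uw V open_dom by (subst (asm) AE_restrict_space_iff, force) (subst AE_restrict_space_iff, force, auto elim!: eventually_mono)
  \<comment> \<open>A factor supported in \<open>K\<close>, hence in V, allows replacing
    \<open>u\<close> by \<open>w\<close>.\<close>
  have swap: "integral\<^sup>L ?M (\<lambda>\<xi>. u \<xi> * p \<xi>) = integral\<^sup>L ?M (\<lambda>\<xi>. if \<xi> \<in> V then w \<xi> * p \<xi> else 0)"
    if p: "smooth_on UNIV p" "\<And>\<xi>. \<xi> \<notin> K \<Longrightarrow> p \<xi> = 0" for p
  proof (rule integral_cong_AE)
    show "(\<lambda>\<xi>. u \<xi> * p \<xi>) \<in> borel_measurable ?M" using times[OF uI p(1)] by auto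
    show "(\<lambda>\<xi>. if \<xi> \<in> V then w \<xi> * p \<xi> else 0) \<in> borel_measurable ?M"
      using integrable_sm[OF smooth_ext_by_zero[OF V w p(1) K(1,2) p(2)]] by auto
    show "AE \<xi> in ?M. u \<xi> * p \<xi> = (if \<xi> \<in> V then w \<xi> * p \<xi> else 0)"
    proof (rule AE_mp[OF uwO], intro AE_I2 impI)
      fix \<xi> assume "\<xi> \<in> V \<longrightarrow> u \<xi> = w \<xi>"
      then show "u \<xi> * p \<xi> = (if \<xi> \<in> V then w \<xi> * p \<xi> else 0)"
        using p(2)[of \<xi>] K(2) by (cases "\<xi> \<in> V") auto
    qed
  qed
  define A where "A \<xi> = (if \<xi> \<in> V then XX j w \<xi> * \<phi> \<xi> else 0)" for \<xi>
  have sXw: "smooth_on V (XX j w)" by (rule smooth_XX[OF V w])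
  have sA: "smooth_on UNIV A" unfolding A_def by (rule smooth_ext_by_zero[OF V sXw \<phi> K])
  have XXK: "XX j p \<xi> = 0" if "\<And>\<xi>. \<xi> \<notin> K \<Longrightarrow> p \<xi> = 0" "\<xi> \<notin> K" for p \<xi>
    by (rule XX_0_off_closed[OF K(1) that])
  \<comment> \<open>Identifies the weak derivative with that of \<open>w\<close> after cutting off
    near the frontier. The cutoff is removed by dominated convergence afterwards.\<close>
  have gA: "integral\<^sup>L ?M (\<lambda>\<xi>. (g \<xi> $ j * \<phi> \<xi> - A \<xi>) * chi k \<xi>) = 0" for k
  proof -
    define \<theta> where "\<theta> \<xi> = chi k \<xi> * \<phi> \<xi>" for \<xi>
    have \<theta>t: "\<theta> \<in> test_functions \<Omega>" unfolding \<theta>_def[abs_def] by (rule test_mult[OF chi_test \<phi>])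
    have \<theta>s: "smooth_on UNIV \<theta>" by (rule test_smooth[OF \<theta>t])
    have \<theta>K: "\<theta> \<xi> = 0" if "\<xi> \<notin> K" for \<xi> using K(3)[OF that] by (simp add: \<theta>_def)
    define W where "W \<xi> = (if \<xi> \<in> V then w \<xi> * \<theta> \<xi> else 0)" for \<xi>
    have sW: "smooth_on UNIV W" unfolding W_def by (rule smooth_ext_by_zero[OF V w \<theta>s K(1,2) \<theta>K])
    obtain K' where K': "compact K'" "K' \<subseteq> \<Omega>" "\<And>\<xi>. \<xi> \<notin> K' \<Longrightarrow> \<theta> \<xi> = 0" "smooth_on UNIV \<theta>"
      by (rule test_functionsE[OF \<theta>t], rule that)
    have "W \<in> test_functions \<Omega>"
      by (rule test_functionsI[OF sW compact_imp_closed[OF K'(1)] K'(2)]) (simp add: W_def K'(3))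
    from test_integral_XX[OF this]
    have "0 = integral\<^sup>L ?M (XX j W)" by simp
    also have "XX j W = (\<lambda>\<xi>. (if \<xi> \<in> V then w \<xi> * XX j \<theta> \<xi> else 0) + A \<xi> * chi k \<xi>)"
    proof (rule ext)
      fix \<xi>
      have "XX j W \<xi> = (if \<xi> \<in> V then w \<xi> * XX j \<theta> \<xi> else 0) + (if \<xi> \<in> V then XX j w \<xi> * \<theta> \<xi> else 0)"
        unfolding W_def[abs_def] by (rule XX_ext[OF V w \<theta>s K(1,2) \<theta>K])
      then show "XX j W \<xi> = (if \<xi> \<in> V then w \<xi> * XX j \<theta> \<xi> else 0) + A \<xi> * chi k \<xi>"
        by (simp add: A_def \<theta>_def)
    qed
    also have "integral\<^sup>L ?M \<dots> = integral\<^sup>L ?M (\<lambda>\<xi>. if \<xi> \<in> V then w \<xi> * XX j \<theta> \<xi> else 0) + integral\<^sup>L ?M (\<lambda>\<xi>. A \<xi> * chi k \<xi>)"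
      by (rule Bochner_Integration.integral_add
          [OF integrable_sm[OF smooth_ext_by_zero[OF V w smooth_XX[OF open_UNIV \<theta>s] K(1,2) XXK[OF \<theta>K]]]
             integrable_sm[OF smooth_on_mult[OF open_UNIV sA smooth_chi]]])
    also have "integral\<^sup>L ?M (\<lambda>\<xi>. if \<xi> \<in> V then w \<xi> * XX j \<theta> \<xi> else 0) = - integral\<^sup>L ?M (\<lambda>\<xi>. g \<xi> $ j * \<theta> \<xi>)"
      using swap[OF smooth_XX[OF open_UNIV \<theta>s] XXK[OF \<theta>K]] weak[OF \<theta>t] by simp
    finally have "integral\<^sup>L ?M (\<lambda>\<xi>. g \<xi> $ j * \<theta> \<xi>) = integral\<^sup>L ?M (\<lambda>\<xi>. A \<xi> * chi k \<xi>)" by simp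
    moreover have "(\<lambda>\<xi>. (g \<xi> $ j * \<phi> \<xi> - A \<xi>) * chi k \<xi>) = (\<lambda>\<xi>. g \<xi> $ j * \<theta> \<xi> - A \<xi> * chi k \<xi>)"
      by (rule ext) (simp add: \<theta>_def algebra_simps)
    moreover have "integrable ?M (\<lambda>\<xi>. A \<xi> * chi k \<xi>)" by (intro integrable_sm smooth_intros open_UNIV sA smooth_chi)
    ultimately show ?thesis using times[OF gI \<theta>s, of j] by simp
  qed
  have igA: "integrable ?M (\<lambda>\<xi>. g \<xi> $ j * \<phi> \<xi> - A \<xi>)" using times[OF gI \<phi>, of j] integrable_sm[OF sA] by simp
  have "(\<lambda>k. integral\<^sup>L ?M (\<lambda>\<xi>. (g \<xi> $ j * \<phi> \<xi> - A \<xi>) * chi k \<xi>)) \<longlonglongrightarrow> integral\<^sup>L ?M (\<lambda>\<xi>. g \<xi> $ j * \<phi> \<xi> - A \<xi>)"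
  proof (rule integral_dominated_convergence[where w = "\<lambda>\<xi>. \<bar>g \<xi> $ j * \<phi> \<xi> - A \<xi>\<bar>"])
    show "integrable ?M (\<lambda>\<xi>. \<bar>g \<xi> $ j * \<phi> \<xi> - A \<xi>\<bar>)" using igA by simp
    show "(\<lambda>\<xi>. g \<xi> $ j * \<phi> \<xi> - A \<xi>) \<in> borel_measurable ?M" using igA by auto
    show "(\<lambda>\<xi>. (g \<xi> $ j * \<phi> \<xi> - A \<xi>) * chi k \<xi>) \<in> borel_measurable ?M" for k
      using times[OF igA smooth_chi] by auto
    show "AE \<xi> in ?M. (\<lambda>k. (g \<xi> $ j * \<phi> \<xi> - A \<xi>) * chi k \<xi>) \<longlonglongrightarrow> g \<xi> $ j * \<phi> \<xi> - A \<xi>"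
    proof (rule AE_I2)
      fix \<xi> assume "\<xi> \<in> space ?M"
      then have "(\<lambda>k. chi k \<xi>) \<longlonglongrightarrow> 1" using chi_tendsto by simp
      from tendsto_mult[OF tendsto_const this]
      show "(\<lambda>k. (g \<xi> $ j * \<phi> \<xi> - A \<xi>) * chi k \<xi>) \<longlonglongrightarrow> g \<xi> $ j * \<phi> \<xi> - A \<xi>" by simp
    qed
    show "AE \<xi> in ?M. norm ((g \<xi> $ j * \<phi> \<xi> - A \<xi>) * chi k \<xi>) \<le> \<bar>g \<xi> $ j * \<phi> \<xi> - A \<xi>\<bar>" for k
      using chi_bounds by (intro AE_I2) (simp add: abs_mult mult_left_le)
  qed
  then have "integral\<^sup>L ?M (\<lambda>\<xi>. g \<xi> $ j * \<phi> \<xi> - A \<xi>) = 0" by (simp add: gA LIMSEQ_const_iff)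
  then have gA': "integral\<^sup>L ?M (\<lambda>\<xi>. g \<xi> $ j * \<phi> \<xi>) = integral\<^sup>L ?M A"
    using times[OF gI \<phi>, of j] integrable_sm[OF sA] by simp
  have "XX j (\<lambda>\<xi>. if \<xi> \<in> V then w \<xi> * \<phi> \<xi> else 0) = (\<lambda>\<xi>. (if \<xi> \<in> V then w \<xi> * XX j \<phi> \<xi> else 0) + A \<xi>)"
    unfolding A_def by (rule ext, rule XX_ext[OF V w \<phi> K])
  then have "integral\<^sup>L ?M (XX j (\<lambda>\<xi>. if \<xi> \<in> V then w \<xi> * \<phi> \<xi> else 0))
      = integral\<^sup>L ?M (\<lambda>\<xi>. (if \<xi> \<in> V then w \<xi> * XX j \<phi> \<xi> else 0) + A \<xi>)" by simp
  also have "\<dots> = integral\<^sup>L ?M (\<lambda>\<xi>. if \<xi> \<in> V then w \<xi> * XX j \<phi> \<xi> else 0) + integral\<^sup>L ?M A"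
    by (rule Bochner_Integration.integral_add
        [OF integrable_sm[OF smooth_ext_by_zero[OF V w sX\<phi> K(1,2) XXK[OF K(3)]]] integrable_sm[OF sA]])
  also have "integral\<^sup>L ?M (\<lambda>\<xi>. if \<xi> \<in> V then w \<xi> * XX j \<phi> \<xi> else 0) = integral\<^sup>L ?M (\<lambda>\<xi>. u \<xi> * XX j \<phi> \<xi>)"
    using swap[OF sX\<phi> XXK[OF K(3)]] by simp
  finally show ?thesis using ibp gA' by simp
qed

text \<open>Localise \<open>w\<close> by a bump at \<open>p\<close>. By \<open>trace_flux\<close>
  the localised function has no flux against smooth weights, so \<open>boundary_flux_eq_0\<close>
  makes its product with X_j f vanish at \<open>p\<close>.\<close>

lemma trace_noncharacteristic:
  assumes u: "u \<in> H10 \<Omega>" and V: "open V" "frontier \<Omega> \<subseteq> V" and w: "smooth_on V w"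
    and uw: "AE \<xi> in lebesgue_on (V \<inter> \<Omega>). u \<xi> = w \<xi>"
    and p: "p \<in> frontier \<Omega>" and nc: "XX j f p \<noteq> 0"
  shows "w p = 0"
proof -
  obtain \<rho> where \<rho>: "\<rho> > 0" "cball p \<rho> \<subseteq> V" using V p open_contains_cball by blast
  define a where "a \<xi> = (if \<xi> \<in> V then w \<xi> * bump p \<rho> \<xi> else 0)" for \<xi>
  have off: "bump p \<rho> \<xi> = 0" if "\<xi> \<notin> cball p \<rho>" for \<xi>
    using bump_props(3)[OF \<rho>(1), of \<xi> p] that by (simp add: dist_commute)
  have sa: "smooth_on UNIV a"
    unfolding a_def by (rule smooth_ext_by_zero[OF V(1) w smooth_bump closed_cball \<rho>(2) off])
  have "a p * XX j f p = 0"
  proof (rule boundary_flux_eq_0[OF sa _ p])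
    fix q :: "'n heis \<Rightarrow> real" assume q: "smooth_on UNIV q"
    have "(\<lambda>\<xi>. a \<xi> * q \<xi>) = (\<lambda>\<xi>. if \<xi> \<in> V then w \<xi> * (bump p \<rho> \<xi> * q \<xi>) else 0)"
      by (rule ext) (simp add: a_def)
    then show "integral\<^sup>L (lebesgue_on \<Omega>) (XX j (\<lambda>\<xi>. a \<xi> * q \<xi>)) = 0"
      using trace_flux[OF u V(1) w uw smooth_on_mult[OF open_UNIV smooth_bump q] closed_cball \<rho>(2), where j = j] off
      by simp
  qed
  then have "a p = 0" using nc by simp
  then show ?thesis using bump_props(4)[OF \<rho>(1), of p] V(2) p by (auto simp: a_def split: if_splits)
qed



lemma grad_f_nonzero':
  assumes "p \<in> frontier \<Omega>" "\<And>i. pd (axis i 1, 0) f p = 0"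
  shows "pd (0, 1) f p \<noteq> 0"
proof
  assume 0: "pd (0, 1) f p = 0"
  have df: "f differentiable (at p)" using smooth_on_differentiable[OF smooth_f] by simp
  have "pd b f p = 0" for b
  proof -
    have "b = (\<Sum>i\<in>UNIV. (fst b $ i) *\<^sub>R (axis i 1, 0)) + snd b *\<^sub>R (0, 1)"
      by (simp add: prod_eq_iff fst_sum snd_sum vec_eq_iff axis_def if_distrib sum.delta cong: if_cong)
    then have "pd b f p = pd ((\<Sum>i\<in>UNIV. (fst b $ i) *\<^sub>R (axis i 1, 0)) + snd b *\<^sub>R (0, 1)) f p" by simp
    also have "\<dots> = 0" by (simp only: pd_add_dir[OF df] pd_sum_dir[OF df] pd_scaleR_dir[OF df] 0 assms(2)) simp
    finally show ?thesis .
  qed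
  then show False using grad_f_nonzero[OF assms(1)] by blast
qed

section \<open>Characteristic points of a cylindrically symmetric boundary\<close>

context
  assumes cyl: "cylindrically_symmetric \<Omega>"
begin

lemma cyl_iff: "norm x' = norm x \<Longrightarrow> (x', t) \<in> \<Omega> \<longleftrightarrow> (x, t) \<in> \<Omega>"
  using cyl unfolding cylindrically_symmetric_def by metis

text \<open>The defining function need not be invariant, so its sign at the image point is examined.
  A negative value would put (x, t) itself in \<Omega>. A positive value persists nearby, including
  at images of points of \<Omega>, contradicting the invariance of \<Omega>.\<close>

lemma rotation_frontier:
  assumes A: "bounded_linear A" "\<And>x. norm (A x) = norm x" and p: "(x, t) \<in> frontier \<Omega>"
  shows "(A x, t) \<in> frontier \<Omega>"
proof -
  have "f (A x, t) = 0"
  proof (rule ccontr)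
    assume "f (A x, t) \<noteq> 0"
    then consider "f (A x, t) < 0" | "f (A x, t) > 0" by linarith
    then show False
    proof cases
      case 1
      then have "(x, t) \<in> \<Omega>" using cyl_iff[OF A(2)] by (simp add: dom_eq)
      then show False using p by (simp add: frontier_eq) (simp add: dom_eq)
    next
      case 2
      define h where "h \<xi> = f (A (fst \<xi>), snd \<xi>)" for \<xi> :: "'n heis"
      have "continuous_on UNIV h"
        unfolding h_def
        by (intro continuous_on_compose2[OF smooth_on_continuous[OF smooth_f]] continuous_intros
            continuous_on_compose2[OF linear_continuous_on[OF A(1)]]) auto
      then have "open {\<xi>. 0 < h \<xi>}" by (intro open_Collect_less continuous_intros) auto
      moreover have "(x, t) \<in> {\<xi>. 0 < h \<xi>}" using 2 by (simp add: h_def)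
      moreover have "(x, t) \<in> closure \<Omega>" using p by (simp add: frontier_def)
      ultimately obtain \<xi> where \<xi>: "\<xi> \<in> \<Omega>" "0 < h \<xi>"
        using open_Int_closure_eq_empty[of "{\<xi>. 0 < h \<xi>}" \<Omega>] by blast
      then have "(A (fst \<xi>), snd \<xi>) \<in> \<Omega>" using cyl_iff[OF A(2), of "fst \<xi>" "snd \<xi>"] by simp
      then show False using \<xi>(2) by (simp add: dom_eq h_def)
    qed
  qed
  then show ?thesis by (simp add: frontier_eq)
qed

text \<open>On the axis every point of the boundary is characteristic; off the axis none is.\<close>

lemma noncharacteristic_off_axis:
  assumes p: "p \<in> frontier \<Omega>" and x: "fst p \<noteq> 0"
  shows "\<exists>j. XX j f p \<noteq> 0"
proof (rule ccontr)
  assume "\<not> ?thesis"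
  then have 0: "XX j f p = 0" for j by blast
  define x where "x = fst p"
  have df: "f differentiable (at p)" using smooth_on_differentiable[OF smooth_f] by simp
  \<comment> \<open>The circle through \<open>p\<close> in the plane of x and Jx. It stays in the
    frontier, so the derivative of \<open>f\<close> along Jx is zero.\<close>
  define c where "c \<theta> = (cos \<theta> *\<^sub>R x + sin \<theta> *\<^sub>R hJ x, snd p)" for \<theta> :: real
  have c0: "c 0 = p" by (simp add: c_def x_def)
  have fc: "f (c \<theta>) = 0" for \<theta>
  proof -
    have bl: "bounded_linear (\<lambda>y::'n hvec. cos \<theta> *\<^sub>R y + sin \<theta> *\<^sub>R hJ y)"
      using linear_hJ by (intro bounded_linear_add bounded_linear_const_scaleR bounded_linear_ident) (simp add: linear_conv_bounded_linear)
    have nm: "norm (cos \<theta> *\<^sub>R y + sin \<theta> *\<^sub>R hJ y) = norm y" for y :: "'n hvec"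
    proof -
      have "(cos \<theta> *\<^sub>R y + sin \<theta> *\<^sub>R hJ y) \<bullet> (cos \<theta> *\<^sub>R y + sin \<theta> *\<^sub>R hJ y) = ((cos \<theta>)\<^sup>2 + (sin \<theta>)\<^sup>2) * (y \<bullet> y)"
        by (simp only: inner_add_left inner_add_right inner_scaleR_left inner_scaleR_right hJ_inner_self hJ_inner_hJ) algebra
      then show ?thesis by (simp only: norm_eq_sqrt_inner sin_cos_squared_add2 mult_1)
    qed
    have "(x, snd p) \<in> frontier \<Omega>" using p by (simp add: x_def)
    from rotation_frontier[OF bl nm this] show ?thesis by (simp add: frontier_eq c_def)
  qed
  have "(c has_derivative (\<lambda>h. h *\<^sub>R (hJ x, 0))) (at 0)"
    unfolding c_def[abs_def] by (auto intro!: derivative_eq_intros simp: fun_eq_iff)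
  from has_derivative_compose[OF this smooth_on_has_derivative[OF smooth_f open_UNIV UNIV_I]]
  have "((\<lambda>\<theta>. f (c \<theta>)) has_derivative (\<lambda>h. pd (h *\<^sub>R (hJ x, 0)) f (c 0))) (at 0)" .
  moreover have "((\<lambda>\<theta>. f (c \<theta>)) has_derivative (\<lambda>h. 0)) (at 0)" by (simp add: fc)
  ultimately have "(\<lambda>h. pd (h *\<^sub>R (hJ x, 0)) f (c 0)) = (\<lambda>h. 0)" by (rule has_derivative_unique)
  then have "pd (1 *\<^sub>R (hJ x, 0)) f p = 0" unfolding c0 by (rule fun_cong)
  then have Jx: "pd (hJ x, 0) f p = 0" by simp
  have "(hJ x, 0) = (\<Sum>j\<in>UNIV. (hJ x $ j) *\<^sub>R ((axis j 1, 0) :: 'n heis))"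
    by (simp add: prod_eq_iff fst_sum snd_sum vec_eq_iff axis_def if_distrib sum.delta cong: if_cong)
  then have "pd (hJ x, 0) f p = (\<Sum>j\<in>UNIV. (hJ x $ j) * pd (axis j 1, 0) f p)"
    using pd_sum_dir[OF df, where c = "\<lambda>j. hJ x $ j" and a = "\<lambda>j. (axis j 1, 0)" and I = UNIV] by simp
  moreover have "pd (axis j 1, 0) f p = - (2 * (hJ x $ j) * pd (0, 1) f p)" for j
    using 0[of j] by (simp add: XX_def x_def)
  \<comment> \<open>If all X_j f vanish, each horizontal partial derivative is -2 (Jx)_j times the
    vertical one; inserted in the derivative along Jx this leaves |x|^2 times the vertical
    derivative.\<close>
  ultimately have "0 = - (2 * (\<Sum>j\<in>UNIV. (hJ x $ j)\<^sup>2)) * pd (0, 1) f p"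
    using Jx by (simp add: sum_distrib_left sum_distrib_right sum_negf power2_eq_square mult_ac)
  moreover have "(\<Sum>j\<in>UNIV. (hJ x $ j)\<^sup>2) = (norm x)\<^sup>2" by (simp add: norm_sq_sum[symmetric])
  ultimately have t0: "pd (0, 1) f p = 0" using x by (simp add: x_def)
  have "pd (axis j 1, 0) f p = 0" for j using 0[of j] t0 by (simp add: XX_def)
  then show False using grad_f_nonzero'[OF p] t0 by blast
qed

text \<open>With a nonzero derivative \<open>f\<close> would have opposite signs at (h y, T) and (-h
  y, T) for small h, although \<Omega> contains both points or neither.\<close>

lemma axis_frontier_derivatives:
  assumes p: "(0, T) \<in> frontier \<Omega>"
  shows "pd (y, 0) f (0, T) = 0"
proof -
  have le: "pd (y, 0) f (0, T) \<le> 0" for y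
  proof (rule ccontr)
    assume "\<not> ?thesis"
    then have pos: "pd (y, 0) f (0, T) > 0" by simp
    have D: "((\<lambda>s. f ((0, T) + s *\<^sub>R (y, 0))) has_field_derivative pd (y, 0) f (0, T)) (at 0)"
      using smooth_on_line[OF smooth_f open_UNIV, of "(0, T)" 0 "(y, 0)"] by simp
    have f0: "f (0, T) = 0" using p by (simp add: frontier_eq)
    obtain d1 where d1: "d1 > 0" "\<And>h. h > 0 \<Longrightarrow> h < d1 \<Longrightarrow> f (0, T) < f (h *\<^sub>R y, T)"
      using DERIV_pos_inc_right[OF D pos] by auto
    obtain d2 where d2: "d2 > 0" "\<And>h. h > 0 \<Longrightarrow> h < d2 \<Longrightarrow> f (- (h *\<^sub>R y), T) < f (0, T)"
      using DERIV_pos_inc_left[OF D pos] by auto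
    define h where "h = min d1 d2 / 2"
    have h: "h > 0" "h < d1" "h < d2" using d1 d2 by (auto simp: h_def)
    have "(- (h *\<^sub>R y), T) \<in> \<Omega>" using d2(2)[OF h(1,3)] f0 by (simp add: dom_eq)
    then have "(h *\<^sub>R y, T) \<in> \<Omega>" using cyl_iff[of "h *\<^sub>R y" "- (h *\<^sub>R y)" T] by simp
    then show False using d1(2)[OF h(1,2)] f0 by (simp add: dom_eq)
  qed
  have "pd ((-1) *\<^sub>R (y, 0)) f (0, T) = - pd (y, 0) f (0, T)"
    using pd_scaleR_dir[OF smooth_on_differentiable[OF smooth_f open_UNIV UNIV_I], of "-1" "(y, 0)"] by simp
  then show ?thesis using le[of y] le[of "- y"] by simp
qed

text \<open>Off the axis \<open>trace_noncharacteristic\<close> applies. At an axis point the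
  vertical derivative of \<open>f\<close> is nonzero, so the frontier crosses vertical segments
  slightly off the axis; the zeros of \<open>w\<close> found there accumulate at the axis
  point.\<close>

lemma trace_zero:
  assumes u: "u \<in> H10 \<Omega>" and V: "open V" "frontier \<Omega> \<subseteq> V" and w: "smooth_on V w"
    and uw: "AE \<xi> in lebesgue_on (V \<inter> \<Omega>). u \<xi> = w \<xi>" and p: "p \<in> frontier \<Omega>"
  shows "w p = 0"
proof (cases "fst p = 0")
  case False
  then show ?thesis using noncharacteristic_off_axis[OF p] trace_noncharacteristic[OF u V w uw p] by blast
next
  case True
  define T where "T = snd p"
  have pT: "p = (0, T)" using True by (simp add: T_def prod_eq_iff)
  have pV: "p \<in> V" using p V by blast
  show ?thesis
  proof (rule ccontr)
    assume wp: "w p \<noteq> 0"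
    have cw: "continuous_on V w" by (rule smooth_on_continuous[OF w])
    have "open {\<xi> \<in> V. w \<xi> \<noteq> 0}"
      using continuous_open_preimage[OF cw V(1), of "- {0}"] by (auto simp: vimage_def Int_def)
    then obtain r where r: "r > 0" "ball p r \<subseteq> {\<xi> \<in> V. w \<xi> \<noteq> 0}"
      using wp pV openE[of "{\<xi> \<in> V. w \<xi> \<noteq> 0}" p] by blast
    have D0: "pd (0, 1) f (0, T) \<noteq> 0"
      using grad_f_nonzero'[OF p] axis_frontier_derivatives[of T] p pT by simp
    have f0: "f (0, T) = 0" using p pT by (simp add: frontier_eq)
    have D: "((\<lambda>s. f ((0, T) + s *\<^sub>R (0, 1))) has_field_derivative pd (0, 1) f (0, T)) (at 0)"
      using smooth_on_line[OF smooth_f open_UNIV, of "(0, T)" 0 "(0, 1)"] by simp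
    have "\<exists>h>0. h < r / 2 \<and> f (0, T + h) * f (0, T - h) < 0"
    proof (cases "pd (0, 1) f (0, T) > 0")
      case pos: True
      obtain d1 where d1: "d1 > 0" "\<And>h. h > 0 \<Longrightarrow> h < d1 \<Longrightarrow> 0 < f (0, T + h)"
        using DERIV_pos_inc_right[OF D pos] f0 by auto
      obtain d2 where d2: "d2 > 0" "\<And>h. h > 0 \<Longrightarrow> h < d2 \<Longrightarrow> f (0, T - h) < 0"
        using DERIV_pos_inc_left[OF D pos] f0 by auto
      define h where "h = min (min d1 d2) r / 3"
      have "h > 0" "h < d1" "h < d2" "h < r / 2" using d1(1) d2(1) r(1) by (auto simp: h_def min_def)
      then show ?thesis using d1(2)[of h] d2(2)[of h] by (intro exI[of _ h]) (auto simp: mult_less_0_iff)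
    next
      case False
      then have neg: "pd (0, 1) f (0, T) < 0" using D0 by simp
      obtain d1 where d1: "d1 > 0" "\<And>h. h > 0 \<Longrightarrow> h < d1 \<Longrightarrow> f (0, T + h) < 0"
        using DERIV_neg_dec_right[OF D neg] f0 by auto
      obtain d2 where d2: "d2 > 0" "\<And>h. h > 0 \<Longrightarrow> h < d2 \<Longrightarrow> 0 < f (0, T - h)"
        using DERIV_neg_dec_left[OF D neg] f0 by auto
      define h where "h = min (min d1 d2) r / 3"
      have "h > 0" "h < d1" "h < d2" "h < r / 2" using d1(1) d2(1) r(1) by (auto simp: h_def min_def)
      then show ?thesis using d1(2)[of h] d2(2)[of h] by (intro exI[of _ h]) (auto simp: mult_less_0_iff)
    qed
    then obtain h where h: "h > 0" "h < r / 2" "f (0, T + h) * f (0, T - h) < 0" by blast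
    define e :: "'n hvec" where "e = axis (Inl undefined) 1"
    have e: "norm e = 1" by (simp add: e_def)
    \<comment> \<open>Opposite signs of \<open>f\<close> above and below the axis point persist at
      small distance s from the axis, and the intermediate value theorem on the vertical segment
      gives a frontier point off the axis.\<close>
    define G where "G s = f (s *\<^sub>R e, T + h) * f (s *\<^sub>R e, T - h)" for s :: real
    have "isCont G 0"
    proof -
      have "continuous_on UNIV G"
        unfolding G_def by (intro continuous_intros continuous_on_compose2[OF smooth_on_continuous[OF smooth_f]]) auto
      then show ?thesis using continuous_on_eq_continuous_at[OF open_UNIV] by blast
    qed
    moreover have "G 0 < 0" using h(3) by (simp add: G_def)
    ultimately have "eventually (\<lambda>s. G s < 0) (at_right 0)"
      using order_tendstoD(2)[of G "G 0" "at 0" 0] eventually_at_split by (metis isCont_def)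
    moreover have "eventually (\<lambda>s. 0 < s \<and> s < r / 2) (at_right (0::real))"
      using r(1) by (intro eventually_conj eventually_at_right_less eventually_at_rightI[of 0 "r/2"]) auto
    ultimately have "eventually (\<lambda>s. G s < 0 \<and> 0 < s \<and> s < r / 2) (at_right 0)" by eventually_elim auto
    then obtain s where s: "G s < 0" "0 < s" "s < r / 2"
      using eventually_happens[of _ "at_right (0::real)"] by force
    define g where "g t = f (s *\<^sub>R e, t)" for t
    have cg: "continuous_on {T - h..T + h} g"
      unfolding g_def by (intro continuous_on_compose2[OF smooth_on_continuous[OF smooth_f]] continuous_intros) auto
    have "\<exists>t\<ge>T - h. t \<le> T + h \<and> g t = 0"
    proof (cases "g (T - h) < 0")
      case True
      then show ?thesis using s(1) h(1) by (intro IVT'[OF _ _ _ cg]) (auto simp: G_def g_def mult_less_0_iff)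
    next
      case False
      then show ?thesis using s(1) h(1) by (intro IVT2'[OF _ _ _ cg]) (auto simp: G_def g_def mult_less_0_iff)
    qed
    then obtain t where t: "T - h \<le> t" "t \<le> T + h" "g t = 0" by blast
    define q where "q = (s *\<^sub>R e, t)"
    have qf: "q \<in> frontier \<Omega>" using t(3) by (simp add: frontier_eq q_def g_def)
    have "fst q \<noteq> 0" using s(2) e by (auto simp: q_def)
    then have "w q = 0" using noncharacteristic_off_axis[OF qf] trace_noncharacteristic[OF u V w uw qf] by blast
    moreover have "dist p q < r"
    proof -
      have "dist p q \<le> norm (s *\<^sub>R e) + \<bar>T - t\<bar>"
        unfolding pT q_def dist_Pair_Pair using sqrt_sum_squares_le_sum_abs[of "dist 0 (s *\<^sub>R e)" "dist T t"]
        by (simp add: dist_norm)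
      then show ?thesis using t(1,2) h s e by simp
    qed
    then have "q \<in> ball p r" by simp
    ultimately show False using r(2) by blast
  qed
qed

end

end

section \<open>Interior regularity and rotational symmetry of the solution\<close>

lemma less_double_add_1: "0 \<le> y \<Longrightarrow> y < 2 * (y + 1)" for y :: real
  by (simp add: distrib_left)

lemma lapH_cmult:
  assumes "smooth_on UNIV f"
  shows "lapH (\<lambda>y. c * f y) \<xi> = c * lapH f \<xi>"
proof -
  have "XX j (XX j (\<lambda>y. c * f y)) \<xi> = c * XX j (XX j f) \<xi>" for j
  proof -
    have "XX j (\<lambda>y. c * f y) = (\<lambda>y. c * XX j f y)"
      by (rule ext) (rule XX_cmult[OF smooth_on_differentiable[OF assms open_UNIV UNIV_I]])
    then show ?thesis
      using XX_cmult[OF smooth_on_differentiable[OF smooth_XX[OF open_UNIV assms] open_UNIV UNIV_I]] by simp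
  qed
  then show ?thesis by (simp add: lapH_def sum_distrib_left)
qed

lemma second_derivative_local_max:
  fixes g :: "real \<Rightarrow> real"
  assumes \<delta>: "\<delta> > 0" and D1: "\<And>\<tau>. \<bar>\<tau>\<bar> < \<delta> \<Longrightarrow> (g has_field_derivative g' \<tau>) (at \<tau>)"
    and D2: "(g' has_field_derivative D) (at 0)" and max: "\<And>\<tau>. \<bar>\<tau>\<bar> < \<delta> \<Longrightarrow> g \<tau> \<le> g 0"
  shows "g' 0 = 0" "D \<le> 0"
proof -
  show g0: "g' 0 = 0"
    by (rule DERIV_local_max[OF D1[of 0] \<delta>]) (use \<delta> max in auto)
  show "D \<le> 0"
  proof (rule ccontr)
    assume "\<not> D \<le> 0"
    then obtain d where d: "d > 0" "\<And>h. h > 0 \<Longrightarrow> h < d \<Longrightarrow> g' 0 < g' h"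
      using DERIV_pos_inc_right[OF D2] by auto
    define h where "h = min d \<delta> / 2"
    have h: "0 < h" "h < d" "h < \<delta>" using d \<delta> by (auto simp: h_def)
    obtain \<tau> where \<tau>: "0 < \<tau>" "\<tau> < h" "g h - g 0 = (h - 0) * g' \<tau>"
      using MVT2[OF h(1), of g g'] D1 h by auto
    have "g' \<tau> > 0" using d(2)[of \<tau>] \<tau> h g0 by auto
    then have "g h > g 0" using \<tau>(3) h(1) by (simp add: zero_less_mult_iff algebra_simps)
    then show False using max[of h] h by auto
  qed
qed

text \<open>The trace of a bilinear form is the same in every orthonormal basis; the rows of the
  matrix of \<open>A\<close> are orthonormal.\<close>

lemma trace_orthogonal:
  fixes C :: "real ^ 'm::finite \<Rightarrow> real ^ 'm \<Rightarrow> real"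
    and A :: "real ^ 'm \<Rightarrow> real ^ 'm"
  assumes l: "\<And>b. linear (\<lambda>a. C a b)" and r: "\<And>a. linear (C a)" and A: "orthogonal_transformation A"
  shows "(\<Sum>j\<in>UNIV. C (A (axis j 1)) (A (axis j 1))) = (\<Sum>j\<in>UNIV. C (axis j 1) (axis j 1))"
proof -
  define M where "M = matrix A"
  have "orthogonal_matrix M" using A orthogonal_transformation_matrix by (auto simp: M_def)
  then have "M ** transpose M = mat 1" by (simp add: orthogonal_matrix_def)
  then have MM: "(\<Sum>j\<in>UNIV. M $ k $ j * M $ l $ j) = (if k = l then 1 else 0)" for k l
    by (simp add: vec_eq_iff matrix_matrix_mult_def transpose_def mat_def)
  have Aj: "A (axis j 1) = (\<Sum>k\<in>UNIV. (M $ k $ j) *\<^sub>R axis k 1)" for j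
    by (simp add: M_def matrix_def vec_eq_iff axis_def if_distrib sum.delta cong: if_cong)
  have "C (A (axis j 1)) (A (axis j 1)) = (\<Sum>k\<in>UNIV. \<Sum>i\<in>UNIV. M $ k $ j * M $ i $ j * C (axis k 1) (axis i 1))" for j
  proof -
    have "C (A (axis j 1)) (A (axis j 1)) = (\<Sum>k\<in>UNIV. M $ k $ j * C (axis k 1) (A (axis j 1)))"
      by (subst (1) Aj) (simp add: linear_sum[OF l] linear_cmul[OF l])
    also have "\<dots> = (\<Sum>k\<in>UNIV. M $ k $ j * (\<Sum>i\<in>UNIV. M $ i $ j * C (axis k 1) (axis i 1)))"
      by (subst Aj) (simp add: linear_sum[OF r] linear_cmul[OF r])
    finally show ?thesis by (simp add: sum_distrib_left mult.assoc)
  qed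
  then have "(\<Sum>j\<in>UNIV. C (A (axis j 1)) (A (axis j 1)))
      = (\<Sum>j\<in>UNIV. \<Sum>k\<in>UNIV. \<Sum>i\<in>UNIV. M $ k $ j * M $ i $ j * C (axis k 1) (axis i 1))" by simp
  also have "\<dots> = (\<Sum>k\<in>UNIV. \<Sum>j\<in>UNIV. \<Sum>i\<in>UNIV. M $ k $ j * M $ i $ j * C (axis k 1) (axis i 1))"
    by (rule sum.swap)
  also have "\<dots> = (\<Sum>k\<in>UNIV. \<Sum>i\<in>UNIV. \<Sum>j\<in>UNIV. M $ k $ j * M $ i $ j * C (axis k 1) (axis i 1))"
    by (intro sum.cong refl sum.swap)
  also have "\<dots> = (\<Sum>k\<in>UNIV. \<Sum>i\<in>UNIV. (if k = i then 1 else 0) * C (axis k 1) (axis i 1))"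
    by (simp add: sum_distrib_right[symmetric] MM)
  also have "\<dots> = (\<Sum>j\<in>UNIV. C (axis j 1) (axis j 1))"
    by (simp add: if_distrib[of "\<lambda>x. x * _"] sum.delta cong: if_cong)
  finally show ?thesis .
qed

text \<open>By \<open>pd_pd_frozen\<close> the sub-Laplacian at \<open>q\<close> is the trace of the
  second derivative restricted to the horizontal plane at \<open>q\<close>, so any orthonormal frame
  of that plane may be used.\<close>

lemma lapH_frame:
  fixes v :: "'n::finite heis \<Rightarrow> real" and A :: "'n hvec \<Rightarrow> 'n hvec"
  assumes S: "open S" "smooth_on S v" "q \<in> S" and A: "orthogonal_transformation A"
  defines "T \<equiv> \<lambda>e. (e, 2 * (hJ (fst q) \<bullet> e))"
  shows "lapH v q = (\<Sum>j\<in>UNIV. pd (T (A (axis j 1))) (pd (T (A (axis j 1))) v) q)"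
proof -
  have dv: "v differentiable (at y)" if "y \<in> S" for y using smooth_on_differentiable[OF S(2,1) that] .
  have dpd: "pd b v differentiable (at q)" for b by (rule smooth_on_differentiable[OF smooth_on_pd[OF S(1,2)] S(1,3)])
  have T: "T (a + b) = T a + T b" "T (r *\<^sub>R a) = r *\<^sub>R T a" for a b r
    by (simp_all add: T_def inner_add_right algebra_simps)
  have "(\<Sum>j\<in>UNIV. pd (T (A (axis j 1))) (pd (T (A (axis j 1))) v) q) = (\<Sum>j\<in>UNIV. pd (T (axis j 1)) (pd (T (axis j 1)) v) q)"
  proof (rule trace_orthogonal[OF _ _ A, of "\<lambda>a b. pd (T a) (pd (T b) v) q"])
    show "linear (\<lambda>a. pd (T a) (pd (T b) v) q)" for b
      by (rule linearI) (simp_all add: T pd_add_dir[OF dpd] pd_scaleR_dir[OF dpd])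
    show "linear (\<lambda>b. pd (T a) (pd (T b) v) q)" for a
    proof (rule linearI)
      show "pd (T a) (pd (T (b + c)) v) q = pd (T a) (pd (T b) v) q + pd (T a) (pd (T c) v) q" for b c
      proof -
        have "pd (T a) (pd (T (b + c)) v) q = pd (T a) (\<lambda>y. pd (T b) v y + pd (T c) v y) q"
          by (rule pd_cong[OF S(1,3)]) (simp add: T pd_add_dir[OF dv])
        then show ?thesis by (simp add: pd_add[OF dpd dpd])
      qed
      show "pd (T a) (pd (T (r *\<^sub>R b)) v) q = r *\<^sub>R pd (T a) (pd (T b) v) q" for r b
      proof -
        have "pd (T a) (pd (T (r *\<^sub>R b)) v) q = pd (T a) (\<lambda>y. r * pd (T b) v y) q"
          by (rule pd_cong[OF S(1,3)]) (simp add: T pd_scaleR_dir[OF dv])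
        also have "\<dots> = r * pd (T a) (pd (T b) v) q"
          using pd_mult[of "\<lambda>_. r" q "pd (T b) v" "T a"] dpd by (simp add: pd_def)
        finally show ?thesis by simp
      qed
    qed
  qed
  moreover have "T (axis j 1) = hX j (fst q)" for j by (simp add: T_def hX_def inner_axis)
  ultimately show ?thesis by (simp add: lapH_def pd_pd_frozen[OF S])
qed

context smooth_domain
begin

text \<open>Both horizontal derivatives are moved to the test function, using that X_j \<psi> is
  again a test function. The constant is Q + 2 = 2n + 4.\<close>

lemma weak_solution_lapH:
  assumes u: "weak_solution \<Omega> u"
  shows "integrable (lebesgue_on \<Omega>) u"
    and "\<psi> \<in> test_functions \<Omega> \<Longrightarrow> integral\<^sup>L (lebesgue_on \<Omega>) (\<lambda>\<xi>. u \<xi> * lapH \<psi> \<xi>)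
       = (2 * real CARD('n) + 4) * integral\<^sup>L (lebesgue_on \<Omega>) (\<lambda>\<xi>. F4 \<xi> * \<psi> \<xi>)"
proof -
  let ?M = "lebesgue_on \<Omega>"
  obtain g where g: "has_weak_hgrad \<Omega> u g" and
    eq: "\<And>\<psi>. \<psi> \<in> test_functions \<Omega> \<Longrightarrow> integral\<^sup>L ?M (\<lambda>\<xi>. g \<xi> \<bullet> hgrad \<psi> \<xi>)
           + (hom_dim TYPE('n) + 2) * integral\<^sup>L ?M (\<lambda>\<xi>. F4 \<xi> * \<psi> \<xi>) = 0"
    using u unfolding weak_solution_def by blast
  have weak: "integral\<^sup>L ?M (\<lambda>\<xi>. u \<xi> * XX j \<theta> \<xi>) = - integral\<^sup>L ?M (\<lambda>\<xi>. g \<xi> $ j * \<theta> \<xi>)" if "\<theta> \<in> test_functions \<Omega>" for \<theta> j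
    using g that by (auto simp: has_weak_hgrad_def hgrad_nth)
  have L2: "L2_on \<Omega> u" "L2_on \<Omega> g" using g by (auto simp: has_weak_hgrad_def)
  show uI: "integrable ?M u"
  proof (rule square_integrable_imp_integrable)
    show "u \<in> borel_measurable ?M" "integrable ?M (\<lambda>\<xi>. (u \<xi>)\<^sup>2)" using L2(1) by (simp_all add: L2_on_def)
  qed
  have gI: "integrable ?M (\<lambda>\<xi>. g \<xi> $ i)" for i
    by (rule square_integrable_imp_integrable[OF L2_on_component[OF L2(2)]])
  have times: "integrable ?M (\<lambda>\<xi>. h \<xi> * s \<xi>)" if "integrable ?M h" "smooth_on UNIV s" for h s
    by (rule integrable_mult_continuous[OF open_dom bounded_dom that(1) continuous_on_subset[OF smooth_on_continuous[OF that(2)] subset_UNIV]])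
  show "integral\<^sup>L ?M (\<lambda>\<xi>. u \<xi> * lapH \<psi> \<xi>) = (2 * real CARD('n) + 4) * integral\<^sup>L ?M (\<lambda>\<xi>. F4 \<xi> * \<psi> \<xi>)"
    if \<psi>: "\<psi> \<in> test_functions \<Omega>"
  proof -
    have s: "smooth_on UNIV (XX j \<psi>)" "smooth_on UNIV (XX j (XX j \<psi>))" for j
      using test_smooth[OF test_XX[OF \<psi>]] test_smooth[OF test_XX[OF test_XX[OF \<psi>]]] by blast+
    have "integral\<^sup>L ?M (\<lambda>\<xi>. u \<xi> * lapH \<psi> \<xi>) = integral\<^sup>L ?M (\<lambda>\<xi>. \<Sum>j\<in>UNIV. u \<xi> * XX j (XX j \<psi>) \<xi>)"
      by (simp add: lapH_def sum_distrib_left)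
    also have "\<dots> = (\<Sum>j\<in>UNIV. integral\<^sup>L ?M (\<lambda>\<xi>. u \<xi> * XX j (XX j \<psi>) \<xi>))"
      by (rule Bochner_Integration.integral_sum) (rule times[OF uI s(2)])
    also have "\<dots> = - (\<Sum>j\<in>UNIV. integral\<^sup>L ?M (\<lambda>\<xi>. g \<xi> $ j * XX j \<psi> \<xi>))"
      by (simp add: weak[OF test_XX[OF \<psi>]] sum_negf)
    also have "(\<Sum>j\<in>UNIV. integral\<^sup>L ?M (\<lambda>\<xi>. g \<xi> $ j * XX j \<psi> \<xi>)) = integral\<^sup>L ?M (\<lambda>\<xi>. g \<xi> \<bullet> hgrad \<psi> \<xi>)"
      by (subst Bochner_Integration.integral_sum[symmetric]) (auto simp: inner_vec_def hgrad_nth times[OF gI s(1)])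
    finally show ?thesis using eq[OF \<psi>] by (simp add: hom_dim_def algebra_simps)
  qed
qed

text \<open>Subtracting the explicit solution leaves a weakly harmonic function, to which
  \<open>Weyl\<close> applies. Inside \<Omega> the smooth representative and \<open>w\<close> agree
  on V by continuity, so the two glue to one function near the closure.\<close>

lemma solution_extension:
  assumes u: "weak_solution \<Omega> u" and V: "open V" "frontier \<Omega> \<subseteq> V" and w: "smooth_on V w"
    and uw: "AE \<xi> in lebesgue_on (V \<inter> \<Omega>). u \<xi> = w \<xi>"
  obtains v U where "open U" "closure \<Omega> \<subseteq> U" "smooth_on U v" "V \<subseteq> U"
    "\<And>\<xi>. \<xi> \<in> \<Omega> \<Longrightarrow> lapH v \<xi> = (2 * real CARD('n) + 4) * (norm (fst \<xi>))\<^sup>2"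
    "AE \<xi> in lebesgue_on \<Omega>. u \<xi> = v \<xi>" "\<And>\<xi>. \<xi> \<in> V \<Longrightarrow> v \<xi> = w \<xi>"
proof -
  let ?M = "lebesgue_on \<Omega>"
  \<comment> \<open>A quarter of the fourth power of the gauge, an explicit solution by
    \<open>lapH_qH\<close>.\<close>
  define b where "b \<xi> = (1/4) * qH (0 :: 'n heis) \<xi>" for \<xi>
  have sb: "smooth_on UNIV b" unfolding b_def by (intro smooth_intros smooth_qH open_UNIV)
  have sb\<Omega>: "smooth_on \<Omega> b" by (rule smooth_on_subset[OF open_dom open_UNIV subset_UNIV sb])
  have lb: "lapH b \<xi> = (2 * real CARD('n) + 4) * (norm (fst \<xi>))\<^sup>2" for \<xi>
  proof -
    have "lapH b \<xi> = (1/4) * lapH (qH 0) \<xi>" unfolding b_def by (rule lapH_cmult[OF smooth_qH])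
    then show ?thesis unfolding lapH_qH hd2_def dot_square_norm by (simp only:) simp
  qed
  note uI = weak_solution_lapH(1)[OF u]
  have wh: "weakly_harmonic (\<lambda>\<xi>. u \<xi> - b \<xi>)"
    unfolding weakly_harmonic_def
  proof (intro conjI ballI)
    show "integrable ?M (\<lambda>\<xi>. u \<xi> - b \<xi>)" using uI integrable_sm[OF sb] by simp
    fix \<psi> assume \<psi>: "\<psi> \<in> test_functions \<Omega>"
    have slp: "smooth_on UNIV (lapH \<psi>)" by (rule smooth_lapH[OF open_UNIV test_smooth[OF \<psi>]])
    have i1: "integrable ?M (\<lambda>\<xi>. u \<xi> * lapH \<psi> \<xi>)"
      by (rule integrable_mult_continuous[OF open_dom bounded_dom uI continuous_on_subset[OF smooth_on_continuous[OF slp] subset_UNIV]])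
    have "integral\<^sup>L ?M (\<lambda>\<xi>. (u \<xi> - b \<xi>) * lapH \<psi> \<xi>)
        = integral\<^sup>L ?M (\<lambda>\<xi>. u \<xi> * lapH \<psi> \<xi>) - integral\<^sup>L ?M (\<lambda>\<xi>. b \<xi> * lapH \<psi> \<xi>)"
      using i1 Green_test(2)[OF sb\<Omega> \<psi>] by (simp add: left_diff_distrib)
    also have "integral\<^sup>L ?M (\<lambda>\<xi>. b \<xi> * lapH \<psi> \<xi>) = integral\<^sup>L ?M (\<lambda>\<xi>. (2 * real CARD('n) + 4) * (F4 \<xi> * \<psi> \<xi>))"
      unfolding Green_test(1)[OF sb\<Omega> \<psi>] by (simp add: lb F4_def mult.assoc)
    finally show "integral\<^sup>L ?M (\<lambda>\<xi>. (u \<xi> - b \<xi>) * lapH \<psi> \<xi>) = 0"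
      using weak_solution_lapH(2)[OF u \<psi>] by simp
  qed
  obtain h where h: "smooth_on \<Omega> h" "AE \<xi> in ?M. u \<xi> - b \<xi> = h \<xi>" "\<And>\<xi>. \<xi> \<in> \<Omega> \<Longrightarrow> lapH h \<xi> = 0"
    by (rule Weyl[OF wh], rule that)
  \<comment> \<open>The sum h + b written as a difference, to fit \<open>lapH_diff\<close>.\<close>
  define v0 where "v0 \<xi> = h \<xi> - (- 1) * b \<xi>" for \<xi>
  have smb: "smooth_on UNIV (\<lambda>\<xi>. (- 1) * b \<xi>)" by (intro smooth_intros sb open_UNIV)
  have sv0: "smooth_on \<Omega> v0"
    unfolding v0_def by (intro smooth_on_diff open_dom h smooth_on_subset[OF open_dom open_UNIV subset_UNIV smb])
  have lv0: "lapH v0 \<xi> = (2 * real CARD('n) + 4) * (norm (fst \<xi>))\<^sup>2" if "\<xi> \<in> \<Omega>" for \<xi>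
  proof -
    have "lapH v0 \<xi> = lapH h \<xi> - lapH (\<lambda>\<xi>. (- 1) * b \<xi>) \<xi>"
      unfolding v0_def by (rule lapH_diff[OF open_dom h(1) smooth_on_subset[OF open_dom open_UNIV subset_UNIV smb] that])
    also have "lapH (\<lambda>\<xi>. (- 1) * b \<xi>) \<xi> = (- 1) * lapH b \<xi>" by (rule lapH_cmult[OF sb])
    finally show ?thesis by (simp add: h(3)[OF that] lb)
  qed
  have uv0: "AE \<xi> in ?M. u \<xi> = v0 \<xi>" using h(2) by (auto simp: v0_def elim!: eventually_mono)
  have oVO: "open (V \<inter> \<Omega>)" using V open_dom by blast
  have vw: "v0 \<xi> = w \<xi>" if "\<xi> \<in> V \<inter> \<Omega>" for \<xi>
  proof -
    have "AE \<xi> in lebesgue_on (V \<inter> \<Omega>). u \<xi> = v0 \<xi>"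
      using uv0 open_dom oVO by (subst (asm) AE_restrict_space_iff, force) (subst AE_restrict_space_iff, force, auto elim!: eventually_mono)
    then have "AE \<xi> in lebesgue_on (V \<inter> \<Omega>). v0 \<xi> - w \<xi> = 0" using uw by eventually_elim simp
    moreover have "continuous_on (V \<inter> \<Omega>) (\<lambda>\<xi>. v0 \<xi> - w \<xi>)"
      using continuous_on_subset[OF smooth_on_continuous[OF sv0], of "V \<inter> \<Omega>"]
        continuous_on_subset[OF smooth_on_continuous[OF w], of "V \<inter> \<Omega>"] by (intro continuous_intros) auto
    ultimately show ?thesis using AE_continuous_eq_0[OF oVO _ _ that, of "\<lambda>\<xi>. v0 \<xi> - w \<xi>"] by simp
  qed
  define v where "v \<xi> = (if \<xi> \<in> \<Omega> then v0 \<xi> else w \<xi>)" for \<xi>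
  have vV: "v \<xi> = w \<xi>" if "\<xi> \<in> V" for \<xi> using vw[of \<xi>] that by (auto simp: v_def)
  have "smooth_on \<Omega> v" by (rule smooth_on_cong[OF open_dom _ sv0]) (simp add: v_def)
  moreover have "smooth_on V v" by (rule smooth_on_cong[OF V(1) _ w]) (simp add: vV)
  ultimately have "smooth_on (\<Omega> \<union> V) v" using smooth_on_Un[OF open_dom V(1)] by blast
  moreover have "closure \<Omega> \<subseteq> \<Omega> \<union> V" using V(2) closure_Un_frontier[of \<Omega>] by blast
  moreover have "lapH v \<xi> = (2 * real CARD('n) + 4) * (norm (fst \<xi>))\<^sup>2" if "\<xi> \<in> \<Omega>" for \<xi>
    using lapH_cong[OF open_dom that, of v v0] lv0[OF that] by (simp add: v_def)
  moreover have "AE \<xi> in ?M. u \<xi> = v \<xi>"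
    by (rule AE_mp[OF uv0], intro AE_I2) (auto simp: v_def)
  ultimately show ?thesis using that[of "\<Omega> \<union> V" v] vV open_dom V(1) by (simp add: open_Un)
qed

context
  fixes v :: "'n heis \<Rightarrow> real" and U
  assumes cyl: "cylindrically_symmetric \<Omega>"
    and U: "open U" "closure \<Omega> \<subseteq> U" and sv: "smooth_on U v"
    and lap: "\<And>\<xi>. \<xi> \<in> \<Omega> \<Longrightarrow> lapH v \<xi> = (2 * real CARD('n) + 4) * (norm (fst \<xi>))\<^sup>2"
    and v0: "\<And>\<xi>. \<xi> \<in> frontier \<Omega> \<Longrightarrow> v \<xi> = 0"
begin

text \<open>A unitary map preserves the equation and the zero boundary values. If s times the
  difference were positive somewhere, adding a small multiple of |x|^2 would still leave an interior
  maximum; there the sub-Laplacian is nonpositive, while that of the perturbation is positive and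
  those of the two solutions cancel.\<close>

lemma unitary_le:
  assumes A: "orthogonal_transformation A" "\<And>x. hJ (A x) = A (hJ x)" and s: "s = 1 \<or> s = - 1" and \<xi>1: "\<xi>1 \<in> \<Omega>"
  shows "s * (v (A (fst \<xi>1), snd \<xi>1) - v \<xi>1) \<le> 0"
proof (rule ccontr)
  assume neg: "\<not> ?thesis"
  define Ah where "Ah \<xi> = (A (fst \<xi>), snd \<xi>)" for \<xi> :: "'n heis"
  define h where "h \<xi> = s * (v (Ah \<xi>) - v \<xi>)" for \<xi>
  have m: "h \<xi>1 > 0" using neg by (simp add: h_def Ah_def)
  have lA: "linear A" using A(1) by (simp add: orthogonal_transformation)
  have bA: "bounded_linear A" using lA by (simp add: linear_conv_bounded_linear)
  have nA: "norm (A x) = norm x" for x using A(1) by (simp add: orthogonal_transformation)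
  have iA: "A x \<bullet> A y = x \<bullet> y" for x y using A(1) by (simp add: orthogonal_transformation_def)
  have AO: "Ah \<xi> \<in> \<Omega>" if "\<xi> \<in> \<Omega>" for \<xi> using cyl_iff[OF cyl nA, of "fst \<xi>" "snd \<xi>"] that by (simp add: Ah_def)
  have AF: "Ah \<xi> \<in> frontier \<Omega>" if "\<xi> \<in> frontier \<Omega>" for \<xi>
    using rotation_frontier[OF cyl bA nA, of "fst \<xi>" "snd \<xi>"] that by (simp add: Ah_def)
  have cO: "closure \<Omega> = \<Omega> \<union> frontier \<Omega>" using closure_Un_frontier by blast
  have AC: "Ah ` closure \<Omega> \<subseteq> closure \<Omega>" using AO AF unfolding cO by blast
  have cv: "continuous_on (closure \<Omega>) v" by (rule continuous_on_subset[OF smooth_on_continuous[OF sv] U(2)])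
  have cA: "continuous_on (closure \<Omega>) Ah"
    unfolding Ah_def by (intro continuous_intros continuous_on_compose2[OF linear_continuous_on[OF bA, of UNIV]]) auto
  obtain R where R: "\<And>\<xi>. \<xi> \<in> closure \<Omega> \<Longrightarrow> norm \<xi> \<le> R"
    using compact_imp_bounded[OF compact_closure_dom] unfolding bounded_iff by blast
  \<comment> \<open>Small enough that the perturbation on the frontier stays below the supposed
    positive value at \<open>\<xi>1\<close>, which forces the maximum into \<Omega>.\<close>
  define \<epsilon> where "\<epsilon> = h \<xi>1 / (2 * (R\<^sup>2 + 1))"
  have \<epsilon>: "\<epsilon> > 0" using m by (simp add: \<epsilon>_def add_nonneg_pos)
  have \<epsilon>R: "\<epsilon> * R\<^sup>2 < h \<xi>1"
  proof -
    have "\<epsilon> * (2 * (R\<^sup>2 + 1)) = h \<xi>1"     proof -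
      have "R\<^sup>2 + 1 > 0" by (intro add_nonneg_pos) auto
      then show ?thesis by (simp add: \<epsilon>_def)
    qed
    moreover have "\<epsilon> * R\<^sup>2 < \<epsilon> * (2 * (R\<^sup>2 + 1))"     proof (rule mult_strict_left_mono[OF _ \<epsilon>])
      show "R\<^sup>2 < 2 * (R\<^sup>2 + 1)" by (rule less_double_add_1[OF zero_le_power2])
    qed
    ultimately show ?thesis by simp
  qed
  define G where "G \<xi> = h \<xi> + \<epsilon> * (fst \<xi> \<bullet> fst \<xi>)" for \<xi>
  have ne: "closure \<Omega> \<noteq> {}"
  proof
    assume "closure \<Omega> = {}"
    with subsetD[OF closure_subset \<xi>1] show False by simp
  qed
  have "continuous_on (closure \<Omega>) G"
    unfolding G_def h_def by (intro continuous_intros cv continuous_on_compose2[OF cv cA AC])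
  then obtain p where p: "p \<in> closure \<Omega>" "\<And>\<xi>. \<xi> \<in> closure \<Omega> \<Longrightarrow> G \<xi> \<le> G p"
    using continuous_attains_sup[OF compact_closure_dom ne] by blast
  have pO: "p \<in> \<Omega>"
  proof (rule ccontr)
    assume "p \<notin> \<Omega>"
    then have pf: "p \<in> frontier \<Omega>" using p(1) cO by blast
    have "norm (fst p) \<le> R" using norm_fst_le[of "fst p" "snd p"] R[OF p(1)] by simp
    then have "fst p \<bullet> fst p \<le> R\<^sup>2" by (simp add: dot_square_norm power_mono)
    then have "G p \<le> \<epsilon> * R\<^sup>2" using v0[OF pf] v0[OF AF[OF pf]] \<epsilon> by (simp add: G_def h_def)
    moreover have "G \<xi>1 \<ge> h \<xi>1" using \<epsilon> by (simp add: G_def)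
    ultimately show False using p(2)[OF subsetD[OF closure_subset \<xi>1]] \<epsilon>R by linarith
  qed
  define q where "q = Ah p"
  have qO: "q \<in> \<Omega>" unfolding q_def by (rule AO[OF pO])
  have OU: "\<Omega> \<subseteq> U" using U(2) closure_subset by blast
  have svO: "smooth_on \<Omega> v" by (rule smooth_on_subset[OF open_dom U(1) OU sv])
  define T where "T e = (e, 2 * (hJ (fst q) \<bullet> e))" for e
  have second: "s * (pd (T (A (axis j 1))) (pd (T (A (axis j 1))) v) q - XX j (XX j v) p) + 2 * \<epsilon> \<le> 0" for j
  proof -
    define d where "d = hX j (fst p)"
    define d' where "d' = T (A (axis j 1))"
    have line: "Ah (p + \<tau> *\<^sub>R d) = q + \<tau> *\<^sub>R d'" for \<tau>
    proof -
      have "hJ (fst q) \<bullet> A (axis j 1) = hJ (fst p) $ j"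
        by (simp add: q_def Ah_def A(2) iA inner_axis)
      then show ?thesis
        by (simp add: d_def d'_def T_def q_def Ah_def hX_def prod_eq_iff linear_add[OF lA] linear_cmul[OF lA])
    qed
    obtain \<delta> where \<delta>: "\<delta> > 0" "\<And>\<tau>. \<bar>\<tau>\<bar> < \<delta> \<Longrightarrow> p + \<tau> *\<^sub>R d \<in> \<Omega>"
    proof -
      have "((\<lambda>\<tau>. p + \<tau> *\<^sub>R d) \<longlongrightarrow> p + 0 *\<^sub>R d) (at 0)" by (intro tendsto_intros)
      then have "eventually (\<lambda>\<tau>. p + \<tau> *\<^sub>R d \<in> \<Omega>) (at 0)"
        using topological_tendstoD[OF _ open_dom] pO by simp
      then obtain \<delta> where "\<delta> > 0" "\<And>\<tau>. \<tau> \<noteq> 0 \<Longrightarrow> \<bar>\<tau>\<bar> < \<delta> \<Longrightarrow> p + \<tau> *\<^sub>R d \<in> \<Omega>"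
        unfolding eventually_at by (auto simp: dist_real_def)
      then show ?thesis using that[of \<delta>] pO by (metis add.right_neutral scale_zero_left)
    qed
    have \<delta>': "q + \<tau> *\<^sub>R d' \<in> \<Omega>" if "\<bar>\<tau>\<bar> < \<delta>" for \<tau> using AO[OF \<delta>(2)[OF that]] by (simp add: line)
    define g where "g \<tau> = G (p + \<tau> *\<^sub>R d)" for \<tau>
    have geq: "g = (\<lambda>\<tau>. s * (v (q + \<tau> *\<^sub>R d') - v (p + \<tau> *\<^sub>R d)) + \<epsilon> * (fst p \<bullet> fst p + 2 * \<tau> * (fst p $ j) + \<tau>\<^sup>2))"
    proof (rule ext)
      fix \<tau>
      have "fst (p + \<tau> *\<^sub>R d) = fst p + \<tau> *\<^sub>R axis j 1" by (simp add: d_def hX_def)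
      moreover have "(fst p + \<tau> *\<^sub>R axis j 1) \<bullet> (fst p + \<tau> *\<^sub>R axis j 1) = fst p \<bullet> fst p + 2 * \<tau> * (fst p $ j) + \<tau>\<^sup>2"
        by (simp add: inner_add_left inner_add_right inner_axis inner_axis_axis inner_commute[of "axis j 1" "fst p"] power2_eq_square algebra_simps)
      ultimately show "g \<tau> = s * (v (q + \<tau> *\<^sub>R d') - v (p + \<tau> *\<^sub>R d)) + \<epsilon> * (fst p \<bullet> fst p + 2 * \<tau> * (fst p $ j) + \<tau>\<^sup>2)"
        by (simp only: g_def G_def h_def line)
    qed
    define g' where "g' \<tau> = s * (pd d' v (q + \<tau> *\<^sub>R d') - pd d v (p + \<tau> *\<^sub>R d)) + \<epsilon> * (2 * (fst p $ j) + 2 * \<tau>)" for \<tau>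
    have "s * (pd d' (pd d' v) q - pd d (pd d v) p) + \<epsilon> * 2 \<le> 0"
    proof (rule second_derivative_local_max(2)[OF \<delta>(1)])
      show "(g has_field_derivative g' \<tau>) (at \<tau>)" if "\<bar>\<tau>\<bar> < \<delta>" for \<tau>
        unfolding geq g'_def
        by (rule derivative_eq_intros smooth_on_line[OF svO open_dom \<delta>'[OF that]] smooth_on_line[OF svO open_dom \<delta>(2)[OF that]] refl)+ simp
      have sp: "smooth_on \<Omega> (pd b v)" for b by (rule smooth_on_pd[OF open_dom svO])
      show "(g' has_field_derivative s * (pd d' (pd d' v) q - pd d (pd d v) p) + \<epsilon> * 2) (at 0)"
        unfolding g'_def
        using smooth_on_line[OF sp open_dom, of q 0 d' d'] smooth_on_line[OF sp open_dom, of p 0 d d] pO qO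
        by (auto intro!: derivative_eq_intros)
      show "g \<tau> \<le> g 0" if "\<bar>\<tau>\<bar> < \<delta>" for \<tau>
        using p(2)[OF subsetD[OF closure_subset \<delta>(2)[OF that]]] by (simp add: g_def)
    qed
    then show ?thesis
      using pd_pd_frozen[OF open_dom svO pO, of j] by (simp add: d_def d'_def mult.commute)
  qed
  \<comment> \<open>Summed over j, the frame sums are the sub-Laplacians at \<open>q\<close> and
    \<open>p\<close>. They agree because the right-hand side depends on |x| only, so a positive
    multiple of \<epsilon> would be nonpositive.\<close>
  have "(\<Sum>j\<in>UNIV. s * (pd (T (A (axis j 1))) (pd (T (A (axis j 1))) v) q - XX j (XX j v) p) + 2 * \<epsilon>) \<le> 0"
    by (rule sum_nonpos) (rule second)
  moreover have "(\<Sum>j\<in>UNIV. pd (T (A (axis j 1))) (pd (T (A (axis j 1))) v) q) = lapH v q"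
    using lapH_frame[OF open_dom svO qO A(1)] by (simp add: T_def)
  moreover have "lapH v q = lapH v p"
    using lap[OF qO] lap[OF pO] by (simp add: q_def Ah_def nA)
  ultimately have "real CARD('n + 'n) * (2 * \<epsilon>) \<le> 0"
    by (simp add: sum.distrib sum_distrib_left[symmetric] sum_subtractf lapH_def[of v p])
  then show False using \<epsilon> by (simp add: mult_le_0_iff)
qed

lemma unitary_invariance:
  assumes A: "orthogonal_transformation A" "\<And>x. hJ (A x) = A (hJ x)" and \<xi>: "(x, t) \<in> \<Omega>"
  shows "v (A x, t) = v (x, t)"
  using unitary_le[OF A _ \<xi>, of 1] unitary_le[OF A _ \<xi>, of "- 1"] by simp

text \<open>The unitary group acts transitively on spheres: after a phase rotation the Hermitian
  product of \<open>y\<close> and \<open>x'\<close> is real, and then a complex Householder reflection maps \<open>y\<close> to \<open>x'\<close>.\<close>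

lemma solution_symmetric:
  assumes \<xi>: "(x, t) \<in> \<Omega>" and n: "norm x' = norm x"
  shows "v (x', t) = v (x, t)"
proof -
  define a where "a = x \<bullet> hJ x'"
  define b where "b = x \<bullet> x'"
  \<comment> \<open>The phase, a unit vector orthogonal to (a, b), makes the product of
    \<open>y\<close> with Jx' vanish; any phase works if a = b = 0.\<close>
  obtain c s where cs: "c\<^sup>2 + s\<^sup>2 = 1" "c * a + s * b = 0"
  proof (cases "a\<^sup>2 + b\<^sup>2 = 0")
    case True
    then show ?thesis using that[of 1 0] by simp
  next
    case False
    define r where "r = sqrt (a\<^sup>2 + b\<^sup>2)"
    have r: "r\<^sup>2 = a\<^sup>2 + b\<^sup>2" "r \<noteq> 0" using False by (simp_all add: r_def)
    have "(b / r)\<^sup>2 + (- a / r)\<^sup>2 = (a\<^sup>2 + b\<^sup>2) / r\<^sup>2" by (simp add: power_divide add_divide_distrib)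
    also have "\<dots> = 1" using r by (simp add: r(1)[symmetric])
    finally show ?thesis using that[of "b / r" "- a / r"] by simp
  qed
  define P where "P y = c *\<^sub>R y + s *\<^sub>R hJ y" for y :: "'n hvec"
  define y where "y = P x"
  have PP: "P y \<bullet> P z = y \<bullet> z" for y z
  proof -
    have "P y \<bullet> P z = (c\<^sup>2 + s\<^sup>2) * (y \<bullet> z)"
      using hJ_inner[of y z] by (simp add: P_def inner_add_left inner_add_right power2_eq_square algebra_simps)
    then show ?thesis using cs by simp
  qed
  have lP: "linear P"
    by (rule linearI) (simp_all add: P_def hJ_linear_simps algebra_simps)
  have oP: "orthogonal_transformation P" using lP PP by (simp add: orthogonal_transformation_def)
  have JP: "hJ (P z) = P (hJ z)" for z by (simp add: P_def hJ_linear_simps)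
  have vy: "v (y, t) = v (x, t)" unfolding y_def by (rule unitary_invariance[OF oP JP \<xi>])
  have ny: "y \<bullet> y = x' \<bullet> x'" unfolding y_def PP using n by (simp add: dot_square_norm)
  have yO: "(y, t) \<in> \<Omega>" using cyl_iff[OF cyl, of y x t] \<xi> n ny by (simp add: norm_eq_sqrt_inner)
  have yJ: "y \<bullet> hJ x' = 0"
    using cs(2) by (simp add: y_def P_def inner_add_left a_def b_def)
  show ?thesis
  proof (cases "y = x'")
    case True
    then show ?thesis using vy by simp
  next
    case False
    define d where "d = y - x'"
    define k where "k = 2 / (d \<bullet> d)"
    have d: "d \<bullet> d > 0" using False by (simp add: d_def)
    have kd: "k * (d \<bullet> d) = 2" using d by (simp add: k_def)
    \<comment> \<open>Reflecting along both d and Jd makes the map commute with J, hence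
      unitary.\<close>
    define H where "H z = z - k *\<^sub>R ((d \<bullet> z) *\<^sub>R d + (hJ d \<bullet> z) *\<^sub>R hJ d)" for z
    have HH: "H w \<bullet> H z = w \<bullet> z" for w z
    proof -
      have "H w \<bullet> H z = w \<bullet> z + (k * (d \<bullet> d) - 2) * k * ((d \<bullet> w) * (d \<bullet> z) + (hJ d \<bullet> w) * (hJ d \<bullet> z))"
        by (simp add: H_def inner_diff_left inner_diff_right inner_add_left inner_add_right
            inner_commute[of w d] inner_commute[of w "hJ d"] algebra_simps)
      then show ?thesis by (simp add: kd)
    qed
    have lH: "linear H"
      by (rule linearI) (simp_all add: H_def inner_add_right algebra_simps)
    have oH: "orthogonal_transformation H" using lH HH by (simp add: orthogonal_transformation_def)
    have JH: "hJ (H z) = H (hJ z)" for z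
      using hJ_inner[of d z] by (simp add: H_def hJ_linear_simps hJ_hJ algebra_simps)
    \<comment> \<open>Uses that y and x' have equal length; it makes the component of y along d
      exactly d itself.\<close>
    have "d \<bullet> d = 2 * (d \<bullet> y)" using ny by (simp add: d_def inner_diff_left inner_diff_right inner_commute)
    then have "k * (d \<bullet> y) = 1" using kd by simp
    moreover have "hJ d \<bullet> y = 0" using yJ by (simp add: d_def hJ_linear_simps inner_diff_left inner_diff_right inner_commute)
    ultimately have "H y = x'" by (simp add: H_def d_def)
    then show ?thesis using unitary_invariance[OF oH JH yO] vy by simp
  qed
qed

end

end

section \<open>The \<open>P\<close>-function\<close>

lemma frechet_curve:
  fixes v :: "'a::euclidean_space \<Rightarrow> real"
  assumes v: "smooth_on S v" "open S" "c \<tau> \<in> S" and c: "(c has_vector_derivative d) (at \<tau>)"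
  shows "((\<lambda>\<tau>. v (c \<tau>)) has_field_derivative pd d v (c \<tau>)) (at \<tau>)"
proof -
  have "((\<lambda>\<tau>. v (c \<tau>)) has_derivative (\<lambda>h. pd (h *\<^sub>R d) v (c \<tau>))) (at \<tau>)"
    using has_derivative_compose[OF c[unfolded has_vector_derivative_def] smooth_on_has_derivative[OF v]] .
  moreover have "(\<lambda>h. pd (h *\<^sub>R d) v (c \<tau>)) = (*) (pd d v (c \<tau>))"
    using pd_scaleR_dir[OF smooth_on_differentiable[OF v], of _ d] by (simp add: fun_eq_iff)
  ultimately show ?thesis by (simp add: has_field_derivative_def)
qed

lemma hJ_rotation:
  "bounded_linear (\<lambda>y::'n::finite hvec. cos \<theta> *\<^sub>R y + sin \<theta> *\<^sub>R hJ y)"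
  "norm (cos \<theta> *\<^sub>R y + sin \<theta> *\<^sub>R hJ (y::'n hvec)) = norm y"
proof -
  show "bounded_linear (\<lambda>y::'n hvec. cos \<theta> *\<^sub>R y + sin \<theta> *\<^sub>R hJ y)"
    using linear_hJ by (intro bounded_linear_add bounded_linear_const_scaleR bounded_linear_ident) (simp add: linear_conv_bounded_linear)
  have "(cos \<theta> *\<^sub>R y + sin \<theta> *\<^sub>R hJ y) \<bullet> (cos \<theta> *\<^sub>R y + sin \<theta> *\<^sub>R hJ y) = ((cos \<theta>)\<^sup>2 + (sin \<theta>)\<^sup>2) * (y \<bullet> y)"
    by (simp only: inner_add_left inner_add_right inner_scaleR_left inner_scaleR_right hJ_inner_self hJ_inner_hJ) algebra
  then show "norm (cos \<theta> *\<^sub>R y + sin \<theta> *\<^sub>R hJ y) = norm y" by (simp only: norm_eq_sqrt_inner sin_cos_squared_add2 mult_1)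
qed

lemma ZZ_eq_pd:
  assumes "g differentiable (at \<xi>)"
  shows "ZZ g \<xi> = pd (fst \<xi>, 2 * snd \<xi>) g \<xi>"
proof -
  have "(fst \<xi>, 2 * snd \<xi>) = (\<Sum>i\<in>UNIV. (fst \<xi> $ i) *\<^sub>R (axis i 1, 0)) + (2 * snd \<xi>) *\<^sub>R (0, 1)"
    by (simp add: prod_eq_iff fst_sum snd_sum vec_eq_iff axis_def if_distrib sum.delta cong: if_cong)
  then have "pd (fst \<xi>, 2 * snd \<xi>) g \<xi> = pd ((\<Sum>i\<in>UNIV. (fst \<xi> $ i) *\<^sub>R (axis i 1, 0)) + (2 * snd \<xi>) *\<^sub>R (0, 1)) g \<xi>" by simp
  then show ?thesis by (simp only: ZZ_def pd_add_dir[OF assms] pd_sum_dir[OF assms] pd_scaleR_dir[OF assms])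
qed

lemma ZZ_at: "(g has_derivative g') (at \<xi>) \<Longrightarrow> ZZ g \<xi> = g' (fst \<xi>, 2 * snd \<xi>)"
  using ZZ_eq_pd[of g \<xi>] pd_at[of g g' \<xi>] by (simp add: differentiableI)

text \<open>The dilation field \<open>ZZ\<close> is homogeneous: \<open>[X\<^sub>j, Z] = X\<^sub>j\<close>.\<close>

lemma XX_ZZ_commute:
  fixes g :: "'n::finite heis \<Rightarrow> real"
  assumes S: "open S" "smooth_on S g" "\<xi> \<in> S"
  shows "XX j (ZZ g) \<xi> = ZZ (XX j g) \<xi> + XX j g \<xi>"
proof -
  define D where "D i = pd (axis i 1, 0) g" for i :: "'n + 'n"
  define T where "T = pd (0, 1) g"
  have sD: "smooth_on S (D i)" and sT: "smooth_on S T" for i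
    unfolding D_def T_def by (rule smooth_on_pd[OF S(1,2)])+
  note dD = smooth_on_has_derivative[OF sD S(1,3)]
  note dT = smooth_on_has_derivative[OF sT S(1,3)]
  have ZZg: "ZZ g = (\<lambda>\<xi>. (\<Sum>i\<in>UNIV. fst \<xi> $ i * D i \<xi>) + 2 * snd \<xi> * T \<xi>)"
    by (rule ext) (simp add: ZZ_def D_def T_def)
  have XXg: "XX j g = (\<lambda>\<xi>. D j \<xi> + 2 * (hJ (fst \<xi>) $ j) * T \<xi>)"
    by (rule ext) (simp add: XX_def D_def T_def)
  have cx: "((\<lambda>\<xi>. fst \<xi> $ i) has_derivative (\<lambda>h. fst h $ i)) (at \<xi>)" for i
    by (rule bounded_linear_imp_has_derivative[OF bounded_linear_coord])
  have cJ: "((\<lambda>\<xi>. hJ (fst \<xi>) $ j) has_derivative (\<lambda>h. hJ (fst h) $ j)) (at \<xi>)"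
    by (rule bounded_linear_imp_has_derivative[OF bounded_linear_hJ_coord])
  have cs: "(snd has_derivative snd) (at \<xi>)" by (rule bounded_linear_imp_has_derivative[OF bounded_linear_snd])
  let ?d = "hX j (fst \<xi>)"
  let ?z = "(fst \<xi>, 2 * snd \<xi>)"
  have L: "XX j (ZZ g) \<xi> = (\<Sum>i\<in>UNIV. fst \<xi> $ i * pd ?d (D i) \<xi> + fst ?d $ i * D i \<xi>) + (2 * snd \<xi> * pd ?d T \<xi> + 2 * snd ?d * T \<xi>)"
    unfolding ZZg
    by (rule XX_at) (intro has_derivative_add has_derivative_sum has_derivative_mult cx dD dT has_derivative_mult_right cs)
  have R: "ZZ (XX j g) \<xi> = pd ?z (D j) \<xi> + (2 * (hJ (fst \<xi>) $ j) * pd ?z T \<xi> + 2 * (hJ (fst ?z) $ j) * T \<xi>)"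
    unfolding XXg
    by (rule ZZ_at) (intro has_derivative_add has_derivative_mult cJ dD dT has_derivative_mult_right)
  have d1: "(\<Sum>i\<in>UNIV. fst ?d $ i * D i \<xi>) = D j \<xi>"
    by (simp add: hX_def axis_def if_distrib[of "\<lambda>x. x * _"] sum.delta cong: if_cong)
  have dp: "pd ?d h \<xi> = pd (axis j 1, 0) h \<xi> + 2 * (hJ (fst \<xi>) $ j) * pd (0, 1) h \<xi>" if "smooth_on S h" for h
    using XX_eq_pd[OF smooth_on_differentiable[OF that S(1,3)], of j] by (simp add: XX_def)
  have zp: "pd ?z h \<xi> = (\<Sum>i\<in>UNIV. fst \<xi> $ i * pd (axis i 1, 0) h \<xi>) + 2 * snd \<xi> * pd (0, 1) h \<xi>" if "smooth_on S h" for h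
    using ZZ_eq_pd[OF smooth_on_differentiable[OF that S(1,3)]] by (simp add: ZZ_def)
  have c1: "pd (axis i 1, 0) (D j) \<xi> = pd (axis j 1, 0) (D i) \<xi>" "pd (0, 1) (D i) \<xi> = pd (axis i 1, 0) T \<xi>" for i
    unfolding D_def T_def by (rule pd_commute[OF S])+
  show ?thesis
    unfolding L R sum.distrib d1 dp[OF sD] dp[OF sT] zp[OF sD] zp[OF sT] c1
    by (simp add: hX_def XXg sum_distrib_left sum.distrib algebra_simps)
qed

text \<open>A fixed unit vector; the points (r e, t) with r > 0 form the half plane that carries a
  cylindrically symmetric function off the axis.\<close>

definition ax :: "'n::finite itself \<Rightarrow> 'n hvec" where
  "ax _ = axis (Inl undefined) 1"

text \<open>With s = r^2 the abbreviations are al = v_ss, si = v_st and de = v_s / s.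
  \<open>E\<close> is the equation on the half plane and \<open>Er\<close>, \<open>Et\<close> are
  its derivatives in r and t; they eliminate v111, v112 and v22. The remaining third derivatives
  cancel, and the left side, the operator applied to P, becomes a sum of squares. The squares vanish
  exactly when al = v22 = de = 1/2 and si = 0, as for (r^4 + t^2) / 4.\<close>

lemma P_function_identity:
  fixes r N :: real
  assumes r: "r > 0"
    and E: "v11 + (2 * N - 1) * (v1 / r) + 4 * r\<^sup>2 * v22 = (2 * N + 4) * r\<^sup>2"
    and Er: "v111 + (2 * N - 1) * (v11 / r - v1 / r\<^sup>2) + (8 * r * v22 + 4 * r\<^sup>2 * v122) = 2 * (2 * N + 4) * r"
    and Et: "v112 + (2 * N - 1) * (v12 / r) + 4 * r\<^sup>2 * v222 = 0"
    and al: "al = v11 / (4 * r\<^sup>2) - v1 / (4 * r ^ 3)" and de: "de = v1 / (2 * r ^ 3)" and si: "si = v12 / (2 * r)"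
  shows "((v11\<^sup>2 + v1 * v111) / (2 * r\<^sup>2) - 2 * v1 * v11 / r ^ 3 + 3 * v1\<^sup>2 / (2 * r ^ 4) + 2 * v12\<^sup>2 + 2 * v2 * v112 - v11)
     + (2 * N - 1) / r * (v1 * v11 / (2 * r\<^sup>2) - v1\<^sup>2 / (2 * r ^ 3) + 2 * v2 * v12 - v1)
     + 4 * r\<^sup>2 * ((v12\<^sup>2 + v1 * v122) / (2 * r\<^sup>2) + 2 * v22\<^sup>2 + 2 * v2 * v222 - v22)
     = 8 * r\<^sup>2 * ((al - 1/2)\<^sup>2 + (v22 - 1/2)\<^sup>2 + N * (de - 1/2)\<^sup>2 + 2 * si\<^sup>2)"
proof -
  have r0: "r \<noteq> 0" using r by simp
  have v1: "v1 = 2 * r ^ 3 * de" using r0 by (simp add: de)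
  have v12: "v12 = 2 * r * si" using r0 by (simp add: si)
  have v11: "v11 = 4 * r\<^sup>2 * al + 2 * r\<^sup>2 * de"
    using r0 by (simp add: al de field_simps power2_eq_square power3_eq_cube)
  have e1: "v1 / r = 2 * r\<^sup>2 * de" "v11 / r - v1 / r\<^sup>2 = 4 * r * al" "v12 / r = 2 * si"
    using r0 by (simp_all add: v1 v11 v12 field_simps power2_eq_square power3_eq_cube)
  have "r\<^sup>2 * (4 * al + 4 * N * de + 4 * v22 - (2 * N + 4)) = 0"
    using E unfolding e1 v11 by (simp add: algebra_simps)
  then have "4 * al + 4 * N * de + 4 * v22 = 2 * N + 4" using r0 by simp
  then have E': "v22 = (N + 2) / 2 - al - N * de" by (simp add: field_simps)
  have v111: "v111 = 2 * (2 * N + 4) * r - (2 * N - 1) * (4 * r * al) - 8 * r * v22 - 4 * r\<^sup>2 * v122"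
    using Er unfolding e1 by simp
  have v112: "v112 = - ((2 * N - 1) * (2 * si)) - 4 * r\<^sup>2 * v222" using Et unfolding e1 by simp
  have d1: "(v11\<^sup>2 + v1 * v111) / (2 * r\<^sup>2) = 2 * r\<^sup>2 * (2 * al + de)\<^sup>2 + r * de * v111"
    using r0 by (simp add: v1 v11 field_simps power2_eq_square power3_eq_cube)
  have d2: "2 * v1 * v11 / r ^ 3 = 8 * r\<^sup>2 * de * (2 * al + de)"
    using r0 by (simp add: v1 v11 field_simps power2_eq_square power3_eq_cube)
  have d3: "3 * v1\<^sup>2 / (2 * r ^ 4) = 6 * r\<^sup>2 * de\<^sup>2"
    using r0 by (simp add: v1 field_simps power2_eq_square power3_eq_cube power4_eq_xxxx)
  have d4: "(2 * N - 1) / r * (v1 * v11 / (2 * r\<^sup>2) - v1\<^sup>2 / (2 * r ^ 3) + 2 * v2 * v12 - v1)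
     = (2 * N - 1) * (r\<^sup>2 * de * (4 * al + 2 * de) - 2 * r\<^sup>2 * de\<^sup>2 + 4 * v2 * si - 2 * r\<^sup>2 * de)"
    using r0 by (simp add: v1 v11 v12 field_simps power2_eq_square power3_eq_cube)
  have d5: "(v12\<^sup>2 + v1 * v122) / (2 * r\<^sup>2) = 2 * si\<^sup>2 + r * de * v122"
    using r0 by (simp add: v1 v12 field_simps power2_eq_square power3_eq_cube)
  show ?thesis
    unfolding d1 d2 d3 d4 d5 unfolding v111 v112 unfolding v11 v12 E'
    by (simp add: field_simps power2_eq_square power3_eq_cube)
qed

lemma DERIV_P:
  fixes f g h q :: "real \<Rightarrow> real"
  assumes D: "(f has_field_derivative f') (at r)" "(g has_field_derivative g') (at r)" "(h has_field_derivative h') (at r)"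
    and q: "(q has_field_derivative q') (at r)"
  shows "((\<lambda>r. (f r)\<^sup>2 * q r + (g r)\<^sup>2 - h r) has_field_derivative
      2 * f r * f' * q r + (f r)\<^sup>2 * q' + 2 * g r * g' - h') (at r)"
  by (rule derivative_eq_intros D q refl)+ (simp add: algebra_simps)

lemma DERIV_Pr:
  fixes f f1 g g1 q :: "real \<Rightarrow> real"
  assumes D: "(f has_field_derivative f') (at r)" "(f1 has_field_derivative f1') (at r)"
      "(g has_field_derivative g') (at r)" "(g1 has_field_derivative g1') (at r)"
    and q: "(q has_field_derivative q') (at r)" "(k has_field_derivative k') (at r)" and h: "(h has_field_derivative h') (at r)"
  shows "((\<lambda>r. f r * f1 r * q r - (f r)\<^sup>2 * k r + 2 * g r * g1 r - h r) has_field_derivative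
      (f' * f1 r + f r * f1') * q r + f r * f1 r * q' - (2 * f r * f' * k r + (f r)\<^sup>2 * k') + 2 * (g' * g1 r + g r * g1') - h') (at r)"
  by (rule derivative_eq_intros D q h refl)+ (simp add: algebra_simps)

lemma DERIV_slice_operator:
  fixes f f1 h :: "real \<Rightarrow> real"
  assumes D: "(f has_field_derivative f') (at r)" "(f1 has_field_derivative f1') (at r)" "(h has_field_derivative h') (at r)" and "r \<noteq> 0"
  shows "((\<lambda>s. f1 s + K * (f s / s) + 4 * s\<^sup>2 * h s) has_field_derivative
      f1' + K * (f' / r - f r / r\<^sup>2) + (8 * r * h r + 4 * r\<^sup>2 * h')) (at r)"
proof -
  have "((\<lambda>s. f s / s) has_field_derivative (f' * r - f r * 1) / (r * r)) (at r)"
    by (rule DERIV_divide[OF D(1) DERIV_ident assms(4)])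
  then have q: "((\<lambda>s. f s / s) has_field_derivative f' / r - f r / r\<^sup>2) (at r)"
    using assms(4) by (simp add: diff_divide_distrib power2_eq_square)
  show ?thesis by (rule derivative_eq_intros D q refl)+ simp
qed

lemma DERIV_inv_power: "r \<noteq> 0 \<Longrightarrow> ((\<lambda>r. c / r ^ m) has_field_derivative - (c * m / r ^ Suc m)) (at r)" for r c :: real
proof (cases m)
  case (Suc k)
  assume "r \<noteq> 0"
  then have "((\<lambda>r. c / r ^ m) has_field_derivative (0 * r ^ m - c * (m * r ^ (m - Suc 0))) / (r ^ m * r ^ m)) (at r)"
    by (intro DERIV_divide DERIV_const DERIV_pow) auto
  then show ?thesis using \<open>r \<noteq> 0\<close> by (simp add: Suc)
qed simp

section \<open>The smooth solution on the half plane\<close>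

text \<open>The weak formulation is gone here: \<open>v\<close> is the smooth function on a
  neighbourhood of the closure, with both boundary conditions holding pointwise.\<close>

locale overdetermined = smooth_domain \<Omega> f for \<Omega> :: "'n::finite heis set" and f +
  fixes v :: "'n heis \<Rightarrow> real" and U and c :: real
  assumes cyl: "cylindrically_symmetric \<Omega>"
    and U: "open U" "closure \<Omega> \<subseteq> U" and sv: "smooth_on U v"
    and lap: "\<And>\<xi>. \<xi> \<in> \<Omega> \<Longrightarrow> lapH v \<xi> = (2 * real CARD('n) + 4) * (norm (fst \<xi>))\<^sup>2"
    and v0: "\<And>\<xi>. \<xi> \<in> frontier \<Omega> \<Longrightarrow> v \<xi> = 0"
    and c: "c > 0" and grad: "\<And>\<xi>. \<xi> \<in> frontier \<Omega> \<Longrightarrow> norm (hgrad v \<xi>) = c * norm (fst \<xi>)"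
begin

abbreviation "e \<equiv> ax TYPE('n)"
abbreviation "v1 \<equiv> pd (e, 0) v"
abbreviation "v2 \<equiv> pd (0, 1) v"
abbreviation "v11 \<equiv> pd (e, 0) v1"
abbreviation "v12 \<equiv> pd (0, 1) v1"
abbreviation "v22 \<equiv> pd (0, 1) v2"

lemma norm_e [simp]: "norm e = 1" by (simp add: ax_def)

lemma svO: "smooth_on \<Omega> v"
  using smooth_on_subset[OF open_dom U(1) _ sv] U(2) closure_subset[of \<Omega>] by (metis order_trans)

lemma sO: "smooth_on \<Omega> g \<Longrightarrow> smooth_on \<Omega> (pd b g)"
  by (rule smooth_on_pd[OF open_dom])

lemma sym: "(x, t) \<in> \<Omega> \<Longrightarrow> norm x' = norm x \<Longrightarrow> v (x', t) = v (x, t)"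
  by (rule solution_symmetric[OF cyl U sv lap v0])

lemma near_dom:
  assumes "p \<in> \<Omega>"
  obtains \<delta> where "\<delta> > 0" "\<And>\<tau>. \<bar>\<tau>\<bar> < \<delta> \<Longrightarrow> p + \<tau> *\<^sub>R d \<in> \<Omega>"
proof -
  have "((\<lambda>\<tau>. p + \<tau> *\<^sub>R d) \<longlongrightarrow> p + 0 *\<^sub>R d) (at 0)" by (intro tendsto_intros)
  then have "eventually (\<lambda>\<tau>. p + \<tau> *\<^sub>R d \<in> \<Omega>) (at 0)"
    using topological_tendstoD[OF _ open_dom] assms by simp
  then obtain \<delta> where \<delta>: "\<delta> > 0" "\<And>\<tau>. \<tau> \<noteq> 0 \<Longrightarrow> \<bar>\<tau>\<bar> < \<delta> \<Longrightarrow> p + \<tau> *\<^sub>R d \<in> \<Omega>"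
    unfolding eventually_at by (auto simp: dist_real_def)
  show ?thesis
  proof (rule that[OF \<delta>(1)])
    show "p + \<tau> *\<^sub>R d \<in> \<Omega>" if "\<bar>\<tau>\<bar> < \<delta>" for \<tau>
      using \<delta>(2)[OF _ that] assms by (cases "\<tau> = 0") simp_all
  qed
qed

text \<open>Along a horizontal line orthogonal to the radial direction the radial variable is
  \<open>sqrt (r\<^sup>2 + \<tau>\<^sup>2)\<close>.\<close>

lemma transversal_second_derivative:
  assumes r: "r > 0" and p: "(r *\<^sub>R e, t) \<in> \<Omega>" and y: "norm y = 1" "e \<bullet> y = 0"
  shows "pd (y, 2 * b) (pd (y, 2 * b) v) (r *\<^sub>R e, t) = v1 (r *\<^sub>R e, t) / r + 4 * b\<^sup>2 * v22 (r *\<^sub>R e, t)"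
proof -
  define d where "d = (y, 2 * b)"
  define p where "p = (r *\<^sub>R e, t)"
  have pO: "p \<in> \<Omega>" using p by (simp add: p_def)
  obtain \<delta> where \<delta>: "\<delta> > 0" "\<And>\<tau>. \<bar>\<tau>\<bar> < \<delta> \<Longrightarrow> p + \<tau> *\<^sub>R d \<in> \<Omega>" using near_dom[OF pO] by blast
  define \<rho> where "\<rho> \<tau> = sqrt (r\<^sup>2 + \<tau>\<^sup>2)" for \<tau>
  have pos: "r\<^sup>2 + \<tau>\<^sup>2 > 0" for \<tau> using r by (simp add: add_pos_nonneg)
  have \<rho>pos: "\<rho> \<tau> > 0" for \<tau> using pos by (simp add: \<rho>_def)
  have \<rho>0: "\<rho> 0 = r" using r by (simp add: \<rho>_def)
  have D\<rho>: "(\<rho> has_field_derivative \<tau> / \<rho> \<tau>) (at \<tau>)" for \<tau>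
    unfolding \<rho>_def using pos[of \<tau>] by (auto intro!: derivative_eq_intros simp: divide_simps)
  define cu where "cu \<tau> = (\<rho> \<tau> *\<^sub>R e, t + 2 * b * \<tau>)" for \<tau>
  have cu0: "cu 0 = p" by (simp add: cu_def p_def \<rho>0)
  \<comment> \<open>Since y is orthogonal to e, the moving point and its representative on the half
    plane have equal horizontal norm, so the symmetry of \<open>v\<close> applies.\<close>
  have nrm: "norm (r *\<^sub>R e + \<tau> *\<^sub>R y) = norm (\<rho> \<tau> *\<^sub>R e)" for \<tau>
  proof -
    have "(r *\<^sub>R e + \<tau> *\<^sub>R y) \<bullet> (r *\<^sub>R e + \<tau> *\<^sub>R y) = r\<^sup>2 * (e \<bullet> e) + \<tau>\<^sup>2 * (y \<bullet> y)"
      using y(2) by (simp add: inner_add_left inner_add_right inner_commute power2_eq_square)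
    also have "\<dots> = r\<^sup>2 + \<tau>\<^sup>2" using y(1) norm_e unfolding norm_eq_1 by simp
    finally show ?thesis using \<rho>pos[of \<tau>] by (simp add: norm_eq_sqrt_inner[of "_ + _"] \<rho>_def)
  qed
  have ptau: "p + \<tau> *\<^sub>R d = (r *\<^sub>R e + \<tau> *\<^sub>R y, t + 2 * b * \<tau>)" for \<tau> by (simp add: p_def d_def)
  have cuO: "cu \<tau> \<in> \<Omega>" if "\<bar>\<tau>\<bar> < \<delta>" for \<tau>
    using \<delta>(2)[OF that] cyl_iff[OF cyl nrm, of \<tau> "t + 2 * b * \<tau>"] by (simp add: ptau cu_def)
  have eq: "v (p + \<tau> *\<^sub>R d) = v (cu \<tau>)" if "\<bar>\<tau>\<bar> < \<delta>" for \<tau>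
    using sym[OF cuO[OF that, unfolded cu_def] nrm] by (simp add: ptau cu_def)
  have Dcu: "(cu has_vector_derivative ((\<tau> / \<rho> \<tau>) *\<^sub>R e, 2 * b)) (at \<tau>)" for \<tau>
  proof -
    have "((\<lambda>\<tau>. \<rho> \<tau> *\<^sub>R e) has_vector_derivative (\<tau> / \<rho> \<tau>) *\<^sub>R e) (at \<tau>)"
      using has_vector_derivative_scaleR[OF D\<rho> has_vector_derivative_const, of e] by simp
    moreover have "((\<lambda>\<tau>. t + 2 * b * \<tau>) has_vector_derivative 2 * b) (at \<tau>)"
      by (auto intro!: derivative_eq_intros)
    ultimately show ?thesis unfolding cu_def[abs_def] by (rule has_vector_derivative_Pair)
  qed
  have split: "pd ((\<tau> / \<rho> \<tau>) *\<^sub>R e, 2 * b) g q = \<tau> / \<rho> \<tau> * pd (e, 0) g q + 2 * b * pd (0, 1) g q"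
    if "smooth_on \<Omega> g" "q \<in> \<Omega>" for g q \<tau>
  proof -
    have "((\<tau> / \<rho> \<tau>) *\<^sub>R e, 2 * b) = (\<tau> / \<rho> \<tau>) *\<^sub>R (e, 0) + (2 * b) *\<^sub>R (0, 1)" by simp
    then show ?thesis
      using smooth_on_differentiable[OF that(1) open_dom that(2)] by (simp only: pd_add_dir pd_scaleR_dir)
  qed
  have first: "pd d v (p + \<tau> *\<^sub>R d) = \<tau> / \<rho> \<tau> * v1 (cu \<tau>) + 2 * b * v2 (cu \<tau>)" if \<tau>: "\<bar>\<tau>\<bar> < \<delta>" for \<tau>
  proof -
    have "((\<lambda>\<tau>. v (cu \<tau>)) has_field_derivative pd ((\<tau> / \<rho> \<tau>) *\<^sub>R e, 2 * b) v (cu \<tau>)) (at \<tau>)"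
      by (rule frechet_curve[OF svO open_dom cuO[OF \<tau>] Dcu])
    moreover have "((\<lambda>\<tau>. v (cu \<tau>)) has_field_derivative pd d v (p + \<tau> *\<^sub>R d)) (at \<tau>)"
      by (rule has_field_derivative_transform_within_open[OF smooth_on_line[OF svO open_dom \<delta>(2)[OF \<tau>]], of "{- \<delta> <..< \<delta>}"])
        (use \<tau> eq in auto)
    ultimately show ?thesis using DERIV_unique split[OF svO cuO[OF \<tau>]] by metis
  qed
  have "((\<lambda>\<tau>. \<tau> / \<rho> \<tau> * v1 (cu \<tau>) + 2 * b * v2 (cu \<tau>)) has_field_derivative
     (1 / r * v1 p + 0 * pd ((0 / \<rho> 0) *\<^sub>R e, 2 * b) v1 p) + 2 * b * pd ((0 / \<rho> 0) *\<^sub>R e, 2 * b) v2 p) (at 0)"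
  proof -
    have q: "((\<lambda>\<tau>. \<tau> / \<rho> \<tau>) has_field_derivative 1 / r) (at 0)"
    proof -
      have "((\<lambda>\<tau>. \<tau> / \<rho> \<tau>) has_field_derivative (1 * \<rho> 0 - 0 * (0 / \<rho> 0)) / (\<rho> 0 * \<rho> 0)) (at 0)"
        by (rule DERIV_divide[OF DERIV_ident D\<rho>]) (use \<rho>pos[of 0] in simp)
      then show ?thesis using r by (simp add: \<rho>0)
    qed
    have c1: "((\<lambda>\<tau>. g (cu \<tau>)) has_field_derivative pd ((0 / \<rho> 0) *\<^sub>R e, 2 * b) g p) (at 0)" if "smooth_on \<Omega> g" for g
      using frechet_curve[OF that open_dom _ Dcu, of 0] pO unfolding cu0 by simp
    have m: "((\<lambda>\<tau>. \<tau> / \<rho> \<tau> * v1 (cu \<tau>)) has_field_derivative 1 / r * v1 p + 0 * pd ((0 / \<rho> 0) *\<^sub>R e, 2 * b) v1 p) (at 0)"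
      using DERIV_mult[OF q c1[OF sO[OF svO]]] by (simp add: cu0 mult.commute)
    show ?thesis by (rule DERIV_add[OF m DERIV_cmult[OF c1[OF sO[OF svO]]]])
  qed
  then have "((\<lambda>\<tau>. pd d v (p + \<tau> *\<^sub>R d)) has_field_derivative
     (1 / r * v1 p + 0 * pd ((0 / \<rho> 0) *\<^sub>R e, 2 * b) v1 p) + 2 * b * pd ((0 / \<rho> 0) *\<^sub>R e, 2 * b) v2 p) (at 0)"
    by (rule has_field_derivative_transform_within_open[where S = "{- \<delta> <..< \<delta>}"]) (use first \<delta>(1) in auto)
  moreover have "((\<lambda>\<tau>. pd d v (p + \<tau> *\<^sub>R d)) has_field_derivative pd d (pd d v) p) (at 0)"
    using smooth_on_line[OF sO[OF svO] open_dom, of p 0 d d] pO by simp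
  ultimately have "pd d (pd d v) p = (1 / r * v1 p + 0) + 2 * b * pd ((0 / \<rho> 0) *\<^sub>R e, 2 * b) v2 p"
    using DERIV_unique by fastforce
  also have "pd ((0 / \<rho> 0) *\<^sub>R e, 2 * b) v2 p = 2 * b * v22 p"
    using split[OF sO[OF svO] pO, of 0] by simp
  finally show ?thesis by (simp add: d_def p_def power2_eq_square)
qed

text \<open>The radial direction contributes v_rr, each of the other 2n - 1 horizontal directions
  v_r / r. The direction Je alone has a vertical component, 2r, at these points and adds 4 r^2
  v_tt.\<close>

lemma slice_equation:
  assumes r: "r > 0" and p: "(r *\<^sub>R e, t) \<in> \<Omega>"
  shows "v11 (r *\<^sub>R e, t) + (2 * real CARD('n) - 1) * (v1 (r *\<^sub>R e, t) / r) + 4 * r\<^sup>2 * v22 (r *\<^sub>R e, t)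
    = (2 * real CARD('n) + 4) * r\<^sup>2"
proof -
  define k0 :: 'n where "k0 = undefined"
  have e: "e = axis (Inl k0) 1" by (simp add: ax_def k0_def)
  let ?p = "(r *\<^sub>R e, t)"
  have XXj: "XX j (XX j v) ?p = pd (axis j 1, 2 * (hJ (r *\<^sub>R e) $ j)) (pd (axis j 1, 2 * (hJ (r *\<^sub>R e) $ j)) v) ?p" for j
    using pd_pd_frozen[OF open_dom svO p] by (simp add: hX_def)
  have Je: "hJ (r *\<^sub>R e) $ j = (if j = Inr k0 then r else 0)" for j
    by (auto simp: hJ_linear_simps e hJ_nth axis_def split: sum.splits)
  have A: "XX (Inl k0) (XX (Inl k0) v) ?p = v11 ?p" unfolding XXj Je by (simp add: e)
  have B: "XX j (XX j v) ?p = v1 ?p / r + (if j = Inr k0 then 4 * r\<^sup>2 * v22 ?p else 0)" if "j \<noteq> Inl k0" for j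
    unfolding XXj Je using transversal_second_derivative[OF r p, of "axis j 1" "if j = Inr k0 then r else 0"] that
    by (auto simp: e inner_axis_axis)
  have "lapH v ?p = XX (Inl k0) (XX (Inl k0) v) ?p + (\<Sum>j\<in>UNIV - {Inl k0}. XX j (XX j v) ?p)"
    unfolding lapH_def by (subst sum.remove[of UNIV "Inl k0"]) auto
  also have "(\<Sum>j\<in>UNIV - {Inl k0}. XX j (XX j v) ?p)
      = (\<Sum>j\<in>UNIV - {Inl k0}. v1 ?p / r + (if j = Inr k0 then 4 * r\<^sup>2 * v22 ?p else 0))"
    by (rule sum.cong) (auto simp: B)
  also have "\<dots> = (2 * real CARD('n) - 1) * (v1 ?p / r) + 4 * r\<^sup>2 * v22 ?p"
  proof -
    have "0 < CARD('n)" by simp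
    then have "real (CARD('n) + CARD('n) - Suc 0) = 2 * real CARD('n) - 1"
      by (subst of_nat_diff) (linarith, simp)
    then show ?thesis by (simp add: sum.distrib sum.delta card_Diff_singleton card_UNIV_sum)
  qed
  finally show ?thesis using lap[OF p] by (simp add: A)
qed

text \<open>This is |D_H v|^2 / (4 |x|^2) - v for a cylindrically symmetric \<open>v\<close>, by
  \<open>hgrad_sq_radial\<close>.\<close>

definition PP :: "real \<Rightarrow> real \<Rightarrow> real" where
  "PP r t = (v1 (r *\<^sub>R e, t))\<^sup>2 / (4 * r\<^sup>2) + (v2 (r *\<^sub>R e, t))\<^sup>2 - v (r *\<^sub>R e, t)"

definition PPr :: "real \<Rightarrow> real \<Rightarrow> real" where
  "PPr r t = (let p = (r *\<^sub>R e, t) in v1 p * v11 p / (2 * r\<^sup>2) - (v1 p)\<^sup>2 / (2 * r ^ 3) + 2 * v2 p * v12 p - v1 p)"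

definition PPt :: "real \<Rightarrow> real \<Rightarrow> real" where
  "PPt r t = (let p = (r *\<^sub>R e, t) in v1 p * v12 p / (2 * r\<^sup>2) + 2 * v2 p * v22 p - v2 p)"

lemma line_r:
  assumes "smooth_on \<Omega> g" "(r *\<^sub>R e, t) \<in> \<Omega>"
  shows "((\<lambda>r. g (r *\<^sub>R e, t)) has_field_derivative pd (e, 0) g (r *\<^sub>R e, t)) (at r)"
  using smooth_on_line[OF assms(1) open_dom, of "(0, t)" r "(e, 0)"] assms(2) by simp

lemma line_t:
  assumes "smooth_on \<Omega> g" "(r *\<^sub>R e, t) \<in> \<Omega>"
  shows "((\<lambda>t. g (r *\<^sub>R e, t)) has_field_derivative pd (0, 1) g (r *\<^sub>R e, t)) (at t)"
  using smooth_on_line[OF assms(1) open_dom, of "(r *\<^sub>R e, 0)" t "(0, 1)"] assms(2) by simp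

lemma v21: "p \<in> \<Omega> \<Longrightarrow> pd (e, 0) v2 p = v12 p"
  by (rule pd_commute[OF open_dom svO])

text \<open>The equation holds on an open piece of the half plane, so it may be differentiated in r
  and in t; \<open>P_function_identity\<close> then applies to the derivatives of \<open>v\<close>
  at the point.\<close>

lemma PP_derivatives:
  assumes r: "r > 0" and p: "(r *\<^sub>R e, t) \<in> \<Omega>"
  shows "((\<lambda>r. PP r t) has_field_derivative PPr r t) (at r)"
    and "((\<lambda>t. PP r t) has_field_derivative PPt r t) (at t)"
    and "\<exists>Drr Dtt. ((\<lambda>r. PPr r t) has_field_derivative Drr) (at r) \<and> ((\<lambda>t. PPt r t) has_field_derivative Dtt) (at t) \<and>
      Drr + (2 * real CARD('n) - 1) / r * PPr r t + 4 * r\<^sup>2 * Dtt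
      = 8 * r\<^sup>2 * ((v11 (r *\<^sub>R e, t) / (4 * r\<^sup>2) - v1 (r *\<^sub>R e, t) / (4 * r ^ 3) - 1/2)\<^sup>2 + (v22 (r *\<^sub>R e, t) - 1/2)\<^sup>2
         + real CARD('n) * (v1 (r *\<^sub>R e, t) / (2 * r ^ 3) - 1/2)\<^sup>2 + 2 * (v12 (r *\<^sub>R e, t) / (2 * r))\<^sup>2)"
proof -
  let ?p = "(r *\<^sub>R e, t)"
  have s1: "smooth_on \<Omega> v1" and s2: "smooth_on \<Omega> v2" and s11: "smooth_on \<Omega> v11" and s12: "smooth_on \<Omega> v12" and s22: "smooth_on \<Omega> v22"
    by (intro sO svO)+
  define v111 v112 v122 v222 where "v111 = pd (e, 0) v11 ?p" and "v112 = pd (0, 1) v11 ?p" and "v122 = pd (0, 1) v12 ?p" and "v222 = pd (0, 1) v22 ?p"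
  note Dr = line_r[OF svO p] line_r[OF s1 p] line_r[OF s2 p, unfolded v21[OF p]] line_r[OF s11 p, folded v111_def]
  note Dt = line_t[OF svO p] line_t[OF s1 p] line_t[OF s2 p] line_t[OF s12 p, folded v122_def] line_t[OF s22 p, folded v222_def] line_t[OF s11 p, folded v112_def]
  have r12: "((\<lambda>r. v12 (r *\<^sub>R e, t)) has_field_derivative v112) (at r)"
    using line_r[OF s12 p] pd_commute[OF open_dom s1 p, of "(e, 0)" "(0, 1)"] by (simp add: v112_def)
  have r22: "((\<lambda>r. v22 (r *\<^sub>R e, t)) has_field_derivative v122) (at r)"
  proof -
    have "pd (e, 0) v22 ?p = pd (0, 1) (pd (e, 0) v2) ?p" by (rule pd_commute[OF open_dom s2 p])
    also have "\<dots> = v122" unfolding v122_def by (rule pd_cong[OF open_dom p]) (rule v21)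
    finally show ?thesis using line_r[OF s22 p] by simp
  qed
  have r0: "r \<noteq> 0" using r by simp
  show "((\<lambda>r. PP r t) has_field_derivative PPr r t) (at r)"
    using DERIV_P[OF Dr(2,3,1) DERIV_inv_power[OF r0, of "1/4" 2]] r0
    unfolding PP_def PPr_def Let_def by (simp add: numeral_3_eq_3 mult_ac)
  show "((\<lambda>t. PP r t) has_field_derivative PPt r t) (at t)"
    using DERIV_P[OF Dt(2,3,1) DERIV_const[of "1 / (4 * r\<^sup>2)"]]
    unfolding PP_def PPt_def Let_def by (simp add: mult_ac)
  obtain \<delta> where \<delta>: "\<delta> > 0" "\<And>\<tau>. \<bar>\<tau>\<bar> < \<delta> \<Longrightarrow> ?p + \<tau> *\<^sub>R (e, 0) \<in> \<Omega>" using near_dom[OF p] by blast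
  obtain \<eta> where \<eta>: "\<eta> > 0" "\<And>\<tau>. \<bar>\<tau>\<bar> < \<eta> \<Longrightarrow> ?p + \<tau> *\<^sub>R (0, 1) \<in> \<Omega>" using near_dom[OF p] by blast
  define N where "N = real CARD('n)"
  \<comment> \<open>The maximum with 0 keeps the radial variable positive, as
    \<open>slice_equation\<close> demands.\<close>
  have eqr: "v11 (s *\<^sub>R e, t) + (2 * N - 1) * (v1 (s *\<^sub>R e, t) / s) + 4 * s\<^sup>2 * v22 (s *\<^sub>R e, t) = (2 * N + 4) * s\<^sup>2"
    if "s \<in> {max 0 (r - \<delta>) <..< r + \<delta>}" for s
    using slice_equation[of s t] \<delta>(2)[of "s - r"] that by (auto simp: scaleR_left_diff_distrib N_def)
  have eqt: "v11 (r *\<^sub>R e, s) + (2 * N - 1) * (v1 (r *\<^sub>R e, s) / r) + 4 * r\<^sup>2 * v22 (r *\<^sub>R e, s) = (2 * N + 4) * r\<^sup>2"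
    if "s \<in> {t - \<eta> <..< t + \<eta>}" for s
    using slice_equation[OF r, of s] \<eta>(2)[of "s - t"] that by (auto simp: N_def)
  \<comment> \<open>Both sides of the equation agree near the point, so uniqueness of the derivative
    gives the differentiated equation.\<close>
  have Er: "v111 + (2 * N - 1) * (v11 ?p / r - v1 ?p / r\<^sup>2) + (8 * r * v22 ?p + 4 * r\<^sup>2 * v122) = 2 * (2 * N + 4) * r"
  proof (rule DERIV_unique)
    show "((\<lambda>s. v11 (s *\<^sub>R e, t) + (2 * N - 1) * (v1 (s *\<^sub>R e, t) / s) + 4 * s\<^sup>2 * v22 (s *\<^sub>R e, t)) has_field_derivative
       v111 + (2 * N - 1) * (v11 ?p / r - v1 ?p / r\<^sup>2) + (8 * r * v22 ?p + 4 * r\<^sup>2 * v122)) (at r)"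
      by (rule DERIV_slice_operator[OF Dr(2,4) r22 r0])
    have "((\<lambda>s. (2 * N + 4) * s\<^sup>2) has_field_derivative 2 * (2 * N + 4) * r) (at r)"
      by (auto intro!: derivative_eq_intros)
    then show "((\<lambda>s. v11 (s *\<^sub>R e, t) + (2 * N - 1) * (v1 (s *\<^sub>R e, t) / s) + 4 * s\<^sup>2 * v22 (s *\<^sub>R e, t)) has_field_derivative
       2 * (2 * N + 4) * r) (at r)"
      by (rule has_field_derivative_transform_within_open[where S = "{max 0 (r - \<delta>) <..< r + \<delta>}"]) (use eqr r \<delta>(1) in auto)
  qed
  have Et: "v112 + (2 * N - 1) * (v12 ?p / r) + 4 * r\<^sup>2 * v222 = 0"
  proof (rule DERIV_unique)
    show "((\<lambda>s. v11 (r *\<^sub>R e, s) + (2 * N - 1) * (v1 (r *\<^sub>R e, s) / r) + 4 * r\<^sup>2 * v22 (r *\<^sub>R e, s)) has_field_derivative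
       v112 + (2 * N - 1) * (v12 ?p / r) + 4 * r\<^sup>2 * v222) (at t)"
      by (intro DERIV_add DERIV_cmult DERIV_cdivide Dt)
    have "((\<lambda>s. (2 * N + 4) * r\<^sup>2) has_field_derivative 0) (at t)" by simp
    then show "((\<lambda>s. v11 (r *\<^sub>R e, s) + (2 * N - 1) * (v1 (r *\<^sub>R e, s) / r) + 4 * r\<^sup>2 * v22 (r *\<^sub>R e, s)) has_field_derivative 0) (at t)"
      by (rule has_field_derivative_transform_within_open[where S = "{t - \<eta> <..< t + \<eta>}"]) (use eqt \<eta>(1) in auto)
  qed
  have E: "v11 ?p + (2 * N - 1) * (v1 ?p / r) + 4 * r\<^sup>2 * v22 ?p = (2 * N + 4) * r\<^sup>2"
    using slice_equation[OF r p] by (simp add: N_def)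
  have Drr: "((\<lambda>r. PPr r t) has_field_derivative
      (((v11 ?p)\<^sup>2 + v1 ?p * v111) / (2 * r\<^sup>2) - 2 * v1 ?p * v11 ?p / r ^ 3 + 3 * (v1 ?p)\<^sup>2 / (2 * r ^ 4) + 2 * (v12 ?p)\<^sup>2 + 2 * v2 ?p * v112 - v11 ?p)) (at r)"
  proof -
    have "((\<lambda>r. PPr r t) has_field_derivative
      (v11 ?p * v11 ?p + v1 ?p * v111) * (1 / 2 / r\<^sup>2) + v1 ?p * v11 ?p * - (1 / 2 * real 2 / r ^ Suc 2)
       - (2 * v1 ?p * v11 ?p * (1 / 2 / r ^ 3) + (v1 ?p)\<^sup>2 * - (1 / 2 * real 3 / r ^ Suc 3)) + 2 * (v12 ?p * v12 ?p + v2 ?p * v112) - v11 ?p) (at r)"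
      using DERIV_Pr[OF Dr(2,4,3) r12 DERIV_inv_power[OF r0, of "1/2" 2] DERIV_inv_power[OF r0, of "1/2" 3] Dr(2)]
      unfolding PPr_def Let_def by simp
    moreover have "(v11 ?p * v11 ?p + v1 ?p * v111) * (1 / 2 / r\<^sup>2) + v1 ?p * v11 ?p * - (1 / 2 * real 2 / r ^ Suc 2)
       - (2 * v1 ?p * v11 ?p * (1 / 2 / r ^ 3) + (v1 ?p)\<^sup>2 * - (1 / 2 * real 3 / r ^ Suc 3)) + 2 * (v12 ?p * v12 ?p + v2 ?p * v112) - v11 ?p
      = ((v11 ?p)\<^sup>2 + v1 ?p * v111) / (2 * r\<^sup>2) - 2 * v1 ?p * v11 ?p / r ^ 3 + 3 * (v1 ?p)\<^sup>2 / (2 * r ^ 4) + 2 * (v12 ?p)\<^sup>2 + 2 * v2 ?p * v112 - v11 ?p"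
      using r0 by (simp add: field_simps power2_eq_square eval_nat_numeral)
    ultimately show ?thesis by (rule DERIV_cong)
  qed
  have Dtt: "((\<lambda>t. PPt r t) has_field_derivative
      (((v12 ?p)\<^sup>2 + v1 ?p * v122) / (2 * r\<^sup>2) + 2 * (v22 ?p)\<^sup>2 + 2 * v2 ?p * v222 - v22 ?p)) (at t)"
    using DERIV_Pr[OF Dt(2,4,3,5) DERIV_const[of "1 / (2 * r\<^sup>2)"] DERIV_const[of 0] Dt(3)]
    unfolding PPt_def Let_def by (simp add: power2_eq_square add_divide_distrib algebra_simps)
  show "\<exists>Drr Dtt. ((\<lambda>r. PPr r t) has_field_derivative Drr) (at r) \<and> ((\<lambda>t. PPt r t) has_field_derivative Dtt) (at t) \<and>
      Drr + (2 * real CARD('n) - 1) / r * PPr r t + 4 * r\<^sup>2 * Dtt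
      = 8 * r\<^sup>2 * ((v11 (r *\<^sub>R e, t) / (4 * r\<^sup>2) - v1 (r *\<^sub>R e, t) / (4 * r ^ 3) - 1/2)\<^sup>2 + (v22 (r *\<^sub>R e, t) - 1/2)\<^sup>2
         + real CARD('n) * (v1 (r *\<^sub>R e, t) / (2 * r ^ 3) - 1/2)\<^sup>2 + 2 * (v12 (r *\<^sub>R e, t) / (2 * r))\<^sup>2)"
    using Drr Dtt P_function_identity[OF r E Er Et refl refl refl, of "v2 ?p"]
    unfolding N_def PPr_def Let_def by blast
qed

end

section \<open>Maximum principle for the P-function\<close>

context overdetermined
begin

lemma closure_eq: "closure \<Omega> = \<Omega> \<union> frontier \<Omega>"
  using closure_Un_frontier by blast

lemma bounded_on_closure:
  assumes "smooth_on U g"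
  obtains B where "B > 0" "\<And>\<xi>. \<xi> \<in> closure \<Omega> \<Longrightarrow> \<bar>g \<xi>\<bar> \<le> B"
proof -
  have "bounded (g ` closure \<Omega>)"
    by (rule compact_imp_bounded[OF compact_continuous_image[OF continuous_on_subset[OF smooth_on_continuous[OF assms] U(2)] compact_closure_dom]])
  then obtain B where B: "\<And>\<xi>. \<xi> \<in> closure \<Omega> \<Longrightarrow> \<bar>g \<xi>\<bar> \<le> B" unfolding bounded_iff by auto
  show ?thesis
  proof (rule that[of "max B 1"])
    show "\<bar>g \<xi>\<bar> \<le> max B 1" if "\<xi> \<in> closure \<Omega>" for \<xi>
      using B[OF that] by linarith
  qed simp
qed

lemma sU: "smooth_on U g \<Longrightarrow> smooth_on U (pd b g)"
  by (rule smooth_on_pd[OF U(1)])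

text \<open>The circle through the point in the plane of e and Je stays in the frontier, where
  \<open>v\<close> is zero.\<close>

lemma tangential_derivative:
  assumes r: "r > 0" and p: "(r *\<^sub>R e, t) \<in> frontier \<Omega>"
  shows "pd (hJ e, 0) v (r *\<^sub>R e, t) = 0"
proof -
  define cu where "cu \<theta> = (cos \<theta> *\<^sub>R (r *\<^sub>R e) + sin \<theta> *\<^sub>R hJ (r *\<^sub>R e), t)" for \<theta>
  have cu0: "cu 0 = (r *\<^sub>R e, t)" by (simp add: cu_def)
  have zero: "v (cu \<theta>) = 0" for \<theta>
    unfolding cu_def by (rule v0[OF rotation_frontier[OF cyl hJ_rotation p]])
  have "(cu has_derivative (\<lambda>h. h *\<^sub>R (hJ (r *\<^sub>R e), 0))) (at 0)"
    unfolding cu_def[abs_def] by (auto intro!: derivative_eq_intros simp: fun_eq_iff)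
  then have "(cu has_vector_derivative (hJ (r *\<^sub>R e), 0)) (at 0)" by (simp only: has_vector_derivative_def)
  moreover have pU: "(r *\<^sub>R e, t) \<in> U" using p U(2) closure_eq by blast
  ultimately have "((\<lambda>\<theta>. v (cu \<theta>)) has_field_derivative pd (hJ (r *\<^sub>R e), 0) v (r *\<^sub>R e, t)) (at 0)"
    using frechet_curve[OF sv U(1), of cu 0] by (simp only: cu0)
  then have "pd (hJ (r *\<^sub>R e), 0) v (r *\<^sub>R e, t) = 0"
    using DERIV_unique[of "\<lambda>\<theta>. v (cu \<theta>)" _ 0 0] by (simp add: zero)
  then have "pd (r *\<^sub>R (hJ e, 0)) v (r *\<^sub>R e, t) = 0" by (simp add: hJ_linear_simps)
  then show ?thesis using pd_scaleR_dir[OF smooth_on_differentiable[OF sv U(1) pU], of r "(hJ e, 0)"] r by simp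
qed

lemma XX_e: "XX (Inl undefined) v (r *\<^sub>R e, t) = v1 (r *\<^sub>R e, t)"
  by (simp add: XX_def ax_def hJ_linear_simps)

text \<open>Only the components of the gradient along e and Je are kept, hence an inequality; the
  second is 2 r v_t because the tangential derivative vanishes.\<close>

lemma PP_frontier_le:
  assumes r: "r > 0" and p: "(r *\<^sub>R e, t) \<in> frontier \<Omega>"
  shows "PP r t \<le> c\<^sup>2 / 4"
proof -
  define k0 :: 'n where "k0 = undefined"
  let ?p = "(r *\<^sub>R e, t)"
  have Je: "hJ e = axis (Inr k0) 1" by (auto simp: ax_def vec_eq_iff hJ_nth axis_def k0_def split: sum.splits)
  have "hJ (r *\<^sub>R e) $ Inr k0 = r" by (simp add: hJ_linear_simps Je)
  then have X2: "XX (Inr k0) v ?p = 2 * r * v2 ?p"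
    using tangential_derivative[OF r p] by (simp add: XX_def Je)
  have X1: "XX (Inl k0) v ?p = v1 ?p" using XX_e[of r t] by (simp only: k0_def)
  have "(\<Sum>j\<in>{Inl k0, Inr k0}. (hgrad v ?p $ j)\<^sup>2) \<le> (norm (hgrad v ?p))\<^sup>2"
    unfolding norm_sq_sum by (rule sum_mono2) auto
  also have "norm (hgrad v ?p) = c * r" using grad[OF p] r by simp
  finally have "(v1 ?p)\<^sup>2 + (2 * r * v2 ?p)\<^sup>2 \<le> c\<^sup>2 * r\<^sup>2"
    using X1 by (simp add: hgrad_nth X2 power_mult_distrib)
  then have "((v1 ?p)\<^sup>2 + (2 * r * v2 ?p)\<^sup>2) / (4 * r\<^sup>2) \<le> c\<^sup>2 * r\<^sup>2 / (4 * r\<^sup>2)"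
    by (rule divide_right_mono) simp
  then show ?thesis using r v0[OF p] by (simp add: PP_def add_divide_distrib power_mult_distrib)
qed

text \<open>Moving inward from the point, one reaches either the axis, where v_r = 0 by reflection
  symmetry, or the frontier at some radius \<rho>, where the gradient condition gives |v_r| <= c
  \<rho>. A bound on v_rr covers the rest of the way. It is this linear bound that keeps v_r^2 / (4
  r^2) bounded near the axis.\<close>

lemma radial_derivative_bound:
  obtains C where "C > 0" "\<And>r t. r > 0 \<Longrightarrow> (r *\<^sub>R e, t) \<in> \<Omega> \<Longrightarrow> \<bar>v1 (r *\<^sub>R e, t)\<bar> \<le> C * r"
proof -
  obtain B where B: "B > 0" "\<And>\<xi>. \<xi> \<in> closure \<Omega> \<Longrightarrow> \<bar>v11 \<xi>\<bar> \<le> B" using bounded_on_closure[OF sU[OF sU[OF sv]]] by blast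
  show ?thesis
  proof (rule that[of "max c B"])
    show "max c B > 0" using c by simp
    fix r t assume r: "r > 0" and p: "(r *\<^sub>R e, t) \<in> \<Omega>"
    have ex: "\<exists>\<rho>\<ge>0. \<rho> < r \<and> \<bar>v1 (\<rho> *\<^sub>R e, t)\<bar> \<le> c * \<rho> \<and> (\<forall>s\<in>{\<rho>..r}. (s *\<^sub>R e, t) \<in> closure \<Omega>)"
    proof (cases "\<forall>s\<in>{0..r}. (s *\<^sub>R e, t) \<in> \<Omega>")
      case True
      then have zO: "(0 *\<^sub>R e, t) \<in> \<Omega>" using r by force
      obtain \<delta> where \<delta>: "\<delta> > 0" "\<And>\<tau>. \<bar>\<tau>\<bar> < \<delta> \<Longrightarrow> (0 *\<^sub>R e, t) + \<tau> *\<^sub>R (e, 0) \<in> \<Omega>" using near_dom[OF zO] by blast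
      have D: "((\<lambda>s. v (s *\<^sub>R e, t)) has_field_derivative v1 (0 *\<^sub>R e, t)) (at 0)" by (rule line_r[OF svO zO])
      have "((\<lambda>s. v ((- s) *\<^sub>R e, t)) has_field_derivative v1 (0 *\<^sub>R e, t) * - 1) (at 0)"
        by (rule DERIV_chain2[where f = "\<lambda>s. v (s *\<^sub>R e, t)" and g = uminus])
          (use D in \<open>auto intro!: derivative_eq_intros\<close>)
      then have "((\<lambda>s. v (s *\<^sub>R e, t)) has_field_derivative v1 (0 *\<^sub>R e, t) * - 1) (at 0)"
      proof (rule has_field_derivative_transform_within_open[where S = "{- \<delta> <..< \<delta>}"])
        show "v ((- s) *\<^sub>R e, t) = v (s *\<^sub>R e, t)" if "s \<in> {- \<delta> <..< \<delta>}" for s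
          using sym[of "s *\<^sub>R e" t "(- s) *\<^sub>R e"] \<delta>(2)[of s] that by (simp add: abs_less_iff)
      qed (use \<delta> in auto)
      from DERIV_unique[OF D this] have "v1 (0 *\<^sub>R e, t) = 0" by linarith
      then show ?thesis using True r closure_subset[of \<Omega>] by (intro exI[of _ 0]) (auto simp: subset_eq)
    next
      case False
      \<comment> \<open>The largest element is the radius where the inward ray first leaves
        \<Omega>; by continuity of \<open>f\<close> that point lies on the frontier.\<close>
      define S where "S = {s \<in> {0..r}. f (s *\<^sub>R e, t) \<ge> 0}"
      have "closed S"
      proof -
        have "continuous_on UNIV (\<lambda>s. f (s *\<^sub>R e, t))"
          by (intro continuous_on_compose2[OF smooth_on_continuous[OF smooth_f]] continuous_intros) auto
        then have "closed {s. 0 \<le> f (s *\<^sub>R e, t)}" by (intro closed_Collect_le continuous_intros)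
        then have "closed ({0..r} \<inter> {s. 0 \<le> f (s *\<^sub>R e, t)})" by (intro closed_Int) auto
        moreover have "S = {0..r} \<inter> {s. 0 \<le> f (s *\<^sub>R e, t)}" by (auto simp: S_def)
        ultimately show ?thesis by simp
      qed
      moreover have "bounded S" by (rule bounded_subset[OF bounded_closed_interval[of 0 r]]) (auto simp: S_def)
      ultimately have Sc: "compact S" by (simp add: compact_eq_bounded_closed)
      have "S \<noteq> {}" using False by (force simp: S_def dom_eq not_less)
      then obtain \<rho> where \<rho>: "\<rho> \<in> S" "\<And>s. s \<in> S \<Longrightarrow> s \<le> \<rho>" using compact_attains_sup[OF Sc] by blast
      have fr: "f (r *\<^sub>R e, t) < 0" using p by (simp add: dom_eq)
      have \<rho>1: "0 \<le> \<rho>" "\<rho> < r" "f (\<rho> *\<^sub>R e, t) \<ge> 0"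
        using \<rho>(1) fr by (auto simp: S_def less_le)
      have inO: "(s *\<^sub>R e, t) \<in> \<Omega>" if "\<rho> < s" "s \<le> r" for s
        using \<rho>(2)[of s] that \<rho>1(1) by (force simp: S_def dom_eq not_le)
      have "f (\<rho> *\<^sub>R e, t) \<le> 0"
      proof (rule tendsto_upperbound)
        have "continuous_on UNIV (\<lambda>s. f (s *\<^sub>R e, t))"
          by (intro continuous_on_compose2[OF smooth_on_continuous[OF smooth_f]] continuous_intros) auto
        then have "isCont (\<lambda>s. f (s *\<^sub>R e, t)) \<rho>" using continuous_on_eq_continuous_at[OF open_UNIV] by blast
        then show "((\<lambda>s. f (s *\<^sub>R e, t)) \<longlongrightarrow> f (\<rho> *\<^sub>R e, t)) (at_right \<rho>)"
          unfolding isCont_def by (rule filterlim_mono) (auto simp: at_le)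
        show "eventually (\<lambda>s. f (s *\<^sub>R e, t) \<le> 0) (at_right \<rho>)"
          by (rule eventually_at_rightI[OF _ \<rho>1(2)]) (use inO in \<open>force simp: dom_eq\<close>)
      qed simp
      then have pf: "(\<rho> *\<^sub>R e, t) \<in> frontier \<Omega>" using \<rho>1(3) by (simp add: frontier_eq)
      have "\<bar>v1 (\<rho> *\<^sub>R e, t)\<bar> \<le> norm (hgrad v (\<rho> *\<^sub>R e, t))"
        using component_le_norm_cart[of "hgrad v (\<rho> *\<^sub>R e, t)" "Inl undefined"] XX_e[of \<rho> t] by (simp add: hgrad_nth)
      also have "\<dots> = c * \<rho>" using grad[OF pf] \<rho>1 by simp
      finally have "\<bar>v1 (\<rho> *\<^sub>R e, t)\<bar> \<le> c * \<rho>" .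
      moreover have "(s *\<^sub>R e, t) \<in> closure \<Omega>" if "s \<in> {\<rho>..r}" for s
        using inO[of s] pf that closure_eq by (cases "s = \<rho>") auto
      ultimately show ?thesis using \<rho>1 by blast
    qed
    then obtain \<rho> where \<rho>: "0 \<le> \<rho>" "\<rho> < r" "\<bar>v1 (\<rho> *\<^sub>R e, t)\<bar> \<le> c * \<rho>" "\<And>s. s \<in> {\<rho>..r} \<Longrightarrow> (s *\<^sub>R e, t) \<in> closure \<Omega>" by blast
    have "\<exists>s>\<rho>. s < r \<and> v1 (r *\<^sub>R e, t) - v1 (\<rho> *\<^sub>R e, t) = (r - \<rho>) * v11 (s *\<^sub>R e, t)"
    proof (rule MVT2[OF \<rho>(2)])
      fix s assume "\<rho> \<le> s" "s \<le> r"
      then have "(s *\<^sub>R e, t) \<in> U" using \<rho>(4) U(2) by auto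
      then show "((\<lambda>s. v1 (s *\<^sub>R e, t)) has_field_derivative v11 (s *\<^sub>R e, t)) (at s)"
        using smooth_on_line[OF sU[OF sv] U(1), of "(0, t)" s "(e, 0)"] by simp
    qed
    then obtain s where s: "\<rho> < s" "s < r" "v1 (r *\<^sub>R e, t) - v1 (\<rho> *\<^sub>R e, t) = (r - \<rho>) * v11 (s *\<^sub>R e, t)" by blast
    have "\<bar>v1 (r *\<^sub>R e, t)\<bar> \<le> c * \<rho> + (r - \<rho>) * B"
    proof -
      have "\<bar>(r - \<rho>) * v11 (s *\<^sub>R e, t)\<bar> \<le> (r - \<rho>) * B"
        unfolding abs_mult using B(2)[OF \<rho>(4)[of s]] s \<rho> by (intro mult_mono) auto
      then show ?thesis using s(3) \<rho>(3) by linarith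
    qed
    also have "\<dots> \<le> max c B * \<rho> + (r - \<rho>) * max c B"
      using \<rho> by (intro add_mono mult_right_mono mult_left_mono) auto
    finally show "\<bar>v1 (r *\<^sub>R e, t)\<bar> \<le> max c B * r" by (simp add: algebra_simps)
  qed
qed

text \<open>The logarithmic term is \<open>L\<close>-subharmonic and tends to \<open>-\<infinity>\<close> on the axis, so the maximum
  principle does not see the axis, where \<open>PP\<close> is only known to be bounded.\<close>

lemma PP_le:
  assumes r0: "r0 > 0" and p0: "(r0 *\<^sub>R e, t0) \<in> \<Omega>"
  shows "PP r0 t0 \<le> c\<^sup>2 / 4"
proof (rule ccontr)
  assume "\<not> ?thesis"
  then have big: "PP r0 t0 > c\<^sup>2 / 4" by simp
  obtain C where C: "C > 0" "\<And>r t. r > 0 \<Longrightarrow> (r *\<^sub>R e, t) \<in> \<Omega> \<Longrightarrow> \<bar>v1 (r *\<^sub>R e, t)\<bar> \<le> C * r" using radial_derivative_bound by blast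
  obtain B2 where B2: "B2 > 0" "\<And>\<xi>. \<xi> \<in> closure \<Omega> \<Longrightarrow> \<bar>v2 \<xi>\<bar> \<le> B2" using bounded_on_closure[OF sU[OF sv]] by blast
  obtain B0 where B0: "B0 > 0" "\<And>\<xi>. \<xi> \<in> closure \<Omega> \<Longrightarrow> \<bar>v \<xi>\<bar> \<le> B0" using bounded_on_closure[OF sv] by blast
  \<comment> \<open>A crude bound for P on the whole closure off the axis, from the bounds on v_r /
    r, v_t and \<open>v\<close>.\<close>
  define A where "A = max (c\<^sup>2 / 4) (C\<^sup>2 / 4 + B2\<^sup>2 + B0)"
  have PA: "PP r t \<le> A" if "r > 0" "(r *\<^sub>R e, t) \<in> closure \<Omega>" for r t
  proof (cases "(r *\<^sub>R e, t) \<in> \<Omega>")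
    case False
    then have "PP r t \<le> c\<^sup>2 / 4" using PP_frontier_le[OF that(1)] that(2) closure_eq by blast
    then show ?thesis unfolding A_def by linarith
  next
    case True
    have "(v1 (r *\<^sub>R e, t))\<^sup>2 \<le> (C * r)\<^sup>2" using C(2)[OF that(1) True] C(1) that(1) by (simp add: abs_le_square_iff[symmetric])
    then have "(v1 (r *\<^sub>R e, t))\<^sup>2 / (4 * r\<^sup>2) \<le> (C * r)\<^sup>2 / (4 * r\<^sup>2)" by (rule divide_right_mono) simp
    then have 1: "(v1 (r *\<^sub>R e, t))\<^sup>2 / (4 * r\<^sup>2) \<le> C\<^sup>2 / 4" using that(1) by (simp add: power_mult_distrib)
    have 2: "(v2 (r *\<^sub>R e, t))\<^sup>2 \<le> B2\<^sup>2" using B2(2)[OF that(2)] B2(1) by (simp add: abs_le_square_iff[symmetric])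
    have 3: "- v (r *\<^sub>R e, t) \<le> B0" using B0(2)[OF that(2)] by linarith
    show ?thesis using 1 2 3 by (simp add: PP_def A_def)
  qed
  obtain R where R: "\<And>\<xi>. \<xi> \<in> closure \<Omega> \<Longrightarrow> norm \<xi> \<le> R"
    using compact_imp_bounded[OF compact_closure_dom] unfolding bounded_iff by blast
  have rR: "r \<le> R" "\<bar>t\<bar> \<le> R" if "r > 0" "(r *\<^sub>R e, t) \<in> closure \<Omega>" for r t
    using R[OF that(2)] norm_fst_le[of "r *\<^sub>R e" t] norm_snd_le[of t "r *\<^sub>R e"] that(1) by auto
  have p0c: "(r0 *\<^sub>R e, t0) \<in> closure \<Omega>" using p0 closure_eq by blast
  have Rp: "R > 0" using rR(1)[OF r0 p0c] r0 by simp
  define M where "M = 2 * ln R + R\<^sup>2"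
  \<comment> \<open>The operator applied to 2 ln r gives (2n - 2) 2 / r^2, nonnegative as n >= 1;
    the summand t^2 adds 8 r^2 and makes the total strictly positive.\<close>
  define m where "m r t = 2 * ln r + t\<^sup>2" for r t :: real
  have mM: "m r t \<le> M" if "r > 0" "(r *\<^sub>R e, t) \<in> closure \<Omega>" for r t
  proof -
    have "ln r \<le> ln R" using rR(1)[OF that] that(1) by simp
    moreover have "t\<^sup>2 \<le> R\<^sup>2" using rR(2)[OF that] Rp by (simp add: abs_le_square_iff[symmetric])
    ultimately show ?thesis by (simp add: m_def M_def)
  qed
  \<comment> \<open>Chosen so that the perturbed function at the given point still exceeds its bound
    on the frontier.\<close>
  define \<epsilon> where "\<epsilon> = (PP r0 t0 - c\<^sup>2 / 4) / (2 * (M - m r0 t0 + 1))"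
  have Mm: "M - m r0 t0 \<ge> 0" using mM[OF r0 p0c] by simp
  have \<epsilon>: "\<epsilon> > 0" using big Mm by (simp add: \<epsilon>_def)
  have \<epsilon>M: "c\<^sup>2 / 4 + \<epsilon> * M < PP r0 t0 + \<epsilon> * m r0 t0"
  proof -
    have "\<epsilon> * (2 * (M - m r0 t0 + 1)) = PP r0 t0 - c\<^sup>2 / 4" using Mm by (simp add: \<epsilon>_def)
    moreover have "\<epsilon> * (M - m r0 t0) < \<epsilon> * (2 * (M - m r0 t0 + 1))"
      using less_double_add_1[OF Mm] \<epsilon> by (rule mult_strict_left_mono)
    ultimately show ?thesis by (simp add: right_diff_distrib)
  qed
  define G where "G r t = PP r t + \<epsilon> * m r t" for r t
  \<comment> \<open>So close to the axis that the logarithm pushes the perturbed function below its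
    value at the given point on r = \<eta>; the bound r0 / 2 keeps that point in the region.\<close>
  define \<eta> where "\<eta> = min (r0 / 2) (exp ((G r0 t0 - A - \<epsilon> * R\<^sup>2) / (2 * \<epsilon>) - 1))"
  have \<eta>: "\<eta> > 0" "\<eta> < r0" using r0 by (auto simp: \<eta>_def)
  have ln\<eta>: "A + \<epsilon> * (2 * ln \<eta> + R\<^sup>2) < G r0 t0"
  proof -
    have "ln \<eta> \<le> ln (exp ((G r0 t0 - A - \<epsilon> * R\<^sup>2) / (2 * \<epsilon>) - 1))" using \<eta>(1) by (subst ln_le_cancel_iff) (auto simp: \<eta>_def)
    then have "ln \<eta> < (G r0 t0 - A - \<epsilon> * R\<^sup>2) / (2 * \<epsilon>)" by simp
    then have "ln \<eta> * (2 * \<epsilon>) < G r0 t0 - A - \<epsilon> * R\<^sup>2" using \<epsilon> by (simp add: less_divide_eq)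
    then show ?thesis by (simp add: algebra_simps)
  qed
  define K where "K = {q. fst q \<in> {\<eta>..R} \<and> snd q \<in> {- R..R} \<and> (fst q *\<^sub>R e, snd q) \<in> closure \<Omega>}"
  have Kc: "compact K"
  proof -
    have "closed ({\<eta>..R} \<times> {- R..R} \<inter> (\<lambda>q. (fst q *\<^sub>R e, snd q)) -` closure \<Omega>)"
      by (intro closed_Int closed_Times closed_vimage continuous_intros) auto
    moreover have "K = {\<eta>..R} \<times> {- R..R} \<inter> (\<lambda>q. (fst q *\<^sub>R e, snd q)) -` closure \<Omega>" by (auto simp: K_def)
    moreover have "bounded ({\<eta>..R} \<times> {- R..R})" by (intro bounded_Times bounded_closed_interval)
    moreover have "K \<subseteq> {\<eta>..R} \<times> {- R..R}" by (auto simp: K_def)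
    ultimately show ?thesis by (simp only: compact_eq_bounded_closed) (metis bounded_subset)
  qed
  have q0K: "(r0, t0) \<in> K" using rR[OF r0 p0c] \<eta> p0c by (auto simp: K_def)
  have cK: "continuous_on K (\<lambda>q. g (fst q *\<^sub>R e, snd q))" if "smooth_on U g" for g
    by (rule continuous_on_compose2[OF continuous_on_subset[OF smooth_on_continuous[OF that] U(2)]])
      (auto intro!: continuous_intros simp: K_def)
  have "continuous_on K (\<lambda>q. G (fst q) (snd q))"
    unfolding G_def PP_def m_def
    by (intro continuous_intros cK sU sv) (use \<eta>(1) in \<open>auto simp: K_def\<close>)
  then obtain q where q: "q \<in> K" "\<And>q'. q' \<in> K \<Longrightarrow> G (fst q') (snd q') \<le> G (fst q) (snd q)"
    using continuous_attains_sup[OF Kc] q0K by blast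
  define r t where "r = fst q" and "t = snd q"
  have Gq: "G r0 t0 \<le> G r t" using q(2)[OF q0K] by (simp add: r_def t_def)
  have rt: "\<eta> \<le> r" "(r *\<^sub>R e, t) \<in> closure \<Omega>" using q(1) by (auto simp: K_def r_def t_def)
  have rpos: "r > 0" using rt(1) \<eta>(1) by simp
  have rO: "(r *\<^sub>R e, t) \<in> \<Omega>"
  proof (rule ccontr)
    assume "(r *\<^sub>R e, t) \<notin> \<Omega>"
    then have "PP r t \<le> c\<^sup>2 / 4" using PP_frontier_le[OF rpos] rt(2) closure_eq by blast
    moreover have "\<epsilon> * m r t \<le> \<epsilon> * M" using mM[OF rpos rt(2)] \<epsilon> by simp
    ultimately show False using Gq \<epsilon>M by (simp add: G_def)
  qed
  have r\<eta>: "\<eta> < r"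
  proof (rule ccontr)
    assume "\<not> \<eta> < r"
    then have "r = \<eta>" using rt(1) by simp
    moreover have "t\<^sup>2 \<le> R\<^sup>2" using rR(2)[OF rpos rt(2)] Rp by (simp add: abs_le_square_iff[symmetric])
    then have "\<epsilon> * m r t \<le> \<epsilon> * (2 * ln r + R\<^sup>2)" using \<epsilon> by (simp add: m_def)
    ultimately show False using Gq ln\<eta> PA[OF rpos rt(2)] by (simp add: G_def)
  qed
  obtain \<delta>1 where \<delta>1: "\<delta>1 > 0" "\<And>\<tau>. \<bar>\<tau>\<bar> < \<delta>1 \<Longrightarrow> (r *\<^sub>R e, t) + \<tau> *\<^sub>R (e, 0) \<in> \<Omega>" using near_dom[OF rO] by blast
  obtain \<delta>2 where \<delta>2: "\<delta>2 > 0" "\<And>\<tau>. \<bar>\<tau>\<bar> < \<delta>2 \<Longrightarrow> (r *\<^sub>R e, t) + \<tau> *\<^sub>R (0, 1) \<in> \<Omega>" using near_dom[OF rO] by blast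
  define \<delta> where "\<delta> = min (min \<delta>1 \<delta>2) (r - \<eta>)"
  have \<delta>: "\<delta> > 0" using \<delta>1 \<delta>2 r\<eta> by (simp add: \<delta>_def)
  have inr: "((r + \<tau>) *\<^sub>R e, t) \<in> \<Omega>" "r + \<tau> > \<eta>" if "\<bar>\<tau>\<bar> < \<delta>" for \<tau>
    using \<delta>1(2)[of \<tau>] that by (auto simp: \<delta>_def scaleR_add_left)
  have int: "(r *\<^sub>R e, t + \<tau>) \<in> \<Omega>" if "\<bar>\<tau>\<bar> < \<delta>" for \<tau>
    using \<delta>2(2)[of \<tau>] that by (auto simp: \<delta>_def)
  have memK: "(s, u) \<in> K" if "(s *\<^sub>R e, u) \<in> \<Omega>" "\<eta> < s" for s u
  proof -
    have "(s *\<^sub>R e, u) \<in> closure \<Omega>" "s > 0" using that closure_eq \<eta>(1) by auto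
    then show ?thesis using rR[of s u] that(2) by (auto simp: K_def)
  qed
  obtain Drr Dtt where D: "((\<lambda>r. PPr r t) has_field_derivative Drr) (at r)" "((\<lambda>t. PPt r t) has_field_derivative Dtt) (at t)"
    and LP: "Drr + (2 * real CARD('n) - 1) / r * PPr r t + 4 * r\<^sup>2 * Dtt \<ge> 0"
    using PP_derivatives(3)[OF rpos rO] by force
  have shift: "((\<lambda>\<tau>. g (a + \<tau>)) has_field_derivative g') (at \<tau>)" if "(g has_field_derivative g') (at (a + \<tau>))" for g :: "real \<Rightarrow> real" and g' a \<tau>
    using that by (simp add: DERIV_shift add.commute)
  have r_max: "PPr r t + \<epsilon> * (2 / r) = 0" "Drr + \<epsilon> * (- 2 / r\<^sup>2) \<le> 0"
  proof -
    let ?g = "\<lambda>\<tau>. G (r + \<tau>) t" and ?g' = "\<lambda>\<tau>. PPr (r + \<tau>) t + \<epsilon> * (2 / (r + \<tau>))"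
    have D1: "(?g has_field_derivative ?g' \<tau>) (at \<tau>)" if "\<bar>\<tau>\<bar> < \<delta>" for \<tau>
    proof (rule shift[of "\<lambda>r. G r t"])
      have pos: "r + \<tau> > 0" using inr(2)[OF that] \<eta>(1) by simp
      have "((\<lambda>r. 2 * ln r + t\<^sup>2) has_field_derivative 2 / (r + \<tau>)) (at (r + \<tau>))"
        using pos by (auto intro!: derivative_eq_intros)
      then show "((\<lambda>r. G r t) has_field_derivative ?g' \<tau>) (at (r + \<tau>))"
        unfolding G_def m_def by (intro DERIV_add DERIV_cmult PP_derivatives(1)[OF pos inr(1)[OF that]])
    qed
    have D2: "(?g' has_field_derivative Drr + \<epsilon> * (- 2 / r\<^sup>2)) (at 0)"
    proof (rule shift[of "\<lambda>r. PPr r t + \<epsilon> * (2 / r)"])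
      have "((\<lambda>r. 2 / r) has_field_derivative - 2 / r\<^sup>2) (at r)"
        using DERIV_inv_power[of r 2 1] rpos by (simp add: numeral_2_eq_2)
      then show "((\<lambda>r. PPr r t + \<epsilon> * (2 / r)) has_field_derivative Drr + \<epsilon> * (- 2 / r\<^sup>2)) (at (r + 0))"
        using D(1) by (simp only: add_0_right) (intro DERIV_add DERIV_cmult)
    qed
    have mx: "?g \<tau> \<le> ?g 0" if "\<bar>\<tau>\<bar> < \<delta>" for \<tau>
      using q(2)[OF memK[OF inr[OF that]]] by (simp add: r_def t_def)
    show "PPr r t + \<epsilon> * (2 / r) = 0" using second_derivative_local_max(1)[OF \<delta> D1 D2 mx] by simp
    show "Drr + \<epsilon> * (- 2 / r\<^sup>2) \<le> 0" by (rule second_derivative_local_max(2)[OF \<delta> D1 D2 mx])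
  qed
  have t_max: "Dtt + \<epsilon> * 2 \<le> 0"
  proof -
    let ?g = "\<lambda>\<tau>. G r (t + \<tau>)" and ?g' = "\<lambda>\<tau>. PPt r (t + \<tau>) + \<epsilon> * (2 * (t + \<tau>))"
    have D1: "(?g has_field_derivative ?g' \<tau>) (at \<tau>)" if "\<bar>\<tau>\<bar> < \<delta>" for \<tau>
    proof (rule shift[of "\<lambda>t. G r t"])
      have "((\<lambda>t. 2 * ln r + t\<^sup>2) has_field_derivative 2 * (t + \<tau>)) (at (t + \<tau>))"
        by (auto intro!: derivative_eq_intros)
      then show "((\<lambda>t. G r t) has_field_derivative ?g' \<tau>) (at (t + \<tau>))"
        unfolding G_def m_def by (intro DERIV_add DERIV_cmult PP_derivatives(2)[OF rpos int[OF that]])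
    qed
    have D2: "(?g' has_field_derivative Dtt + \<epsilon> * 2) (at 0)"
    proof (rule shift[of "\<lambda>t. PPt r t + \<epsilon> * (2 * t)"])
      have "((\<lambda>t. 2 * t) has_field_derivative 2) (at t)" by (auto intro!: derivative_eq_intros)
      then show "((\<lambda>t. PPt r t + \<epsilon> * (2 * t)) has_field_derivative Dtt + \<epsilon> * 2) (at (t + 0))"
        using D(2) by (simp only: add_0_right) (intro DERIV_add DERIV_cmult)
    qed
    have mx: "?g \<tau> \<le> ?g 0" if "\<bar>\<tau>\<bar> < \<delta>" for \<tau>
      using q(2)[OF memK[OF int[OF that] r\<eta>]] by (simp add: r_def t_def)
    show ?thesis by (rule second_derivative_local_max(2)[OF \<delta> D1 D2 mx])
  qed
  have N1: "real CARD('n) \<ge> 1" using zero_less_card_finite[where 'a = 'n] by linarith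
  \<comment> \<open>At the maximum P_r = -2 \<epsilon> / r. The first-order term is then at most -2
    \<epsilon> / r^2, which cancels the largest possible P_rr, and the negative second derivative in
    t contradicts the subsolution property.\<close>
  have P1: "PPr r t = - (\<epsilon> * (2 / r))" using r_max(1) by linarith
  have "(2 * real CARD('n) - 1) / r * PPr r t = - ((2 * real CARD('n) - 1) * (2 * \<epsilon> / r\<^sup>2))"
    unfolding P1 using rpos by (simp add: power2_eq_square)
  moreover have "(2 * real CARD('n) - 1) * (2 * \<epsilon> / r\<^sup>2) \<ge> 1 * (2 * \<epsilon> / r\<^sup>2)"
    using N1 \<epsilon> by (intro mult_right_mono) auto
  moreover have "Drr \<le> 2 * \<epsilon> / r\<^sup>2" using r_max(2) by (simp add: mult.commute)
  moreover have "4 * r\<^sup>2 * Dtt < 0"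
    using t_max \<epsilon> rpos by (intro mult_pos_neg) auto
  ultimately show False using LP by linarith
qed


end

section \<open>The integral identity and constancy of the P-function\<close>

lemma ZZ_add: "f differentiable (at \<xi>) \<Longrightarrow> g differentiable (at \<xi>) \<Longrightarrow> ZZ (\<lambda>y. f y + g y) \<xi> = ZZ f \<xi> + ZZ g \<xi>"
  by (simp add: ZZ_def pd_add sum.distrib algebra_simps)

context overdetermined
begin

text \<open>Near the point \<open>v\<close> equals its composition with the map (x, t) -> (|x| e,
  t), which is differentiable off the axis; the chain rule does the rest.\<close>

lemma radial_derivative:
  assumes "(x, t) \<in> \<Omega>" "x \<noteq> 0"
  shows "pd (y, b) v (x, t) = (x \<bullet> y) / norm x * v1 (norm x *\<^sub>R e, t) + b * v2 (norm x *\<^sub>R e, t)"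
proof -
  define r where "r = norm x"
  define \<phi> where "\<phi> \<xi> = (norm (fst \<xi>) *\<^sub>R e, snd \<xi>)" for \<xi> :: "'n heis"
  have pO: "\<phi> (x, t) \<in> \<Omega>" using cyl_iff[OF cyl, of "norm x *\<^sub>R e" x t] assms(1) by (simp add: \<phi>_def)
  have n: "((\<lambda>\<xi>::'n heis. norm (fst \<xi>)) has_derivative (\<lambda>h. fst h \<bullet> sgn x)) (at (x, t))"
    by (rule has_derivative_compose[OF bounded_linear_imp_has_derivative[OF bounded_linear_fst], of norm _ "(x, t)", simplified fst_conv])
      (rule has_derivative_norm[OF assms(2)])
  have "(\<phi> has_derivative (\<lambda>h. ((fst h \<bullet> sgn x) *\<^sub>R e, snd h))) (at (x, t))"
    unfolding \<phi>_def[abs_def]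
    by (intro has_derivative_Pair has_derivative_scaleR_left n bounded_linear_imp_has_derivative[OF bounded_linear_snd])
  from has_derivative_compose[OF this smooth_on_has_derivative[OF svO open_dom pO]]
  have "((\<lambda>\<xi>. v (\<phi> \<xi>)) has_derivative (\<lambda>h. pd ((fst h \<bullet> sgn x) *\<^sub>R e, snd h) v (\<phi> (x, t)))) (at (x, t))" .
  then have "pd (y, b) (\<lambda>\<xi>. v (\<phi> \<xi>)) (x, t) = pd ((y \<bullet> sgn x) *\<^sub>R e, b) v (\<phi> (x, t))"
    by (simp add: pd_at)
  moreover have "pd (y, b) v (x, t) = pd (y, b) (\<lambda>\<xi>. v (\<phi> \<xi>)) (x, t)"
  proof (rule pd_cong[OF open_dom assms(1)])
    fix \<xi> assume "\<xi> \<in> \<Omega>"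
    then show "v \<xi> = v (\<phi> \<xi>)" using sym[of "fst \<xi>" "snd \<xi>" "norm (fst \<xi>) *\<^sub>R e"] by (simp add: \<phi>_def)
  qed
  moreover have "pd ((y \<bullet> sgn x) *\<^sub>R e, b) v (\<phi> (x, t)) = (y \<bullet> sgn x) * v1 (\<phi> (x, t)) + b * v2 (\<phi> (x, t))"
  proof -
    have D: "v differentiable (at (\<phi> (x, t)))" by (rule smooth_on_differentiable[OF svO open_dom pO])
    have "((y \<bullet> sgn x) *\<^sub>R e, b) = (y \<bullet> sgn x) *\<^sub>R (e, 0) + b *\<^sub>R (0, 1)" by simp
    then show ?thesis by (simp only: pd_add_dir[OF D] pd_scaleR_dir[OF D])
  qed
  moreover have "y \<bullet> sgn x = (x \<bullet> y) / norm x" by (simp add: sgn_div_norm inner_commute divide_inverse mult.commute)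
  ultimately show ?thesis by (simp add: \<phi>_def)
qed

lemma radial_mem: "(x, t) \<in> \<Omega> \<Longrightarrow> (norm x *\<^sub>R e, t) \<in> \<Omega>"
  using cyl_iff[OF cyl, of "norm x *\<^sub>R e" x t] by simp

text \<open>The horizontal gradient is (v_r / r) x + 2 v_t Jx, and x and Jx are orthogonal vectors
  of length r.\<close>

lemma hgrad_sq_radial:
  assumes "(x, t) \<in> \<Omega>" "x \<noteq> 0"
  shows "(\<Sum>j\<in>UNIV. (XX j v (x, t))\<^sup>2) = 4 * (norm x)\<^sup>2 * (PP (norm x) t + v (x, t))"
proof -
  define r where "r = norm x"
  have r: "r > 0" using assms by (simp add: r_def)
  define a b where "a = v1 (r *\<^sub>R e, t)" and "b = v2 (r *\<^sub>R e, t)"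
  have "XX j v (x, t) = a / r * (x $ j) + 2 * b * (hJ x $ j)" for j
    using XX_eq_pd[OF smooth_on_differentiable[OF svO open_dom assms(1)], of j] radial_derivative[OF assms, of "axis j 1" "2 * (hJ x $ j)"]
    by (simp add: hX_def inner_axis r_def a_def b_def)
  then have "(\<Sum>j\<in>UNIV. (XX j v (x, t))\<^sup>2)
      = (\<Sum>j\<in>UNIV. (a / r)\<^sup>2 * (x $ j * x $ j) + (4 * b\<^sup>2) * (hJ x $ j * hJ x $ j) + (4 * (a / r) * b) * (x $ j * hJ x $ j))"
    by (intro sum.cong) (simp_all add: power2_eq_square algebra_simps)
  also have "\<dots> = (a / r)\<^sup>2 * (x \<bullet> x) + (4 * b\<^sup>2) * (hJ x \<bullet> hJ x) + (4 * (a / r) * b) * (x \<bullet> hJ x)"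
    by (simp only: inner_vec_def inner_real_def sum.distrib sum_distrib_left)
  also have "\<dots> = a\<^sup>2 + 4 * b\<^sup>2 * r\<^sup>2" using r by (simp add: dot_square_norm r_def power_divide)
  also have "\<dots> = 4 * r\<^sup>2 * (PP r t + v (r *\<^sub>R e, t))"
    using r by (simp add: PP_def a_def b_def field_simps)
  also have "v (r *\<^sub>R e, t) = v (x, t)" by (rule sym[OF assms(1)]) (simp add: r_def)
  finally show ?thesis by (simp add: r_def)
qed

text \<open>Every axis point of \<Omega> is a limit of points off the axis, so continuity carries
  the inequality over.\<close>

lemma le_0_across_axis:
  assumes g: "smooth_on \<Omega> g" and le: "\<And>x t. (x, t) \<in> \<Omega> \<Longrightarrow> x \<noteq> 0 \<Longrightarrow> g (x, t) \<le> 0" and p: "(x, t) \<in> \<Omega>"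
  shows "g (x, t) \<le> 0"
proof (cases "x = 0")
  case True
  obtain \<delta> where \<delta>: "\<delta> > 0" "\<And>\<tau>. \<bar>\<tau>\<bar> < \<delta> \<Longrightarrow> (x, t) + \<tau> *\<^sub>R (e, 0) \<in> \<Omega>" using near_dom[OF p] by blast
  have "isCont (\<lambda>\<tau>. g ((x, t) + \<tau> *\<^sub>R (e, 0))) 0"
    by (rule DERIV_isCont[OF smooth_on_line[OF g open_dom]]) (use p in simp)
  then have "((\<lambda>\<tau>. g ((x, t) + \<tau> *\<^sub>R (e, 0))) \<longlongrightarrow> g (x, t)) (at_right 0)"
    by (intro tendsto_within_subset[where S = UNIV and T = "{0<..}"]) (simp_all add: isCont_def)
  moreover have "eventually (\<lambda>\<tau>. g ((x, t) + \<tau> *\<^sub>R (e, 0)) \<le> 0) (at_right 0)"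
  proof (rule eventually_at_rightI[OF _ \<delta>(1)])
    fix \<tau> assume \<tau>: "\<tau> \<in> {0<..<\<delta>}"
    have "e \<noteq> 0" using norm_e by (metis norm_zero zero_neq_one)
    then show "g ((x, t) + \<tau> *\<^sub>R (e, 0)) \<le> 0" using le[of "\<tau> *\<^sub>R e" t] \<delta>(2)[of \<tau>] \<tau> True by simp
  qed
  ultimately show ?thesis by (rule tendsto_upperbound) simp
qed (rule le[OF p])

lemma eq_0_across_axis:
  assumes g: "smooth_on \<Omega> g" and eq: "\<And>x t. (x, t) \<in> \<Omega> \<Longrightarrow> x \<noteq> 0 \<Longrightarrow> g (x, t) = 0" and p: "(x, t) \<in> \<Omega>"
  shows "g (x, t) = 0"
  using le_0_across_axis[OF g _ p] le_0_across_axis[OF smooth_on_uminus[OF open_dom g] _ p] eq by fastforce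

lemma smooth_norm_sq: "open S \<Longrightarrow> smooth_on S (\<lambda>\<xi>::'n heis. (norm (fst \<xi>))\<^sup>2)"
  unfolding norm_sq_sum by (intro smooth_intros smooth_coord)

definition grad_sq :: "'n heis \<Rightarrow> real" where
  "grad_sq \<xi> = (\<Sum>j\<in>UNIV. (XX j v \<xi>)\<^sup>2)"

text \<open>Since \<open>v\<close> vanishes on the frontier, the field v D_H g has no flux through
  it.\<close>

lemma divergence_integral:
  assumes g: "smooth_on U g"
  shows "integrable (lebesgue_on \<Omega>) (\<lambda>\<xi>. \<Sum>j\<in>UNIV. XX j (\<lambda>\<xi>. v \<xi> * XX j g \<xi>) \<xi>)"
    and "integral\<^sup>L (lebesgue_on \<Omega>) (\<lambda>\<xi>. \<Sum>j\<in>UNIV. XX j (\<lambda>\<xi>. v \<xi> * XX j g \<xi>) \<xi>) = 0"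
    and "\<xi> \<in> \<Omega> \<Longrightarrow> (\<Sum>j\<in>UNIV. XX j (\<lambda>\<xi>. v \<xi> * XX j g \<xi>) \<xi>) = v \<xi> * lapH g \<xi> + (\<Sum>j\<in>UNIV. XX j v \<xi> * XX j g \<xi>)"
proof -
  have s: "smooth_on U (\<lambda>\<xi>. v \<xi> * XX j g \<xi>)" for j by (intro smooth_intros smooth_XX U sv g)
  have i: "integrable (lebesgue_on \<Omega>) (XX j (\<lambda>\<xi>. v \<xi> * XX j g \<xi>))" for j
    by (rule integrable_smooth[OF open_dom bounded_dom U smooth_XX[OF U(1) s]])
  show "integrable (lebesgue_on \<Omega>) (\<lambda>\<xi>. \<Sum>j\<in>UNIV. XX j (\<lambda>\<xi>. v \<xi> * XX j g \<xi>) \<xi>)"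
    by (intro Bochner_Integration.integrable_sum i)
  have "integral\<^sup>L (lebesgue_on \<Omega>) (XX j (\<lambda>\<xi>. v \<xi> * XX j g \<xi>)) = 0" for j
    by (rule integral_XX_eq_0[OF open_dom bounded_dom negligible_frontier U s]) (simp add: v0)
  then show "integral\<^sup>L (lebesgue_on \<Omega>) (\<lambda>\<xi>. \<Sum>j\<in>UNIV. XX j (\<lambda>\<xi>. v \<xi> * XX j g \<xi>) \<xi>) = 0"
    by (simp add: Bochner_Integration.integral_sum i)
  assume "\<xi> \<in> \<Omega>"
  then have "\<xi> \<in> U" using U(2) closure_subset by blast
  then have "XX j (\<lambda>\<xi>. v \<xi> * XX j g \<xi>) \<xi> = v \<xi> * XX j (XX j g) \<xi> + XX j v \<xi> * XX j g \<xi>" for j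
    by (intro XX_mult smooth_on_differentiable[OF _ U(1)] smooth_XX U sv g)
  then show "(\<Sum>j\<in>UNIV. XX j (\<lambda>\<xi>. v \<xi> * XX j g \<xi>) \<xi>) = v \<xi> * lapH g \<xi> + (\<Sum>j\<in>UNIV. XX j v \<xi> * XX j g \<xi>)"
    by (simp add: sum.distrib lapH_def sum_distrib_left)
qed

lemma ZZ_norm_sq: "ZZ (\<lambda>\<xi>::'n heis. a * (norm (fst \<xi>))\<^sup>2) \<xi> = 2 * a * (norm (fst \<xi>))\<^sup>2"
proof -
  have "((\<lambda>\<xi>::'n heis. a * (fst \<xi> \<bullet> fst \<xi>)) has_derivative (\<lambda>h. a * (2 * (fst \<xi> \<bullet> fst h)))) (at \<xi>)"
    by (auto intro!: derivative_eq_intros simp: inner_commute)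
  from ZZ_at[OF this] show ?thesis by (simp add: dot_square_norm)
qed

text \<open>Applying [X_j, Z] = X_j twice gives lap Z = Z lap + 2 lap. The right-hand side of the
  equation is homogeneous of degree 2 under dilations, so the total factor is 2 + 2.\<close>

lemma lapH_ZZ:
  assumes "\<xi> \<in> \<Omega>"
  shows "lapH (ZZ v) \<xi> = 4 * (2 * real CARD('n) + 4) * (norm (fst \<xi>))\<^sup>2"
proof -
  have "XX j (XX j (ZZ v)) \<xi> = ZZ (XX j (XX j v)) \<xi> + 2 * XX j (XX j v) \<xi>" for j
  proof -
    note sX = smooth_XX[OF open_dom svO, of j]
    have "XX j (XX j (ZZ v)) \<xi> = XX j (\<lambda>\<xi>. ZZ (XX j v) \<xi> + XX j v \<xi>) \<xi>"
      by (rule XX_cong[OF open_dom assms]) (rule XX_ZZ_commute[OF open_dom svO])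
    also have "\<dots> = XX j (ZZ (XX j v)) \<xi> + XX j (XX j v) \<xi>"
      by (intro XX_add smooth_on_differentiable[OF _ open_dom assms] smooth_ZZ sX open_dom)
    finally show ?thesis using XX_ZZ_commute[OF open_dom sX assms, of j] by simp
  qed
  then have "lapH (ZZ v) \<xi> = (\<Sum>j\<in>UNIV. ZZ (XX j (XX j v)) \<xi>) + 2 * lapH v \<xi>"
    by (simp add: lapH_def sum.distrib sum_distrib_left)
  also have "(\<Sum>j\<in>UNIV. ZZ (XX j (XX j v)) \<xi>) = ZZ (lapH v) \<xi>"
  proof -
    have s: "smooth_on \<Omega> (XX j (XX j v))" for j by (intro smooth_XX open_dom svO)
    have "(lapH v has_derivative (\<lambda>h. \<Sum>j\<in>UNIV. pd h (XX j (XX j v)) \<xi>)) (at \<xi>)"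
      unfolding lapH_def[abs_def] by (intro has_derivative_sum smooth_on_has_derivative[OF s open_dom assms])
    from ZZ_at[OF this] show ?thesis
      by (simp add: ZZ_eq_pd[OF smooth_on_differentiable[OF s open_dom assms]])
  qed
  also have "ZZ (lapH v) \<xi> = ZZ (\<lambda>\<xi>. (2 * real CARD('n) + 4) * (norm (fst \<xi>))\<^sup>2) \<xi>"
    unfolding ZZ_def using pd_cong[OF open_dom assms lap] by simp
  finally show ?thesis unfolding ZZ_norm_sq lap[OF assms] by (simp add: algebra_simps)
qed

lemma ZZ_grad_sq:
  assumes "\<xi> \<in> \<Omega>"
  shows "ZZ grad_sq \<xi> = 2 * (\<Sum>j\<in>UNIV. XX j v \<xi> * XX j (ZZ v) \<xi>) - 2 * grad_sq \<xi>"
proof -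
  have s: "smooth_on \<Omega> (XX j v)" for j by (intro smooth_XX open_dom svO)
  have "(grad_sq has_derivative (\<lambda>h. \<Sum>j\<in>UNIV. XX j v \<xi> * pd h (XX j v) \<xi> + pd h (XX j v) \<xi> * XX j v \<xi>)) (at \<xi>)"
    unfolding grad_sq_def[abs_def] power2_eq_square
    by (intro has_derivative_sum has_derivative_mult smooth_on_has_derivative[OF s open_dom assms])
  from ZZ_at[OF this] have "ZZ grad_sq \<xi> = (\<Sum>j\<in>UNIV. 2 * (XX j v \<xi> * ZZ (XX j v) \<xi>))"
    by (simp add: ZZ_eq_pd[OF smooth_on_differentiable[OF s open_dom assms]] mult.commute)
  also have "\<dots> = (\<Sum>j\<in>UNIV. 2 * (XX j v \<xi> * XX j (ZZ v) \<xi>) - 2 * (XX j v \<xi>)\<^sup>2)"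
    by (simp add: XX_ZZ_commute[OF open_dom svO assms] power2_eq_square algebra_simps)
  finally show ?thesis by (simp add: sum_subtractf sum_distrib_left grad_sq_def)
qed

text \<open>An identity of Pohozaev type. The fields v D_H v, v D_H (Z v) and (|D_H v|^2 - c^2
  |x|^2) Z all vanish on the frontier, the last one by the gradient condition, so their divergences
  integrate to zero. The integrand is a combination of these three divergences.\<close>

lemma integral_grad_sq_defect:
  "integral\<^sup>L (lebesgue_on \<Omega>) (\<lambda>\<xi>. grad_sq \<xi> - 4 * (norm (fst \<xi>))\<^sup>2 * v \<xi> - c\<^sup>2 * (norm (fst \<xi>))\<^sup>2) = 0"
proof -
  let ?M = "lebesgue_on \<Omega>" and ?F = "\<lambda>\<xi>::'n heis. (norm (fst \<xi>))\<^sup>2"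
  define N where "N = 2 * real CARD('n) + 4"
  define I1 where "I1 \<xi> = (\<Sum>j\<in>UNIV. XX j (\<lambda>\<xi>. v \<xi> * XX j v \<xi>) \<xi>)" for \<xi>
  define I3 where "I3 \<xi> = (\<Sum>j\<in>UNIV. XX j (\<lambda>\<xi>. v \<xi> * XX j (ZZ v) \<xi>) \<xi>)" for \<xi>
  define G where "G \<xi> = grad_sq \<xi> - c\<^sup>2 * ?F \<xi>" for \<xi>
  define I2 where "I2 \<xi> = ZZ G \<xi> + (2 * real CARD('n) + 2) * G \<xi>" for \<xi>
  have sW: "smooth_on U grad_sq" unfolding grad_sq_def[abs_def] by (intro smooth_intros smooth_XX U sv)
  have sG: "smooth_on U G" unfolding G_def[abs_def] by (intro smooth_intros sW smooth_norm_sq U)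
  have G0: "G \<xi> = 0" if "\<xi> \<in> frontier \<Omega>" for \<xi>
    using grad[OF that] norm_sq_sum[of "hgrad v \<xi>"] by (simp add: G_def grad_sq_def hgrad_nth power_mult_distrib)
  note i1 = divergence_integral(1,2)[OF sv, folded I1_def]
  note i3 = divergence_integral(1,2)[OF smooth_ZZ[OF U(1) sv], folded I3_def]
  have i2: "integrable ?M I2" "integral\<^sup>L ?M I2 = 0"
  proof -
    show "integrable ?M I2" unfolding I2_def[abs_def]
      by (rule integrable_smooth[OF open_dom bounded_dom U]) (intro smooth_intros smooth_ZZ sG U)
    show "integral\<^sup>L ?M I2 = 0" unfolding I2_def[abs_def]
      by (rule integral_ZZ[OF open_dom bounded_dom negligible_frontier U sG G0])
  qed
  \<comment> \<open>The weights 1, -2 and 4 are those for which the mixed term \<open>S\<close>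
    cancels and the rest is a multiple, by N = 2n + 4, of the integrand.\<close>
  have key: "grad_sq \<xi> - 4 * ?F \<xi> * v \<xi> - c\<^sup>2 * ?F \<xi> = (I2 \<xi> - 2 * I3 \<xi> + 4 * I1 \<xi>) / N" if "\<xi> \<in> \<Omega>" for \<xi>
  proof -
    have \<xi>U: "\<xi> \<in> U" using that U(2) closure_subset by blast
    define S where "S = (\<Sum>j\<in>UNIV. XX j v \<xi> * XX j (ZZ v) \<xi>)"
    have 1: "I1 \<xi> = N * ?F \<xi> * v \<xi> + grad_sq \<xi>"
      unfolding I1_def divergence_integral(3)[OF sv that] by (simp add: lap[OF that] N_def grad_sq_def power2_eq_square mult_ac)
    have 3: "I3 \<xi> = 4 * N * ?F \<xi> * v \<xi> + S"
      unfolding I3_def divergence_integral(3)[OF smooth_ZZ[OF U(1) sv] that] by (simp add: lapH_ZZ[OF that] N_def S_def mult_ac)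
    have "ZZ (\<lambda>\<xi>. grad_sq \<xi> + (- c\<^sup>2) * ?F \<xi>) \<xi> = ZZ grad_sq \<xi> + ZZ (\<lambda>\<xi>. (- c\<^sup>2) * ?F \<xi>) \<xi>"
      by (intro ZZ_add smooth_on_differentiable[OF _ U(1) \<xi>U] sW smooth_intros smooth_norm_sq U)
    then have "ZZ G \<xi> = 2 * S - 2 * grad_sq \<xi> - 2 * c\<^sup>2 * ?F \<xi>"
      unfolding ZZ_norm_sq ZZ_grad_sq[OF that] by (simp add: G_def[abs_def] S_def)
    then have 2: "I2 \<xi> = 2 * S + (N - 4) * grad_sq \<xi> - N * c\<^sup>2 * ?F \<xi>"
      unfolding I2_def by (simp add: G_def N_def algebra_simps)
    have "N > 0" by (simp add: N_def)
    then show ?thesis unfolding 1 2 3 by (simp add: field_simps)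
  qed
  have "integral\<^sup>L ?M (\<lambda>\<xi>. grad_sq \<xi> - 4 * ?F \<xi> * v \<xi> - c\<^sup>2 * ?F \<xi>) = integral\<^sup>L ?M (\<lambda>\<xi>. (I2 \<xi> - 2 * I3 \<xi> + 4 * I1 \<xi>) / N)"
    by (rule Bochner_Integration.integral_cong) (use key in auto)
  also have "\<dots> = 0" using i1 i2 i3 by simp
  finally show ?thesis .
qed

text \<open>\<open>H\<close> equals 4 |x|^2 (P - c^2 / 4) off the axis. It is nonpositive by
  \<open>PP_le\<close> and has integral zero, so by continuity it vanishes identically.\<close>

lemma PP_eq:
  assumes r: "r > 0" and p: "(r *\<^sub>R e, t) \<in> \<Omega>"
  shows "PP r t = c\<^sup>2 / 4"
proof -
  define H where "H \<xi> = grad_sq \<xi> - 4 * (norm (fst \<xi>))\<^sup>2 * v \<xi> - c\<^sup>2 * (norm (fst \<xi>))\<^sup>2" for \<xi>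
  have sH: "smooth_on U H"
  proof -
    have "smooth_on U (\<lambda>\<xi>. (\<Sum>j\<in>UNIV. (XX j v \<xi>)\<^sup>2) - 4 * (norm (fst \<xi>))\<^sup>2 * v \<xi> - c\<^sup>2 * (norm (fst \<xi>))\<^sup>2)"
      by (intro smooth_intros smooth_XX smooth_norm_sq U sv)
    then show ?thesis by (simp only: H_def[abs_def] grad_sq_def)
  qed
  have sHO: "smooth_on \<Omega> H" using smooth_on_subset[OF open_dom U(1) _ sH] U(2) closure_subset[of \<Omega>] by (metis order_trans)
  have HP: "H (x, t) = 4 * (norm x)\<^sup>2 * (PP (norm x) t - c\<^sup>2 / 4)" if "(x, t) \<in> \<Omega>" "x \<noteq> 0" for x t
    unfolding H_def grad_sq_def hgrad_sq_radial[OF that] by (simp add: algebra_simps)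
  have le: "H (x, t) \<le> 0" if "(x, t) \<in> \<Omega>" for x t
  proof (rule le_0_across_axis[OF sHO _ that])
    fix x t assume x: "(x, t) \<in> \<Omega>" "x \<noteq> 0"
    show "H (x, t) \<le> 0" unfolding HP[OF x]
      using PP_le[OF _ radial_mem[OF x(1)]] x(2) by (intro mult_nonneg_nonpos) auto
  qed
  have iH: "integrable (lebesgue_on \<Omega>) H" by (rule integrable_smooth[OF open_dom bounded_dom U sH])
  have "integral\<^sup>L (lebesgue_on \<Omega>) H = 0" using integral_grad_sq_defect by (simp only: H_def[abs_def])
  then have "integral\<^sup>L (lebesgue_on \<Omega>) (\<lambda>\<xi>. - H \<xi>) = 0" by simp
  moreover have "AE \<xi> in lebesgue_on \<Omega>. 0 \<le> - H \<xi>" using le by (intro AE_I2) auto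
  ultimately have "AE \<xi> in lebesgue_on \<Omega>. - H \<xi> = 0"
    using integral_nonneg_eq_0_iff_AE[of "lebesgue_on \<Omega>" "\<lambda>\<xi>. - H \<xi>"] iH by simp
  then have "AE \<xi> in lebesgue_on \<Omega>. H \<xi> = 0" by simp
  then have "H (r *\<^sub>R e, t) = 0" by (rule AE_continuous_eq_0[OF open_dom smooth_on_continuous[OF sHO] _ p])
  moreover have "e \<noteq> 0" using norm_e by (metis norm_zero zero_neq_one)
  ultimately show ?thesis using HP[OF p] r by simp
qed

end

section \<open>Rigidity of the solution and of the domain\<close>

context overdetermined
begin

text \<open>P is constant, so the operator applied to it is zero and every square in
  \<open>PP_derivatives\<close> vanishes; two of them give the claims.\<close>

lemma slice_rigid:
  assumes r: "r > 0" and p: "(r *\<^sub>R e, t) \<in> \<Omega>"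
  shows "v1 (r *\<^sub>R e, t) = r ^ 3" "v22 (r *\<^sub>R e, t) = 1 / 2"
proof -
  obtain \<delta>1 where \<delta>1: "\<delta>1 > 0" "\<And>\<tau>. \<bar>\<tau>\<bar> < \<delta>1 \<Longrightarrow> (r *\<^sub>R e, t) + \<tau> *\<^sub>R (e, 0) \<in> \<Omega>" using near_dom[OF p] by blast
  obtain \<delta>2 where \<delta>2: "\<delta>2 > 0" "\<And>\<tau>. \<bar>\<tau>\<bar> < \<delta>2 \<Longrightarrow> (r *\<^sub>R e, t) + \<tau> *\<^sub>R (0, 1) \<in> \<Omega>" using near_dom[OF p] by blast
  have zero: "g' = 0" if "(g has_field_derivative g') (at x)" "\<delta> > 0" "\<And>y. \<bar>y - x\<bar> < \<delta> \<Longrightarrow> g y = k"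
    for g :: "real \<Rightarrow> real" and g' x \<delta> k
  proof -
    have "((\<lambda>_. k) has_field_derivative g') (at x)"
      by (rule has_field_derivative_transform_within_open[OF that(1), where S = "{x - \<delta> <..< x + \<delta>}"])
        (use that(2,3) in \<open>auto simp: abs_less_iff\<close>)
    then show ?thesis using DERIV_const DERIV_unique by blast
  qed
  have inr: "(s *\<^sub>R e, t) \<in> \<Omega>" "s > 0" if "\<bar>s - r\<bar> < min \<delta>1 r" for s
    using \<delta>1(2)[of "s - r"] that by (auto simp: scaleR_left_diff_distrib)
  have int: "(r *\<^sub>R e, s) \<in> \<Omega>" if "\<bar>s - t\<bar> < \<delta>2" for s
    using \<delta>2(2)[of "s - t"] that by auto
  have PPr0: "PPr s u = 0" if s: "s > 0" and m: "(s *\<^sub>R e, u) \<in> \<Omega>" for s u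
  proof -
    obtain \<delta> where \<delta>: "\<delta> > 0" "\<And>\<tau>. \<bar>\<tau>\<bar> < \<delta> \<Longrightarrow> (s *\<^sub>R e, u) + \<tau> *\<^sub>R (e, 0) \<in> \<Omega>" using near_dom[OF m] by blast
    show ?thesis
    proof (rule zero[OF PP_derivatives(1)[OF s m]])
      show "min \<delta> s > 0" using \<delta> s by simp
      show "PP y u = c\<^sup>2 / 4" if "\<bar>y - s\<bar> < min \<delta> s" for y
        using \<delta>(2)[of "y - s"] that by (intro PP_eq) (auto simp: scaleR_left_diff_distrib)
    qed
  qed
  have PPt0: "PPt s u = 0" if s: "s > 0" and m: "(s *\<^sub>R e, u) \<in> \<Omega>" for s u
  proof -
    obtain \<delta> where \<delta>: "\<delta> > 0" "\<And>\<tau>. \<bar>\<tau>\<bar> < \<delta> \<Longrightarrow> (s *\<^sub>R e, u) + \<tau> *\<^sub>R (0, 1) \<in> \<Omega>" using near_dom[OF m] by blast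
    show ?thesis
    proof (rule zero[OF PP_derivatives(2)[OF s m] \<delta>(1)])
      show "PP s y = c\<^sup>2 / 4" if "\<bar>y - u\<bar> < \<delta>" for y
        using \<delta>(2)[of "y - u"] that s by (intro PP_eq) auto
    qed
  qed
  let ?p = "(r *\<^sub>R e, t)"
  define A B C D where "A = (v11 ?p / (4 * r\<^sup>2) - v1 ?p / (4 * r ^ 3) - 1/2)\<^sup>2" and "B = (v22 ?p - 1/2)\<^sup>2"
    and "C = (v1 ?p / (2 * r ^ 3) - 1/2)\<^sup>2" and "D = (v12 ?p / (2 * r))\<^sup>2"
  obtain Drr Dtt where D: "((\<lambda>r. PPr r t) has_field_derivative Drr) (at r)" "((\<lambda>t. PPt r t) has_field_derivative Dtt) (at t)"
    and LP: "Drr + (2 * real CARD('n) - 1) / r * PPr r t + 4 * r\<^sup>2 * Dtt = 8 * r\<^sup>2 * (A + B + real CARD('n) * C + 2 * D)"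
    using PP_derivatives(3)[OF r p] unfolding A_def B_def C_def D_def by blast
  have "Drr = 0" by (rule zero[OF D(1), of "min \<delta>1 r" 0]) (use \<delta>1(1) r inr PPr0 in auto)
  moreover have "Dtt = 0" by (rule zero[OF D(2) \<delta>2(1), of 0]) (use r int PPt0 in auto)
  ultimately have "A + B + real CARD('n) * C + 2 * D = 0" using LP PPr0[OF r p] r by simp
  moreover have nn: "A \<ge> 0" "B \<ge> 0" "real CARD('n) * C \<ge> 0" "D \<ge> 0" by (simp_all add: A_def B_def C_def D_def)
  ultimately have "B = 0" "real CARD('n) * C = 0" by linarith+
  then have "B = 0" "C = 0" by simp_all
  then show "v1 ?p = r ^ 3" "v22 ?p = 1 / 2" using r by (simp_all add: B_def C_def)
qed

text \<open>Off the axis this is \<open>radial_derivative\<close> with v_r = r^3; the polynomial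
  form makes sense on the axis too and extends there by continuity.\<close>

lemma horizontal_derivative_rigid:
  assumes "(x, t) \<in> \<Omega>"
  shows "pd (y, 0) v (x, t) = (norm x)\<^sup>2 * (x \<bullet> y)"
proof -
  define g where "g \<xi> = pd (y, 0) v \<xi> - (norm (fst \<xi>))\<^sup>2 * (fst \<xi> \<bullet> y)" for \<xi>
  have s: "smooth_on \<Omega> (\<lambda>\<xi>::'n heis. fst \<xi> \<bullet> y)"
    by (rule smooth_on_linear) (rule bounded_linear_compose[OF bounded_linear_inner_left bounded_linear_fst])
  have "smooth_on \<Omega> g" unfolding g_def[abs_def] by (intro smooth_intros sO svO smooth_norm_sq open_dom s)
  then have "g (x, t) = 0"
  proof (rule eq_0_across_axis[OF _ _ assms])
    fix x t assume x: "(x, t) \<in> \<Omega>" "x \<noteq> 0"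
    have "v1 (norm x *\<^sub>R e, t) = norm x ^ 3" using x by (intro slice_rigid radial_mem) auto
    then show "g (x, t) = 0" using radial_derivative[OF x, of y 0] x(2) by (simp add: g_def power2_eq_square power3_eq_cube)
  qed
  then show ?thesis by (simp add: g_def)
qed

lemma vertical_second_derivative_rigid:
  assumes "(x, t) \<in> \<Omega>"
  shows "v22 (x, t) = 1 / 2"
proof -
  have "v22 (x, t) - 1 / 2 = 0"
  proof (rule eq_0_across_axis[of "\<lambda>\<xi>. v22 \<xi> - 1 / 2", OF _ _ assms])
    show "smooth_on \<Omega> (\<lambda>\<xi>. v22 \<xi> - 1 / 2)" by (intro smooth_intros sO svO open_dom)
    fix x t assume x: "(x, t) \<in> \<Omega>" "x \<noteq> 0"
    obtain \<delta> where \<delta>: "\<delta> > 0" "\<And>\<tau>. \<bar>\<tau>\<bar> < \<delta> \<Longrightarrow> (x, t) + \<tau> *\<^sub>R (0, 1) \<in> \<Omega>" using near_dom[OF x(1)] by blast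
    have "((\<lambda>s. v2 (x, s)) has_field_derivative v22 (x, t)) (at t)"
      using smooth_on_line[OF sO[OF svO] open_dom, of "(x, 0)" t "(0, 1)"] x(1) by simp
    moreover have "((\<lambda>s. v2 (x, s)) has_field_derivative v22 (norm x *\<^sub>R e, t)) (at t)"
    proof (rule has_field_derivative_transform_within_open[OF line_t[OF sO[OF svO] radial_mem[OF x(1)]], where S = "{t - \<delta> <..< t + \<delta>}"])
      fix s assume "s \<in> {t - \<delta> <..< t + \<delta>}"
      then have "(x, s) \<in> \<Omega>" using \<delta>(2)[of "s - t"] by (simp add: abs_less_iff)
      then show "v2 (norm x *\<^sub>R e, s) = v2 (x, s)" using radial_derivative[of x s 0 1] x(2) by simp
    qed (use \<delta>(1) in auto)
    moreover have "v22 (norm x *\<^sub>R e, t) = 1 / 2" using x by (intro slice_rigid radial_mem) auto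
    ultimately show "v22 (x, t) - 1 / 2 = 0" using DERIV_unique by fastforce
  qed
  then show ?thesis by simp
qed

text \<open>Horizontal derivatives do not depend on t, so mixed derivatives vanish, and v_tt = 1/2.
  Hence v_t - t / 2 has zero derivative and is constant on the connected domain, which defines t0.
  The formula for \<open>v\<close> is then read off algebraically from P = c^2 / 4.\<close>

lemma solution_rigid:
  assumes conn: "connected \<Omega>" and ne: "\<Omega> \<noteq> {}"
  obtains t0 where "\<And>x t. (x, t) \<in> \<Omega> \<Longrightarrow> v (x, t) = (norm x ^ 4 + (t - t0)\<^sup>2 - c\<^sup>2) / 4"
proof -
  define g where "g \<xi> = v2 \<xi> - snd \<xi> / 2" for \<xi> :: "'n heis"
  have Dg: "(g has_derivative (\<lambda>_. 0)) (at \<xi>)" if "\<xi> \<in> \<Omega>" for \<xi>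
  proof -
    have sv2: "smooth_on \<Omega> v2" by (rule sO[OF svO])
    note d = smooth_on_differentiable[OF sv2 open_dom that]
    have pd_v2: "pd h v2 \<xi> = snd h / 2" for h
    proof -
      have "pd (fst h, 0) v2 \<xi> = pd (0, 1) (pd (fst h, 0) v) \<xi>" by (rule pd_commute[OF open_dom svO that])
      also have "\<dots> = pd (0, 1) (\<lambda>\<xi>. (norm (fst \<xi>))\<^sup>2 * (fst \<xi> \<bullet> fst h)) \<xi>"
      proof (rule pd_cong[OF open_dom that])
        show "pd (fst h, 0) v \<eta> = (norm (fst \<eta>))\<^sup>2 * (fst \<eta> \<bullet> fst h)" if "\<eta> \<in> \<Omega>" for \<eta>
          using horizontal_derivative_rigid[of "fst \<eta>" "snd \<eta>"] that by simp
      qed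
      also have "\<dots> = 0"
      proof -
        have "((\<lambda>\<xi>::'n heis. (fst \<xi> \<bullet> fst \<xi>) * (fst \<xi> \<bullet> fst h)) has_derivative
            (\<lambda>k. (fst \<xi> \<bullet> fst \<xi>) * (fst k \<bullet> fst h) + (2 * (fst \<xi> \<bullet> fst k)) * (fst \<xi> \<bullet> fst h))) (at \<xi>)"
          by (auto intro!: derivative_eq_intros simp: inner_commute)
        from pd_at[OF this, of "(0, 1)"] show ?thesis by (simp add: dot_square_norm)
      qed
      finally have 1: "pd (fst h, 0) v2 \<xi> = 0" .
      have 2: "v22 \<xi> = 1 / 2" using vertical_second_derivative_rigid[of "fst \<xi>" "snd \<xi>"] that by simp
      have "h = (fst h, 0) + snd h *\<^sub>R (0, 1)" by (simp add: prod_eq_iff)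
      then have "pd h v2 \<xi> = pd (fst h, 0) v2 \<xi> + snd h * v22 \<xi>"
        by (metis pd_add_dir[OF d] pd_scaleR_dir[OF d])
      then show ?thesis by (simp add: 1 2)
    qed
    have "(v2 has_derivative (\<lambda>h. snd h / 2)) (at \<xi>)"
      using smooth_on_has_derivative[OF sv2 open_dom that] by (simp only: pd_v2)
    from has_derivative_diff[OF this, of "\<lambda>\<xi>. snd \<xi> / 2" "\<lambda>h. snd h / 2"] show ?thesis
      unfolding g_def[abs_def] by (simp add: bounded_linear_imp_has_derivative bounded_linear_snd bounded_linear_divide[THEN bounded_linear_compose])
  qed
  obtain p where p: "p \<in> \<Omega>" using ne by blast
  \<comment> \<open>Normalised so that v_t = (t - t0) / 2.\<close>
  define t0 where "t0 = - 2 * g p"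
  have v2: "v2 (x, t) = (t - t0) / 2" if "(x, t) \<in> \<Omega>" for x t
    using has_derivative_zero_unique_connected[OF open_dom conn Dg that p] by (simp add: g_def t0_def field_simps)
  show ?thesis
  proof (rule that[of t0])
    fix x t assume xt: "(x, t) \<in> \<Omega>"
    define H where "H \<xi> = v \<xi> - (((norm (fst \<xi>))\<^sup>2)\<^sup>2 + (snd \<xi> - t0)\<^sup>2 - c\<^sup>2) / 4" for \<xi>
    have "smooth_on \<Omega> H" unfolding H_def[abs_def] by (intro smooth_intros svO smooth_norm_sq smooth_snd open_dom)
    then have "H (x, t) = 0"
    proof (rule eq_0_across_axis[OF _ _ xt])
      fix x t assume x: "(x, t) \<in> \<Omega>" "x \<noteq> 0"
      define r where "r = norm x"
      have r: "r > 0" and m: "(r *\<^sub>R e, t) \<in> \<Omega>" using x radial_mem by (auto simp: r_def)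
      have "(r ^ 3)\<^sup>2 / (4 * r\<^sup>2) + ((t - t0) / 2)\<^sup>2 - v (r *\<^sub>R e, t) = c\<^sup>2 / 4"
        using PP_eq[OF r m] slice_rigid(1)[OF r m] v2[OF m] by (simp add: PP_def)
      moreover have "(r ^ 3)\<^sup>2 / (4 * r\<^sup>2) = (r\<^sup>2)\<^sup>2 / 4" using r by (simp add: field_simps eval_nat_numeral)
      moreover have "v (r *\<^sub>R e, t) = v (x, t)" by (rule sym[OF x(1)]) (simp add: r_def)
      ultimately show "H (x, t) = 0" by (simp add: H_def r_def power_divide)
    qed
    then show "v (x, t) = (norm x ^ 4 + (t - t0)\<^sup>2 - c\<^sup>2) / 4" by (simp add: H_def)
  qed
qed

text \<open>By continuity the formula holds on the closure, so \<gamma> = c^2 on the frontier.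
  \<gamma> has no positive interior maximum, since dilations about (0, t0) increase it, so \<Omega>
  lies in the set where \<gamma> < c^2. That set is star-shaped, hence connected, meets \<Omega> and
  misses its frontier, so it equals \<Omega>.\<close>

lemma domain_eq_gauge_ball:
  assumes ne: "\<Omega> \<noteq> {}" and form: "\<And>x t. (x, t) \<in> \<Omega> \<Longrightarrow> v (x, t) = (norm x ^ 4 + (t - t0)\<^sup>2 - c\<^sup>2) / 4"
  shows "\<Omega> = gauge_ball (0, t0) (sqrt c)"
proof -
  define \<gamma> where "\<gamma> \<xi> = norm (fst \<xi>) ^ 4 + (snd \<xi> - t0)\<^sup>2" for \<xi> :: "'n heis"
  have cont: "continuous_on S \<gamma>" for S unfolding \<gamma>_def[abs_def] by (intro continuous_intros)
  have v\<gamma>: "4 * v \<xi> + c\<^sup>2 - \<gamma> \<xi> = 0" if "\<xi> \<in> closure \<Omega>" for \<xi>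
  proof (rule continuous_constant_on_closure[OF _ _ that])
    show "continuous_on (closure \<Omega>) (\<lambda>\<xi>. 4 * v \<xi> + c\<^sup>2 - \<gamma> \<xi>)"
      by (intro continuous_intros continuous_on_subset[OF smooth_on_continuous[OF sv] U(2)] cont)
    show "4 * v \<xi> + c\<^sup>2 - \<gamma> \<xi> = 0" if "\<xi> \<in> \<Omega>" for \<xi>
      using form[of "fst \<xi>" "snd \<xi>"] that by (simp add: \<gamma>_def)
  qed
  have fr: "\<gamma> \<xi> = c\<^sup>2" if "\<xi> \<in> frontier \<Omega>" for \<xi>
    using v\<gamma>[of \<xi>] v0[OF that] that closure_eq by auto
  have sub: "\<gamma> \<xi> < c\<^sup>2" if \<xi>: "\<xi> \<in> \<Omega>" for \<xi>
  proof (rule ccontr)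
    assume "\<not> \<gamma> \<xi> < c\<^sup>2"
    then have big: "c\<^sup>2 \<le> \<gamma> \<xi>" by simp
    have \<xi>c: "\<xi> \<in> closure \<Omega>" using \<xi> closure_eq by blast
    have "closure \<Omega> \<noteq> {}" using ne by simp
    from continuous_attains_sup[OF compact_closure_dom this cont[of "closure \<Omega>"]]
    obtain q' where q': "q' \<in> closure \<Omega>" "\<And>\<eta>. \<eta> \<in> closure \<Omega> \<Longrightarrow> \<gamma> \<eta> \<le> \<gamma> q'" by (elim bexE) simp
    \<comment> \<open>An interior maximum point: if the maximum is attained on the frontier it
      equals c^2, and then \<xi> attains it too.\<close>
    obtain q where q: "q \<in> \<Omega>" "\<And>\<eta>. \<eta> \<in> closure \<Omega> \<Longrightarrow> \<gamma> \<eta> \<le> \<gamma> q"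
    proof (cases "q' \<in> \<Omega>")
      case False
      then have q'_eq: "\<gamma> q' = c\<^sup>2" using q'(1) fr closure_eq by blast
      show ?thesis
      proof (rule that[OF \<xi>])
        show "\<gamma> \<eta> \<le> \<gamma> \<xi>" if "\<eta> \<in> closure \<Omega>" for \<eta>
          using q'(2)[OF that] q'_eq big by linarith
      qed
    qed (rule that[OF _ q'(2)])
    have pos: "\<gamma> q > 0"
    proof -
      have "0 < c\<^sup>2" using c by simp
      then show ?thesis using big q(2)[OF \<xi>c] by linarith
    qed
    obtain \<delta> where \<delta>: "\<delta> > 0" "\<And>\<tau>. \<bar>\<tau>\<bar> < \<delta> \<Longrightarrow> q + \<tau> *\<^sub>R (fst q, snd q - t0) \<in> \<Omega>" using near_dom[OF q(1)] by blast
    \<comment> \<open>Moving outward from (0, t0) by the Euclidean factor 1 + \<tau> multiplies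
      \<gamma> by at least the square of this factor.\<close>
    define \<tau> where "\<tau> = \<delta> / 2"
    have \<tau>: "\<tau> > 0" "\<bar>\<tau>\<bar> < \<delta>" using \<delta>(1) by (auto simp: \<tau>_def)
    let ?q = "q + \<tau> *\<^sub>R (fst q, snd q - t0)"
    have e1: "norm (fst ?q) = (1 + \<tau>) * norm (fst q)"
    proof -
      have "fst ?q = (1 + \<tau>) *\<^sub>R fst q" by (simp add: scaleR_add_left)
      then show ?thesis using \<tau> by simp
    qed
    have e2: "snd ?q - t0 = (1 + \<tau>) * (snd q - t0)" by (simp add: algebra_simps)
    have "(1 + \<tau>)\<^sup>2 * \<gamma> q \<le> \<gamma> ?q"
    proof -
      have "(1 + \<tau>)\<^sup>2 * norm (fst q) ^ 4 \<le> (1 + \<tau>) ^ 4 * norm (fst q) ^ 4"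
        using \<tau> by (intro mult_right_mono power_increasing) auto
      then show ?thesis unfolding \<gamma>_def e1 e2 by (simp add: power_mult_distrib distrib_left)
    qed
    moreover have "\<gamma> ?q \<le> \<gamma> q" using q(2) \<delta>(2)[OF \<tau>(2)] closure_eq by blast
    moreover have "1 * \<gamma> q < (1 + \<tau>)\<^sup>2 * \<gamma> q"
      using pos \<tau> by (intro mult_strict_right_mono one_less_power) auto
    ultimately show False by linarith
  qed
  define B where "B = {\<xi>. \<gamma> \<xi> < c\<^sup>2}"
  have "starlike B"
    unfolding starlike_def
  proof (intro bexI ballI subsetI)
    show "(0, t0) \<in> B" using c by (simp add: B_def \<gamma>_def)
    fix \<xi> \<eta> assume \<xi>: "\<xi> \<in> B" and "\<eta> \<in> closed_segment (0, t0) \<xi>"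
    then obtain s where s: "0 \<le> s" "s \<le> 1" "\<eta> = (1 - s) *\<^sub>R (0, t0) + s *\<^sub>R \<xi>" by (auto simp: closed_segment_def)
    have e1: "norm (fst \<eta>) = s * norm (fst \<xi>)" using s by simp
    have e2: "snd \<eta> - t0 = s * (snd \<xi> - t0)" unfolding s(3) by (simp add: algebra_simps)
    have "s ^ 4 * norm (fst \<xi>) ^ 4 + s\<^sup>2 * (snd \<xi> - t0)\<^sup>2 \<le> 1 * norm (fst \<xi>) ^ 4 + 1 * (snd \<xi> - t0)\<^sup>2"
      using s by (intro add_mono mult_right_mono power_le_one) auto
    then have "\<gamma> \<eta> \<le> \<gamma> \<xi>" unfolding \<gamma>_def e1 e2 by (simp add: power_mult_distrib)
    then show "\<eta> \<in> B" using \<xi> by (simp add: B_def)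
  qed
  then have "connected B" by (rule starlike_imp_connected)
  moreover have "\<Omega> \<subseteq> B" using sub by (auto simp: B_def)
  moreover have "B \<inter> frontier \<Omega> = {}" using fr by (fastforce simp: B_def)
  ultimately have "\<Omega> = B" using connected_Int_frontier[of B \<Omega>] ne by blast
  also have "B = gauge_ball (0, t0) (sqrt c)"
  proof -
    have c4: "root 4 (c\<^sup>2) = sqrt c"
    proof -
      have "c\<^sup>2 = (sqrt c) ^ 4" using c by (simp add: power2_eq_square power4_eq_xxxx)
      then show ?thesis using c by (simp only: real_root_power_cancel zero_less_numeral real_sqrt_ge_zero less_imp_le)
    qed
    have "gauge_norm (hmult (hinv (0, t0)) \<xi>) = root 4 (\<gamma> \<xi>)" for \<xi> :: "'n heis"
      by (simp add: gauge_norm_def hmult_def hinv_def \<gamma>_def hJ_linear_simps)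
    then show ?thesis by (simp add: gauge_ball_def B_def c4[symmetric])
  qed
  finally show ?thesis .
qed

end

section \<open>From the overdetermined weak solution to the gauge ball\<close>

theorem theorem4p2:
  fixes \<Omega> :: "'n::finite heis set" and u :: "'n heis \<Rightarrow> real" and c :: real
  assumes "c > 0"
    and "competitor_set \<Omega>"
    and "cylindrically_symmetric \<Omega>"
    and "overdetermined_solution c \<Omega> u"
  shows "\<exists>t\<^sub>0::real. \<Omega> = gauge_ball (0, t\<^sub>0) (sqrt c) \<and>
    (AE (x, t) in lebesgue_on \<Omega>. u (x, t) = (norm x ^ 4 + (t - t\<^sub>0)\<^sup>2 - c\<^sup>2) / 4)"
proof -
  obtain f where f: "defining_function \<Omega> f" and dom: "\<Omega> \<noteq> {}" "open \<Omega>" "bounded \<Omega>" "connected \<Omega>"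
    using assms(2) unfolding competitor_set_def by blast
  interpret smooth_domain \<Omega> f by unfold_locales (fact dom f)+
  obtain w V where sol: "weak_solution \<Omega> u" and V: "open V" "frontier \<Omega> \<subseteq> V" "smooth_on V w"
    and uw: "AE \<xi> in lebesgue_on (V \<inter> \<Omega>). u \<xi> = w \<xi>"
    and grad: "\<And>\<xi>. \<xi> \<in> frontier \<Omega> \<Longrightarrow> norm (hgrad w \<xi>) = c * sqrt (F4 \<xi>)"
    using assms(4) unfolding overdetermined_solution_def smooth_near_boundary_def by blast
  have H: "u \<in> H10 \<Omega>" using sol unfolding weak_solution_def by blast
  obtain v U where U: "open U" "closure \<Omega> \<subseteq> U" "smooth_on U v" "V \<subseteq> U"
    and lap: "\<And>\<xi>. \<xi> \<in> \<Omega> \<Longrightarrow> lapH v \<xi> = (2 * real CARD('n) + 4) * (norm (fst \<xi>))\<^sup>2"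
    and uv: "AE \<xi> in lebesgue_on \<Omega>. u \<xi> = v \<xi>" and vw: "\<And>\<xi>. \<xi> \<in> V \<Longrightarrow> v \<xi> = w \<xi>"
    by (rule solution_extension[OF sol V uw], rule that)
  \<comment> \<open>\<open>v\<close> and \<open>w\<close> agree on a neighbourhood of the frontier,
    so the zero trace and the gradient condition pass from \<open>w\<close> to
    \<open>v\<close>.\<close>
  interpret overdetermined \<Omega> f v U c
  proof unfold_locales
    show "v \<xi> = 0" if "\<xi> \<in> frontier \<Omega>" for \<xi>
    proof -
      have "\<xi> \<in> V" using V(2) that by blast
      then show ?thesis using trace_zero[OF assms(3) H V uw that] by (simp only: vw)
    qed
    show "norm (hgrad v \<xi>) = c * norm (fst \<xi>)" if "\<xi> \<in> frontier \<Omega>" for \<xi>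
    proof -
      have "\<xi> \<in> V" using V(2) that by blast
      then have "hgrad v \<xi> = hgrad w \<xi>"
        unfolding vec_eq_iff hgrad_nth by (intro allI XX_cong[OF V(1)] vw)
      then show ?thesis using grad[OF that] by (simp add: F4_def)
    qed
  qed (fact assms U lap)+
  obtain t0 where t0: "\<And>x t. (x, t) \<in> \<Omega> \<Longrightarrow> v (x, t) = (norm x ^ 4 + (t - t0)\<^sup>2 - c\<^sup>2) / 4"
    by (rule solution_rigid[OF dom(4,1)], rule that)
  have "AE \<xi> in lebesgue_on \<Omega>. \<xi> \<in> \<Omega>" by (intro AE_I2) simp
  with uv have "AE (x, t) in lebesgue_on \<Omega>. u (x, t) = (norm x ^ 4 + (t - t0)\<^sup>2 - c\<^sup>2) / 4"
    by eventually_elim (auto simp: t0)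
  with domain_eq_gauge_ball[OF dom(1) t0] show ?thesis by (intro exI conjI)
qed

end
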